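(* Consider the problem $\min_x\{f(x): Ax=b,\ x\in\mathcal{K}\}$ with $\mathcal{K}$ equipped with a $\vartheta$-LHSC barrier function $B$, and let Assumption A (stated in the context) hold. Let $\epsilon\in(0,1)$, $x^0\in\Omega^{\rm o}$, $\zeta\in(0,1)$, $\beta\in[\sqrt{\epsilon},1)$, $\theta\in(0,1)$, $\eta\in(0,1)$, $\delta\in(0,1)$ be the inputs of the NCGB method (described in the context). Define $$c_d=\frac{(1-\beta)^3}{(L_H+\zeta+4)[(1-\beta)^2+\sqrt{\vartheta}]+1-\beta},\qquad c_{\rm sol}=\eta\min\left\{c_d^2,\left[\frac{6(1-\beta)(1-\eta)\theta}{L_H(1-\beta)+1/2}\right]^2\right\},$$ $$c_{\rm nc}=\frac{\eta}{2}\min\left\{1,\left[\frac{3(1-\beta)(1-\eta)\theta}{L_H(1-\beta)+1/2}\right]^2\right\},\qquad \phi^0=f(x^0)+\bar\mu\max\{B(x^0),0\},$$ $$K_1=\left\lceil\frac{\phi^0-\underline{\phi}}{\min\{c_{\rm sol},c_{\rm nc}\}}\epsilon^{-3/2}\right\rceil+\left\lceil\frac{64(\phi^0-\underline{\phi})}{c_{\rm nc}}\epsilon^{-3/2}\right\rceil+1,\qquad K_2=\left\lceil\frac{64(\phi^0-\underline{\phi})}{c_{\rm nc}}\epsilon^{-3/2}\right\rceil+1.$$ Then the following statements hold. (i) The total number of calls of the minimum eigenvalue oracle in the NCGB method is at most $K_2$. (ii) The total number of calls of the capped CG method in the NCGB method is at most $K_1$. (iii) The NCGB method terminates in at most $K_1+K_2$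 iterations. Its output $x^k$ is a deterministic $\epsilon$-first-order stationary point for some $k\le K_1+K_2$. Moreover, it is an $(\epsilon,\sqrt{\epsilon})$-second-order stationary point with probability at least $1-\sqrt{2.75n}\,\delta^{\|H_k\|^{-1/2}}$, which is bounded below by $1-\sqrt{2.75n}\,\delta^{U_H^{-1/2}}$, where $H_k=P_k^T\nabla^2 f(x^k)P_k$.
   Context: **Problem.** $A\in\mathbb{R}^{m\times n}$ has full row rank, $b\in\mathbb{R}^m$, $\mathcal{K}\subseteq\mathbb{R}^n$ is a closed pointed convex cone with nonempty interior $\mathrm{int}\,\mathcal{K}$ and dual cone $\mathcal{K}^*$. The problem $\min_x\{f(x):Ax=b,\ x\in\mathcal{K}\}$ has at least one optimal solution, $\Omega^{\rm o}=\{x:Ax=b,\ x\in\mathrm{int}\,\mathcal{K}\}\ne\emptyset$, and $f$ is twice continuously differentiable and nonconvex on $\Omega^{\rm o}$ (and all derivatives of $f$ appearing below are presumed to exist and be continuous where they are used). $\|\cdot\|$ is the Euclidean/spectral norm and $\lambda_{\min}$ the minimum eigenvalue. **Barrier.** $B:\mathrm{int}\,\mathcal{K}\to\mathbb{R}$ is a $\vartheta$-logarithmically homogeneous self-concordant ($\vartheta$-LHSC) barrier function for $\mathcal{K}$, $\vartheta\ge1$: (1) $B$ is convex and three times continuously differentiable, and $|\varphi'''(0)|\le2(\varphi''(0))^{3/2}$ for all $x\in\mathrm{int}\,\mathcal{K}$, $u\in\mathbb{R}^n$, where $\varphi(t)=B(x+tu)$; (2) $B(x)\to\infty$ as $x$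 approaches the boundary of $\mathcal{K}$; (3) $B(tx)=B(x)-\vartheta\ln t$ for all $x\in\mathrm{int}\,\mathcal{K}$, $t>0$. (Since $\mathcal{K}$ is pointed, $\nabla^2B(x)$ is positive definite on $\mathrm{int}\,\mathcal{K}$.) For $x\in\mathrm{int}\,\mathcal{K}$: $\|v\|_x=(v^T\nabla^2B(x)v)^{1/2}$, $\|v\|_x^*=(v^T[\nabla^2B(x)]^{-1}v)^{1/2}$ for $v\in\mathbb{R}^n$, and $\|M\|_x^*=\max_{\|v\|_x\le1}\|Mv\|_x^*$ for $M\in\mathbb{R}^{n\times n}$. For $\mu>0$, $\phi_\mu(x)=f(x)+\mu B(x)$. **Stationary points.** For $\epsilon_g>0$, $x$ is an $\epsilon_g$-first-order stationary point if for some $\lambda\in\mathbb{R}^m$: $Ax=b$, $x\in\mathrm{int}\,\mathcal{K}$, $\nabla f(x)+A^T\lambda\in\mathcal{K}^*$, and $\|\nabla f(x)+A^T\lambda\|_x^*\le\epsilon_g$. For $\epsilon_g,\epsilon_H>0$ it is an $(\epsilon_g,\epsilon_H)$-second-order stationary point if in addition $d^T[\nabla^2B(x)]^{-1/2}\nabla^2f(x)[\nabla^2B(x)]^{-1/2}d\ge-\epsilon_H\|d\|^2$ for all $d$ with $A[\nabla^2B(x)]^{-1/2}d=0$. "Deterministic" means the property holds surely, not just with some probability. **Capped CG method.** Input: symmetric $H\in\mathbb{R}^{n\times n}$, $g\ne0$, $\varepsilon\in(0,1)$, $\zeta\in(0,1)$, scalar $U\ge0$. Output: a vector $\hat d$ and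 a flag d_type $\in\{\text{SOL},\text{NC}\}$. Set $\bar H=H+2\varepsilon I$, $\kappa=(U+2\varepsilon)/\varepsilon$, $\hat\zeta=\zeta/(3\kappa)$, $\tau=\sqrt\kappa/(\sqrt\kappa+1)$, $T=4\kappa^4/(1-\sqrt\tau)^2$ (whenever $U$ is updated these are recomputed). Set $y^0=0$, $r^0=g$, $p^0=-g$, $j=0$. If $(p^0)^T\bar Hp^0<\varepsilon\|p^0\|^2$, return $\hat d=p^0$, NC; else if $\|Hp^0\|>U\|p^0\|$, set $U\leftarrow\|Hp^0\|/\|p^0\|$. Then loop: - CG step: $\alpha_j=(r^j)^Tr^j/((p^j)^T\bar Hp^j)$, $y^{j+1}=y^j+\alpha_jp^j$, $r^{j+1}=r^j+\alpha_j\bar Hp^j$, $\beta_{j+1}=\|r^{j+1}\|^2/\|r^j\|^2$, $p^{j+1}=-r^{j+1}+\beta_{j+1}p^j$, $j\leftarrow j+1$. - For $w=p^j$, then $w=y^j$, then $w=r^j$: if $\|Hw\|>U\|w\|$, set $U\leftarrow\|Hw\|/\|w\|$. - If $(y^j)^T\bar Hy^j<\varepsilon\|y^j\|^2$, return $\hat d=y^j$, NC; else if $\|r^j\|\le\hat\zeta\|r^0\|$, return $\hat d=y^j$, SOL; else if $(p^j)^T\bar Hp^j<\varepsilon\|p^j\|^2$, return $\hat d=p^j$, NC; else if $\|r^j\|>\sqrt T\tau^{j/2}\|r^0\|$, compute $\alpha_j,y^{j+1}$ as in the CG step, find $i\in\{0,\dots,j-1\}$ with $(y^{j+1}-y^i)^T\bar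 H(y^{j+1}-y^i)<\varepsilon\|y^{j+1}-y^i\|^2$, and return $\hat d=y^{j+1}-y^i$, NC. **Minimum eigenvalue oracle.** Input: symmetric $H\in\mathbb{R}^{n\times n}$, $\varepsilon>0$, $\delta\in(0,1)$. Run the Lanczos method for estimating $\lambda_{\min}(H)$ from a random vector uniform on the unit sphere for at most $\min\{n,1+\lceil\varepsilon^{-1/2}\ln\delta^{-1}\rceil\}$ iterations. If a unit vector $v$ with $v^THv\le-\varepsilon/2$ is found at some iteration, stop and return $v$; otherwise it certifies that $\lambda_{\min}(H)\ge-\varepsilon$ (which holds with probability at least $1-\sqrt{2.75n}\,\delta^{\|H\|^{-1/2}}$). **NCGB method** (Newton-CG based barrier method). At each iterate $x^k\in\mathrm{int}\,\mathcal{K}$ let $M_k\in\mathbb{R}^{n\times n}$ satisfy $M_kM_k^T=[\nabla^2B(x^k)]^{-1}$, and let $Q_k=I-M_k^TA^T(AM_kM_k^TA^T)^{-1}AM_k$, $P_k=M_kQ_k$, $R_k=-(AM_kM_k^TA^T)^{-1}AM_kM_k^T$. Let $\mathrm{sgn}(t)=1$ if $t\ge0$ and $-1$ otherwise; $c/0=\infty$ for $c>0$. Inputs: $\epsilon\in(0,1)$, $x^0\in\Omega^{\rm o}$, $\zeta\in(0,1)$, $\beta\in[\sqrt\epsilon,1)$, $\theta,\eta,\delta\in(0,1)$, $\vartheta$. Set $x^{-1}=x^0$, $d^{-1}=0$, $\mu=\frac{(1-\beta)\epsilon}{2((1-\beta)^2+\sqrt\vartheta)}$, d_type $=$ NC,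 $\alpha_{-1}=0$, $\lambda^{(2)}_{-1}=0$. For $k=0,1,2,\dots$: 1. Set $\lambda_k^{(1)}=R_k\nabla\phi_\mu(x^k)$. If d_type $=$ SOL and $\alpha_{k-1}=1$, set $\lambda_k^{(2)}=R_{k-1}(\nabla^2f(x^{k-1})P_{k-1}d^{k-1}+\nabla\phi_\mu(x^{k-1}))$; else $\lambda_k^{(2)}=\lambda_{k-1}^{(2)}$. 2. If $\min\{\|\nabla f(x^k)+A^T\lambda_k^{(1)}+\mu\nabla B(x^k)\|_{x^k}^*,\ \|\nabla f(x^k)+A^T\lambda_k^{(2)}+\mu\nabla B(x^{k-1})\|_{x^k}^*\}>(1-\beta)\mu$: call the capped CG method with $H=P_k^T\nabla^2\phi_\mu(x^k)P_k$, $\varepsilon=\sqrt\epsilon$, $g=P_k^T\nabla\phi_\mu(x^k)$, accuracy $\zeta$, $U=0$, obtaining $\hat d^k$ and d_type. If d_type $=$ NC, set $d^k=-\mathrm{sgn}(g^T\hat d^k)\min\Big\{\frac{|(\hat d^k)^TP_k^T\nabla^2\phi_\mu(x^k)P_k\hat d^k|}{\|\hat d^k\|^3},\frac{\beta}{\|Q_k\hat d^k\|}\Big\}\hat d^k$; if d_type $=$ SOL, set $d^k=\min\{1,\beta/\|Q_k\hat d^k\|\}\hat d^k$. 3. Otherwise: call the minimum eigenvalue oracle with $H=P_k^T\nabla^2f(x^k)P_k$, $\varepsilon=\sqrt\epsilon$, and $\delta$. If it certifies $\lambda_{\min}(H)\ge-\sqrt\epsilon$, output $x^k$ and terminate. Otherwise,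 with the returned $v$, set $d^k=-\mathrm{sgn}(v^TP_k^T\nabla\phi_\mu(x^k))\min\{|v^TP_k^T\nabla^2\phi_\mu(x^k)P_kv|,\ \beta/\|Q_kv\|\}v$ and d_type $=$ NC. 4. Line search: $\alpha_k=\theta^{j_k}$, where $j_k$ is the smallest nonnegative integer $j$ such that: if d_type $=$ SOL, $\phi_\mu(x^k+\theta^jP_kd^k)<\phi_\mu(x^k)-\eta\sqrt\epsilon\,\theta^{2j}\|d^k\|^2$; if d_type $=$ NC, $\phi_\mu(x^k+\theta^jP_kd^k)<\phi_\mu(x^k)-\eta\theta^{2j}\|d^k\|^3/2$. Set $x^{k+1}=x^k+\alpha_kP_kd^k$. **Assumption A.** (a) There exist $\bar\mu\ge\mu$ and $\underline\phi\in\mathbb{R}$ such that $\phi_{\tilde\mu}(x)\ge\underline\phi$ for all $\tilde\mu\in(0,\bar\mu]$, $x\in\Omega^{\rm o}$, and $\mathcal{S}=\bigcup_{\tilde\mu\in(0,\bar\mu]}\{x\in\Omega^{\rm o}:\phi_{\tilde\mu}(x)\le\phi_{\tilde\mu}(x^0)\}$ is bounded. (b) There exists $L_H>0$ such that $\|\nabla^2f(y)-\nabla^2f(x)\|_x^*\le L_H\|x-y\|_x$ for all $x\in\mathcal{S}$ and all $y$ with $\|y-x\|_x\le\beta$. (c) $U_g=\sup_{x\in\mathcal{S}}\|\nabla f(x)\|_x^*$ and $U_H=\sup_{x\in\mathcal{S}}\|\nabla^2f(x)\|_x^*$ are finite. *)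

theory Defs
  imports "HOL-Analysis.Analysis"
begin

section \<open>Derivatives\<close>

definition grad :: "('a::real_inner \<Rightarrow> real) \<Rightarrow> 'a \<Rightarrow> 'a" where
  "grad f x = (THE D. GDERIV f x :> D)"

definition hess :: "(real^'n \<Rightarrow> real) \<Rightarrow> real^'n \<Rightarrow> real^'n^'n" where
  "hess f x = jacobian (grad f) (at x)"

text \<open>\<open>C_k_on k S f\<close>: \<open>f\<close> is \<open>k\<close> times continuously differentiable on the open set \<open>S\<close>.\<close>

fun C_k_on :: "nat \<Rightarrow> 'a::real_normed_vector set \<Rightarrow> ('a \<Rightarrow> 'b::real_normed_vector) \<Rightarrow> bool" where
  "C_k_on 0 S f \<longleftrightarrow> continuous_on S f"
| "C_k_on (Suc k) S f \<longleftrightarrow> (\<forall>x\<in>S. f differentiable (at x)) \<and>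
     (\<forall>v. C_k_on k S (\<lambda>x. frechet_derivative f (at x) v))"

section \<open>Cones, barriers and local norms\<close>

definition pointed :: "'a::real_vector set \<Rightarrow> bool" where
  "pointed K \<longleftrightarrow> K \<inter> uminus ` K = {0}"

definition dual_cone :: "'a::real_inner set \<Rightarrow> 'a set" where
  "dual_cone K = {s. \<forall>x\<in>K. 0 \<le> s \<bullet> x}"

definition LHSC_barrier :: "real \<Rightarrow> (real^'n) set \<Rightarrow> (real^'n \<Rightarrow> real) \<Rightarrow> bool" where
  "LHSC_barrier \<nu> K B \<longleftrightarrow>
     1 \<le> \<nu> \<and>
     convex_on (interior K) B \<and> C_k_on 3 (interior K) B \<and>
     (\<forall>x\<in>interior K. \<forall>u. let \<phi> = (\<lambda>t. B (x + t *\<^sub>R u)) in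
        \<bar>(deriv ^^ 3) \<phi> 0\<bar> \<le> 2 * ((deriv ^^ 2) \<phi> 0) powr (3/2)) \<and>
     (\<forall>y\<in>frontier K. filterlim B at_top (at y within interior K)) \<and>
     (\<forall>x\<in>interior K. \<forall>t>0. B (t *\<^sub>R x) = B x - \<nu> * ln t)"

definition local_norm :: "(real^'n \<Rightarrow> real) \<Rightarrow> real^'n \<Rightarrow> real^'n \<Rightarrow> real" where
  "local_norm B x v = sqrt (v \<bullet> (hess B x *v v))"

definition local_dual_norm :: "(real^'n \<Rightarrow> real) \<Rightarrow> real^'n \<Rightarrow> real^'n \<Rightarrow> real" where
  "local_dual_norm B x v = sqrt (v \<bullet> (matrix_inv (hess B x) *v v))"

definition local_dual_opnorm :: "(real^'n \<Rightarrow> real) \<Rightarrow> real^'n \<Rightarrow> real^'n^'n \<Rightarrow> real" where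
  "local_dual_opnorm B x M = (SUP v\<in>{v. local_norm B x v \<le> 1}. local_dual_norm B x (M *v v))"

definition psd_sqrt :: "real^'n^'n \<Rightarrow> real^'n^'n" where
  "psd_sqrt S = (THE R. transpose R = R \<and> (\<forall>v. 0 \<le> v \<bullet> (R *v v)) \<and> R ** R = S)"

section \<open>The conic problem and its stationary points\<close>

definition strictly_feasible :: "real^'n^'m \<Rightarrow> real^'m \<Rightarrow> (real^'n) set \<Rightarrow> (real^'n) set" where
  "strictly_feasible A b K = {x. A *v x = b \<and> x \<in> interior K}"

definition barrier_fun ::
  "(real^'n \<Rightarrow> real) \<Rightarrow> (real^'n \<Rightarrow> real) \<Rightarrow> real \<Rightarrow> real^'n \<Rightarrow> real" where
  "barrier_fun f B \<mu> = (\<lambda>x. f x + \<mu> * B x)"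

definition level_union ::
  "(real^'n \<Rightarrow> real) \<Rightarrow> real^'n^'m \<Rightarrow> real^'m \<Rightarrow> (real^'n) set \<Rightarrow> (real^'n \<Rightarrow> real) \<Rightarrow>
   real \<Rightarrow> real^'n \<Rightarrow> (real^'n) set" where
  "level_union f A b K B \<mu>bar x0 =
     (\<Union>\<mu>\<in>{0<..\<mu>bar}. {x \<in> strictly_feasible A b K. barrier_fun f B \<mu> x \<le> barrier_fun f B \<mu> x0})"

definition first_order_stationary ::
  "(real^'n \<Rightarrow> real) \<Rightarrow> real^'n^'m \<Rightarrow> real^'m \<Rightarrow> (real^'n) set \<Rightarrow> (real^'n \<Rightarrow> real) \<Rightarrow>
   real \<Rightarrow> real^'n \<Rightarrow> bool" where
  "first_order_stationary f A b K B \<epsilon>g x \<longleftrightarrow>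
     (\<exists>l::real^'m. A *v x = b \<and> x \<in> interior K \<and>
        grad f x + transpose A *v l \<in> dual_cone K \<and>
        local_dual_norm B x (grad f x + transpose A *v l) \<le> \<epsilon>g)"

definition second_order_stationary ::
  "(real^'n \<Rightarrow> real) \<Rightarrow> real^'n^'m \<Rightarrow> real^'m \<Rightarrow> (real^'n) set \<Rightarrow> (real^'n \<Rightarrow> real) \<Rightarrow>
   real \<Rightarrow> real \<Rightarrow> real^'n \<Rightarrow> bool" where
  "second_order_stationary f A b K B \<epsilon>g \<epsilon>H x \<longleftrightarrow>
     first_order_stationary f A b K B \<epsilon>g x \<and>
     (let S = psd_sqrt (matrix_inv (hess B x)) in
      \<forall>d. A *v (S *v d) = 0 \<longrightarrow> d \<bullet> ((S ** hess f x ** S) *v d) \<ge> - \<epsilon>H * (norm d)\<^sup>2)"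

section \<open>The capped CG method\<close>

datatype dtype = SOL | NC

fun cg_iter :: "real^'n^'n \<Rightarrow> real^'n \<Rightarrow> nat \<Rightarrow> (real^'n) \<times> (real^'n) \<times> (real^'n)" where
  "cg_iter Hbar g 0 = (0, g, - g)"
| "cg_iter Hbar g (Suc j) =
     (let (y, r, p) = cg_iter Hbar g j;
          \<alpha> = (r \<bullet> r) / (p \<bullet> (Hbar *v p));
          r' = r + \<alpha> *\<^sub>R (Hbar *v p);
          \<beta> = (norm r')\<^sup>2 / (norm r)\<^sup>2
      in (y + \<alpha> *\<^sub>R p, r', - r' + \<beta> *\<^sub>R p))"

definition cg_y where "cg_y Hbar g j = fst (cg_iter Hbar g j)"
definition cg_r where "cg_r Hbar g j = fst (snd (cg_iter Hbar g j))"
definition cg_p where "cg_p Hbar g j = snd (snd (cg_iter Hbar g j))"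

definition bump :: "real^'n^'n \<Rightarrow> real \<Rightarrow> real^'n \<Rightarrow> real" where
  "bump H U w = (if norm (H *v w) > U * norm w then norm (H *v w) / norm w else U)"

text \<open>The value of \<open>U\<close> when the return tests of iteration \<open>j\<close> are made (for \<open>j = 0\<close>: on entry
  to the loop).\<close>

fun cg_U :: "real^'n^'n \<Rightarrow> real^'n^'n \<Rightarrow> real^'n \<Rightarrow> real \<Rightarrow> nat \<Rightarrow> real" where
  "cg_U H Hbar g U 0 = bump H U (cg_p Hbar g 0)"
| "cg_U H Hbar g U (Suc j) =
     bump H (bump H (bump H (cg_U H Hbar g U j)
       (cg_p Hbar g (Suc j))) (cg_y Hbar g (Suc j))) (cg_r Hbar g (Suc j))"

definition low_curv :: "real^'n^'n \<Rightarrow> real \<Rightarrow> real^'n \<Rightarrow> bool" where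
  "low_curv Hbar \<epsilon> w \<longleftrightarrow> w \<bullet> (Hbar *v w) < \<epsilon> * (norm w)\<^sup>2"

text \<open>\<open>None\<close>: the loop goes on after iteration \<open>j\<close>. \<open>Some X\<close>: the method stops there, and \<open>X\<close> is
  the set of its admissible answers; \<open>X\<close> has more than one element only if several indices \<open>i\<close>
  qualify in the last branch, and it is empty if none does.\<close>

definition cg_exit ::
  "real^'n^'n \<Rightarrow> real^'n \<Rightarrow> real \<Rightarrow> real \<Rightarrow> real \<Rightarrow> nat \<Rightarrow> ((real^'n) \<times> dtype) set option" where
  "cg_exit H g \<epsilon> \<zeta> U0 j =
     (let Hbar = H + mat (2 * \<epsilon>);
          y = cg_y Hbar g; r = cg_r Hbar g; p = cg_p Hbar g;
          U = cg_U H Hbar g U0 j;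
          \<kappa> = (U + 2 * \<epsilon>) / \<epsilon>;
          \<zeta>hat = \<zeta> / (3 * \<kappa>);
          \<tau> = sqrt \<kappa> / (sqrt \<kappa> + 1);
          T = 4 * \<kappa> ^ 4 / (1 - sqrt \<tau>)\<^sup>2
      in
      if j = 0 then (if low_curv Hbar \<epsilon> (p 0) then Some {(p 0, NC)} else None)
      else if low_curv Hbar \<epsilon> (y j) then Some {(y j, NC)}
      else if norm (r j) \<le> \<zeta>hat * norm (r 0) then Some {(y j, SOL)}
      else if low_curv Hbar \<epsilon> (p j) then Some {(p j, NC)}
      else if norm (r j) > sqrt T * \<tau> powr (real j / 2) * norm (r 0)
        then Some {(y (Suc j) - y i, NC) |i. i < j \<and> low_curv Hbar \<epsilon> (y (Suc j) - y i)}
      else None)"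

text \<open>The set of admissible answers; empty if the loop runs forever.\<close>

definition capped_cg ::
  "real^'n^'n \<Rightarrow> real^'n \<Rightarrow> real \<Rightarrow> real \<Rightarrow> real \<Rightarrow> ((real^'n) \<times> dtype) set" where
  "capped_cg H g \<epsilon> \<zeta> U =
     (if \<exists>j. cg_exit H g \<epsilon> \<zeta> U j \<noteq> None
      then the (cg_exit H g \<epsilon> \<zeta> U (LEAST j. cg_exit H g \<epsilon> \<zeta> U j \<noteq> None))
      else {})"

section \<open>The minimum eigenvalue oracle\<close>

text \<open>Lanczos three-term recurrence: the state is the previous Lanczos vector, the current one, and
  the off-diagonal coefficient joining them. On breakdown all later vectors are zero, so that the
  span of the Lanczos vectors no longer grows.\<close>

fun lanczos :: "real^'n^'n \<Rightarrow> real^'n \<Rightarrow> nat \<Rightarrow> (real^'n) \<times> (real^'n) \<times> real" where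
  "lanczos H u 0 = (0, u, 0)"
| "lanczos H u (Suc j) =
     (let (q', q, b) = lanczos H u j;
          a = q \<bullet> (H *v q);
          w = H *v q - a *\<^sub>R q - b *\<^sub>R q'
      in (q, w /\<^sub>R norm w, norm w))"

definition lanczos_space :: "real^'n^'n \<Rightarrow> real^'n \<Rightarrow> nat \<Rightarrow> (real^'n) set" where
  "lanczos_space H u j = span {fst (snd (lanczos H u i)) |i. i < j}"

definition ritz_pair :: "real^'n^'n \<Rightarrow> (real^'n) set \<Rightarrow> real \<Rightarrow> real^'n \<Rightarrow> bool" where
  "ritz_pair H V \<theta> v \<longleftrightarrow> v \<in> V \<and> norm v = 1 \<and> (\<forall>w\<in>V. (H *v v - \<theta> *\<^sub>R v) \<bullet> w = 0)"

definition least_ritz_vectors :: "real^'n^'n \<Rightarrow> (real^'n) set \<Rightarrow> (real^'n) set" where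
  "least_ritz_vectors H V =
     {v. \<exists>\<theta>. ritz_pair H V \<theta> v \<and> (\<forall>\<theta>' v'. ritz_pair H V \<theta>' v' \<longrightarrow> \<theta> \<le> \<theta>')}"

definition lanczos_found :: "real^'n^'n \<Rightarrow> real \<Rightarrow> real^'n \<Rightarrow> nat \<Rightarrow> (real^'n) set" where
  "lanczos_found H \<epsilon> u j =
     {v \<in> least_ritz_vectors H (lanczos_space H u j). v \<bullet> (H *v v) \<le> - \<epsilon> / 2}"

text \<open>\<open>u\<close> is the (random) starting vector and \<open>sel\<close> resolves the choice among the Ritz vectors found.
  \<open>None\<close> means that the oracle certifies that the least eigenvalue of \<open>H\<close> is at least \<open>- \<epsilon>\<close>.\<close>

definition min_eig_oracle ::
  "real^'n^'n \<Rightarrow> real \<Rightarrow> real \<Rightarrow> real^'n \<Rightarrow> ((real^'n) set \<Rightarrow> real^'n) \<Rightarrow> (real^'n) option" where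
  "min_eig_oracle H \<epsilon> \<delta> u sel =
     (let N = min (int CARD('n)) (1 + \<lceil>\<epsilon> powr (- 1/2) * ln (1 / \<delta>)\<rceil>);
          hit = (\<lambda>j. 1 \<le> j \<and> int j \<le> N \<and> lanczos_found H \<epsilon> u j \<noteq> {})
      in if \<exists>j. hit j then Some (sel (lanczos_found H \<epsilon> u (LEAST j. hit j))) else None)"

text \<open>The uniform distribution on the unit sphere, as the radial projection of the uniform
  distribution on the unit ball.\<close>

definition uniform_sphere :: "'a::euclidean_space measure" where
  "uniform_sphere = distr (uniform_measure lborel (cball 0 1)) borel sgn"

text \<open>\<open>sqrt (2.75 n) \<delta>\<^bsup>h^(-1/2)\<^esup>\<close>, where the exponent is infinite, and hence the power is \<open>0\<close>,
  if \<open>h = 0\<close>.\<close>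

definition oracle_failure :: "nat \<Rightarrow> real \<Rightarrow> real \<Rightarrow> real" where
  "oracle_failure n \<delta> h =
     sqrt (2.75 * real n) * (if h = 0 then 0 else \<delta> powr (h powr (- 1/2)))"

section \<open>The Newton-CG based barrier method\<close>

definition sgn1 :: "real \<Rightarrow> real" where
  "sgn1 t = (if t \<ge> 0 then 1 else -1)"

text \<open>\<open>min {a, c / t}\<close> with \<open>c / 0 = \<infinity>\<close>.\<close>

definition capped :: "real \<Rightarrow> real \<Rightarrow> real \<Rightarrow> real" where
  "capped a c t = (if t = 0 then a else min a (c / t))"

definition Qmat :: "real^'n^'m \<Rightarrow> real^'n^'n \<Rightarrow> real^'n^'n" where
  "Qmat A M = mat 1 -
     transpose M ** transpose A ** matrix_inv (A ** M ** transpose M ** transpose A) ** A ** M"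

definition Pmat :: "real^'n^'m \<Rightarrow> real^'n^'n \<Rightarrow> real^'n^'n" where
  "Pmat A M = M ** Qmat A M"

definition Rmat :: "real^'n^'m \<Rightarrow> real^'n^'n \<Rightarrow> real^'n^'m" where
  "Rmat A M = - (matrix_inv (A ** M ** transpose M ** transpose A) ** A ** M ** transpose M)"

definition ncgb_mu :: "real \<Rightarrow> real \<Rightarrow> real \<Rightarrow> real" where
  "ncgb_mu \<epsilon> \<beta> \<nu> = (1 - \<beta>) * \<epsilon> / (2 * ((1 - \<beta>)\<^sup>2 + sqrt \<nu>))"

text \<open>The data with which iteration \<open>k\<close> starts: the iterate, and what it needs of iteration
  \<open>k - 1\<close>.\<close>

record ('n::finite, 'm::finite) ncgb_state =
  cur :: "real^'n"
  prev :: "real^'n"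
  prev_M :: "real^'n^'n"
  prev_dir :: "real^'n"
  prev_type :: dtype
  prev_step :: real
  prev_lam2 :: "real^'m"

text \<open>\<open>Stuck\<close>: a line search does not end, or a call of the capped CG method gives no answer.\<close>

datatype ('n::finite, 'm::finite) ncgb_outcome =
  Running "('n, 'm) ncgb_state" | Terminated "real^'n" | Stuck

text \<open>\<open>M k x\<close> is the factor used in iteration \<open>k\<close> at the iterate \<open>x\<close>; \<open>cgsel k\<close> and \<open>ritzsel k\<close>
  resolve the remaining choices in iteration \<open>k\<close>. The sequence \<open>rnd\<close> supplies the random
  starting vectors: \<open>rnd k\<close> is used by the oracle if it is called in iteration \<open>k\<close>.\<close>

locale ncgb =
  fixes f :: "real^'n \<Rightarrow> real"
    and A :: "real^'n^'m"
    and B :: "real^'n \<Rightarrow> real"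
    and \<nu> :: real
    and \<epsilon> :: real
    and x0 :: "real^'n"
    and \<zeta> \<beta> \<theta> \<eta> \<delta> :: real
    and M :: "nat \<Rightarrow> real^'n \<Rightarrow> real^'n^'n"
    and cgsel :: "nat \<Rightarrow> ((real^'n) \<times> dtype) set \<Rightarrow> (real^'n) \<times> dtype"
    and ritzsel :: "nat \<Rightarrow> (real^'n) set \<Rightarrow> real^'n"
begin

definition \<mu> :: real where "\<mu> = ncgb_mu \<epsilon> \<beta> \<nu>"

definition \<phi> :: "real^'n \<Rightarrow> real" where "\<phi> = barrier_fun f B \<mu>"

definition P :: "nat \<Rightarrow> real^'n \<Rightarrow> real^'n^'n" where "P k x = Pmat A (M k x)"

definition Q :: "nat \<Rightarrow> real^'n \<Rightarrow> real^'n^'n" where "Q k x = Qmat A (M k x)"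

definition init :: "('n, 'm) ncgb_state" where
  "init = \<lparr>cur = x0, prev = x0, prev_M = 0, prev_dir = 0, prev_type = NC, prev_step = 0,
     prev_lam2 = 0\<rparr>"

definition lam1 :: "nat \<Rightarrow> ('n, 'm) ncgb_state \<Rightarrow> real^'m" where
  "lam1 k s = Rmat A (M k (cur s)) *v grad \<phi> (cur s)"

definition lam2 :: "('n, 'm) ncgb_state \<Rightarrow> real^'m" where
  "lam2 s =
     (if prev_type s = SOL \<and> prev_step s = 1
      then Rmat A (prev_M s) *v
        (hess f (prev s) *v (Pmat A (prev_M s) *v prev_dir s) + grad \<phi> (prev s))
      else prev_lam2 s)"

definition calls_cg :: "nat \<Rightarrow> ('n, 'm) ncgb_state \<Rightarrow> bool" where
  "calls_cg k s \<longleftrightarrow>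
     (let x = cur s in
      min (local_dual_norm B x (grad f x + transpose A *v lam1 k s + \<mu> *\<^sub>R grad B x))
          (local_dual_norm B x (grad f x + transpose A *v lam2 s + \<mu> *\<^sub>R grad B (prev s)))
      > (1 - \<beta>) * \<mu>)"

definition sufficient_decrease :: "nat \<Rightarrow> real^'n \<Rightarrow> dtype \<Rightarrow> real^'n \<Rightarrow> nat \<Rightarrow> bool" where
  "sufficient_decrease k x t d j \<longleftrightarrow>
     \<phi> (x + \<theta> ^ j *\<^sub>R (P k x *v d)) <
     \<phi> x - (case t of SOL \<Rightarrow> \<eta> * sqrt \<epsilon> * \<theta> ^ (2 * j) * (norm d)\<^sup>2
                   | NC \<Rightarrow> \<eta> * \<theta> ^ (2 * j) * norm d ^ 3 / 2)"

definition advance ::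
  "nat \<Rightarrow> ('n, 'm) ncgb_state \<Rightarrow> dtype \<Rightarrow> real^'n \<Rightarrow> ('n, 'm) ncgb_outcome" where
  "advance k s t d =
     (let x = cur s in
      if \<exists>j. sufficient_decrease k x t d j
      then let \<alpha> = \<theta> ^ (LEAST j. sufficient_decrease k x t d j) in
        Running \<lparr>cur = x + \<alpha> *\<^sub>R (P k x *v d), prev = x, prev_M = M k x, prev_dir = d,
          prev_type = t, prev_step = \<alpha>, prev_lam2 = lam2 s\<rparr>
      else Stuck)"

definition cg_direction :: "nat \<Rightarrow> real^'n \<Rightarrow> dtype \<Rightarrow> real^'n \<Rightarrow> real^'n" where
  "cg_direction k x t dh =
     (let H = transpose (P k x) ** hess \<phi> x ** P k x;
          g = transpose (P k x) *v grad \<phi> x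
      in case t of
           NC \<Rightarrow> (- sgn1 (g \<bullet> dh) *
              capped (\<bar>dh \<bullet> (H *v dh)\<bar> / norm dh ^ 3) \<beta> (norm (Q k x *v dh))) *\<^sub>R dh
         | SOL \<Rightarrow> capped 1 \<beta> (norm (Q k x *v dh)) *\<^sub>R dh)"

definition eig_direction :: "nat \<Rightarrow> real^'n \<Rightarrow> real^'n \<Rightarrow> real^'n" where
  "eig_direction k x v =
     (let H = transpose (P k x) ** hess \<phi> x ** P k x;
          g = transpose (P k x) *v grad \<phi> x
      in (- sgn1 (v \<bullet> g) * capped \<bar>v \<bullet> (H *v v)\<bar> \<beta> (norm (Q k x *v v))) *\<^sub>R v)"

definition reduced_hess :: "nat \<Rightarrow> real^'n \<Rightarrow> real^'n^'n" where
  "reduced_hess k x = transpose (P k x) ** hess f x ** P k x"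

definition iteration ::
  "(nat \<Rightarrow> real^'n) \<Rightarrow> nat \<Rightarrow> ('n, 'm) ncgb_state \<Rightarrow> ('n, 'm) ncgb_outcome" where
  "iteration rnd k s =
     (let x = cur s in
      if calls_cg k s then
        (let X = capped_cg (transpose (P k x) ** hess \<phi> x ** P k x)
                   (transpose (P k x) *v grad \<phi> x) (sqrt \<epsilon>) \<zeta> 0
         in if X = {} then Stuck
            else let (dh, t) = cgsel k X in advance k s t (cg_direction k x t dh))
      else
        (case min_eig_oracle (reduced_hess k x) (sqrt \<epsilon>) \<delta> (rnd k) (ritzsel k) of
           None \<Rightarrow> Terminated x
         | Some v \<Rightarrow> advance k s NC (eig_direction k x v)))"

text \<open>\<open>run rnd k\<close> is \<open>Running s\<close> iff iteration \<open>k\<close> is entered, with data \<open>s\<close>.\<close>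

fun run :: "(nat \<Rightarrow> real^'n) \<Rightarrow> nat \<Rightarrow> ('n, 'm) ncgb_outcome" where
  "run rnd 0 = Running init"
| "run rnd (Suc k) =
     (case run rnd k of Running s \<Rightarrow> iteration rnd k s | Terminated x \<Rightarrow> Terminated x | Stuck \<Rightarrow> Stuck)"

definition cg_calls :: "(nat \<Rightarrow> real^'n) \<Rightarrow> nat set" where
  "cg_calls rnd = {k. \<exists>s. run rnd k = Running s \<and> calls_cg k s}"

definition oracle_calls :: "(nat \<Rightarrow> real^'n) \<Rightarrow> nat set" where
  "oracle_calls rnd = {k. \<exists>s. run rnd k = Running s \<and> \<not> calls_cg k s}"

end

end

theory Submission
  imports Defs
begin

text \<open>
  Why the bounds hold. Write \<open>\<phi> = f + \<mu> B\<close> and measure steps at \<open>x\<close> in the local norm of the barrier. In the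
  coordinates \<open>d \<mapsto> x + P d\<close> this norm is at most the Euclidean norm of \<open>d\<close>, the constraint \<open>A x = b\<close> is kept,
  and a step of local length at most \<open>\<beta> < 1\<close> stays in the cone. There \<open>\<phi>\<close> has a second-order Taylor expansion
  with a cubic error (lemma \<open>phi_upper\<close>): the Hessian of \<open>f\<close> is Lipschitz by assumption, and that of \<open>B\<close> is
  controlled by self-concordance. Hence a direction of negative curvature lowers \<open>\<phi>\<close> by a multiple of
  \<open>\<epsilon>\<^bsup>3/2\<^esup>\<close> (\<open>negative_curvature_step\<close>), and so does an inexact Newton step that is damped or long
  (\<open>newton_step\<close>). A full and short Newton step leads to a point at which the second multiplier estimate passes
  the test, because the new residual is quadratic in the step (\<open>full_step_length\<close>); the next iteration then
  calls the eigenvalue oracle. As \<open>\<phi>\<close> is bounded below, only boundedly many oracle calls find negative curvature, and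
  only boundedly many calls of CG are followed by another one; all other calls of CG are followed by a call of the
  oracle. This gives both counts and termination (\<open>termination_and_call_counts\<close>).

  At termination \<open>\<nabla>f + A\<^sup>T \<lambda>\<close> is within local dual distance \<open>(1 - \<beta>) \<mu>\<close> of \<open>- \<mu> \<nabla>B\<close> at the current or the
  previous iterate. The vector \<open>- \<nabla>B(z)\<close> lies in the dual cone with room to spare, because
  \<open>- \<nabla>B(z) \<bullet> w\<close> is at least the local norm of \<open>w\<close> for each \<open>w\<close> in the cone (\<open>norm_le_grad_cone\<close>), and its
  dual norm is \<open>\<surd>\<nu>\<close>. This is first-order stationarity, and it holds surely.

  Three ingredients are of independent interest.

  \<^item> The capped CG method always answers (\<open>capped_cg_correct\<close>). It leaves its loop since nonzero residuals are
    orthogonal. If it stops because the residuals decrease too slowly, some earlier iterate and the next one must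
    span a direction of low curvature: otherwise the quadratic would look strongly convex along all differences
    that matter, and the estimating functions of accelerated gradient methods, applied to CG, would force the
    decrease (\<open>residual_decay\<close>).

  \<^item> The eigenvalue oracle detects an eigenvalue below \<open>-\<epsilon>\<close> with the stated probability
    (\<open>oracle_success_probability\<close>). Failure means that the Rayleigh quotient exceeds \<open>-\<epsilon>/2\<close> on a Krylov space; testing
    this on a Chebyshev polynomial of odd degree shows that the start vector is nearly orthogonal to an
    eigenvector, and the volume of a thin equatorial band of the ball bounds the probability of that.

  \<^item> For a self-concordant barrier the third derivative along arbitrary directions is bounded by the
    Hessian (\<open>third_bound\<close>), although the definition speaks of one direction only: a symmetric trilinear form attains its
    norm on the diagonal (\<open>symmetric_trilinear_diagonal\<close>). This makes Hessians at nearby points comparable.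
\<close>

section \<open>Symmetric matrices\<close>

text \<open>Transposes are moved across inner products by \<open>transpose_dot\<close>; rewriting \<open>transpose A *v x\<close> to
  \<open>x v* A\<close> would hide them.\<close>

declare transpose_matrix_vector [simp del]

abbreviation symmetric_matrix :: "real^'n^'n \<Rightarrow> bool" where
  "symmetric_matrix H \<equiv> transpose H = H"

lemma symmetric_matrix_dot:
  fixes H :: "real^'n^'n"
  assumes "symmetric_matrix H"
  shows "(H *v x) \<bullet> y = x \<bullet> (H *v y)"
  by (metis assms dot_lmul_matrix transpose_matrix_vector)

lemma transpose_dot: "(transpose A *v x) \<bullet> y = x \<bullet> (A *v y)"
  for A :: "real^'n^'m"
  by (metis dot_lmul_matrix transpose_matrix_vector)

lemma symmetric_matrixI:
  fixes H :: "real^'n^'n"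
  assumes "\<And>x y. (H *v x) \<bullet> y = x \<bullet> (H *v y)"
  shows "symmetric_matrix H"
proof -
  have "transpose H *v x = H *v x" for x
    by (metis assms transpose_dot inner_commute vector_eq_rdot)
  then show ?thesis by (simp add: matrix_eq)
qed

text \<open>For small \<open>t\<close> of the sign opposite to \<open>a\<close> the linear term would win. This is the form in which first-order
  optimality conditions are used below.\<close>

lemma linear_coefficient_zero:
  fixes a c :: real
  assumes "\<And>t. 0 \<le> 2 * t * a + t\<^sup>2 * c"
  shows "a = 0"
proof (rule ccontr)
  assume "a \<noteq> 0"
  define k where "k = \<bar>c\<bar> + 1"
  have k: "k > 0" "c \<le> k" "c < k" unfolding k_def by auto
  have "0 \<le> 2 * (- a / k) * a + (- a / k)\<^sup>2 * c" by (rule assms)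
  also have "\<dots> = (a\<^sup>2 / k) * (c / k - 2)" using k by (simp add: power2_eq_square field_simps)
  finally have "0 \<le> (a\<^sup>2 / k) * (c / k - 2)" .
  moreover have "a\<^sup>2 / k > 0" using k \<open>a \<noteq> 0\<close> by simp
  moreover have "c / k < 2" using k by (simp add: divide_less_eq)
  ultimately show False by (smt (verit) mult_pos_neg)
qed

text \<open>The first-order optimality condition for the quadratic form \<open>x \<bullet> H x - m (x \<bullet> x)\<close> on \<open>V\<close>, which has
  its minimum \<open>0\<close> at \<open>v\<close>.\<close>

lemma form_minimum_stationary:
  fixes H :: "real^'n^'n"
  assumes H: "symmetric_matrix H" and V: "subspace V"
    and min: "\<And>x. x \<in> V \<Longrightarrow> m * (x \<bullet> x) \<le> x \<bullet> (H *v x)"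
    and v: "v \<in> V" "v \<bullet> (H *v v) = m * (v \<bullet> v)" and w: "w \<in> V"
  shows "(H *v v - m *\<^sub>R v) \<bullet> w = 0"
proof (rule linear_coefficient_zero)
  fix t :: real
  have "v + t *\<^sub>R w \<in> V" using V v w by (simp add: subspace_add subspace_scale)
  from min[OF this]
  show "0 \<le> 2 * t * ((H *v v - m *\<^sub>R v) \<bullet> w) + t\<^sup>2 * (w \<bullet> (H *v w) - m * (w \<bullet> w))"
    using v(2) symmetric_matrix_dot[OF H, of v w] symmetric_matrix_dot[OF H, of w v]
    by (simp add: algebra_simps inner_add_left inner_add_right matrix_vector_right_distrib
        matrix_vector_mult_scaleR power2_eq_square inner_commute)
qed

lemma rayleigh_minimum_exists:
  fixes H :: "real^'n^'n"
  assumes V: "subspace V" "V \<noteq> {0}"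
  obtains v m where "v \<in> V" "norm v = 1" "v \<bullet> (H *v v) = m"
    "\<And>x. x \<in> V \<Longrightarrow> m * (x \<bullet> x) \<le> x \<bullet> (H *v x)"
proof -
  define C where "C = V \<inter> sphere 0 1"
  have "compact C" unfolding C_def
    using V(1) by (simp add: closed_Int_compact closed_subspace)
  moreover obtain x where x: "x \<in> V" "x \<noteq> 0"
    using V subspace_0 by blast
  have "x /\<^sub>R norm x \<in> C" unfolding C_def using V(1) x by (simp add: subspace_scale)
  then have "C \<noteq> {}" by auto
  moreover have "continuous_on C (\<lambda>x. x \<bullet> (H *v x))"
    by (intro continuous_intros)
  ultimately obtain v where v: "v \<in> C" "\<And>y. y \<in> C \<Longrightarrow> v \<bullet> (H *v v) \<le> y \<bullet> (H *v y)"
    using continuous_attains_inf by metis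
  have "(v \<bullet> (H *v v)) * (x \<bullet> x) \<le> x \<bullet> (H *v x)" if "x \<in> V" for x
  proof (cases "x = 0")
    case False
    have "x /\<^sub>R norm x \<in> C" unfolding C_def using V(1) that False by (simp add: subspace_scale)
    from v(2)[OF this] have "v \<bullet> (H *v v) \<le> (x \<bullet> (H *v x)) / (norm x)\<^sup>2"
      by (simp add: matrix_vector_mult_scaleR power2_eq_square field_simps)
    then show ?thesis using False by (simp add: field_simps dot_square_norm)
  qed simp
  with v(1) show ?thesis using that unfolding C_def by auto
qed

text \<open>The spectral theorem, by splitting off a minimiser of the Rayleigh quotient: it is an eigenvector, and its
  orthogonal complement in \<open>V\<close> is again invariant.\<close>

lemma spectral_theorem_subspace:
  fixes H :: "real^'n^'n"
  assumes H: "symmetric_matrix H"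
  shows "subspace V \<Longrightarrow> (\<And>x. x \<in> V \<Longrightarrow> H *v x \<in> V) \<Longrightarrow>
    \<exists>E. finite E \<and> E \<subseteq> V \<and> pairwise orthogonal E \<and> span E = V \<and>
      (\<forall>e\<in>E. norm e = 1 \<and> (\<exists>l. H *v e = l *\<^sub>R e))"
proof (induction "dim V" arbitrary: V rule: less_induct)
  case less
  show ?case
  proof (cases "V = {0}")
    case True
    then show ?thesis by (intro exI[of _ "{}"]) auto
  next
    case False
    from rayleigh_minimum_exists[OF less.prems(1) this, of H]
    obtain v m where v: "v \<in> V" "norm v = 1" "v \<bullet> (H *v v) = m"
      and min: "\<And>x. x \<in> V \<Longrightarrow> m * (x \<bullet> x) \<le> x \<bullet> (H *v x)" by metis
    have vv: "v \<bullet> v = 1" using v(2) by (simp add: dot_square_norm)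
    have st: "(H *v v - m *\<^sub>R v) \<bullet> w = 0" if "w \<in> V" for w
      using form_minimum_stationary[OF H less.prems(1) min v(1) _ that] v(3) vv by simp
    have "H *v v - m *\<^sub>R v \<in> V"
      using less.prems v(1) by (simp add: subspace_diff subspace_scale)
    from st[OF this] have ev: "H *v v = m *\<^sub>R v" by simp
    define W where "W = {x \<in> V. x \<bullet> v = 0}"
    have sW: "subspace W" unfolding W_def using less.prems(1)
      by (auto simp: subspace_def inner_add_left)
    have iW: "H *v x \<in> W" if "x \<in> W" for x
      using that less.prems(2) unfolding W_def
      by (auto simp: symmetric_matrix_dot[OF H] ev)
    have WV: "W \<subseteq> V" unfolding W_def by auto
    have "v \<notin> W" unfolding W_def using vv by auto
    then have "W \<noteq> V" using v(1) by auto
    then have "dim W < dim V"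
      by (metis WV sW less.prems(1) dim_subset subspace_dim_equal le_neq_implies_less order.refl)
    from less.hyps[OF this sW iW] obtain E where E: "finite E" "E \<subseteq> W" "pairwise orthogonal E"
      "span E = W" "\<And>e. e \<in> E \<Longrightarrow> norm e = 1 \<and> (\<exists>l. H *v e = l *\<^sub>R e)" by blast
    have "span (insert v E) = V"
    proof
      show "span (insert v E) \<subseteq> V"
        using E(2) WV v(1) less.prems(1) by (intro span_minimal) auto
      show "V \<subseteq> span (insert v E)"
      proof
        fix x assume x: "x \<in> V"
        have "x - (x \<bullet> v) *\<^sub>R v \<in> W" unfolding W_def
          using x v(1) vv less.prems(1)
          by (simp add: subspace_diff subspace_scale inner_diff_left)
        then show "x \<in> span (insert v E)" using E(4) span_breakdown_eq by blast
      qed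
    qed
    moreover have "pairwise orthogonal (insert v E)"
      using E(2,3) unfolding pairwise_insert W_def orthogonal_def
      by (auto simp: inner_commute)
    ultimately show ?thesis
      using E v ev WV by (intro exI[of _ "insert v E"]) auto
  qed
qed

lemma spectral_theorem:
  fixes H :: "real^'n^'n"
  assumes "symmetric_matrix H"
  obtains E l where "finite E" "pairwise orthogonal E" "span E = UNIV"
    "\<And>e. e \<in> E \<Longrightarrow> norm e = 1" "\<And>e. e \<in> E \<Longrightarrow> H *v e = l e *\<^sub>R e"
  using spectral_theorem_subspace[OF assms, of UNIV] by (metis UNIV_I subspace_UNIV)

lemma orthonormal_expansion:
  fixes E :: "'a::euclidean_space set"
  assumes E: "finite E" "pairwise orthogonal E" "span E = UNIV" "\<And>e. e \<in> E \<Longrightarrow> norm e = 1"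
  shows "x = (\<Sum>e\<in>E. (x \<bullet> e) *\<^sub>R e)"
proof -
  define y where "y = (\<Sum>e\<in>E. (x \<bullet> e) *\<^sub>R e)"
  have "orthogonal (x - y) e" if "e \<in> E" for e
  proof -
    have "y \<bullet> e = (\<Sum>e'\<in>E. (x \<bullet> e') * (e' \<bullet> e))" unfolding y_def by (simp add: inner_sum_left)
    also have "\<dots> = (\<Sum>e'\<in>E. if e' = e then x \<bullet> e else 0)"
      using E(2,4) that by (intro sum.cong) (auto simp: pairwise_def orthogonal_def dot_square_norm)
    also have "\<dots> = x \<bullet> e" using E(1) that by simp
    finally show ?thesis by (simp add: orthogonal_def inner_diff_left)
  qed
  then have "orthogonal (x - y) z" if "z \<in> span E" for z
    using that orthogonal_to_span by blast
  then have "orthogonal (x - y) (x - y)" using E(3) by blast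
  then show ?thesis unfolding y_def orthogonal_def by simp
qed

lemma orthonormal_parseval:
  fixes E :: "'a::euclidean_space set"
  assumes "finite E" "pairwise orthogonal E" "span E = UNIV" "\<And>e. e \<in> E \<Longrightarrow> norm e = 1"
  shows "x \<bullet> y = (\<Sum>e\<in>E. (x \<bullet> e) * (y \<bullet> e))"
proof -
  have "x \<bullet> y = (\<Sum>e\<in>E. (x \<bullet> e) *\<^sub>R e) \<bullet> y"
    using orthonormal_expansion[OF assms, of x] by simp
  also have "\<dots> = (\<Sum>e\<in>E. (x \<bullet> e) * (y \<bullet> e))"
    by (simp only: inner_sum_left inner_scaleR_left inner_commute[of y])
  finally show ?thesis .
qed

lemma form_eigen_expansion:
  fixes H :: "real^'n^'n"
  assumes H: "symmetric_matrix H"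
    and E: "finite E" "pairwise orthogonal E" "span E = UNIV" "\<And>e. e \<in> E \<Longrightarrow> norm e = 1"
      "\<And>e. e \<in> E \<Longrightarrow> H *v e = l e *\<^sub>R e"
  shows "x \<bullet> (H *v x) = (\<Sum>e\<in>E. l e * (x \<bullet> e)\<^sup>2)"
proof -
  have "x \<bullet> (H *v x) = (\<Sum>e\<in>E. (x \<bullet> e) * ((H *v x) \<bullet> e))"
    by (rule orthonormal_parseval[OF E(1-4)])
  also have "\<dots> = (\<Sum>e\<in>E. l e * (x \<bullet> e)\<^sup>2)"
    using E(5) by (intro sum.cong) (auto simp: symmetric_matrix_dot[OF H] power2_eq_square)
  finally show ?thesis .
qed

lemma psd_sqrt_exists:
  fixes S :: "real^'n^'n"
  assumes S: "symmetric_matrix S" and nn: "\<And>v. 0 \<le> v \<bullet> (S *v v)"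
  obtains R where "symmetric_matrix R" "\<And>v. 0 \<le> v \<bullet> (R *v v)" "R ** R = S"
proof -
  obtain E l where E: "finite E" "pairwise orthogonal E" "span E = UNIV"
    "\<And>e. e \<in> E \<Longrightarrow> norm e = 1" "\<And>e. e \<in> E \<Longrightarrow> S *v e = l e *\<^sub>R e"
    using spectral_theorem[OF S] by metis
  have l: "l e \<ge> 0" if "e \<in> E" for e
    using nn[of e] E(4,5)[OF that] by (simp add: dot_square_norm)
  (* the square root on the basis of eigenvectors *)
  define r where "r x = (\<Sum>e\<in>E. (sqrt (l e) * (x \<bullet> e)) *\<^sub>R e)" for x
  have lin: "linear r" unfolding r_def
    by (rule linearI) (auto simp: inner_add_left algebra_simps sum.distrib scaleR_sum_right)
  have re: "r x \<bullet> e = sqrt (l e) * (x \<bullet> e)" if "e \<in> E" for x e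
  proof -
    have "r x \<bullet> e = (\<Sum>e'\<in>E. (sqrt (l e') * (x \<bullet> e')) * (e' \<bullet> e))"
      unfolding r_def by (simp add: inner_sum_left)
    also have "\<dots> = (\<Sum>e'\<in>E. if e' = e then sqrt (l e) * (x \<bullet> e) else 0)"
      using E(2,4) that by (intro sum.cong) (auto simp: pairwise_def orthogonal_def dot_square_norm)
    finally show ?thesis using E(1) that by simp
  qed
  define R where "R = matrix r"
  have R: "R *v x = r x" for x unfolding R_def by (simp add: lin)
  have form: "r x \<bullet> y = (\<Sum>e\<in>E. sqrt (l e) * (x \<bullet> e) * (y \<bullet> e))" for x y
    using orthonormal_parseval[OF E(1-4)] by (rule trans) (auto simp: re intro!: sum.cong)
  have "symmetric_matrix R"
    by (rule symmetric_matrixI) (simp add: R form inner_commute[of _ "r _"] mult_ac)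
  moreover have "0 \<le> v \<bullet> (R *v v)" for v
    unfolding R inner_commute[of v] form by (intro sum_nonneg) (simp add: l mult.assoc)
  moreover have "R ** R = S"
  proof -
    have "r (r x) = S *v x" for x
    proof -
      have "r (r x) = (\<Sum>e\<in>E. (l e * (x \<bullet> e)) *\<^sub>R e)"
        unfolding r_def[of "r x"] using l by (intro sum.cong) (auto simp: re)
      also have "\<dots> = (\<Sum>e\<in>E. ((S *v x) \<bullet> e) *\<^sub>R e)"
        using E(5) by (intro sum.cong) (auto simp: symmetric_matrix_dot[OF S])
      also have "\<dots> = S *v x" by (rule orthonormal_expansion[OF E(1-4), symmetric])
      finally show ?thesis .
    qed
    then show ?thesis by (simp add: matrix_eq R flip: matrix_vector_mul_assoc)
  qed
  ultimately show ?thesis using that by blast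
qed

lemma psd_form_zero:
  fixes R :: "real^'n^'n"
  assumes "symmetric_matrix R" "\<And>v. 0 \<le> v \<bullet> (R *v v)" "e \<bullet> (R *v e) = 0"
  shows "R *v e = 0"
  using form_minimum_stationary[OF assms(1) subspace_UNIV, of 0 e "R *v e"] assms(2,3) by auto

text \<open>An eigenvector of the difference of two square roots of the same matrix, for a nonzero eigenvalue, would be in
  the kernel of both.\<close>

lemma psd_sqrt_unique:
  fixes R R' :: "real^'n^'n"
  assumes R: "symmetric_matrix R" "\<And>v. 0 \<le> v \<bullet> (R *v v)"
    and R': "symmetric_matrix R'" "\<And>v. 0 \<le> v \<bullet> (R' *v v)" and eq: "R ** R = R' ** R'"
  shows "R = R'"
proof -
  have D: "symmetric_matrix (R - R')"
    by (rule symmetric_matrixI)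
      (simp add: matrix_vector_mult_diff_rdistrib inner_diff_left inner_diff_right
        symmetric_matrix_dot[OF R(1)] symmetric_matrix_dot[OF R'(1)])
  obtain E l where E: "finite E" "pairwise orthogonal E" "span E = UNIV"
    "\<And>e. e \<in> E \<Longrightarrow> norm e = 1" "\<And>e. e \<in> E \<Longrightarrow> (R - R') *v e = l e *\<^sub>R e"
    using spectral_theorem[OF D] by metis
  have z: "(R - R') *v e = 0" if e: "e \<in> E" for e
  proof -
    have dv: "R *v e = R' *v e + l e *\<^sub>R e"
      using E(5)[OF e] by (simp add: matrix_vector_mult_diff_rdistrib algebra_simps)
    have sq: "(R *v e) \<bullet> (R *v e) = (R' *v e) \<bullet> (R' *v e)"
    proof -
      have "(R *v e) \<bullet> (R *v e) = e \<bullet> ((R ** R) *v e)"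
        by (simp add: symmetric_matrix_dot[OF R(1)] flip: matrix_vector_mul_assoc)
      also have "\<dots> = (R' *v e) \<bullet> (R' *v e)"
        by (simp add: eq symmetric_matrix_dot[OF R'(1)] flip: matrix_vector_mul_assoc)
      finally show ?thesis .
    qed
    have "l e * (e \<bullet> (R *v e) + e \<bullet> (R' *v e)) = 0"
    proof -
      have "(R *v e) \<bullet> (R *v e) - (R' *v e) \<bullet> (R' *v e) =
          (R *v e - R' *v e) \<bullet> (R *v e + R' *v e)"
        using inner_commute[of "R *v e" "R' *v e"] by (simp add: inner_diff_left inner_add_right)
      also have "\<dots> = l e * (e \<bullet> (R *v e + R' *v e))" by (simp add: dv)
      finally show ?thesis using sq by (simp add: inner_add_right)
    qed
    then consider "l e = 0" | "e \<bullet> (R *v e) = 0" "e \<bullet> (R' *v e) = 0"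
      using R(2)[of e] R'(2)[of e] by fastforce
    then show ?thesis
    proof cases
      case 1 then show ?thesis using E(5)[OF e] by simp
    next
      case 2
      then show ?thesis using psd_form_zero[OF R 2(1)] psd_form_zero[OF R' 2(2)]
        by (simp add: matrix_vector_mult_diff_rdistrib)
    qed
  qed
  have "(R - R') *v x = 0" for x
    using z linear_eq_0_on_span[OF matrix_vector_mul_linear, of E "R - R'"] E(3) by blast
  then show ?thesis by (metis eq_iff_diff_eq_0 matrix_eq matrix_vector_mult_0)
qed

lemma psd_sqrt:
  fixes S :: "real^'n^'n"
  assumes "symmetric_matrix S" "\<And>v. 0 \<le> v \<bullet> (S *v v)"
  shows "symmetric_matrix (psd_sqrt S)" "psd_sqrt S ** psd_sqrt S = S"
proof -
  obtain R where R: "symmetric_matrix R" "\<And>v. 0 \<le> v \<bullet> (R *v v)" "R ** R = S"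
    using psd_sqrt_exists[OF assms] by metis
  have "psd_sqrt S = R" unfolding psd_sqrt_def
    using R psd_sqrt_unique by (intro the_equality) auto
  then show "symmetric_matrix (psd_sqrt S)" "psd_sqrt S ** psd_sqrt S = S" using R by auto
qed

section \<open>Positive definite matrices and dual norms\<close>

definition pos_def :: "real^'n^'n \<Rightarrow> bool" where
  "pos_def H \<longleftrightarrow> symmetric_matrix H \<and> (\<forall>v. v \<noteq> 0 \<longrightarrow> 0 < v \<bullet> (H *v v))"

definition form_norm :: "real^'n^'n \<Rightarrow> real^'n \<Rightarrow> real" where
  "form_norm H v = sqrt (v \<bullet> (H *v v))"

lemma pos_def_nonneg: "pos_def H \<Longrightarrow> 0 \<le> v \<bullet> (H *v v)"
  by (cases "v = 0") (auto simp: pos_def_def intro: less_imp_le)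

lemma matrix_inv_works:
  fixes A :: "real^'n^'m"
  assumes "invertible A"
  shows "A ** matrix_inv A = mat 1" "matrix_inv A ** A = mat 1"
  using someI_ex[of "\<lambda>A'. A ** A' = mat 1 \<and> A' ** A = mat 1"] assms
  by (auto simp: invertible_def matrix_inv_def)

lemma pos_def_inverse:
  fixes H :: "real^'n^'n"
  assumes "pos_def H"
  shows "H ** matrix_inv H = mat 1" "matrix_inv H ** H = mat 1" "pos_def (matrix_inv H)"
proof -
  have "x = 0" if "H *v x = 0" for x using assms that unfolding pos_def_def by force
  then have "invertible H" using matrix_left_invertible_ker[of H] invertible_left_inverse[of H] by blast
  then show iv: "H ** matrix_inv H = mat 1" "matrix_inv H ** H = mat 1"
    by (fact matrix_inv_works)+
  have H: "symmetric_matrix H" using assms by (simp add: pos_def_def)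
  have canc: "H *v (matrix_inv H *v x) = x" for x by (simp add: iv(1) matrix_vector_mul_assoc)
  have "symmetric_matrix (matrix_inv H)"
  proof (rule symmetric_matrixI)
    fix x y
    show "(matrix_inv H *v x) \<bullet> y = x \<bullet> (matrix_inv H *v y)"
      using symmetric_matrix_dot[OF H, of "matrix_inv H *v x" "matrix_inv H *v y"] canc[of x] canc[of y]
      by simp
  qed
  moreover have "0 < v \<bullet> (matrix_inv H *v v)" if "v \<noteq> 0" for v
  proof -
    have "matrix_inv H *v v \<noteq> 0" using canc[of v] that by auto
    then have "0 < (matrix_inv H *v v) \<bullet> (H *v (matrix_inv H *v v))"
      using assms by (simp add: pos_def_def)
    then show ?thesis by (simp add: canc inner_commute)
  qed
  ultimately show "pos_def (matrix_inv H)" by (simp add: pos_def_def)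
qed

lemma form_norm_nonneg [simp]: "pos_def H \<Longrightarrow> 0 \<le> form_norm H v"
  by (simp add: form_norm_def pos_def_nonneg)

lemma form_norm_0 [simp]: "form_norm H 0 = 0"
  by (simp add: form_norm_def)

lemma form_norm_square: "pos_def H \<Longrightarrow> (form_norm H v)\<^sup>2 = v \<bullet> (H *v v)"
  by (simp add: form_norm_def pos_def_nonneg)

lemma form_norm_eq_0: "pos_def H \<Longrightarrow> form_norm H v = 0 \<longleftrightarrow> v = 0"
  unfolding form_norm_def pos_def_def
  by (metis inner_zero_left less_irrefl real_sqrt_eq_zero_cancel_iff)

lemma form_norm_scaleR: "form_norm H (c *\<^sub>R v) = \<bar>c\<bar> * form_norm H v"
proof -
  have "(c *\<^sub>R v) \<bullet> (H *v (c *\<^sub>R v)) = c\<^sup>2 * (v \<bullet> (H *v v))"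
    by (simp add: matrix_vector_mult_scaleR power2_eq_square mult.assoc)
  then show ?thesis by (simp add: form_norm_def real_sqrt_mult)
qed

lemma form_norm_minus: "form_norm H (- v) = form_norm H v"
  using form_norm_scaleR[of H "-1" v] by simp

lemma pos_def_factor:
  fixes H G :: "real^'n^'n"
  assumes H: "pos_def H" and G: "G ** transpose G = matrix_inv H"
  shows "transpose G ** H ** G = mat 1" "G ** (transpose G ** H) = mat 1"
proof -
  have "G ** (transpose G ** H) = mat 1"
    using G pos_def_inverse(2)[OF H] by (simp add: matrix_mul_assoc)
  then show "G ** (transpose G ** H) = mat 1" "transpose G ** H ** G = mat 1"
    using matrix_left_right_inverse by auto
qed

lemma pos_def_factor_exists:
  fixes H :: "real^'n^'n"
  assumes "pos_def H"
  obtains G :: "real^'n^'n" where "G ** transpose G = matrix_inv H"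
proof -
  have "pos_def (matrix_inv H)" using pos_def_inverse assms by blast
  then obtain R where "symmetric_matrix R" "R ** R = matrix_inv H"
    using psd_sqrt_exists pos_def_nonneg unfolding pos_def_def by metis
  then show ?thesis using that by metis
qed

text \<open>A factor \<open>G\<close> of the inverse of \<open>H\<close> supplies coordinates in which the form norm of \<open>H\<close> and its dual norm are both
  Euclidean. The properties of the two norms are derived in these coordinates.\<close>

lemma form_norm_factor:
  fixes H G :: "real^'n^'n"
  assumes H: "pos_def H" and G: "G ** transpose G = matrix_inv H"
  shows "form_norm H (G *v c) = norm c" "form_norm (matrix_inv H) v = norm (transpose G *v v)"
    "G *v (transpose G *v (H *v v)) = v" "transpose G *v (H *v (G *v c)) = c"
proof -
  show a: "transpose G *v (H *v (G *v c)) = c"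
    using pos_def_factor(1)[OF assms] by (simp add: matrix_vector_mul_assoc matrix_mul_assoc)
  show "G *v (transpose G *v (H *v v)) = v"
    using pos_def_factor(2)[OF assms] by (simp add: matrix_vector_mul_assoc matrix_mul_assoc)
  have "(G *v c) \<bullet> (H *v (G *v c)) = c \<bullet> c"
    by (metis a inner_commute transpose_dot)
  then show "form_norm H (G *v c) = norm c" by (simp add: form_norm_def norm_eq_sqrt_inner)
  have "v \<bullet> (matrix_inv H *v v) = (transpose G *v v) \<bullet> (transpose G *v v)"
    by (simp add: G[symmetric] transpose_dot matrix_vector_mul_assoc)
  then show "form_norm (matrix_inv H) v = norm (transpose G *v v)"
    by (simp add: form_norm_def norm_eq_sqrt_inner)
qed

lemma form_norm_cauchy_schwarz:
  fixes H :: "real^'n^'n"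
  assumes "pos_def H"
  shows "u \<bullet> v \<le> form_norm (matrix_inv H) u * form_norm H v"
proof -
  obtain G :: "real^'n^'n" where G: "G ** transpose G = matrix_inv H" using pos_def_factor_exists[OF assms] .
  note F = form_norm_factor[OF assms G]
  have "u \<bullet> v = u \<bullet> (G *v (transpose G *v (H *v v)))" by (simp add: F)
  also have "\<dots> = (transpose G *v u) \<bullet> (transpose G *v (H *v v))" by (simp add: transpose_dot)
  also have "\<dots> \<le> norm (transpose G *v u) * norm (transpose G *v (H *v v))"
    by (rule norm_cauchy_schwarz)
  also have "\<dots> = form_norm (matrix_inv H) u * form_norm H v"
    using F(1)[of "transpose G *v (H *v v)"] by (simp add: F)
  finally show ?thesis .
qed

lemma form_norm_triangle:
  fixes H :: "real^'n^'n"
  assumes "pos_def H"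
  shows "form_norm H (u + v) \<le> form_norm H u + form_norm H v"
proof -
  obtain G :: "real^'n^'n" where G: "G ** transpose G = matrix_inv H" using pos_def_factor_exists[OF assms] .
  note F = form_norm_factor[OF assms G]
  have e: "form_norm H w = norm (transpose G *v (H *v w))" for w
    using F(1)[of "transpose G *v (H *v w)"] by (simp add: F)
  show ?thesis unfolding e by (simp add: matrix_vector_right_distrib norm_triangle_ineq)
qed

lemma dual_norm_self:
  assumes "pos_def H"
  shows "form_norm H (matrix_inv H *v v) = form_norm (matrix_inv H) v"
  using pos_def_inverse(1)[OF assms]
  by (simp add: form_norm_def matrix_vector_mul_assoc inner_commute)

text \<open>The test vector \<open>matrix_inv H *v v\<close> shows that the dual norm is the least constant \<open>c\<close> with this property. Hence
  duality reverses order.\<close>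

lemma dual_norm_le:
  assumes H: "pos_def H" and b: "\<And>u. v \<bullet> u \<le> c * form_norm H u" and "0 \<le> c"
  shows "form_norm (matrix_inv H) v \<le> c"
proof (cases "v = 0")
  case False
  note H' = pos_def_inverse(3)[OF H]
  have pos: "form_norm (matrix_inv H) v > 0"
    using form_norm_nonneg[OF H', of v] form_norm_eq_0[OF H', of v] False by linarith
  have "(form_norm (matrix_inv H) v)\<^sup>2 \<le> c * form_norm (matrix_inv H) v"
    using b[of "matrix_inv H *v v"] by (simp add: form_norm_square[OF H'] dual_norm_self[OF H])
  then show ?thesis using pos by (simp add: power2_eq_square)
qed (use assms in simp)

lemma dual_norm_antimono:
  assumes H: "pos_def H" "pos_def H'" and c: "0 < c"
    and le: "\<And>u. c * form_norm H u \<le> form_norm H' u"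
  shows "form_norm (matrix_inv H') v \<le> form_norm (matrix_inv H) v / c"
proof (rule dual_norm_le[OF H(2)])
  note n = form_norm_nonneg[OF pos_def_inverse(3)[OF H(1)], of v]
  fix u
  have "v \<bullet> u \<le> form_norm (matrix_inv H) v * form_norm H u"
    by (rule form_norm_cauchy_schwarz[OF H(1)])
  also have "\<dots> \<le> form_norm (matrix_inv H) v * (form_norm H' u / c)"
    using le[of u] c n by (intro mult_left_mono) (auto simp: field_simps)
  finally show "v \<bullet> u \<le> form_norm (matrix_inv H) v / c * form_norm H' u" by simp
  show "0 \<le> form_norm (matrix_inv H) v / c" using n c by simp
qed

section \<open>The capped conjugate gradient method\<close>

lemma matrix_vector_mult_minus: "(A :: real^'n^'m) *v (- x) = - (A *v x)"
  using matrix_vector_mult_scaleR[of A "-1" x] by simp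

lemma cg_initial: "cg_y H g 0 = 0" "cg_r H g 0 = g" "cg_p H g 0 = - g"
  by (auto simp: cg_y_def cg_r_def cg_p_def)

definition cg_alpha :: "real^'n^'n \<Rightarrow> real^'n \<Rightarrow> nat \<Rightarrow> real" where
  "cg_alpha H g j = (cg_r H g j \<bullet> cg_r H g j) / (cg_p H g j \<bullet> (H *v cg_p H g j))"

definition cg_beta :: "real^'n^'n \<Rightarrow> real^'n \<Rightarrow> nat \<Rightarrow> real" where
  "cg_beta H g j = (norm (cg_r H g (Suc j)))\<^sup>2 / (norm (cg_r H g j))\<^sup>2"

lemma cg_step:
  "cg_y H g (Suc j) = cg_y H g j + cg_alpha H g j *\<^sub>R cg_p H g j"
  "cg_r H g (Suc j) = cg_r H g j + cg_alpha H g j *\<^sub>R (H *v cg_p H g j)"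
  "cg_p H g (Suc j) = - cg_r H g (Suc j) + cg_beta H g j *\<^sub>R cg_p H g j"
  unfolding cg_beta_def
  by (auto simp: cg_y_def cg_r_def cg_p_def cg_alpha_def split: prod.splits)
    (auto simp: Let_def split: prod.splits)

lemma cg_residual: "cg_r H g j = H *v cg_y H g j + g"
  by (induction j)
    (auto simp: cg_initial cg_step matrix_vector_right_distrib matrix_vector_mult_scaleR)

text \<open>CG up to step \<open>n\<close>, under the sole requirement that the directions used so far have positive curvature; the
  matrix itself may be indefinite.\<close>

locale cg_positive =
  fixes H :: "real^'n^'n" and g :: "real^'n" and n :: nat
  assumes symH: "symmetric_matrix H"
    and curv: "\<And>i. i < n \<Longrightarrow> 0 < cg_p H g i \<bullet> (H *v cg_p H g i)"
begin

abbreviation "y \<equiv> cg_y H g"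
abbreviation "r \<equiv> cg_r H g"
abbreviation "p \<equiv> cg_p H g"
abbreviation "\<alpha> \<equiv> cg_alpha H g"
abbreviation "\<beta> \<equiv> cg_beta H g"

lemma residual_nonzero: assumes "i < n" shows "r i \<noteq> 0"
proof
  assume r: "r i = 0"
  have "p i = 0"
  proof (cases i)
    case 0 with r show ?thesis by (simp add: cg_initial)
  next
    case (Suc k) with r show ?thesis by (simp add: cg_step(3) cg_beta_def)
  qed
  with curv[OF assms] show False by simp
qed

lemma alpha_pos: "i < n \<Longrightarrow> 0 < \<alpha> i"
  unfolding cg_alpha_def using curv residual_nonzero by simp

lemma direction_image: "i < n \<Longrightarrow> H *v p i = (1 / \<alpha> i) *\<^sub>R (r (Suc i) - r i)"
  using alpha_pos[of i] by (simp add: cg_step(2))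

text \<open>The orthogonality relations of CG depend on each other, so that one induction has to prove them together.\<close>

lemma conjugacy:
  "j \<le> n \<Longrightarrow> (\<forall>i<j. r j \<bullet> p i = 0 \<and> r j \<bullet> r i = 0 \<and> p j \<bullet> (H *v p i) = 0) \<and> r j \<bullet> p j = - (r j \<bullet> r j)"
proof (induction j)
  case 0
  then show ?case by (simp add: cg_initial)
next
  case (Suc j)
  then have j: "j < n" "j \<le> n" by auto
  note IH = Suc.IH[OF j(2)]
  have rp: "r (Suc j) \<bullet> p i = 0" if "i < Suc j" for i
  proof (cases "i = j")
    case True
    have "r (Suc j) \<bullet> p j = r j \<bullet> p j + \<alpha> j * (p j \<bullet> (H *v p j))"
      by (simp add: cg_step(2) inner_add_left inner_commute[of "H *v p j"])
    also have "\<alpha> j * (p j \<bullet> (H *v p j)) = r j \<bullet> r j"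
      using curv[OF j(1)] by (simp add: cg_alpha_def)
    finally show ?thesis using IH True by simp
  next
    case False
    with that have i: "i < j" by simp
    have "r (Suc j) \<bullet> p i = r j \<bullet> p i + \<alpha> j * (p j \<bullet> (H *v p i))"
      by (simp add: cg_step(2) inner_add_left symmetric_matrix_dot[OF symH])
    then show ?thesis using IH i by simp
  qed
  have rr: "r (Suc j) \<bullet> r i = 0" if "i < Suc j" for i
  proof (cases i)
    case 0
    then show ?thesis using rp[of 0] by (simp add: cg_initial)
  next
    case (Suc k)
    have "r i = \<beta> k *\<^sub>R p k - p i" by (simp add: Suc cg_step(3))
    then show ?thesis using rp[of i] rp[of k] that Suc by (simp add: inner_diff_right)
  qed
  have ph: "p (Suc j) \<bullet> (H *v p i) = 0" if i: "i < Suc j" for i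
  proof -
    have e: "p (Suc j) \<bullet> (H *v p i) = - (r (Suc j) \<bullet> (H *v p i)) + \<beta> j * (p j \<bullet> (H *v p i))"
      by (simp add: cg_step(3) inner_add_left inner_diff_left)
    show ?thesis
    proof (cases "i = j")
      case True
      have "r (Suc j) \<bullet> (H *v p j) = (r (Suc j) \<bullet> r (Suc j)) / \<alpha> j"
        unfolding direction_image[OF j(1)] using rr[of j] by (simp add: inner_diff_right)
      also have "\<dots> = \<beta> j * (p j \<bullet> (H *v p j))"
        by (simp add: cg_alpha_def cg_beta_def power2_norm_eq_inner)
      finally show ?thesis using e True by simp
    next
      case False
      with i have "i < j" by simp
      moreover from this j have "i < n" by simp
      moreover have "r (Suc j) \<bullet> (H *v p i) = 0"
        unfolding direction_image[OF \<open>i < n\<close>] using rr[of i] rr[of "Suc i"] \<open>i < j\<close>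
        by (simp add: inner_diff_right)
      ultimately show ?thesis using e IH by simp
    qed
  qed
  have "r (Suc j) \<bullet> p (Suc j) = - (r (Suc j) \<bullet> r (Suc j))"
    using rp[of j] by (simp add: cg_step(3) inner_diff_right inner_add_right)
  then show ?case using rp rr ph by blast
qed

definition search_space :: "nat \<Rightarrow> (real^'n) set" where
  "search_space j = span (p ` {..<j})"

lemma search_space_mono: "i \<le> j \<Longrightarrow> search_space i \<subseteq> search_space j"
  unfolding search_space_def by (intro span_mono) auto

lemma direction_in_space: "i < j \<Longrightarrow> p i \<in> search_space j"
  unfolding search_space_def by (intro span_base) auto

lemma residual_in_space: assumes "i < j" shows "r i \<in> search_space j"
proof (cases i)
  case 0
  then have "r i = - p i" by (simp add: cg_initial)
  then show ?thesis using direction_in_space[OF assms]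
    by (simp add: search_space_def span_neg)
next
  case (Suc k)
  then have "r i = \<beta> k *\<^sub>R p k - p i" by (simp add: cg_step(3))
  moreover have "p k \<in> search_space j" "p i \<in> search_space j"
    using direction_in_space assms Suc by auto
  ultimately show ?thesis by (simp add: search_space_def span_diff span_scale)
qed

lemma iterate_in_space: "y j \<in> search_space j"
proof (induction j)
  case 0 then show ?case by (simp add: cg_initial search_space_def span_zero)
next
  case (Suc j)
  then have "y j \<in> search_space (Suc j)" using search_space_mono[of j "Suc j"] by auto
  moreover have "p j \<in> search_space (Suc j)" by (rule direction_in_space) simp
  ultimately show ?case by (simp add: cg_step(1) search_space_def span_add span_scale)
qed

lemma residual_orthogonal_space: assumes "j \<le> n" "w \<in> search_space j" shows "r j \<bullet> w = 0"
proof -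
  have "orthogonal (r j) w"
    using assms(2) unfolding search_space_def
    by (rule orthogonal_to_span) (use conjugacy[OF assms(1)] in \<open>auto simp: orthogonal_def\<close>)
  then show ?thesis by (simp add: orthogonal_def)
qed

lemma iterate_energy: "j \<le> n \<Longrightarrow> y j \<bullet> (H *v y j) = - (g \<bullet> y j)"
  using residual_orthogonal_space[OF _ iterate_in_space, of j]
  by (simp add: cg_residual inner_add_left inner_commute[of "y j"])

text \<open>The residual \<open>r i\<close> is the gradient of \<open>q\<close> at \<open>y i\<close>.\<close>

definition q :: "real^'n \<Rightarrow> real" where
  "q w = (w \<bullet> (H *v w)) / 2 + g \<bullet> w"

lemma q_expand: "q w = q (y i) + r i \<bullet> (w - y i) + ((w - y i) \<bullet> (H *v (w - y i))) / 2"
proof -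
  define d where "d = w - y i"
  have w: "w = y i + d" by (simp add: d_def)
  have s: "d \<bullet> (H *v y i) = y i \<bullet> (H *v d)" "(H *v y i) \<bullet> d = y i \<bullet> (H *v d)"
    using symmetric_matrix_dot[OF symH, of "y i" d] by (auto simp: inner_commute)
  show ?thesis unfolding d_def[symmetric] unfolding w q_def cg_residual
    by (simp add: matrix_vector_right_distrib inner_add_left inner_add_right s field_simps)
qed

text \<open>A CG step gains at least as much as a gradient step, because conjugacy makes the curvature along \<open>p i\<close> at most
  that along \<open>r i\<close>.\<close>

lemma step_decrease:
  assumes i: "i < n" and L: "r i \<bullet> (H *v r i) \<le> L * (r i \<bullet> r i)" and "0 < L"
  shows "q (y (Suc i)) \<le> q (y i) - (r i \<bullet> r i) / (2 * L)"
proof -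
  have le: "p i \<bullet> (H *v p i) \<le> r i \<bullet> (H *v r i)"
  proof (cases i)
    case 0 then show ?thesis by (simp add: cg_initial matrix_vector_mult_minus)
  next
    case (Suc k)
    have ri: "r i = \<beta> k *\<^sub>R p k - p i" by (simp add: Suc cg_step(3))
    have "p i \<bullet> (H *v p k) = 0" "p k \<bullet> (H *v p i) = 0"
      using conjugacy[of i] i Suc symmetric_matrix_dot[OF symH, of "p i" "p k"]
      by (auto simp: inner_commute)
    then have "r i \<bullet> (H *v r i) = (\<beta> k)\<^sup>2 * (p k \<bullet> (H *v p k)) + p i \<bullet> (H *v p i)"
      unfolding ri
      by (simp add: inner_diff_left inner_diff_right matrix_vector_mult_diff_distrib
          matrix_vector_mult_scaleR power2_eq_square mult.assoc)
    then show ?thesis using curv[of k] i Suc by (simp add: less_imp_le)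
  qed
  define c where "c = p i \<bullet> (H *v p i)"
  define s where "s = r i \<bullet> r i"
  have c: "0 < c" "c \<le> L * s" "0 < s"
    unfolding c_def s_def using curv[OF i] le L residual_nonzero[OF i] by auto
  have "q (y (Suc i)) = q (y i) + r i \<bullet> (\<alpha> i *\<^sub>R p i) + ((\<alpha> i *\<^sub>R p i) \<bullet> (H *v (\<alpha> i *\<^sub>R p i))) / 2"
    using q_expand[of "y (Suc i)" i] by (simp add: cg_step(1))
  also have "\<dots> = q (y i) - \<alpha> i * s + (\<alpha> i)\<^sup>2 * c / 2"
    using conjugacy[of i] i
    by (simp add: c_def s_def matrix_vector_mult_scaleR power2_eq_square mult.assoc)
  also have "\<dots> = q (y i) - s\<^sup>2 / (2 * c)"
    using c by (simp add: cg_alpha_def flip: s_def c_def) (simp add: power2_eq_square field_simps)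
  also have "\<dots> \<le> q (y i) - s / (2 * L)"
  proof -
    have "s * c \<le> s * (L * s)" using c by (intro mult_left_mono) auto
    then have "s / (2 * L) \<le> s\<^sup>2 / (2 * c)"
      using c \<open>0 < L\<close> by (simp add: field_simps power2_eq_square)
    then show ?thesis by simp
  qed
  finally show ?thesis by (simp add: s_def)
qed

end

text \<open>Completing the square in the recursion for the estimating functions. The linear terms in \<open>v\<close> and \<open>y\<close> are
  absent because \<open>r\<close> is orthogonal to both.\<close>

lemma estimate_recursion:
  fixes w v y r :: "'a::real_inner"
  assumes "r \<bullet> v = 0" "r \<bullet> y = 0" "0 < m" "\<tau> + a = (1::real)"
  shows "\<tau> * (\<phi> + m / 2 * (norm (w - v))\<^sup>2) + a * (Q + r \<bullet> (w - y) + m / 2 * (norm (w - y))\<^sup>2) =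
    (\<tau> * \<phi> + a * Q + \<tau> * a * (m / 2) * (norm (v - y))\<^sup>2 - a\<^sup>2 / (2 * m) * (r \<bullet> r)) +
    m / 2 * (norm (w - (\<tau> *\<^sub>R v + a *\<^sub>R y - (a / m) *\<^sub>R r)))\<^sup>2"
proof -
  have t: "\<tau> = 1 - a" using assms(4) by simp
  show ?thesis unfolding power2_norm_eq_inner t using assms(1-3)
    by (simp add: inner_diff_left inner_diff_right inner_add_left inner_add_right inner_commute
        field_simps power2_eq_square) (simp add: algebra_simps)?
qed

text \<open>Linear convergence of CG as long as the quadratic looks strongly convex between all earlier iterates and the
  next one. Nesterov's estimating functions give the rate; with CG their minimisers stay in the search space, to which
  the residual is orthogonal.\<close>

lemma (in cg_positive) residual_decay:
  assumes n: "n = Suc j" "1 \<le> j" and m: "0 < m" "m \<le> L"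
    and L: "\<And>i. i \<le> j \<Longrightarrow> r i \<bullet> (H *v r i) \<le> L * (r i \<bullet> r i)"
    and strong: "\<And>i. i < j \<Longrightarrow>
      m * (norm (y (Suc j) - y i))\<^sup>2 \<le> (y (Suc j) - y i) \<bullet> (H *v (y (Suc j) - y i))"
    and \<kappa>: "\<kappa> = L / m" and \<tau>: "\<tau> = sqrt \<kappa> / (sqrt \<kappa> + 1)"
  shows "(norm (r j))\<^sup>2 \<le> 2 * \<kappa> * \<tau> ^ j * (norm g)\<^sup>2"
proof -
  (* In place of a minimiser, the comparison point is the next iterate: one CG step separates it from y j, and only
     the curvature between it and earlier iterates enters. *)
  define z where "z = y (Suc j)"
  define a where "a = 1 / (sqrt \<kappa> + 1)"
  have \<kappa>1: "1 \<le> \<kappa>" using m \<kappa> by simp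
  then have sk: "1 \<le> sqrt \<kappa>" by simp
  have ta: "\<tau> + a = 1" "0 < a" "0 \<le> \<tau>"
  proof -
    have "0 < sqrt \<kappa> + 1" using sk by linarith
    then show "\<tau> + a = 1" "0 < a" "0 \<le> \<tau>"
      unfolding \<tau> a_def using \<kappa>1 by (auto simp: add_divide_distrib[symmetric])
  qed
  have a2: "a\<^sup>2 \<le> m / L"
  proof -
    have "a \<le> 1 / sqrt \<kappa>" unfolding a_def using \<kappa>1 by (intro frac_le) auto
    then have "a\<^sup>2 \<le> (1 / sqrt \<kappa>)\<^sup>2" using ta by (intro power_mono) auto
    also have "\<dots> = m / L" using \<kappa>1 \<kappa> by (simp add: power_divide)
    finally show ?thesis .
  qed
  have L0: "0 < L" using m by simp
  have low: "q (y i) + r i \<bullet> (z - y i) + m / 2 * (norm (z - y i))\<^sup>2 \<le> q z" if "i < j" for i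
    using q_expand[of z i] strong[OF that] by (simp add: z_def)
  define C where "C = q 0 - q z + m / 2 * (norm z)\<^sup>2"
  (* The estimating function of step t is w |-> \<phi> + m / 2 * |w - v|^2. Its least value dominates q (y t), and its excess
     over q at the point z shrinks by the factor \<tau>. *)
  have est: "t \<le> j \<Longrightarrow> \<exists>\<phi> v. v \<in> search_space t \<and> q (y t) \<le> \<phi> \<and>
      \<phi> + m / 2 * (norm (z - v))\<^sup>2 - q z \<le> \<tau> ^ t * C" for t
  proof (induction t)
    case 0
    show ?case by (rule exI[of _ "q 0"], rule exI[of _ 0])
        (simp add: C_def cg_initial search_space_def span_zero)
  next
    case (Suc t)
    then obtain \<phi> v where h: "v \<in> search_space t" "q (y t) \<le> \<phi>"
      "\<phi> + m / 2 * (norm (z - v))\<^sup>2 - q z \<le> \<tau> ^ t * C" by auto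
    have tn: "t < n" "t \<le> n" "t < j" using Suc.prems n by auto
    have o: "r t \<bullet> v = 0" "r t \<bullet> y t = 0"
      using residual_orthogonal_space[OF tn(2)] h(1) iterate_in_space by auto
    define \<phi>' where "\<phi>' = \<tau> * \<phi> + a * q (y t) + \<tau> * a * (m / 2) * (norm (v - y t))\<^sup>2
      - a\<^sup>2 / (2 * m) * (r t \<bullet> r t)"
    define v' where "v' = \<tau> *\<^sub>R v + a *\<^sub>R y t - (a / m) *\<^sub>R r t"
    have "v' \<in> search_space (Suc t)"
    proof -
      have "v \<in> search_space (Suc t)" "y t \<in> search_space (Suc t)" "r t \<in> search_space (Suc t)"
        using h(1) iterate_in_space[of t] search_space_mono[of t "Suc t"] residual_in_space[of t "Suc t"]
        by auto
      then show ?thesis unfolding v'_def search_space_def by (intro span_diff span_add span_scale)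
    qed
    moreover have "q (y (Suc t)) \<le> \<phi>'"
    proof -
      have "q (y (Suc t)) \<le> q (y t) - (r t \<bullet> r t) / (2 * L)"
        using step_decrease[OF tn(1) L L0] tn by simp
      also have "\<dots> \<le> q (y t) - a\<^sup>2 / (2 * m) * (r t \<bullet> r t)"
      proof -
        have "a\<^sup>2 / (2 * m) * (r t \<bullet> r t) \<le> (m / L) / (2 * m) * (r t \<bullet> r t)"
          using a2 m by (intro mult_right_mono divide_right_mono) auto
        then show ?thesis using m by simp
      qed
      also have "\<dots> \<le> \<phi>'"
      proof -
        have "\<tau> * q (y t) \<le> \<tau> * \<phi>" using h(2) ta by (intro mult_left_mono) auto
        moreover have "q (y t) = \<tau> * q (y t) + a * q (y t)"
          using ta(1) by (metis distrib_right mult_1)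
        moreover have "0 \<le> \<tau> * a * (m / 2) * (norm (v - y t))\<^sup>2" using ta m by simp
        ultimately show ?thesis unfolding \<phi>'_def by linarith
      qed
      finally show ?thesis .
    qed
    moreover have "\<phi>' + m / 2 * (norm (z - v'))\<^sup>2 - q z \<le> \<tau> ^ Suc t * C"
    proof -
      have "\<phi>' + m / 2 * (norm (z - v'))\<^sup>2 =
          \<tau> * (\<phi> + m / 2 * (norm (z - v))\<^sup>2) + a * (q (y t) + r t \<bullet> (z - y t) + m / 2 * (norm (z - y t))\<^sup>2)"
        unfolding \<phi>'_def v'_def by (rule estimate_recursion[OF o m(1) ta(1), symmetric])
      also have "\<dots> \<le> \<tau> * (\<tau> ^ t * C + q z) + a * q z"
      proof (rule add_mono)
        have "\<phi> + m / 2 * (norm (z - v))\<^sup>2 \<le> \<tau> ^ t * C + q z" using h(3) by linarith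
        then show "\<tau> * (\<phi> + m / 2 * (norm (z - v))\<^sup>2) \<le> \<tau> * (\<tau> ^ t * C + q z)"
          using ta(3) by (rule mult_left_mono)
        show "a * (q (y t) + r t \<bullet> (z - y t) + m / 2 * (norm (z - y t))\<^sup>2) \<le> a * q z"
          using low[OF tn(3)] ta(2) by (intro mult_left_mono) auto
      qed
      also have "\<dots> = \<tau> ^ Suc t * C + (\<tau> + a) * q z" by (simp add: algebra_simps)
      finally show ?thesis using ta(1) by simp
    qed
    ultimately show ?case by blast
  qed
  obtain \<phi> v where fin: "q (y j) \<le> \<phi>" "\<phi> + m / 2 * (norm (z - v))\<^sup>2 - q z \<le> \<tau> ^ j * C"
    using est[of j] by auto
  have "0 \<le> m / 2 * (norm (z - v))\<^sup>2" using m by simp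
  then have up: "q (y j) - q z \<le> \<tau> ^ j * C" using fin by linarith
  have dn: "(norm (r j))\<^sup>2 / (2 * L) \<le> q (y j) - q z"
    using step_decrease[of j L] L[of j] L0 n by (simp add: z_def power2_norm_eq_inner)
  have en: "z \<bullet> (H *v z) = - (g \<bullet> z)" unfolding z_def using iterate_energy n by simp
  have s0: "m * (norm z)\<^sup>2 \<le> z \<bullet> (H *v z)" using strong[of 0] n by (simp add: z_def cg_initial)
  have C: "C \<le> z \<bullet> (H *v z)" unfolding C_def q_def using en s0 by simp
  have zH: "z \<bullet> (H *v z) \<le> (norm g)\<^sup>2 / m"
  proof -
    have le: "z \<bullet> (H *v z) \<le> norm g * norm z"
      using en norm_cauchy_schwarz[of "- g" z] by simp
    have "norm z \<le> norm g / m"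
    proof (cases "z = 0")
      case False
      have "m * norm z * norm z \<le> norm g * norm z" using le s0 by (simp add: power2_eq_square)
      then have "m * norm z \<le> norm g" using False by (simp add: mult_le_cancel_right)
      then show ?thesis using m by (simp add: field_simps)
    qed (use m in simp)
    then have "norm g * norm z \<le> norm g * (norm g / m)" by (intro mult_left_mono) auto
    then show ?thesis using le by (simp add: power2_eq_square)
  qed
  have "(norm (r j))\<^sup>2 / (2 * L) \<le> \<tau> ^ j * ((norm g)\<^sup>2 / m)"
    using up dn C zH ta(3) mult_left_mono[of C "(norm g)\<^sup>2 / m" "\<tau> ^ j"] by fastforce
  then show ?thesis using L0 m by (simp add: \<kappa> field_simps)
qed

subsection \<open>The running curvature bound\<close>

lemma bump_bounds: "0 \<le> U \<Longrightarrow> U \<le> bump H U w" "norm (H *v w) \<le> bump H U w * norm w"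
proof -
  show "norm (H *v w) \<le> bump H U w * norm w"
  proof (cases "w = 0")
    case False
    then show ?thesis by (auto simp: bump_def)
  qed simp
  show "U \<le> bump H U w"
  proof (cases "norm (H *v w) > U * norm w")
    case True
    then have "w \<noteq> 0" by auto
    then show ?thesis using True by (simp add: bump_def field_simps)
  qed (simp add: bump_def)
qed

lemma cg_U_nonneg: "0 \<le> U \<Longrightarrow> 0 \<le> cg_U H Hb g U j"
  by (induction j) (auto intro: order_trans[OF _ bump_bounds(1)])

lemma cg_U_Suc: "0 \<le> U \<Longrightarrow> cg_U H Hb g U j \<le> cg_U H Hb g U (Suc j)"
proof -
  assume U: "0 \<le> U"
  note n = cg_U_nonneg[OF U, of H Hb g j]
  show ?thesis unfolding cg_U.simps
    by (intro order_trans[OF _ bump_bounds(1)] n order.refl order_trans[OF n])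
qed

lemma cg_U_mono: "0 \<le> U \<Longrightarrow> i \<le> j \<Longrightarrow> cg_U H Hb g U i \<le> cg_U H Hb g U j"
  using lift_Suc_mono_le[of "cg_U H Hb g U"] cg_U_Suc by blast

text \<open>Since the bound never decreases, its last value is valid for all vectors met so far.\<close>

lemma cg_U_bounds:
  assumes U: "0 \<le> U" and i: "i \<le> j"
  shows "norm (H *v cg_r Hb g i) \<le> cg_U H Hb g U j * norm (cg_r Hb g i)"
    "norm (H *v cg_y Hb g i) \<le> cg_U H Hb g U j * norm (cg_y Hb g i)"
proof -
  have "norm (H *v cg_r Hb g i) \<le> cg_U H Hb g U i * norm (cg_r Hb g i) \<and>
    norm (H *v cg_y Hb g i) \<le> cg_U H Hb g U i * norm (cg_y Hb g i)"
  proof (cases i)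
    case 0
    show ?thesis using bump_bounds(2)[of H "- g" U]
      by (simp add: 0 cg_initial matrix_vector_mult_minus)
  next
    case (Suc k)
    define U1 where "U1 = bump H (cg_U H Hb g U k) (cg_p Hb g i)"
    define U2 where "U2 = bump H U1 (cg_y Hb g i)"
    have U1: "0 \<le> U1" unfolding U1_def
      by (rule order_trans[OF cg_U_nonneg[OF U] bump_bounds(1)[OF cg_U_nonneg[OF U]]])
    have U2: "0 \<le> U2" unfolding U2_def by (rule order_trans[OF U1 bump_bounds(1)[OF U1]])
    have e: "cg_U H Hb g U i = bump H U2 (cg_r Hb g i)" unfolding Suc U2_def U1_def by simp
    have "norm (H *v cg_y Hb g i) \<le> U2 * norm (cg_y Hb g i)"
      unfolding U2_def by (rule bump_bounds(2))
    also have "\<dots> \<le> bump H U2 (cg_r Hb g i) * norm (cg_y Hb g i)"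
      by (intro mult_right_mono bump_bounds(1) U2) simp
    finally show ?thesis unfolding e using bump_bounds(2) by blast
  qed
  with cg_U_mono[OF U i, of H Hb g]
  show "norm (H *v cg_r Hb g i) \<le> cg_U H Hb g U j * norm (cg_r Hb g i)"
    "norm (H *v cg_y Hb g i) \<le> cg_U H Hb g U j * norm (cg_y Hb g i)"
    by (meson mult_right_mono norm_ge_zero order_trans)+
qed

subsection \<open>What the method returns\<close>

lemma mat_scale: "mat c *v x = c *\<^sub>R (x::real^'n)"
proof -
  have "mat c *v x = c *\<^sub>R (mat 1 *v x)"
    by (simp add: vec_eq_iff mat_def matrix_vector_mult_def if_distrib[of "\<lambda>t. t * _"] cong: if_cong)
  then show ?thesis by simp
qed

text \<open>What the analysis of the outer method needs to know of an answer. The residual of an approximate solution is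
  compared with \<open>d\<close> and not with \<open>g\<close>, because the progress of the outer method is measured by \<open>d\<close>.\<close>

definition cg_answer :: "real^'n^'n \<Rightarrow> real^'n \<Rightarrow> real \<Rightarrow> real \<Rightarrow> real^'n \<Rightarrow> dtype \<Rightarrow> bool" where
  "cg_answer H g \<epsilon> \<zeta> d t = (case t of
     NC \<Rightarrow> d \<noteq> 0 \<and> d \<bullet> (H *v d) < - \<epsilon> * (norm d)\<^sup>2
   | SOL \<Rightarrow> d \<noteq> 0 \<and> - \<epsilon> * (norm d)\<^sup>2 \<le> d \<bullet> (H *v d) \<and>
       g \<bullet> d = - (d \<bullet> (H *v d)) - 2 * \<epsilon> * (norm d)\<^sup>2 \<and>
       norm (H *v d + (2 * \<epsilon>) *\<^sub>R d + g) \<le> \<zeta> * \<epsilon> / 2 * norm d)"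

lemma low_curv_shift:
  "low_curv (H + mat (2 * \<epsilon>)) \<epsilon> d \<longleftrightarrow> d \<noteq> 0 \<and> d \<bullet> (H *v d) < - \<epsilon> * (norm d)\<^sup>2"
  by (auto simp: low_curv_def matrix_vector_mult_add_rdistrib mat_scale inner_add_right
      dot_square_norm)

context
  fixes H :: "real^'n^'n" and g :: "real^'n" and \<epsilon> \<zeta> :: real
  assumes symH: "symmetric_matrix H" and g: "g \<noteq> 0" and eps: "0 < \<epsilon>" and zeta: "0 < \<zeta>" "\<zeta> < 1"
begin

abbreviation "Hb \<equiv> H + mat (2 * \<epsilon>)"

lemma symHb: "symmetric_matrix Hb"
  by (rule symmetric_matrixI)
    (simp add: matrix_vector_mult_add_rdistrib mat_scale inner_add_left inner_add_right
      symmetric_matrix_dot[OF symH])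

lemma kappa_ge: "0 \<le> U \<Longrightarrow> 2 \<le> (U + 2 * \<epsilon>) / \<epsilon>"
  using eps by (simp add: field_simps)

lemma continue_facts:
  assumes "cg_exit H g \<epsilon> \<zeta> 0 i = None"
  shows "cg_r Hb g i \<noteq> 0" "\<epsilon> * (norm (cg_p Hb g i))\<^sup>2 \<le> cg_p Hb g i \<bullet> (Hb *v cg_p Hb g i)"
proof -
  have k: "0 \<le> \<zeta> / (3 * ((cg_U H Hb g 0 i + 2 * \<epsilon>) / \<epsilon>))"
    using zeta eps cg_U_nonneg[of 0 H Hb g i] by (intro divide_nonneg_nonneg mult_nonneg_nonneg) auto
  show "cg_r Hb g i \<noteq> 0"
  proof (cases "i = 0")
    case False
    then have "\<not> norm (cg_r Hb g i) \<le> \<zeta> / (3 * ((cg_U H Hb g 0 i + 2 * \<epsilon>) / \<epsilon>)) * norm (cg_r Hb g 0)"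
      using assms by (auto simp: cg_exit_def Let_def split: if_splits)
    then show ?thesis using k mult_nonneg_nonneg[OF k norm_ge_zero[of "cg_r Hb g 0"]] by auto
  qed (simp add: cg_initial g)
  show "\<epsilon> * (norm (cg_p Hb g i))\<^sup>2 \<le> cg_p Hb g i \<bullet> (Hb *v cg_p Hb g i)"
    using assms by (auto simp: cg_exit_def Let_def low_curv_def split: if_splits)
qed

text \<open>A residual different from zero makes the next direction different from zero, and then the failed test for low
  curvature is a strict inequality.\<close>

lemma continue_positive:
  assumes "\<And>i. i < n \<Longrightarrow> cg_r Hb g i \<noteq> 0"
    and "\<And>i. i < n \<Longrightarrow> \<epsilon> * (norm (cg_p Hb g i))\<^sup>2 \<le> cg_p Hb g i \<bullet> (Hb *v cg_p Hb g i)"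
  shows "cg_positive Hb g n"
  using assms
proof (induction n)
  case 0
  then show ?case using symHb by unfold_locales auto
next
  case (Suc n)
  then interpret cg_positive Hb g n by auto
  have "cg_p Hb g n \<noteq> 0"
    using conjugacy[of n] Suc.prems(1)[of n] by auto
  then have "0 < \<epsilon> * (norm (cg_p Hb g n))\<^sup>2" using eps by simp
  then have "0 < cg_p Hb g n \<bullet> (Hb *v cg_p Hb g n)" using Suc.prems(2)[of n] by linarith
  then show ?case using curv symHb by unfold_locales (auto simp: less_Suc_eq)
qed

text \<open>As long as the loop goes on, the residuals are different from zero and mutually orthogonal, so that it cannot
  go on for more steps than the dimension allows.\<close>

lemma cg_exits: "\<exists>j. cg_exit H g \<epsilon> \<zeta> 0 j \<noteq> None"
proof (rule ccontr)
  assume "\<not> ?thesis"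
  then have c: "cg_exit H g \<epsilon> \<zeta> 0 j = None" for j by auto
  let ?N = "Suc (DIM(real^'n))"
  interpret cg_positive Hb g ?N using continue_facts[OF c] by (intro continue_positive) auto
  have orth: "r j \<bullet> r i = 0" if "i < j" "j \<le> ?N" for i j using conjugacy[of j] that by auto
  have nz: "r i \<noteq> 0" for i using continue_facts(1)[OF c] .
  have inj: "inj_on r {..<?N}"
  proof (rule inj_onI)
    fix i j assume *: "i \<in> {..<?N}" "j \<in> {..<?N}" "r i = r j"
    show "i = j"
    proof (rule ccontr)
      assume "i \<noteq> j"
      then have "r i \<bullet> r j = 0" using orth[of i j] orth[of j i] *(1,2)
        by (cases i j rule: linorder_cases) (auto simp: inner_commute)
      then show False using *(3) nz[of i] by simp
    qed
  qed
  have "pairwise orthogonal (r ` {..<?N})"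
  proof (rule pairwiseI)
    fix a b assume "a \<in> r ` {..<?N}" "b \<in> r ` {..<?N}" "a \<noteq> b"
    then obtain i j where "i < ?N" "j < ?N" "a = r i" "b = r j" "i \<noteq> j" by auto
    then show "orthogonal a b"
      using orth[of i j] orth[of j i]
      by (cases i j rule: linorder_cases) (auto simp: inner_commute orthogonal_def)
  qed
  moreover have "0 \<notin> r ` {..<?N}" using nz by auto
  ultimately have "independent (r ` {..<?N})" by (rule pairwise_orthogonal_independent)
  then have "card (r ` {..<?N}) \<le> DIM(real^'n)" using independent_bound by blast
  then show False using card_image[OF inj] by simp
qed

text \<open>If no earlier iterate qualified, \<open>residual_decay\<close> would apply with the modulus \<open>\<epsilon>\<close>, and the residual would be
  at most the threshold \<open>sqrt T \<tau>\<^bsup>j/2\<^esup>\<close> that triggers this branch, as \<open>2 \<kappa> \<le> T\<close>.\<close>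

lemma last_branch_witness:
  assumes j: "1 \<le> j"
    and c: "\<And>i. i < j \<Longrightarrow> cg_exit H g \<epsilon> \<zeta> 0 i = None"
    and rj: "cg_r Hb g j \<noteq> 0" and pj: "\<not> low_curv Hb \<epsilon> (cg_p Hb g j)"
    and U: "U = cg_U H Hb g 0 j" and \<kappa>: "\<kappa> = (U + 2 * \<epsilon>) / \<epsilon>" and \<tau>: "\<tau> = sqrt \<kappa> / (sqrt \<kappa> + 1)"
    and T: "T = 4 * \<kappa> ^ 4 / (1 - sqrt \<tau>)\<^sup>2"
    and big: "norm (cg_r Hb g j) > sqrt T * \<tau> powr (real j / 2) * norm (cg_r Hb g 0)"
  shows "\<exists>i<j. low_curv Hb \<epsilon> (cg_y Hb g (Suc j) - cg_y Hb g i)"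
proof (rule ccontr)
  assume neg: "\<not> ?thesis"
  interpret cg_positive Hb g "Suc j"
    using continue_facts[OF c] rj pj
    by (intro continue_positive) (auto simp: low_curv_def less_Suc_eq)
  have U0: "0 \<le> U" unfolding U by (rule cg_U_nonneg) simp
  note k2 = kappa_ge[OF U0, folded \<kappa>]
  have \<tau>01: "0 < \<tau>" "\<tau> < 1" unfolding \<tau> using k2 by (auto simp: divide_less_eq add_pos_pos)
  have "(norm (r j))\<^sup>2 \<le> 2 * \<kappa> * \<tau> ^ j * (norm g)\<^sup>2"
  proof (rule residual_decay[OF refl j eps])
    show "\<epsilon> \<le> U + 2 * \<epsilon>" using U0 eps by simp
    show "r i \<bullet> (Hb *v r i) \<le> (U + 2 * \<epsilon>) * (r i \<bullet> r i)" if "i \<le> j" for i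
    proof -
      have "r i \<bullet> (H *v r i) \<le> norm (r i) * norm (H *v r i)" by (rule norm_cauchy_schwarz)
      also have "\<dots> \<le> norm (r i) * (U * norm (r i))"
        using cg_U_bounds(1)[OF _ that, of 0 H Hb g] unfolding U by (intro mult_left_mono) auto
      finally have "r i \<bullet> (H *v r i) \<le> U * (r i \<bullet> r i)"
        by (simp add: dot_square_norm power2_eq_square mult_ac)
      then show ?thesis
        by (simp add: matrix_vector_mult_add_rdistrib mat_scale inner_add_right distrib_right)
    qed
    show "\<epsilon> * (norm (y (Suc j) - y i))\<^sup>2 \<le> (y (Suc j) - y i) \<bullet> (Hb *v (y (Suc j) - y i))"
      if "i < j" for i
      using neg that by (auto simp: low_curv_def)
  qed (use \<kappa> \<tau> in auto)
  also have "\<dots> \<le> T * \<tau> ^ j * (norm g)\<^sup>2"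
  proof -
    have st: "0 \<le> sqrt \<tau>" "sqrt \<tau> < 1" using \<tau>01 by auto
    have d: "0 < (1 - sqrt \<tau>)\<^sup>2" "(1 - sqrt \<tau>)\<^sup>2 \<le> 1"
      using st by (auto simp: power_le_one)
    have "2 * \<kappa> \<le> 4 * \<kappa> ^ 4"
      using k2 self_le_power[of \<kappa> 4] by linarith
    also have "\<dots> \<le> T" unfolding T
      using d k2 by (simp add: le_divide_eq mult_left_le)
    finally show ?thesis using \<tau>01 by (intro mult_right_mono) auto
  qed
  also have "\<dots> = (sqrt T * \<tau> powr (real j / 2) * norm (r 0))\<^sup>2"
  proof -
    have "0 \<le> T" unfolding T using k2 by simp
    moreover have "(\<tau> powr (real j / 2))\<^sup>2 = \<tau> ^ j"
      using \<tau>01 by (simp add: powr_realpow powr_powr flip: powr_numeral)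
    ultimately show ?thesis by (simp add: power_mult_distrib cg_initial)
  qed
  finally have "norm (r j) \<le> sqrt T * \<tau> powr (real j / 2) * norm (r 0)"
    by (rule power2_le_imp_le) (use k2 T in auto)
  then show False using big by simp
qed

text \<open>The test bounds the residual in terms of \<open>g\<close>. Since \<open>g\<close> is the residual minus \<open>(H + 2\<epsilon>I) y\<close>, its norm is at most a
  multiple of \<open>\<kappa> \<epsilon>\<close> times that of \<open>y\<close>, and the factor \<open>1 / (3 \<kappa>)\<close> in the tolerance compensates for this.\<close>

lemma solution_answer:
  assumes j: "1 \<le> j" and c: "\<And>i. i < j \<Longrightarrow> cg_exit H g \<epsilon> \<zeta> 0 i = None"
    and ylow: "\<not> low_curv Hb \<epsilon> (cg_y Hb g j)"
    and small: "norm (cg_r Hb g j) \<le> \<zeta> / (3 * ((cg_U H Hb g 0 j + 2 * \<epsilon>) / \<epsilon>)) * norm (cg_r Hb g 0)"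
  shows "cg_answer H g \<epsilon> \<zeta> (cg_y Hb g j) SOL"
proof -
  interpret cg_positive Hb g j
    using continue_facts[OF c] by (intro continue_positive) auto
  define U where "U = cg_U H Hb g 0 j"
  define \<kappa> where "\<kappa> = (U + 2 * \<epsilon>) / \<epsilon>"
  define z where "z = \<zeta> / (3 * \<kappa>)"
  have U0: "0 \<le> U" unfolding U_def by (rule cg_U_nonneg) simp
  note k2 = kappa_ge[OF U0, folded \<kappa>_def]
  have z: "0 < z" "z \<le> 1 / 6" unfolding z_def using zeta k2 by (auto simp: field_simps)
  have sm: "norm (r j) \<le> z * norm g" using small by (simp add: cg_initial z_def \<kappa>_def U_def)
  have res: "r j = H *v y j + (2 * \<epsilon>) *\<^sub>R y j + g"
    by (simp add: cg_residual matrix_vector_mult_add_rdistrib mat_scale)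
  have Hy: "norm (H *v y j) \<le> U * norm (y j)"
    using cg_U_bounds(2)[of 0 j j H Hb g] by (simp add: U_def)
  have "norm g \<le> norm (r j) + (U + 2 * \<epsilon>) * norm (y j)"
  proof -
    have "norm g = norm (r j - H *v y j - (2 * \<epsilon>) *\<^sub>R y j)" by (simp add: res)
    also have "\<dots> \<le> norm (r j) + norm (H *v y j) + norm ((2 * \<epsilon>) *\<^sub>R y j)"
      using norm_triangle_ineq4[of "r j - H *v y j" "(2 * \<epsilon>) *\<^sub>R y j"]
        norm_triangle_ineq4[of "r j" "H *v y j"] by linarith
    finally show ?thesis using Hy eps by (simp add: algebra_simps)
  qed
  then have gb: "(1 - z) * norm g \<le> \<kappa> * \<epsilon> * norm (y j)"
  proof -
    have "\<kappa> * \<epsilon> = U + 2 * \<epsilon>" using eps by (simp add: \<kappa>_def)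
    then show ?thesis using \<open>norm g \<le> _\<close> sm by (simp add: left_diff_distrib)
  qed
  have "norm (r j) \<le> \<zeta> * \<epsilon> / 2 * norm (y j)"
  proof -
    have g2: "norm g \<le> 6 / 5 * (\<kappa> * \<epsilon> * norm (y j))"
    proof -
      have "5 / 6 * norm g \<le> (1 - z) * norm g" using z by (intro mult_right_mono) auto
      then show ?thesis using gb by linarith
    qed
    have "norm (r j) \<le> z * (6 / 5 * (\<kappa> * \<epsilon> * norm (y j)))"
      using sm mult_left_mono[OF g2, of z] z by linarith
    also have "\<dots> = 2 / 5 * (\<zeta> * \<epsilon> * norm (y j))" using k2 by (simp add: z_def)
    also have "\<dots> \<le> \<zeta> * \<epsilon> / 2 * norm (y j)"
      using mult_nonneg_nonneg[of "\<zeta> * \<epsilon>" "norm (y j)"] zeta eps by simp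
    finally show ?thesis .
  qed
  moreover have "y j \<noteq> 0"
  proof
    assume "y j = 0"
    then have "norm g \<le> z * norm g" using sm by (simp add: res)
    moreover have "z * norm g \<le> 1 / 6 * norm g" using z by (intro mult_right_mono) auto
    ultimately show False using g by simp
  qed
  moreover have "g \<bullet> y j = - (y j \<bullet> (H *v y j)) - 2 * \<epsilon> * (norm (y j))\<^sup>2"
    using iterate_energy[of j]
    by (simp add: matrix_vector_mult_add_rdistrib mat_scale inner_add_right dot_square_norm)
  moreover have "- \<epsilon> * (norm (y j))\<^sup>2 \<le> y j \<bullet> (H *v y j)"
    using ylow \<open>y j \<noteq> 0\<close> by (simp add: low_curv_shift)
  ultimately show ?thesis by (simp add: cg_answer_def res)
qed

proposition capped_cg_correct:
  shows "capped_cg H g \<epsilon> \<zeta> 0 \<noteq> {}"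
    and "(d, t) \<in> capped_cg H g \<epsilon> \<zeta> 0 \<Longrightarrow> cg_answer H g \<epsilon> \<zeta> d t"
proof -
  define j where "j = (LEAST j. cg_exit H g \<epsilon> \<zeta> 0 j \<noteq> None)"
  obtain X where X: "cg_exit H g \<epsilon> \<zeta> 0 j = Some X"
    using LeastI_ex[OF cg_exits] unfolding j_def by blast
  have c: "cg_exit H g \<epsilon> \<zeta> 0 i = None" if "i < j" for i
    using not_less_Least that unfolding j_def by blast
  have cap: "capped_cg H g \<epsilon> \<zeta> 0 = X"
    using cg_exits X unfolding capped_cg_def j_def[symmetric] by auto
  have nc: "cg_answer H g \<epsilon> \<zeta> d NC" if "low_curv Hb \<epsilon> d" for d
    using that by (simp add: cg_answer_def low_curv_shift)
  have "X \<noteq> {} \<and> (\<forall>(d, t)\<in>X. cg_answer H g \<epsilon> \<zeta> d t)"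
  proof (cases "j = 0")
    case True
    then show ?thesis using X nc by (auto simp: cg_exit_def Let_def split: if_splits)
  next
    case False
    define U where "U = cg_U H Hb g 0 j"
    define \<kappa> where "\<kappa> = (U + 2 * \<epsilon>) / \<epsilon>"
    define \<tau> where "\<tau> = sqrt \<kappa> / (sqrt \<kappa> + 1)"
    define T where "T = 4 * \<kappa> ^ 4 / (1 - sqrt \<tau>)\<^sup>2"
    have k0: "0 \<le> \<zeta> / (3 * \<kappa>)"
      unfolding \<kappa>_def U_def using zeta eps cg_U_nonneg[of 0 H Hb g j]
      by (intro divide_nonneg_nonneg mult_nonneg_nonneg) auto
    consider "low_curv Hb \<epsilon> (cg_y Hb g j)" "X = {(cg_y Hb g j, NC)}"
      | "\<not> low_curv Hb \<epsilon> (cg_y Hb g j)" "norm (cg_r Hb g j) \<le> \<zeta> / (3 * \<kappa>) * norm (cg_r Hb g 0)"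
        "X = {(cg_y Hb g j, SOL)}"
      | "low_curv Hb \<epsilon> (cg_p Hb g j)" "X = {(cg_p Hb g j, NC)}"
      | "\<not> norm (cg_r Hb g j) \<le> \<zeta> / (3 * \<kappa>) * norm (cg_r Hb g 0)" "\<not> low_curv Hb \<epsilon> (cg_p Hb g j)"
        "norm (cg_r Hb g j) > sqrt T * \<tau> powr (real j / 2) * norm (cg_r Hb g 0)"
        "X = {(cg_y Hb g (Suc j) - cg_y Hb g i, NC) |i. i < j \<and> low_curv Hb \<epsilon> (cg_y Hb g (Suc j) - cg_y Hb g i)}"
      using X False unfolding cg_exit_def Let_def
      by (auto simp: U_def \<kappa>_def \<tau>_def T_def split: if_splits)
    then show ?thesis
    proof cases
      case 1 then show ?thesis using nc by auto
    next
      case 2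
      then show ?thesis using solution_answer[of j] False c by (auto simp: \<kappa>_def U_def)
    next
      case 3 then show ?thesis using nc by auto
    next
      case 4
      have "cg_r Hb g j \<noteq> 0"
        using 4(1) mult_nonneg_nonneg[OF k0 norm_ge_zero[of "cg_r Hb g 0"]] by auto
      then obtain i where "i < j" "low_curv Hb \<epsilon> (cg_y Hb g (Suc j) - cg_y Hb g i)"
        using last_branch_witness[OF _ c _ 4(2) U_def \<kappa>_def \<tau>_def T_def 4(3)] False by auto
      then show ?thesis using 4(4) nc by auto
    qed
  qed
  then show "capped_cg H g \<epsilon> \<zeta> 0 \<noteq> {}"
    "(d, t) \<in> capped_cg H g \<epsilon> \<zeta> 0 \<Longrightarrow> cg_answer H g \<epsilon> \<zeta> d t"
    using cap by auto
qed

end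

section \<open>The uniform distribution on the sphere\<close>

lemma nn_integral_lborel_shift:
  fixes c :: "'a::euclidean_space" and f :: "'a \<Rightarrow> ennreal"
  assumes "f \<in> borel_measurable borel"
  shows "(\<integral>\<^sup>+x. f (c + x) \<partial>lborel) = (\<integral>\<^sup>+x. f x \<partial>lborel)"
proof -
  have "(\<integral>\<^sup>+x. f x \<partial>lborel) = (\<integral>\<^sup>+x. f x \<partial>distr lborel borel ((+) c))"
    by (simp add: lborel_distr_plus)
  also have "\<dots> = (\<integral>\<^sup>+x. f (c + x) \<partial>lborel)"
    using assms by (subst nn_integral_distr) auto
  finally show ?thesis by simp
qed

text \<open>Orthogonal invariance of the Lebesgue measure. The set of all \<open>(x, y)\<close> with \<open>y\<close> in the unit ball and
  \<open>T x + y\<close> in \<open>A\<close> is measured in two ways: for fixed \<open>y\<close> the section is a translate of the preimage of \<open>A\<close>; after the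
  substitution of \<open>y\<close> for \<open>T x + y\<close> the section over \<open>y\<close> is a unit ball.\<close>

lemma emeasure_orthogonal_vimage:
  fixes T :: "'a::euclidean_space \<Rightarrow> 'a"
  assumes T: "orthogonal_transformation T" and A: "A \<in> sets borel"
  shows "emeasure lborel (T -` A) = emeasure lborel A"
proof -
  interpret lborel_pair: pair_sigma_finite "lborel :: 'a measure" "lborel :: 'a measure" ..
  have lin: "linear T" using T by (rule orthogonal_transformation_linear)
  have Tm [measurable]: "T \<in> borel_measurable borel"
    using lin linear_continuous_on[OF linear_conv_bounded_linear[THEN iffD1, OF lin]]
    by (intro borel_measurable_continuous_onI)
  note A [measurable]
  have surj: "surj T" by (rule orthogonal_transformation_surj[OF T])
  define B where "B = (cball 0 1 :: 'a set)"
  have B [measurable]: "B \<in> sets borel" unfolding B_def by simp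
  define F where "F x y = (indicator B y * indicator A (T x + y) :: ennreal)" for x y
  have F [measurable]: "case_prod F \<in> borel_measurable (lborel \<Otimes>\<^sub>M lborel)"
    unfolding F_def by measurable
  have sh: "(\<integral>\<^sup>+x. indicator A (T x + y) \<partial>lborel) = emeasure lborel (T -` A)" for y
  proof -
    obtain x0 where x0: "y = T x0" using surj by (metis surjD)
    have "(\<integral>\<^sup>+x. indicator A (T x + y) \<partial>lborel) = (\<integral>\<^sup>+x. indicator A (T (x0 + x)) \<partial>lborel)"
      using lin by (simp add: x0 linear_add add.commute)
    also have "\<dots> = (\<integral>\<^sup>+x. indicator A (T x) \<partial>lborel)"
      by (rule nn_integral_lborel_shift) measurable
    also have "\<dots> = (\<integral>\<^sup>+x. indicator (T -` A) x \<partial>lborel)"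
      by (intro nn_integral_cong) (auto simp: indicator_def)
    also have "\<dots> = emeasure lborel (T -` A)"
      using measurable_sets[OF Tm A] by (intro nn_integral_indicator) auto
    finally show ?thesis .
  qed
  have "emeasure lborel B * emeasure lborel (T -` A) = (\<integral>\<^sup>+y. \<integral>\<^sup>+x. F x y \<partial>lborel \<partial>lborel)"
    unfolding F_def by (subst nn_integral_cmult) (auto simp: sh nn_integral_multc)
  also have "\<dots> = (\<integral>\<^sup>+x. \<integral>\<^sup>+y. F x y \<partial>lborel \<partial>lborel)"
    by (rule lborel_pair.Fubini') measurable
  also have "\<dots> = (\<integral>\<^sup>+x. \<integral>\<^sup>+y. indicator B (y - T x) * indicator A y \<partial>lborel \<partial>lborel)"
  proof (rule nn_integral_cong)
    fix x
    have "(\<integral>\<^sup>+y. indicator B (y - T x) * indicator A y \<partial>lborel) =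
      (\<integral>\<^sup>+y. indicator B ((T x + y) - T x) * indicator A (T x + y) \<partial>lborel)"
      by (rule nn_integral_lborel_shift[symmetric]) measurable
    then show "(\<integral>\<^sup>+y. F x y \<partial>lborel) = (\<integral>\<^sup>+y. indicator B (y - T x) * indicator A y \<partial>lborel)"
      unfolding F_def by simp
  qed
  also have "\<dots> = (\<integral>\<^sup>+y. \<integral>\<^sup>+x. indicator B (y - T x) * indicator A y \<partial>lborel \<partial>lborel)"
    by (rule lborel_pair.Fubini'[symmetric]) measurable
  also have "\<dots> = (\<integral>\<^sup>+y. emeasure lborel B * indicator A y \<partial>lborel)"
  proof (rule nn_integral_cong)
    fix y
    obtain x0 where x0: "y = T x0" using surj by (metis surjD)
    have iB: "indicator B (y - T x) = (indicator (cball x0 1) x :: ennreal)" for x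
    proof -
      have "norm (y - T x) = norm (x0 - x)"
        using orthogonal_transformation_norm[OF T, of "x0 - x"] lin by (simp add: x0 linear_diff)
      then show ?thesis by (simp add: B_def indicator_def dist_norm norm_minus_commute[of "T x"])
    qed
    have "(\<integral>\<^sup>+x. indicator B (y - T x) * indicator A y \<partial>lborel) =
        emeasure lborel (cball x0 1) * indicator A y"
      unfolding iB by (subst nn_integral_multc) (auto intro!: borel_measurable_indicator)
    then show "(\<integral>\<^sup>+x. indicator B (y - T x) * indicator A y \<partial>lborel) = emeasure lborel B * indicator A y"
      by (simp add: B_def emeasure_cball)
  qed
  also have "\<dots> = emeasure lborel B * emeasure lborel A"
    by (simp add: nn_integral_cmult)
  finally have "emeasure lborel B * emeasure lborel (T -` A) = emeasure lborel B * emeasure lborel A" .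
  moreover have "emeasure lborel B \<noteq> 0" "emeasure lborel B \<noteq> \<infinity>"
    using unit_ball_vol_pos[of "real DIM('a)", THEN less_imp_neq] unfolding B_def
    by (auto simp: emeasure_cball)
  ultimately show ?thesis by (simp add: ennreal_mult_cancel_left)
qed

text \<open>The integral of the radius over a unit ball, by integrating the volumes \<open>1 - r\<^sup>d\<close> of the shells between radius \<open>r\<close> and \<open>1\<close>.
  Points are functions on a finite index set, since this is what remains of a Euclidean space when one coordinate is
  split off.\<close>

lemma nn_integral_radius_unit_ball:
  fixes A :: "'i set"
  assumes A: "finite A"
  defines "\<rho> \<equiv> \<lambda>f::'i \<Rightarrow> real. sqrt (\<Sum>i\<in>A. (f i)\<^sup>2)" and "d \<equiv> card A"
  shows "(\<integral>\<^sup>+f. ennreal (\<rho> f) * indicator {f. \<rho> f \<le> 1} f \<partial>Pi\<^sub>M A (\<lambda>_. lborel)) =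
    ennreal (unit_ball_vol (real d) * (real d / real (d + 1)))"
proof -
  let ?M = "Pi\<^sub>M A (\<lambda>_. lborel :: real measure)"
  interpret P: finite_product_sigma_finite "\<lambda>_. lborel :: real measure" A
    by standard (rule A)
  interpret pair_sigma_finite "lborel :: real measure" ?M ..
  have \<rho>m [measurable]: "\<rho> \<in> borel_measurable ?M" unfolding \<rho>_def by measurable
  have vol: "emeasure ?M ({f. \<rho> f \<le> r} \<inter> space ?M) = ennreal (unit_ball_vol (real d) * r ^ d)"
    if "0 < r" for r
    unfolding \<rho>_def d_def by (rule emeasure_cball_aux[OF A that])
  have shell: "emeasure ?M ({f. r < \<rho> f \<and> \<rho> f \<le> 1} \<inter> space ?M) =
      ennreal (unit_ball_vol (real d) * (1 - r ^ d))" if r: "0 < r" "r < 1" for r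
  proof -
    have "{f. r < \<rho> f \<and> \<rho> f \<le> 1} \<inter> space ?M = ({f. \<rho> f \<le> 1} \<inter> space ?M) - ({f. \<rho> f \<le> r} \<inter> space ?M)"
      using r by auto
    also have "emeasure ?M \<dots> = emeasure ?M ({f. \<rho> f \<le> 1} \<inter> space ?M) - emeasure ?M ({f. \<rho> f \<le> r} \<inter> space ?M)"
      using r by (intro emeasure_Diff) (auto simp: vol)
    also have "\<dots> = ennreal (unit_ball_vol (real d) * (1 - r ^ d))"
      using r by (simp add: vol ennreal_minus[symmetric] right_diff_distrib)
    finally show ?thesis .
  qed
  (* the layer cake formula for the radius *)
  have layer: "ennreal (\<rho> f) * indicator {f. \<rho> f \<le> 1} f =
      (\<integral>\<^sup>+r. indicator {0<..<1} r * indicator {f. r < \<rho> f \<and> \<rho> f \<le> 1} f \<partial>lborel)" for f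
  proof (cases "\<rho> f \<le> 1")
    case True
    have nn: "0 \<le> \<rho> f" unfolding \<rho>_def by (simp add: sum_nonneg)
    have "(\<integral>\<^sup>+r. indicator {0<..<1} r * indicator {f. r < \<rho> f \<and> \<rho> f \<le> 1} f \<partial>lborel) =
        (\<integral>\<^sup>+r. indicator {0<..<\<rho> f} r \<partial>lborel)"
      using True by (intro nn_integral_cong) (auto simp: indicator_def)
    also have "\<dots> = ennreal (\<rho> f)" using nn by simp
    finally show ?thesis using True by simp
  qed (simp add: indicator_def)
  have "(\<integral>\<^sup>+f. ennreal (\<rho> f) * indicator {f. \<rho> f \<le> 1} f \<partial>?M) =
      (\<integral>\<^sup>+f. \<integral>\<^sup>+r. indicator {0<..<1} r * indicator {f. r < \<rho> f \<and> \<rho> f \<le> 1} f \<partial>lborel \<partial>?M)"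
    by (simp only: layer)
  also have "\<dots> = (\<integral>\<^sup>+r. \<integral>\<^sup>+f. indicator {0<..<1} r * indicator {f. r < \<rho> f \<and> \<rho> f \<le> 1} f \<partial>?M \<partial>lborel)"
    by (rule Fubini') (simp add: indicator_def, measurable)
  also have "\<dots> = (\<integral>\<^sup>+r. ennreal (unit_ball_vol (real d) * (1 - r ^ d)) * indicator {0..1} r \<partial>lborel)"
  proof (intro nn_integral_cong_AE AE_I[of _ _ "{0,1}"])
    show "{x \<in> space lborel. (\<integral>\<^sup>+f. indicator {0<..<1} x * indicator {f. x < \<rho> f \<and> \<rho> f \<le> 1} f \<partial>?M) \<noteq>
      ennreal (unit_ball_vol (real d) * (1 - x ^ d)) * indicator {0..1} x} \<subseteq> {0,1}"
    proof (intro subsetI, rule ccontr)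
      fix x :: real
      assume "x \<in> {x \<in> space lborel. (\<integral>\<^sup>+f. indicator {0<..<1} x * indicator {f. x < \<rho> f \<and> \<rho> f \<le> 1} f \<partial>?M) \<noteq>
          ennreal (unit_ball_vol (real d) * (1 - x ^ d)) * indicator {0..1} x}" and x: "x \<notin> {0,1}"
      then have ne: "(\<integral>\<^sup>+f. indicator {0<..<1} x * indicator {f. x < \<rho> f \<and> \<rho> f \<le> 1} f \<partial>?M) \<noteq>
          ennreal (unit_ball_vol (real d) * (1 - x ^ d)) * indicator {0..1} x" by simp
      have "(\<integral>\<^sup>+f. indicator {f. x < \<rho> f \<and> \<rho> f \<le> 1} f \<partial>?M) =
        (\<integral>\<^sup>+f. indicator ({f. x < \<rho> f \<and> \<rho> f \<le> 1} \<inter> space ?M) f \<partial>?M)"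
        by (intro nn_integral_cong) (auto simp: indicator_def)
      also have "\<dots> = emeasure ?M ({f. x < \<rho> f \<and> \<rho> f \<le> 1} \<inter> space ?M)"
        by (intro nn_integral_indicator) measurable
      finally show False using ne x shell[of x]
        by (cases "0 < x \<and> x < 1") (auto simp: indicator_def)
    qed
  qed (auto simp: emeasure_lborel_countable)
  also have "\<dots> = (\<integral>\<^sup>+r. ennreal (unit_ball_vol (real d) * (1 - r ^ d) * indicator {0..1} r) \<partial>lborel)"
    by (intro nn_integral_cong) (auto simp: indicator_def)
  also have "\<dots> = ennreal (unit_ball_vol (real d) * (real d / real (d + 1)))"
  proof (rule nn_integral_has_integral_lborel)
    have "((\<lambda>r. unit_ball_vol (real d) * (1 - r ^ d)) has_integral
        (unit_ball_vol (real d) * (1 - 1 ^ Suc d / real (Suc d))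
        - unit_ball_vol (real d) * (0 - 0 ^ Suc d / real (Suc d)))) {0..1::real}"
    proof (rule fundamental_theorem_of_calculus)
      fix x :: real
      have "((\<lambda>r. r ^ Suc d / real (Suc d)) has_real_derivative x ^ d) (at x within {0..1})"
        by (rule DERIV_cdivide[OF DERIV_pow, THEN DERIV_cong]) (simp del: of_nat_Suc)
      then have "((\<lambda>r. unit_ball_vol (real d) * (r - r ^ Suc d / real (Suc d))) has_real_derivative
          unit_ball_vol (real d) * (1 - x ^ d)) (at x within {0..1})"
        by (intro DERIV_cmult DERIV_diff DERIV_ident)
      then show "((\<lambda>r. unit_ball_vol (real d) * (r - r ^ Suc d / real (Suc d))) has_vector_derivative
          unit_ball_vol (real d) * (1 - x ^ d)) (at x within {0..1})"
        by (simp add: has_real_derivative_iff_has_vector_derivative)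
    qed auto
    moreover have "unit_ball_vol (real d) * (1 - 1 ^ Suc d / real (Suc d))
        - unit_ball_vol (real d) * (0 - 0 ^ Suc d / real (Suc d)) = unit_ball_vol (real d) * (real d / real (d + 1))"
      by (simp add: field_simps)
    ultimately have h: "((\<lambda>r. unit_ball_vol (real d) * (1 - r ^ d)) has_integral
        unit_ball_vol (real d) * (real d / real (d + 1))) {0..1::real}" by simp
    have e: "(\<lambda>r::real. if r \<in> {0..1} then unit_ball_vol (real d) * (1 - r ^ d) else 0) =
        (\<lambda>r. unit_ball_vol (real d) * (1 - r ^ d) * indicator {0..1} r)" by auto
    show "((\<lambda>r. unit_ball_vol (real d) * (1 - r ^ d) * indicator {0..1} r) has_integral
        unit_ball_vol (real d) * (real d / real (d + 1))) UNIV"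
      using h by (subst (asm) has_integral_restrict_UNIV[symmetric]) (simp only: e)
  qed (auto simp: indicator_def power_le_one)
  finally show ?thesis .
qed

text \<open>The section of the band over a point of the unit ball in the other coordinates is contained in an interval whose
  length is \<open>2 s\<close> times the radius of that point.\<close>

lemma emeasure_axis_band:
  fixes b :: "'a::euclidean_space"
  assumes b: "b \<in> Basis" and s: "0 \<le> s"
  shows "emeasure lborel {x \<in> cball 0 1. \<bar>x \<bullet> b\<bar> \<le> s * sqrt (x \<bullet> x - (x \<bullet> b)\<^sup>2)} \<le>
    ennreal (2 * s * (unit_ball_vol (real (DIM('a) - 1)) * (real (DIM('a) - 1) / real DIM('a))))"
proof -
  define A where "A = (Basis - {b} :: 'a set)"
  have A: "finite A" "b \<notin> A" "insert b A = Basis" "card A = DIM('a) - 1" "Suc (card A) = DIM('a)"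
    unfolding A_def using b by (auto simp: card_Diff_singleton)
  define S where "S = {x::'a. x \<in> cball 0 1 \<and> \<bar>x \<bullet> b\<bar> \<le> s * sqrt (x \<bullet> x - (x \<bullet> b)\<^sup>2)}"
  define \<rho> where "\<rho> f = sqrt (\<Sum>i\<in>A. (f i)\<^sup>2)" for f :: "'a \<Rightarrow> real"
  let ?M = "\<lambda>I. Pi\<^sub>M I (\<lambda>_::'a. lborel :: real measure)"
  define h where "h f = (\<Sum>b\<in>Basis. f b *\<^sub>R b :: 'a)" for f
  interpret product_sigma_finite "\<lambda>_::'a. lborel :: real measure" by standard
  have Sb [measurable]: "S \<in> sets borel"
  proof -
    have "closed S" unfolding S_def mem_cball
      by (intro closed_Collect_conj closed_Collect_le continuous_intros)
    then show ?thesis by simp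
  qed
  have hm [measurable]: "h \<in> measurable (?M Basis) borel" unfolding h_def by measurable
  have \<rho>m [measurable]: "\<rho> \<in> borel_measurable (?M A)" unfolding \<rho>_def by measurable
  have coord: "h f \<bullet> i = f i" if "i \<in> Basis" for f i
    using that unfolding h_def by simp
  have hh: "h f \<bullet> h f = (\<Sum>i\<in>Basis. (f i)\<^sup>2)" for f
    by (subst euclidean_inner) (simp add: coord power2_eq_square)
  have le: "indicator S (h (f(b := y))) \<le>
      indicator {f. \<rho> f \<le> 1} f * (indicator {- (s * \<rho> f)..s * \<rho> f} y :: ennreal)" for f y
  proof (cases "h (f(b := y)) \<in> S")
    case True
    have sq: "h (f(b := y)) \<bullet> h (f(b := y)) = y\<^sup>2 + (\<Sum>i\<in>A. (f i)\<^sup>2)"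
    proof -
      have "(\<Sum>i\<in>A. ((f(b := y)) i)\<^sup>2) = (\<Sum>i\<in>A. (f i)\<^sup>2)"
        using A(2) by (intro sum.cong) auto
      then show ?thesis unfolding hh A(3)[symmetric] using A(1,2) by simp
    qed
    have "norm (h (f(b := y))) \<le> 1" using True by (simp add: S_def)
    then have "y\<^sup>2 + (\<Sum>i\<in>A. (f i)\<^sup>2) \<le> 1"
      unfolding sq[symmetric] by (simp add: dot_square_norm power_le_one)
    then have "(\<Sum>i\<in>A. (f i)\<^sup>2) \<le> 1" using zero_le_power2[of y] by linarith
    then have "\<rho> f \<le> 1" unfolding \<rho>_def by simp
    moreover have "\<bar>y\<bar> \<le> s * \<rho> f"
      using True unfolding S_def by (simp add: coord b sq \<rho>_def)
    ultimately show ?thesis using True by (simp add: indicator_def abs_le_iff)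
  qed simp
  have "emeasure lborel S = emeasure (distr (?M Basis) borel h) S"
    unfolding h_def by (subst lborel_eq) simp
  also have "\<dots> = emeasure (?M Basis) (h -` S \<inter> space (?M Basis))"
    by (rule emeasure_distr) auto
  also have "\<dots> = (\<integral>\<^sup>+f. indicator (h -` S \<inter> space (?M Basis)) f \<partial>?M Basis)"
    by (rule nn_integral_indicator[symmetric]) measurable
  also have "\<dots> = (\<integral>\<^sup>+f. indicator S (h f) \<partial>?M (insert b A))"
    unfolding A(3) by (intro nn_integral_cong) (auto simp: indicator_def)
  also have "\<dots> = (\<integral>\<^sup>+f. \<integral>\<^sup>+y. indicator S (h (f(b := y))) \<partial>lborel \<partial>?M A)"
    by (rule product_nn_integral_insert[OF A(1,2)]) (unfold A(3), measurable)
  also have "\<dots> \<le> (\<integral>\<^sup>+f. \<integral>\<^sup>+y. indicator {f. \<rho> f \<le> 1} f * (indicator {- (s * \<rho> f)..s * \<rho> f} y) \<partial>lborel \<partial>?M A)"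
    by (intro nn_integral_mono le)
  also have "\<dots> = (\<integral>\<^sup>+f. ennreal (2 * s) * (ennreal (\<rho> f) * indicator {f. \<rho> f \<le> 1} f) \<partial>?M A)"
  proof (rule nn_integral_cong)
    fix f
    have nn: "0 \<le> \<rho> f" unfolding \<rho>_def by (simp add: sum_nonneg)
    have "(\<integral>\<^sup>+y. indicator {f. \<rho> f \<le> 1} f * (indicator {- (s * \<rho> f)..s * \<rho> f} y) \<partial>lborel) =
        indicator {f. \<rho> f \<le> 1} f * emeasure lborel {- (s * \<rho> f)..s * \<rho> f}"
      by (subst nn_integral_cmult) auto
    also have "emeasure lborel {- (s * \<rho> f)..s * \<rho> f} = ennreal (2 * s) * ennreal (\<rho> f)"
      using s nn mult_nonneg_nonneg[OF s nn] by (simp add: ennreal_mult[symmetric])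
    finally show "(\<integral>\<^sup>+y. indicator {f. \<rho> f \<le> 1} f * (indicator {- (s * \<rho> f)..s * \<rho> f} y) \<partial>lborel) =
        ennreal (2 * s) * (ennreal (\<rho> f) * indicator {f. \<rho> f \<le> 1} f)"
      by (simp add: mult_ac)
  qed
  also have "\<dots> = ennreal (2 * s) * ennreal (unit_ball_vol (real (card A)) * (real (card A) / real (card A + 1)))"
    using nn_integral_radius_unit_ball[OF A(1)]
    by (subst nn_integral_cmult) (auto simp flip: \<rho>_def)
  also have "\<dots> = ennreal (2 * s * (unit_ball_vol (real (card A)) * (real (card A) / real (card A + 1))))"
    by (rule ennreal_mult[symmetric]) (use s in auto)
  finally show ?thesis using A(4,5) by (simp add: S_def)
qed

lemma emeasure_band:
  fixes e :: "real^'n"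
  assumes e: "norm e = 1" and s: "0 \<le> s"
  shows "emeasure lborel {x \<in> cball 0 1. \<bar>x \<bullet> e\<bar> \<le> s * sqrt (x \<bullet> x - (x \<bullet> e)\<^sup>2)} \<le>
    ennreal (2 * s * (unit_ball_vol (real (CARD('n) - 1)) * (real (CARD('n) - 1) / real CARD('n))))"
proof -
  obtain b :: "real^'n" where b: "b \<in> Basis" using nonempty_Basis by blast
  obtain T where T: "orthogonal_transformation T" "T e = b"
    using orthogonal_transformation_exists_1[OF e norm_Basis[OF b]] by metis
  let ?S = "\<lambda>e::real^'n. {x \<in> cball 0 1. \<bar>x \<bullet> e\<bar> \<le> s * sqrt (x \<bullet> x - (x \<bullet> e)\<^sup>2)}"
  have "closed (?S b)" unfolding mem_cball
    by (intro closed_Collect_conj closed_Collect_le continuous_intros)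
  then have "?S b \<in> sets borel" by simp
  note eq = emeasure_orthogonal_vimage[OF T(1) this]
  have pres: "T x \<bullet> T y = x \<bullet> y" for x y using T(1) by (simp add: orthogonal_transformation_def)
  have "T -` ?S b = ?S e"
    using pres pres[of _ e] orthogonal_transformation_norm[OF T(1)] by (auto simp: T(2))
  then show ?thesis using emeasure_axis_band[OF b s] eq by simp
qed

text \<open>Log-convexity of the Gamma function between \<open>x\<close> and \<open>x + 1\<close>.\<close>

lemma Gamma_half_step:
  fixes x :: real
  assumes "0 < x"
  shows "Gamma (x + 1 / 2) \<le> sqrt x * Gamma x"
proof -
  have "(ln \<circ> Gamma) ((1 - 1/2) *\<^sub>R x + (1/2) *\<^sub>R (x + 1)) \<le>
      (1 - 1/2) * (ln \<circ> Gamma) x + (1/2) * (ln \<circ> Gamma) (x + 1)"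
    using assms by (intro convex_onD[OF log_convex_Gamma_real]) auto
  moreover have "(1 - 1/2) *\<^sub>R x + (1/2) *\<^sub>R (x + 1) = x + 1 / 2" by (simp add: field_simps)
  ultimately have "ln (Gamma (x + 1/2)) \<le> (ln (Gamma x) + ln (Gamma (x + 1))) / 2" by simp
  also have "Gamma (x + 1) = x * Gamma x" using assms by (intro Gamma_plus1) auto
  also have "(ln (Gamma x) + ln (x * Gamma x)) / 2 = ln (sqrt x * Gamma x)"
    using assms Gamma_real_pos[OF assms] by (simp add: ln_mult ln_sqrt field_simps)
  finally show ?thesis
    using assms Gamma_real_pos[of "x + 1/2"] Gamma_real_pos[OF assms] by (subst (asm) ln_le_cancel_iff) auto
qed

text \<open>The ratio of the two volumes, with its factor, is the density at \<open>0\<close> of a coordinate of a uniformly distributed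
  point on the sphere.\<close>

lemma unit_ball_vol_ratio:
  "unit_ball_vol (real d) * (real d / real (d + 1)) \<le> sqrt (real d / (2 * pi)) * unit_ball_vol (real (d + 1))"
proof (cases "d = 0")
  case False
  define x where "x = real d / 2"
  have x: "0 < x" "x \<ge> 1/2" "real d = 2 * x" using False by (auto simp: x_def)
  have gz: "Gamma (z + 1) = z * Gamma z" if "0 < z" for z :: real
    using that by (intro Gamma_plus1) auto
  have g: "Gamma (x + 1) = x * Gamma x" "Gamma (x + 1/2 + 1) = (x + 1/2) * Gamma (x + 1/2)"
    using x by (intro gz; simp)+
  have pos: "0 < Gamma x" "0 < Gamma (x + 1/2)" using x by (auto intro!: Gamma_real_pos)
  have v1: "unit_ball_vol (real d) * (real d / real (d + 1)) = pi powr x / ((x + 1/2) * Gamma x)"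
  proof -
    have "unit_ball_vol (real d) * (real d / real (d + 1)) = pi powr x / (x * Gamma x) * (2 * x / (2 * x + 1))"
      unfolding unit_ball_vol_def using x g(1) by (simp add: add.commute)
    also have "\<dots> = pi powr x / ((x + 1/2) * Gamma x)" using x pos by (simp add: field_simps)
    finally show ?thesis .
  qed
  have v2: "unit_ball_vol (real (d + 1)) = pi powr x * sqrt pi / ((x + 1/2) * Gamma (x + 1/2))"
  proof -
    have "real (d + 1) / 2 = x + 1/2" by (simp add: x_def field_simps)
    then show ?thesis unfolding unit_ball_vol_def by (simp only: g(2)) (simp add: powr_add powr_half_sqrt)
  qed
  have "sqrt (real d / (2 * pi)) * sqrt pi = sqrt x" by (simp add: x_def flip: real_sqrt_mult)
  then have v3: "sqrt (real d / (2 * pi)) * unit_ball_vol (real (d + 1)) =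
      pi powr x * sqrt x / ((x + 1/2) * Gamma (x + 1/2))"
    unfolding v2 by (metis (no_types, lifting) mult.assoc mult.left_commute times_divide_eq_right)
  have "1 / Gamma x \<le> sqrt x / Gamma (x + 1/2)"
    using Gamma_half_step[OF x(1)] pos by (simp add: field_simps)
  then have "(pi powr x / (x + 1/2)) * (1 / Gamma x) \<le> (pi powr x / (x + 1/2)) * (sqrt x / Gamma (x + 1/2))"
    using x by (intro mult_left_mono) auto
  then show ?thesis unfolding v1 v3 by simp
qed simp

lemma uniform_sphere_prob: "emeasure (uniform_sphere :: 'a::euclidean_space measure) UNIV = 1"
  and sets_uniform_sphere [simp, measurable_cong]: "sets (uniform_sphere :: 'a measure) = sets borel"
  and space_uniform_sphere [simp]: "space (uniform_sphere :: 'a measure) = UNIV"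
  and emeasure_uniform_sphere: "S \<in> sets borel \<Longrightarrow>
    emeasure (uniform_sphere :: 'a measure) S = emeasure lborel (cball 0 1 \<inter> sgn -` S) / emeasure lborel (cball 0 1 :: 'a set)"
proof -
  have sg [measurable]: "(sgn :: 'a \<Rightarrow> 'a) \<in> borel_measurable borel"
    unfolding sgn_div_norm[abs_def] by measurable
  show "sets (uniform_sphere :: 'a measure) = sets borel" "space (uniform_sphere :: 'a measure) = UNIV"
    by (auto simp: uniform_sphere_def)
  show e: "S \<in> sets borel \<Longrightarrow>
    emeasure (uniform_sphere :: 'a measure) S = emeasure lborel (cball 0 1 \<inter> sgn -` S) / emeasure lborel (cball 0 1 :: 'a set)"
    for S :: "'a set"
    using measurable_sets[OF sg, of S] unfolding uniform_sphere_def by (subst emeasure_distr) auto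
  have "emeasure lborel (cball 0 1 :: 'a set) \<noteq> 0"
    using unit_ball_vol_pos[of "real DIM('a)", THEN less_imp_neq] by (auto simp: emeasure_cball)
  then show "emeasure (uniform_sphere :: 'a::euclidean_space measure) UNIV = 1"
    using e[of UNIV] by (simp add: emeasure_cball ennreal_divide_self)
qed

text \<open>The part of the unit ball that projects to \<open>S\<close> is contained in the band whose volume is bounded above.\<close>

lemma uniform_sphere_band:
  fixes e :: "real^'n"
  assumes e: "norm e = 1" and s: "0 \<le> s" and S: "S \<in> sets borel"
    and band: "\<And>u. u \<in> S \<Longrightarrow> norm u = 1 \<Longrightarrow> \<bar>u \<bullet> e\<bar> \<le> s * sqrt (1 - (u \<bullet> e)\<^sup>2)"
  shows "measure uniform_sphere S \<le> s * sqrt (2 * (real CARD('n) - 1) / pi)"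
proof -
  let ?n = "real CARD('n)" and ?d = "CARD('n) - 1"
  let ?band = "{x \<in> cball 0 1. \<bar>x \<bullet> e\<bar> \<le> s * sqrt (x \<bullet> x - (x \<bullet> e)\<^sup>2)}"
  have d1: "?d + 1 = CARD('n)" by (simp add: Suc_leI)
  have clo: "closed ?band" unfolding mem_cball
    by (intro closed_Collect_conj closed_Collect_le continuous_intros)
  have sub: "cball 0 1 \<inter> sgn -` S \<subseteq> ?band"
  proof
    fix x assume x: "x \<in> cball 0 1 \<inter> sgn -` S"
    show "x \<in> ?band"
    proof (cases "x = 0")
      case False
      have "norm x * \<bar>sgn x \<bullet> e\<bar> \<le> norm x * (s * sqrt (1 - (sgn x \<bullet> e)\<^sup>2))"
        using band[of "sgn x"] x False by (intro mult_left_mono) (auto simp: norm_sgn)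
      moreover have "norm x * \<bar>sgn x \<bullet> e\<bar> = \<bar>x \<bullet> e\<bar>"
        using False by (simp add: sgn_div_norm abs_mult)
      moreover have "norm x * sqrt (1 - (sgn x \<bullet> e)\<^sup>2) = sqrt (x \<bullet> x - (x \<bullet> e)\<^sup>2)"
      proof -
        have "norm x * sqrt (1 - (sgn x \<bullet> e)\<^sup>2) = sqrt ((norm x)\<^sup>2 * (1 - (sgn x \<bullet> e)\<^sup>2))"
          by (simp add: real_sqrt_mult)
        also have "(norm x)\<^sup>2 * (1 - (sgn x \<bullet> e)\<^sup>2) = x \<bullet> x - (x \<bullet> e)\<^sup>2"
          using False by (simp add: sgn_div_norm dot_square_norm field_simps)
        finally show ?thesis .
      qed
      ultimately show ?thesis using x by (simp add: mult.left_commute)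
    qed simp
  qed
  let ?v = "unit_ball_vol ?n"
  have vpos: "0 < ?v" by simp
  have "emeasure lborel (cball 0 1 \<inter> sgn -` S) \<le> emeasure lborel ?band"
    using sub clo by (intro emeasure_mono) auto
  also have "\<dots> \<le> ennreal (2 * s * (unit_ball_vol (real ?d) * (real ?d / ?n)))"
    by (rule emeasure_band[OF e s])
  also have "\<dots> \<le> ennreal (2 * s * (sqrt (real ?d / (2 * pi)) * ?v))"
    using unit_ball_vol_ratio[of ?d] s unfolding d1 by (intro ennreal_leI mult_left_mono) auto
  finally have le: "emeasure lborel (cball 0 1 \<inter> sgn -` S) \<le> ennreal (2 * s * sqrt (real ?d / (2 * pi)) * ?v)"
    by (simp add: mult.assoc)
  have "emeasure uniform_sphere S \<le> ennreal (2 * s * sqrt (real ?d / (2 * pi)) * ?v) / emeasure lborel (cball 0 1 :: (real^'n) set)"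
    unfolding emeasure_uniform_sphere[OF S] by (rule divide_right_mono_ennreal[OF le])
  also have "\<dots> = ennreal (2 * s * sqrt (real ?d / (2 * pi)))"
    using s vpos[THEN less_imp_neq] by (simp add: emeasure_cball divide_ennreal)
  also have "2 * s * sqrt (real ?d / (2 * pi)) = s * sqrt (2 * (?n - 1) / pi)"
  proof -
    have "2 * sqrt (real ?d / (2 * pi)) = sqrt (4 * (real ?d / (2 * pi)))"
      by (simp only: real_sqrt_mult real_sqrt_four)
    also have "4 * (real ?d / (2 * pi)) = 2 * (?n - 1) / pi" by (simp add: of_nat_diff Suc_leI field_simps)
    finally show ?thesis by simp
  qed
  finally show ?thesis
    unfolding measure_def using s by (intro enn2real_leI) (auto intro!: mult_nonneg_nonneg)
qed

section \<open>Krylov spaces of the Lanczos method\<close>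

definition lanczos_vector :: "real^'n^'n \<Rightarrow> real^'n \<Rightarrow> nat \<Rightarrow> real^'n" where
  "lanczos_vector H u i = fst (snd (lanczos H u i))"

lemma lanczos_vector_0 [simp]: "lanczos_vector H u 0 = u"
  by (simp add: lanczos_vector_def)

lemma lanczos_space_alt: "lanczos_space H u j = span (lanczos_vector H u ` {..<j})"
  unfolding lanczos_space_def lanczos_vector_def
  by (rule arg_cong[of _ _ span]) auto

lemma subspace_lanczos_space: "subspace (lanczos_space H u j)"
  by (simp add: lanczos_space_alt)

lemma lanczos_space_mono: "i \<le> j \<Longrightarrow> lanczos_space H u i \<subseteq> lanczos_space H u j"
  unfolding lanczos_space_alt by (intro span_mono) auto

lemma lanczos_vector_in_space: "i < j \<Longrightarrow> lanczos_vector H u i \<in> lanczos_space H u j"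
  unfolding lanczos_space_alt by (intro span_base) auto

text \<open>On breakdown the next vector is zero. The coefficient \<open>c'\<close> then cannot be obtained by solving the first equation
  for the next vector, which is why the second one is stated separately.\<close>

lemma lanczos_recurrence:
  obtains a b c q' where
    "H *v lanczos_vector H u i = c *\<^sub>R lanczos_vector H u (Suc i) + a *\<^sub>R lanczos_vector H u i + b *\<^sub>R q'"
    "\<exists>c'. lanczos_vector H u (Suc i) = c' *\<^sub>R (H *v lanczos_vector H u i - a *\<^sub>R lanczos_vector H u i - b *\<^sub>R q')"
    "q' \<in> lanczos_space H u i"
proof -
  obtain q' q b where l: "lanczos H u i = (q', q, b)" by (cases "lanczos H u i") auto
  define a where "a = q \<bullet> (H *v q)"
  define w where "w = H *v q - a *\<^sub>R q - b *\<^sub>R q'"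
  have q: "lanczos_vector H u i = q" by (simp add: lanczos_vector_def l)
  have qs: "lanczos_vector H u (Suc i) = w /\<^sub>R norm w"
    by (simp add: lanczos_vector_def l w_def a_def Let_def)
  have "norm w *\<^sub>R (w /\<^sub>R norm w) = w" by (cases "w = 0") auto
  then have "H *v q = norm w *\<^sub>R lanczos_vector H u (Suc i) + a *\<^sub>R q + b *\<^sub>R q'"
    unfolding qs by (simp add: w_def)
  moreover have "q' \<in> lanczos_space H u i"
  proof (cases i)
    case 0
    then show ?thesis using l by (simp add: lanczos_space_alt)
  next
    case (Suc k)
    then have "q' = lanczos_vector H u k"
      using l by (auto simp: lanczos_vector_def Let_def split: prod.splits)
    then show ?thesis using lanczos_vector_in_space[of k i] Suc by simp
  qed
  moreover have "\<exists>c'. lanczos_vector H u (Suc i) = c' *\<^sub>R (H *v q - a *\<^sub>R q - b *\<^sub>R q')"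
    unfolding qs w_def by blast
  ultimately show ?thesis using that[of "norm w" a b q'] unfolding q by blast
qed

lemma lanczos_space_image:
  assumes "x \<in> lanczos_space H u j"
  shows "H *v x \<in> lanczos_space H u (Suc j)"
proof -
  have "H *v lanczos_vector H u i \<in> lanczos_space H u (Suc j)" if i: "i < j" for i
  proof -
    obtain a b c q' where r:
      "H *v lanczos_vector H u i = c *\<^sub>R lanczos_vector H u (Suc i) + a *\<^sub>R lanczos_vector H u i + b *\<^sub>R q'"
      "q' \<in> lanczos_space H u i"
      using lanczos_recurrence[of H u i] by metis
    have "q' \<in> lanczos_space H u (Suc j)" using r(2) lanczos_space_mono[of i "Suc j"] i by auto
    then show ?thesis unfolding r(1) using i
      by (intro subspace_add subspace_scale subspace_lanczos_space lanczos_vector_in_space) auto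
  qed
  then have "span ((*v) H ` lanczos_vector H u ` {..<j}) \<subseteq> lanczos_space H u (Suc j)"
    by (intro span_minimal subspace_lanczos_space) auto
  then show ?thesis
    using assms unfolding lanczos_space_alt[of H u j]
    by (auto simp: linear_span_image[OF matrix_vector_mul_linear])
qed

lemma lanczos_vector_stays:
  assumes "lanczos_vector H u i \<in> lanczos_space H u i" "i \<le> k"
  shows "lanczos_vector H u k \<in> lanczos_space H u i \<and> lanczos_space H u k = lanczos_space H u i"
  using assms(2)
proof (induction k rule: dec_induct)
  case base
  then show ?case using assms(1) by simp
next
  case (step k)
  have eq: "lanczos_space H u (Suc k) = lanczos_space H u i"
  proof -
    have "lanczos_space H u (Suc k) = span (insert (lanczos_vector H u k) (lanczos_vector H u ` {..<k}))"
      by (simp add: lanczos_space_alt lessThan_Suc)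
    also have "\<dots> = lanczos_space H u k"
      using step.IH by (simp add: span_redundant lanczos_space_alt)
    finally show ?thesis using step.IH by simp
  qed
  obtain a b c' q' where r: "q' \<in> lanczos_space H u k"
    "lanczos_vector H u (Suc k) = c' *\<^sub>R (H *v lanczos_vector H u k - a *\<^sub>R lanczos_vector H u k - b *\<^sub>R q')"
    using lanczos_recurrence[of H u k] by metis
  have "H *v lanczos_vector H u k \<in> lanczos_space H u (Suc k)"
    using step.IH by (intro lanczos_space_image) simp
  then have "lanczos_vector H u (Suc k) \<in> lanczos_space H u i"
    unfolding r(2) using r(1) step.IH eq
    by (intro subspace_scale subspace_diff subspace_lanczos_space) auto
  then show ?case using eq by simp
qed

text \<open>A Krylov space stops growing at the first dependent vector, hence after \<open>CARD('n)\<close> steps at the latest.\<close>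

lemma lanczos_space_saturates:
  fixes H :: "real^'n^'n"
  assumes "CARD('n) \<le> j"
  shows "lanczos_space H u j = lanczos_space H u CARD('n)"
proof (cases "\<exists>i<CARD('n). lanczos_vector H u i \<in> lanczos_space H u i")
  case True
  then show ?thesis using lanczos_vector_stays[of H u] assms by (metis less_imp_le order_trans)
next
  case False
  have dim: "i \<le> CARD('n) \<Longrightarrow> dim (lanczos_space H u i) = i" for i
  proof (induction i)
    case 0 then show ?case by (simp add: lanczos_space_alt)
  next
    case (Suc i)
    then have "dim (lanczos_vector H u ` {..<i}) = i" by (simp add: lanczos_space_alt)
    then show ?case using False Suc.prems
      by (simp add: lanczos_space_alt lessThan_Suc dim_insert)
  qed
  have "lanczos_space H u CARD('n) = UNIV"
    using dim[of "CARD('n)"] by (metis dim_eq_full lanczos_space_alt order.refl span_span DIM_cart DIM_real mult.right_neutral)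
  then show ?thesis using lanczos_space_mono[OF assms, of H u] by auto
qed

text \<open>The least Ritz value is the minimum of the Rayleigh quotient on the Krylov space, so that arbitrary vectors of that
  space can be used as witnesses.\<close>

lemma lanczos_found_iff:
  fixes H :: "real^'n^'n"
  assumes H: "symmetric_matrix H"
  shows "lanczos_found H \<epsilon> u j \<noteq> {} \<longleftrightarrow>
    (\<exists>v\<in>lanczos_space H u j. v \<noteq> 0 \<and> v \<bullet> (H *v v) \<le> - \<epsilon> / 2 * (v \<bullet> v))"
proof
  assume "lanczos_found H \<epsilon> u j \<noteq> {}"
  then obtain v where "v \<in> lanczos_space H u j" "norm v = 1" "v \<bullet> (H *v v) \<le> - \<epsilon> / 2"
    unfolding lanczos_found_def least_ritz_vectors_def ritz_pair_def by auto
  then show "\<exists>v\<in>lanczos_space H u j. v \<noteq> 0 \<and> v \<bullet> (H *v v) \<le> - \<epsilon> / 2 * (v \<bullet> v)"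
    by (intro bexI[of _ v]) (auto simp: dot_square_norm)
next
  let ?V = "lanczos_space H u j"
  assume "\<exists>v\<in>?V. v \<noteq> 0 \<and> v \<bullet> (H *v v) \<le> - \<epsilon> / 2 * (v \<bullet> v)"
  then obtain v where v: "v \<in> ?V" "v \<noteq> 0" "v \<bullet> (H *v v) \<le> - \<epsilon> / 2 * (v \<bullet> v)" by auto
  then have "?V \<noteq> {0}" by auto
  from rayleigh_minimum_exists[OF subspace_lanczos_space this, of H]
  obtain w m where w: "w \<in> ?V" "norm w = 1" "w \<bullet> (H *v w) = m"
    and min: "\<And>x. x \<in> ?V \<Longrightarrow> m * (x \<bullet> x) \<le> x \<bullet> (H *v x)" by metis
  have "(H *v w - m *\<^sub>R w) \<bullet> x = 0" if "x \<in> ?V" for x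
    using form_minimum_stationary[OF H subspace_lanczos_space min w(1) _ that] w(2,3)
    by (simp add: dot_square_norm)
  then have rp: "ritz_pair H ?V m w" using w by (simp add: ritz_pair_def)
  have "m \<le> m'" if "ritz_pair H ?V m' w'" for m' w'
  proof -
    have w': "w' \<in> ?V" "norm w' = 1" "(H *v w' - m' *\<^sub>R w') \<bullet> w' = 0"
      using that unfolding ritz_pair_def by auto
    then have "w' \<bullet> (H *v w') = m'" by (simp add: inner_diff_left dot_square_norm inner_commute[of "H *v w'"])
    then show ?thesis using min[OF w'(1)] w'(2) by (simp add: dot_square_norm)
  qed
  then have "w \<in> least_ritz_vectors H ?V" using rp unfolding least_ritz_vectors_def by blast
  moreover have "m \<le> - \<epsilon> / 2"
  proof -
    have "m * (v \<bullet> v) \<le> - \<epsilon> / 2 * (v \<bullet> v)" using min[OF v(1)] v(3) by linarith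
    moreover have "0 < v \<bullet> v" using v(2) by simp
    ultimately show ?thesis by (rule mult_right_le_imp_le)
  qed
  ultimately show "lanczos_found H \<epsilon> u j \<noteq> {}" using w(3) unfolding lanczos_found_def by auto
qed

section \<open>Chebyshev polynomials of odd degree\<close>

text \<open>\<open>odd_chebyshev k\<close> is the polynomial \<open>q\<close> with \<open>x q(x\<^sup>2) = T\<^bsub>2k+1\<^esub>(x)\<close>. The choice is made for the
  sake of \<open>y q(y)\<^sup>2\<close>, which is at most 1 on \<open>[0,1]\<close> and, for \<open>y < 0\<close>, is negative and exponentially
  large in \<open>k\<close>.\<close>

fun odd_chebyshev :: "nat \<Rightarrow> real \<Rightarrow> real" where
  "odd_chebyshev 0 y = 1"
| "odd_chebyshev (Suc 0) y = 4 * y - 3"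
| "odd_chebyshev (Suc (Suc k)) y = (4 * y - 2) * odd_chebyshev (Suc k) y - odd_chebyshev k y"

lemma odd_chebyshev_cos: "cos t * odd_chebyshev k ((cos t)\<^sup>2) = cos (real (2 * k + 1) * t)"
proof (induction k rule: odd_chebyshev.induct[of _ _ 0, case_names 0 1 step])
  case (1 y)
  have "cos (3 * t) = 4 * cos t ^ 3 - 3 * cos t" by (rule cos_treble_cos)
  then show ?case by (simp add: power2_eq_square power3_eq_cube algebra_simps)
next
  case (step k y)
  have c: "2 * cos (2 * t) = 4 * (cos t)\<^sup>2 - 2" by (simp add: cos_double_cos)
  have "cos t * odd_chebyshev (Suc (Suc k)) ((cos t)\<^sup>2) =
      2 * cos (2 * t) * cos (real (2 * Suc k + 1) * t) - cos (real (2 * k + 1) * t)"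
    unfolding c step[symmetric] by (simp add: algebra_simps)
  also have "2 * cos (2 * t) * cos (real (2 * Suc k + 1) * t) =
      cos (real (2 * Suc (Suc k) + 1) * t) + cos (real (2 * k + 1) * t)"
  proof -
    define a where "a = real (2 * Suc k + 1) * t"
    have "real (2 * Suc (Suc k) + 1) * t = a + 2 * t" "real (2 * k + 1) * t = a - 2 * t"
      unfolding a_def by (auto simp: algebra_simps)
    then show ?thesis unfolding a_def[symmetric] by (simp add: cos_add cos_diff)
  qed
  finally show ?case by simp
qed simp

lemma odd_chebyshev_sinh:
  "sinh a * odd_chebyshev k (- (sinh a)\<^sup>2) = (- 1) ^ k * sinh (real (2 * k + 1) * a)"
proof (induction k rule: odd_chebyshev.induct[of _ _ 0, case_names 0 1 step])
  case (1 y)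
  have "sinh (3 * a) = sinh (2 * a + a)" by simp
  also have "\<dots> = 4 * sinh a ^ 3 + 3 * sinh a"
    unfolding sinh_add sinh_double cosh_double using cosh_square_eq[of a] by algebra
  finally show ?case by (simp add: power2_eq_square power3_eq_cube algebra_simps)
next
  case (step k y)
  have c: "- 2 * cosh (2 * a) = 4 * (- (sinh a)\<^sup>2) - 2" by (simp add: cosh_double cosh_square_eq)
  have "sinh a * odd_chebyshev (Suc (Suc k)) (- (sinh a)\<^sup>2) =
      (- 2 * cosh (2 * a)) * (sinh a * odd_chebyshev (Suc k) (- (sinh a)\<^sup>2)) - sinh a * odd_chebyshev k (- (sinh a)\<^sup>2)"
    unfolding c by (simp add: algebra_simps)
  also have "\<dots> = (- 1) ^ k * (2 * cosh (2 * a) * sinh (real (2 * Suc k + 1) * a) - sinh (real (2 * k + 1) * a))"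
    by (simp only: step.IH) (simp add: algebra_simps)
  also have "2 * cosh (2 * a) * sinh (real (2 * Suc k + 1) * a) =
      sinh (real (2 * Suc (Suc k) + 1) * a) + sinh (real (2 * k + 1) * a)"
  proof -
    define c where "c = real (2 * Suc k + 1) * a"
    have "real (2 * Suc (Suc k) + 1) * a = c + 2 * a" "real (2 * k + 1) * a = c - 2 * a"
      unfolding c_def by (auto simp: algebra_simps)
    then show ?thesis unfolding c_def[symmetric] by (simp add: sinh_add sinh_diff)
  qed
  finally show ?case by simp
qed simp

lemma odd_chebyshev_bounded:
  assumes "0 \<le> y" "y \<le> 1"
  shows "y * (odd_chebyshev k y)\<^sup>2 \<le> 1"
proof -
  define t where "t = arccos (sqrt y)"
  have c: "cos t = sqrt y" unfolding t_def using assms by (intro cos_arccos) (auto intro: order_trans[of _ 0])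
  have "y * (odd_chebyshev k y)\<^sup>2 = (cos t * odd_chebyshev k ((cos t)\<^sup>2))\<^sup>2"
    unfolding c using assms by (simp add: power_mult_distrib)
  also have "\<dots> \<le> 1" unfolding odd_chebyshev_cos by (simp add: abs_square_le_1)
  finally show ?thesis .
qed

lemma odd_chebyshev_growth:
  assumes "y \<le> 0"
  shows "- y * (odd_chebyshev k y)\<^sup>2 = (sinh (real (2 * k + 1) * arsinh (sqrt (- y))))\<^sup>2"
proof -
  define a where "a = arsinh (sqrt (- y))"
  have s: "(sinh a)\<^sup>2 = - y" unfolding a_def using assms by simp
  have "- y * (odd_chebyshev k y)\<^sup>2 = (sinh a * odd_chebyshev k (- (sinh a)\<^sup>2))\<^sup>2"
    unfolding s power_mult_distrib by simp
  also have "\<dots> = (sinh (real (2 * k + 1) * a))\<^sup>2"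
    unfolding odd_chebyshev_sinh by (simp add: power_mult_distrib flip: power_mult)
  finally show ?thesis unfolding a_def .
qed

text \<open>The vector \<open>q(G) u\<close> for \<open>q = odd_chebyshev k\<close>, by a recursion that shows that it belongs to a Krylov
  space.\<close>

fun chebyshev_vector :: "(real^'n \<Rightarrow> real^'n) \<Rightarrow> real^'n \<Rightarrow> nat \<Rightarrow> real^'n" where
  "chebyshev_vector G u 0 = u"
| "chebyshev_vector G u (Suc 0) = 4 *\<^sub>R G u - 3 *\<^sub>R u"
| "chebyshev_vector G u (Suc (Suc k)) = 4 *\<^sub>R G (chebyshev_vector G u (Suc k)) -
     2 *\<^sub>R chebyshev_vector G u (Suc k) - chebyshev_vector G u k"

lemma chebyshev_vector_component:
  assumes "\<And>x. G x \<bullet> e = \<gamma> * (x \<bullet> e)"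
  shows "chebyshev_vector G u k \<bullet> e = odd_chebyshev k \<gamma> * (u \<bullet> e)"
proof (induction k rule: odd_chebyshev.induct[of _ _ 0, case_names 0 1 step])
  case (step k y)
  then show ?case using assms by (simp add: inner_diff_left algebra_simps)
qed (use assms in \<open>simp_all add: inner_diff_left algebra_simps\<close>)

lemma chebyshev_vector_in_space:
  assumes "\<And>i x. x \<in> lanczos_space H u i \<Longrightarrow> G x \<in> lanczos_space H u (Suc i)"
  shows "chebyshev_vector G u k \<in> lanczos_space H u (Suc k)"
proof -
  have u1: "u \<in> lanczos_space H u (Suc 0)" using lanczos_vector_in_space[of 0 "Suc 0" H u] by simp
  have "chebyshev_vector G u k \<in> lanczos_space H u (Suc k) \<and>
    chebyshev_vector G u (Suc k) \<in> lanczos_space H u (Suc (Suc k))"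
  proof (induction k)
    case 0
    have "u \<in> lanczos_space H u (Suc (Suc 0))" by (rule subsetD[OF lanczos_space_mono[of "Suc 0"] u1]) simp
    then show ?case using u1 assms[OF u1]
      by (auto intro!: subspace_diff subspace_scale subspace_lanczos_space)
  next
    case (Suc k)
    have "chebyshev_vector G u k \<in> lanczos_space H u (Suc (Suc (Suc k)))"
      "chebyshev_vector G u (Suc k) \<in> lanczos_space H u (Suc (Suc (Suc k)))"
      using Suc lanczos_space_mono[of "Suc k" "Suc (Suc (Suc k))" H u]
        lanczos_space_mono[of "Suc (Suc k)" "Suc (Suc (Suc k))" H u] by auto
    then show ?case using Suc assms[of "chebyshev_vector G u (Suc k)" "Suc (Suc k)"]
      by (auto intro!: subspace_diff subspace_scale subspace_lanczos_space)
  qed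
  then show ?thesis by simp
qed

section \<open>Failure of the minimum eigenvalue oracle\<close>

text \<open>Failure of the Lanczos method forces the start vector to be nearly orthogonal to an eigenvector of an
  eigenvalue that should have been detected: a Chebyshev vector of the Krylov space amplifies that component, while the
  components that contribute positively to the Rayleigh quotient stay bounded.\<close>

lemma lanczos_failure_component:
  fixes H :: "real^'n^'n"
  assumes H: "symmetric_matrix H" and \<epsilon>: "0 < \<epsilon>"
    and E: "finite E" "pairwise orthogonal E" "span E = UNIV" "\<And>e. e \<in> E \<Longrightarrow> norm e = 1"
      "\<And>e. e \<in> E \<Longrightarrow> H *v e = l e *\<^sub>R e"
    and e0: "e0 \<in> E" "l e0 < - \<epsilon>"
    and fail: "lanczos_found H \<epsilon> u (Suc k) = {}" and u: "norm u = 1"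
  defines "L \<equiv> onorm ((*v) H) + \<epsilon> / 2"
  shows "(u \<bullet> e0)\<^sup>2 * (sinh (real (2 * k + 1) * arsinh (sqrt (- (l e0 + \<epsilon> / 2) / L))))\<^sup>2 \<le> 1 - (u \<bullet> e0)\<^sup>2"
proof -
  have on: "norm (H *v x) \<le> onorm ((*v) H) * norm x" for x by (rule onorm) simp
  have L: "0 < L" unfolding L_def using \<epsilon> onorm_pos_le[of "(*v) H"] by (simp add: add_nonneg_pos)
  (* The shift moves the threshold -\<epsilon>/2 to 0, and the scaling puts the whole spectrum below 1. In the part in
     [0, 1] the Chebyshev factor is at most 1; the negative part only helps. *)
  define \<gamma> where "\<gamma> e = (l e + \<epsilon> / 2) / L" for e
  define G where "G x = (1 / L) *\<^sub>R (H *v x + (\<epsilon> / 2) *\<^sub>R x)" for x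
  have G: "G x \<bullet> e = \<gamma> e * (x \<bullet> e)" if "e \<in> E" for x e
    using L E(5)[OF that]
    by (simp add: G_def \<gamma>_def inner_add_left symmetric_matrix_dot[OF H] field_simps)
  have Gs: "G x \<in> lanczos_space H u (Suc i)" if "x \<in> lanczos_space H u i" for i x
    unfolding G_def using that lanczos_space_image[OF that] lanczos_space_mono[of i "Suc i" H u]
    by (intro subspace_scale subspace_add subspace_lanczos_space) auto
  define v where "v = chebyshev_vector G u k"
  have v: "v \<in> lanczos_space H u (Suc k)" unfolding v_def by (rule chebyshev_vector_in_space[OF Gs])
  have ve: "v \<bullet> e = odd_chebyshev k (\<gamma> e) * (u \<bullet> e)" if "e \<in> E" for e
    unfolding v_def by (rule chebyshev_vector_component[OF G[OF that]])
  have "0 \<le> v \<bullet> (H *v v) + \<epsilon> / 2 * (v \<bullet> v)"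
    using fail v lanczos_found_iff[OF H, of \<epsilon> u "Suc k"] by (cases "v = 0") force+
  also have "\<dots> = (\<Sum>e\<in>E. (l e + \<epsilon> / 2) * (v \<bullet> e)\<^sup>2)"
  proof -
    have "v \<bullet> v = (\<Sum>e\<in>E. (v \<bullet> e)\<^sup>2)"
      using orthonormal_parseval[OF E(1-4), of v v] by (simp add: power2_eq_square)
    then show ?thesis using form_eigen_expansion[OF H E, of v]
      by (simp add: sum_distrib_left distrib_right sum.distrib)
  qed
  also have "\<dots> = L * (\<Sum>e\<in>E. \<gamma> e * (odd_chebyshev k (\<gamma> e))\<^sup>2 * (u \<bullet> e)\<^sup>2)"
    unfolding sum_distrib_left using L
    by (intro sum.cong) (auto simp: ve \<gamma>_def power_mult_distrib)
  finally have nn: "0 \<le> (\<Sum>e\<in>E. \<gamma> e * (odd_chebyshev k (\<gamma> e))\<^sup>2 * (u \<bullet> e)\<^sup>2)"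
    using L by (simp add: zero_le_mult_iff)
  have le1: "\<gamma> e * (odd_chebyshev k (\<gamma> e))\<^sup>2 \<le> 1" if e: "e \<in> E" for e
  proof (cases "0 \<le> \<gamma> e")
    case True
    have "\<bar>l e\<bar> \<le> onorm ((*v) H)" using on[of e] E(4,5)[OF e] by simp
    then have "\<gamma> e \<le> 1" using L by (simp add: \<gamma>_def L_def)
    with True show ?thesis by (rule odd_chebyshev_bounded)
  next
    case False
    then have "\<gamma> e * (odd_chebyshev k (\<gamma> e))\<^sup>2 \<le> 0" by (simp add: mult_nonpos_nonneg)
    then show ?thesis by simp
  qed
  have g0: "\<gamma> e0 \<le> 0" using e0(2) L \<epsilon> by (simp add: \<gamma>_def divide_nonpos_pos)
  have uu: "(\<Sum>e\<in>E. (u \<bullet> e)\<^sup>2) = 1"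
    using orthonormal_parseval[OF E(1-4), of u u] u by (simp add: dot_square_norm power2_eq_square)
  have "(\<Sum>e\<in>E. \<gamma> e * (odd_chebyshev k (\<gamma> e))\<^sup>2 * (u \<bullet> e)\<^sup>2) =
      \<gamma> e0 * (odd_chebyshev k (\<gamma> e0))\<^sup>2 * (u \<bullet> e0)\<^sup>2
      + (\<Sum>e\<in>E - {e0}. \<gamma> e * (odd_chebyshev k (\<gamma> e))\<^sup>2 * (u \<bullet> e)\<^sup>2)"
    using E(1) e0(1) by (rule sum.remove)
  also have "(\<Sum>e\<in>E - {e0}. \<gamma> e * (odd_chebyshev k (\<gamma> e))\<^sup>2 * (u \<bullet> e)\<^sup>2) \<le> (\<Sum>e\<in>E - {e0}. (u \<bullet> e)\<^sup>2)"
    using le1 by (intro sum_mono) (metis DiffD1 mult_left_le_one_le mult_1 mult_right_mono zero_le_power2)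
  also have "(\<Sum>e\<in>E - {e0}. (u \<bullet> e)\<^sup>2) = 1 - (u \<bullet> e0)\<^sup>2"
    using sum.remove[OF E(1) e0(1), of "\<lambda>e. (u \<bullet> e)\<^sup>2"] uu by simp
  finally have "- \<gamma> e0 * (odd_chebyshev k (\<gamma> e0))\<^sup>2 * (u \<bullet> e0)\<^sup>2 \<le> 1 - (u \<bullet> e0)\<^sup>2"
    using nn by simp
  moreover have "- \<gamma> e0 = - (l e0 + \<epsilon> / 2) / L"
    unfolding \<gamma>_def by (rule minus_divide_left)
  ultimately show ?thesis
    unfolding odd_chebyshev_growth[OF g0] by (metis mult.commute)
qed

lemma tanh_le_self: "0 \<le> a \<Longrightarrow> tanh a \<le> (a::real)"
proof -
  assume a: "0 \<le> a"
  have "(\<lambda>x. x - tanh x) 0 \<le> (\<lambda>x. x - tanh x) a"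
  proof (rule DERIV_nonneg_imp_nondecreasing[OF a])
    fix x :: real
    have "((\<lambda>x. x - tanh x) has_real_derivative (tanh x)\<^sup>2) (at x)"
      by (auto intro!: derivative_eq_intros simp: power2_eq_square)
    then show "\<exists>y. ((\<lambda>x. x - tanh x) has_real_derivative y) (at x) \<and> 0 \<le> y" by fastforce
  qed
  then show ?thesis by simp
qed

lemma arsinh_lower: "0 \<le> y \<Longrightarrow> y / sqrt (y\<^sup>2 + 1) \<le> arsinh (y::real)"
proof -
  assume "0 \<le> y"
  then have "0 \<le> arsinh y" by (metis sinh_arsinh_real sinh_real_nonneg_iff)
  then have "tanh (arsinh y) \<le> arsinh y" by (rule tanh_le_self)
  then show ?thesis by (simp add: tanh_def cosh_arsinh_real)
qed

text \<open>For \<open>y\<close> the argument of \<open>arsinh\<close> on the right, \<open>arsinh y \<ge> tanh (arsinh y) = y / \<surd>(y\<^sup>2 + 1) \<ge> \<surd>(\<epsilon> / (4 h))\<close>.\<close>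

lemma exponent_bound:
  fixes h \<epsilon> l \<delta> :: real
  assumes \<epsilon>: "0 < \<epsilon>" and l: "l < - \<epsilon>" "- l \<le> h" and \<delta>: "0 < \<delta>" "\<delta> < 1"
    and k: "real k \<ge> \<epsilon> powr (- 1/2) * ln (1 / \<delta>)"
  shows "h powr (- 1/2) * ln (1 / \<delta>) \<le> real (2 * k + 1) * arsinh (sqrt (- (l + \<epsilon> / 2) / (h + \<epsilon> / 2)))"
proof -
  define y where "y = sqrt (- (l + \<epsilon> / 2) / (h + \<epsilon> / 2))"
  have h: "0 < h" "\<epsilon> < h" using l \<epsilon> by auto
  have y2: "y\<^sup>2 = - (l + \<epsilon> / 2) / (h + \<epsilon> / 2)" unfolding y_def using l \<epsilon> h by (intro real_sqrt_pow2) auto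
  have y0: "0 \<le> y" unfolding y_def using l \<epsilon> h by auto
  have "\<epsilon> / (4 * h) \<le> (y / sqrt (y\<^sup>2 + 1))\<^sup>2"
  proof -
    define t where "t = - (l + \<epsilon> / 2)"
    have t: "\<epsilon> / 2 < t" using l by (simp add: t_def)
    have "(y / sqrt (y\<^sup>2 + 1))\<^sup>2 = y\<^sup>2 / (y\<^sup>2 + 1)" using zero_le_power2[of y] by (simp add: power_divide)
    also have "\<dots> = t / (t + (h + \<epsilon> / 2))"
    proof -
      define c where "c = h + \<epsilon> / 2"
      have "0 < c" using h \<epsilon> by (simp add: c_def)
      then show ?thesis unfolding y2 t_def[symmetric] c_def[symmetric] using t \<epsilon> by (simp add: field_simps)
    qed
    also have "\<dots> \<ge> \<epsilon> / (4 * h)"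
    proof -
      have "\<epsilon> * (t + (h + \<epsilon> / 2)) \<le> t * (4 * h)"
      proof -
        have "\<epsilon> * t \<le> h * t" "\<epsilon> / 2 * (h + \<epsilon>/2) \<le> t * (h + \<epsilon>/2)"
          using t h \<epsilon> by (auto intro!: mult_right_mono)
        moreover have "t * (\<epsilon> / 2) \<le> t * (h / 2)" using t h \<epsilon> by (intro mult_left_mono) auto
        ultimately show ?thesis by (simp add: algebra_simps)
      qed
      then show ?thesis using t h \<epsilon> by (simp add: field_simps)
    qed
    finally show ?thesis .
  qed
  then have "sqrt (\<epsilon> / (4 * h)) \<le> y / sqrt (y\<^sup>2 + 1)"
    using y0 by (intro real_le_lsqrt) auto
  also have "\<dots> \<le> arsinh y" by (rule arsinh_lower[OF y0])
  finally have a: "sqrt (\<epsilon> / (4 * h)) \<le> arsinh y" .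
  have ln: "0 < ln (1 / \<delta>)" using \<delta> by simp
  have "h powr (- 1/2) * ln (1 / \<delta>) = 2 * (\<epsilon> powr (- 1/2) * ln (1 / \<delta>)) * sqrt (\<epsilon> / (4 * h))"
  proof -
    have p: "x powr (- 1/2) = 1 / sqrt x" if "0 < x" for x :: real
      using that powr_minus_divide[of x "1/2"] by (simp add: powr_half_sqrt)
    have "sqrt (\<epsilon> / (4 * h)) = sqrt \<epsilon> / (2 * sqrt h)" by (simp add: real_sqrt_divide real_sqrt_mult)
    then show ?thesis using p[OF h(1)] p[OF \<epsilon>] h \<epsilon> by simp
  qed
  also have "\<dots> \<le> 2 * real k * arsinh y"
    using k a ln h \<epsilon> by (intro mult_mono) auto
  also have "\<dots> \<le> real (2 * k + 1) * arsinh y"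
  proof (rule mult_right_mono)
    have "0 \<le> sqrt (\<epsilon> / (4 * h))" using h \<epsilon> by simp
    then show "0 \<le> arsinh y" using a by linarith
  qed simp
  finally show ?thesis unfolding y_def .
qed

text \<open>Only a claimed failure probability below \<open>1\<close> requires a proof. Then \<open>D\<close> is small, which gives the room needed to
  pass from \<open>sinh\<close> to \<open>exp\<close>.\<close>

lemma failure_constant:
  fixes D x :: real
  assumes D: "0 < D" and small: "sqrt (2.75 * n) * D < 1" and n: "1 \<le> n" and x: "ln (1 / D) \<le> x"
  shows "0 < sinh x" "1 / sinh x * sqrt (2 * (n - 1) / pi) \<le> sqrt (2.75 * n) * D"
proof -
  have q: "(2.75 * n) * D\<^sup>2 < 1"
  proof -
    have "(sqrt (2.75 * n) * D)\<^sup>2 < 1\<^sup>2" using small D n by (intro power_strict_mono) auto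
    then show ?thesis using n by (simp add: power_mult_distrib)
  qed
  then have D2: "D\<^sup>2 < 1 / (2.75 * n)" using n by (simp add: field_simps)
  have "1 / (2.75 * n) < 1" using n by simp
  then have D21: "D\<^sup>2 < 1" using D2 by linarith
  have x0: "sinh (ln (1 / D)) = (1 - D\<^sup>2) / (2 * D)"
    using D by (simp add: sinh_ln_real power2_eq_square field_simps)
  have sx: "(1 - D\<^sup>2) / (2 * D) \<le> sinh x" using x x0 by (metis sinh_real_le_iff)
  have pos: "0 < (1 - D\<^sup>2) / (2 * D)" using D D21 by simp
  then show s: "0 < sinh x" using sx by linarith
  have c: "sqrt (2 * (n - 1) / pi) * 2 \<le> sqrt (2.75 * n) * (1 - D\<^sup>2)"
  proof (rule power2_le_imp_le)
    have "(sqrt (2 * (n - 1) / pi) * 2)\<^sup>2 = 8 * (n - 1) / pi" using n by (simp add: power_mult_distrib)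
    also have "\<dots> \<le> 8 * (n - 1) / 3.14"
      using n pi_approx by (intro divide_left_mono) auto
    also have "\<dots> \<le> 2.75 * n - 2" using n by simp
    also have "\<dots> \<le> 2.75 * n * (1 - 2 * D\<^sup>2)" using q by (simp add: algebra_simps)
    also have "\<dots> \<le> 2.75 * n * (1 - D\<^sup>2)\<^sup>2"
    proof (rule mult_left_mono)
      have "0 \<le> (D\<^sup>2)\<^sup>2" by simp
      then show "1 - 2 * D\<^sup>2 \<le> (1 - D\<^sup>2)\<^sup>2" by (simp add: power2_diff)
    qed (use n in simp)
    also have "\<dots> = (sqrt (2.75 * n) * (1 - D\<^sup>2))\<^sup>2" using n by (simp add: power_mult_distrib)
    finally show "(sqrt (2 * (n - 1) / pi) * 2)\<^sup>2 \<le> (sqrt (2.75 * n) * (1 - D\<^sup>2))\<^sup>2" .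
    show "0 \<le> sqrt (2.75 * n) * (1 - D\<^sup>2)" using n D21 by (intro mult_nonneg_nonneg) auto
  qed
  have "1 / sinh x * sqrt (2 * (n - 1) / pi) \<le> 1 / ((1 - D\<^sup>2) / (2 * D)) * sqrt (2 * (n - 1) / pi)"
    using sx pos s n by (intro mult_right_mono divide_left_mono mult_pos_pos) auto
  also have "\<dots> = (sqrt (2 * (n - 1) / pi) * 2) * D / (1 - D\<^sup>2)" by simp
  also have "\<dots> \<le> (sqrt (2.75 * n) * (1 - D\<^sup>2)) * D / (1 - D\<^sup>2)"
    using c D D21 by (intro divide_right_mono mult_right_mono) auto
  also have "\<dots> = sqrt (2.75 * n) * D" using D21 by simp
  finally show "1 / sinh x * sqrt (2 * (n - 1) / pi) \<le> sqrt (2.75 * n) * D" .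
qed

lemma measurable_matrix_vector [measurable (raw)]:
  fixes H :: "real^'n^'m"
  assumes "f \<in> borel_measurable M"
  shows "(\<lambda>u. H *v f u) \<in> borel_measurable M"
proof (rule measurable_compose[OF assms])
  show "(*v) H \<in> borel_measurable borel"
    by (intro borel_measurable_continuous_onI continuous_intros)
qed

lemma measurable_lanczos:
  fixes H :: "real^'n^'n"
  shows "(\<lambda>u. fst (lanczos H u i)) \<in> borel_measurable borel \<and>
    (\<lambda>u. fst (snd (lanczos H u i))) \<in> borel_measurable borel \<and>
    (\<lambda>u. snd (snd (lanczos H u i))) \<in> borel_measurable borel"
proof (induction i)
  case (Suc i)
  then have [measurable]: "(\<lambda>u. fst (lanczos H u i)) \<in> borel_measurable borel"
    "(\<lambda>u. fst (snd (lanczos H u i))) \<in> borel_measurable borel"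
    "(\<lambda>u. snd (snd (lanczos H u i))) \<in> borel_measurable borel" by auto
  show ?case by (simp add: case_prod_beta Let_def) measurable
qed simp

lemma measurable_lanczos_vector [measurable]: "(\<lambda>u. lanczos_vector H u i) \<in> borel_measurable borel"
  unfolding lanczos_vector_def using measurable_lanczos[of H i] by simp

lemma lanczos_space_combination:
  "v \<in> lanczos_space H u j \<longleftrightarrow> (\<exists>c. v = (\<Sum>i<j. c i *\<^sub>R lanczos_vector H u i))"
proof
  show "\<exists>c. v = (\<Sum>i<j. c i *\<^sub>R lanczos_vector H u i)" if "v \<in> lanczos_space H u j"
    using that
  proof (induction j arbitrary: v)
    case 0 then show ?case by (simp add: lanczos_space_alt)
  next
    case (Suc j)
    then have "v \<in> span (insert (lanczos_vector H u j) (lanczos_vector H u ` {..<j}))"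
      by (simp add: lanczos_space_alt lessThan_Suc)
    then obtain a where "v - a *\<^sub>R lanczos_vector H u j \<in> lanczos_space H u j"
      unfolding span_breakdown_eq lanczos_space_alt by blast
    from Suc.IH[OF this] obtain c where c: "v - a *\<^sub>R lanczos_vector H u j = (\<Sum>i<j. c i *\<^sub>R lanczos_vector H u i)"
      by blast
    have "(\<Sum>i<j. (c(j := a)) i *\<^sub>R lanczos_vector H u i) = (\<Sum>i<j. c i *\<^sub>R lanczos_vector H u i)"
      by (intro sum.cong) auto
    then have "v = (\<Sum>i<Suc j. (c(j := a)) i *\<^sub>R lanczos_vector H u i)"
      using c by (simp add: algebra_simps)
    then show ?case by blast
  qed
  show "v \<in> lanczos_space H u j" if "\<exists>c. v = (\<Sum>i<j. c i *\<^sub>R lanczos_vector H u i)"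
    using that by (auto intro!: subspace_sum subspace_scale subspace_lanczos_space lanczos_vector_in_space)
qed

text \<open>Rational combinations with a strict inequality make the detection event a countable combination of Borel sets;
  the least Rayleigh quotient on the Krylov space is attained, so nothing is lost.\<close>

lemma lanczos_found_rational:
  fixes H :: "real^'n^'n"
  assumes H: "symmetric_matrix H"
  shows "lanczos_found H \<epsilon> u j \<noteq> {} \<longleftrightarrow> (\<forall>m. \<exists>cs::rat list.
    (\<Sum>i<j. of_rat (cs ! i) *\<^sub>R lanczos_vector H u i) \<bullet> (H *v (\<Sum>i<j. of_rat (cs ! i) *\<^sub>R lanczos_vector H u i)) <
    (- \<epsilon> / 2 + inverse (real (Suc m))) *
      ((\<Sum>i<j. of_rat (cs ! i) *\<^sub>R lanczos_vector H u i) \<bullet> (\<Sum>i<j. of_rat (cs ! i) *\<^sub>R lanczos_vector H u i)))"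
    (is "_ \<longleftrightarrow> (\<forall>m. \<exists>cs. ?P m (?v cs))")
proof
  assume "lanczos_found H \<epsilon> u j \<noteq> {}"
  then obtain v where v: "v \<in> lanczos_space H u j" "v \<noteq> 0" "v \<bullet> (H *v v) \<le> - \<epsilon> / 2 * (v \<bullet> v)"
    using lanczos_found_iff[OF H] by blast
  obtain c where c: "v = (\<Sum>i<j. c i *\<^sub>R lanczos_vector H u i)" using v(1) lanczos_space_combination by blast
  show "\<forall>m. \<exists>cs. ?P m (?v cs)"
  proof
    fix m
    define b where "b = - \<epsilon> / 2 + inverse (real (Suc m))"
    have "0 < inverse (real (Suc m)) * (v \<bullet> v)" using v(2) by simp
    then have neg: "v \<bullet> (H *v v) - b * (v \<bullet> v) < 0" using v(3) by (simp add: b_def algebra_simps)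
    have "\<exists>X. (\<lambda>n. of_rat (X n)) \<longlonglongrightarrow> x" for x :: real
    proof -
      have "\<exists>q. dist (of_rat q) x < inverse (real (Suc n))" for n
      proof -
        obtain q where "x - inverse (real (Suc n)) < of_rat q" "of_rat q < x"
          using of_rat_dense[of "x - inverse (real (Suc n))" x] by auto
        then show ?thesis by (intro exI[of _ q]) (auto simp: dist_real_def)
      qed
      then obtain X where X: "\<And>n. dist (of_rat (X n)) x < inverse (real (Suc n))" by metis
      have "(\<lambda>n. of_rat (X n)) \<longlonglongrightarrow> x"
      proof (rule metric_tendsto_imp_tendsto[OF LIMSEQ_inverse_real_of_nat], rule always_eventually, rule allI)
        show "dist (of_rat (X n)) x \<le> dist (inverse (real (Suc n))) 0" for n
          using X[of n] by (simp add: dist_real_def)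
      qed
      then show ?thesis by blast
    qed
    then have "\<exists>X. \<forall>i. (\<lambda>n. of_rat (X i n)) \<longlonglongrightarrow> c i"
      by (intro choice) blast
    then obtain X where X: "(\<lambda>n. of_rat (X i n)) \<longlonglongrightarrow> c i" for i by blast
    define w where "w n = (\<Sum>i<j. of_rat (X i n) *\<^sub>R lanczos_vector H u i)" for n
    have w: "w \<longlonglongrightarrow> v" unfolding w_def c by (intro tendsto_intros X)
    have "(\<lambda>n. H *v w n) \<longlonglongrightarrow> H *v v"
      using w by (rule bounded_linear.tendsto[OF matrix_vector_mul_bounded_linear])
    then have "(\<lambda>n. w n \<bullet> (H *v w n) - b * (w n \<bullet> w n)) \<longlonglongrightarrow> v \<bullet> (H *v v) - b * (v \<bullet> v)"
      using w by (intro tendsto_intros)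
    then have "eventually (\<lambda>n. w n \<bullet> (H *v w n) - b * (w n \<bullet> w n) < 0) sequentially"
      using neg by (rule order_tendstoD(2))
    then obtain n where n: "w n \<bullet> (H *v w n) - b * (w n \<bullet> w n) < 0"
      using eventually_happens'[OF sequentially_bot] by blast
    have "?v (map (\<lambda>i. X i n) [0..<j]) = w n" unfolding w_def by (intro sum.cong) auto
    then show "\<exists>cs. ?P m (?v cs)" using n unfolding b_def
      by (intro exI[of _ "map (\<lambda>i. X i n) [0..<j]"]) simp
  qed
next
  let ?V = "lanczos_space H u j"
  assume P: "\<forall>m. \<exists>cs. ?P m (?v cs)"
  have inV: "?v cs \<in> ?V" for cs :: "rat list"
    unfolding lanczos_space_combination by (rule exI[of _ "\<lambda>i. of_rat (cs ! i)"]) simp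
  have nz: "?v cs \<noteq> 0" if "?P m (?v cs)" for m cs using that by force
  obtain cs where "?P 0 (?v cs)" using P by blast
  then have "?V \<noteq> {0}" using nz inV by blast
  from rayleigh_minimum_exists[OF subspace_lanczos_space this, of H]
  obtain w l where w: "w \<in> ?V" "norm w = 1" "w \<bullet> (H *v w) = l"
    and min: "\<And>x. x \<in> ?V \<Longrightarrow> l * (x \<bullet> x) \<le> x \<bullet> (H *v x)" by metis
  have "l \<le> - \<epsilon> / 2 + inverse (real (Suc m))" for m
  proof -
    obtain cs where cs: "?P m (?v cs)" using P by blast
    have "l * (?v cs \<bullet> ?v cs) \<le> (- \<epsilon> / 2 + inverse (real (Suc m))) * (?v cs \<bullet> ?v cs)"
      using min[OF inV] cs by (meson less_imp_le order_trans)
    moreover have "0 < ?v cs \<bullet> ?v cs" using nz[OF cs] by simp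
    ultimately show ?thesis by (rule mult_right_le_imp_le)
  qed
  moreover have "(\<lambda>m. - \<epsilon> / 2 + inverse (real (Suc m))) \<longlonglongrightarrow> - \<epsilon> / 2 + 0"
    by (intro tendsto_intros LIMSEQ_inverse_real_of_nat)
  ultimately have "l \<le> - \<epsilon> / 2" by (intro LIMSEQ_le_const) auto
  moreover have "w \<noteq> 0" using w(2) by auto
  ultimately show "lanczos_found H \<epsilon> u j \<noteq> {}"
    unfolding lanczos_found_iff[OF H] using w by (intro bexI[of _ w]) (auto simp: dot_square_norm)
qed

lemma borel_lanczos_found:
  fixes H :: "real^'n^'n"
  assumes H: "symmetric_matrix H"
  shows "{u. lanczos_found H \<epsilon> u j \<noteq> {}} \<in> sets borel"
proof -
  have "{u \<in> space borel. lanczos_found H \<epsilon> u j \<noteq> {}} \<in> sets borel"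
    unfolding lanczos_found_rational[OF H] by measurable
  then show ?thesis by simp
qed

definition oracle_iterations :: "nat \<Rightarrow> real \<Rightarrow> real \<Rightarrow> int" where
  "oracle_iterations n \<epsilon> \<delta> = min (int n) (1 + \<lceil>\<epsilon> powr (- 1/2) * ln (1 / \<delta>)\<rceil>)"

lemma min_eig_oracle_None:
  fixes H :: "real^'n^'n"
  shows "min_eig_oracle H \<epsilon> \<delta> u sel = None \<longleftrightarrow>
    (\<forall>j. 1 \<le> j \<and> int j \<le> oracle_iterations CARD('n) \<epsilon> \<delta> \<longrightarrow> lanczos_found H \<epsilon> u j = {})"
  unfolding min_eig_oracle_def oracle_iterations_def Let_def by auto

lemma min_eig_oracle_Some:
  fixes H :: "real^'n^'n"
  assumes "min_eig_oracle H \<epsilon> \<delta> u sel = Some v" "\<And>X. X \<noteq> {} \<Longrightarrow> sel X \<in> X"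
  shows "norm v = 1" "v \<bullet> (H *v v) \<le> - \<epsilon> / 2"
proof -
  define hit where "hit j \<longleftrightarrow> 1 \<le> j \<and> int j \<le> oracle_iterations CARD('n) \<epsilon> \<delta> \<and> lanczos_found H \<epsilon> u j \<noteq> {}" for j
  have "\<exists>j. hit j" "v = sel (lanczos_found H \<epsilon> u (LEAST j. hit j))"
    using assms(1) unfolding min_eig_oracle_def Let_def
    by (simp_all only: hit_def[abs_def] oracle_iterations_def split: if_splits) auto
  then have "v \<in> lanczos_found H \<epsilon> u (LEAST j. hit j)"
    using LeastI_ex[of hit] assms(2) hit_def[of "LEAST j. hit j"] by metis
  then show "norm v = 1" "v \<bullet> (H *v v) \<le> - \<epsilon> / 2"
    by (auto simp: lanczos_found_def least_ritz_vectors_def ritz_pair_def)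
qed

text \<open>Failure confines the start vector to a band around an equator, of relative width \<open>1 / sinh x\<close>, where \<open>x\<close> grows
  linearly with the number of iterations.\<close>

proposition oracle_success_probability:
  fixes H :: "real^'n^'n"
  assumes H: "symmetric_matrix H" and \<epsilon>: "0 < \<epsilon>" and \<delta>: "0 < \<delta>" "\<delta> < 1"
    and c: "c \<bullet> (H *v c) < - \<epsilon> * (c \<bullet> c)"
  shows "1 - oracle_failure CARD('n) \<delta> (onorm ((*v) H)) \<le>
    measure uniform_sphere {u. min_eig_oracle H \<epsilon> \<delta> u sel \<noteq> None}"
proof -
  define h where "h = onorm ((*v) H)"
  define k where "k = nat \<lceil>\<epsilon> powr (- 1/2) * ln (1 / \<delta>)\<rceil>"
  define D where "D = \<delta> powr (h powr (- 1/2))"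
  define F where "F = {u. min_eig_oracle H \<epsilon> \<delta> u sel = None}"
  obtain E l where E: "finite E" "pairwise orthogonal E" "span E = UNIV"
    "\<And>e. e \<in> E \<Longrightarrow> norm e = 1" "\<And>e. e \<in> E \<Longrightarrow> H *v e = l e *\<^sub>R e"
    using spectral_theorem[OF H] by metis
  have "\<exists>e\<in>E. l e < - \<epsilon>"
  proof (rule ccontr)
    assume "\<not> ?thesis"
    then have "(\<Sum>e\<in>E. - \<epsilon> * (c \<bullet> e)\<^sup>2) \<le> (\<Sum>e\<in>E. l e * (c \<bullet> e)\<^sup>2)"
      by (intro sum_mono mult_right_mono) auto
    also have "\<dots> = c \<bullet> (H *v c)" using form_eigen_expansion[OF H E, of c] by simp
    also have "(\<Sum>e\<in>E. - \<epsilon> * (c \<bullet> e)\<^sup>2) = - \<epsilon> * (c \<bullet> c)"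
      using orthonormal_parseval[OF E(1-4), of c c] by (simp add: sum_distrib_left power2_eq_square)
    finally show False using c by simp
  qed
  then obtain e0 where e0: "e0 \<in> E" "l e0 < - \<epsilon>" by blast
  have hl: "- l e0 \<le> h"
    using onorm[OF matrix_vector_mul_bounded_linear, of H e0] E(4,5)[OF e0(1)] by (simp add: h_def)
  then have h0: "0 < h" using e0 \<epsilon> by linarith
  have D0: "0 < D" unfolding D_def using \<delta> by simp
  have of: "oracle_failure CARD('n) \<delta> h = sqrt (2.75 * real CARD('n)) * D"
    unfolding oracle_failure_def D_def using h0 by simp
  have lnD: "ln (1 / D) = h powr (- 1/2) * ln (1 / \<delta>)"
    unfolding D_def using \<delta> by (simp add: ln_div ln_powr)
  have ln: "0 < ln (1 / \<delta>)" using \<delta> by simp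
  then have kpos: "0 < \<epsilon> powr (- 1/2) * ln (1 / \<delta>)" using \<epsilon> by simp
  have k: "\<epsilon> powr (- 1/2) * ln (1 / \<delta>) \<le> real k" "int k = \<lceil>\<epsilon> powr (- 1/2) * ln (1 / \<delta>)\<rceil>"
    unfolding k_def using kpos by linarith+
  have Fb: "F \<in> sets borel"
  proof -
    have "F = (\<Inter>j\<in>{j. 1 \<le> j \<and> int j \<le> oracle_iterations CARD('n) \<epsilon> \<delta>}. - {u. lanczos_found H \<epsilon> u j \<noteq> {}})"
      unfolding F_def min_eig_oracle_None by auto
    moreover have "\<dots> \<in> sets borel"
    proof (cases "{j. 1 \<le> j \<and> int j \<le> oracle_iterations CARD('n) \<epsilon> \<delta>} = {}")
      case False
      then show ?thesis
        using borel_lanczos_found[OF H, of \<epsilon>] borel_comp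
        by (intro sets.countable_INT') auto
    next
      case True
      then show ?thesis unfolding True by simp
    qed
    ultimately show ?thesis by simp
  qed
  (* The limit of CARD('n) iterations costs nothing, because the Krylov spaces do not grow any more. *)
  have fail: "lanczos_found H \<epsilon> u (Suc k) = {}" if "u \<in> F" for u
  proof -
    define j where "j = nat (oracle_iterations CARD('n) \<epsilon> \<delta>)"
    have j: "j = min CARD('n) (Suc k)"
      unfolding j_def oracle_iterations_def k(2)[symmetric] by (auto simp: min_def)
    have "1 \<le> j" unfolding j by (simp add: Suc_leI)
    moreover have "int j \<le> oracle_iterations CARD('n) \<epsilon> \<delta>"
      unfolding j oracle_iterations_def k(2)[symmetric] by simp
    ultimately have "lanczos_found H \<epsilon> u j = {}"
      using that unfolding F_def min_eig_oracle_None by blast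
    moreover have "lanczos_space H u j = lanczos_space H u (Suc k)"
      using lanczos_space_saturates[of "Suc k" H u] unfolding j by (simp add: min_def)
    ultimately show ?thesis unfolding lanczos_found_def by simp
  qed
  have le: "measure uniform_sphere F \<le> oracle_failure CARD('n) \<delta> h" if small: "sqrt (2.75 * real CARD('n)) * D < 1"
  proof -
    define x where "x = real (2 * k + 1) * arsinh (sqrt (- (l e0 + \<epsilon> / 2) / (h + \<epsilon> / 2)))"
    have "ln (1 / D) \<le> x" unfolding lnD x_def by (rule exponent_bound[OF \<epsilon> e0(2) hl \<delta> k(1)])
    from failure_constant[OF D0 small _ this]
    have s: "0 < sinh x" "1 / sinh x * sqrt (2 * (real CARD('n) - 1) / pi) \<le> sqrt (2.75 * real CARD('n)) * D"
      by (auto simp: Suc_leI)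
    have "measure uniform_sphere F \<le> 1 / sinh x * sqrt (2 * (real CARD('n) - 1) / pi)"
    proof (rule uniform_sphere_band[OF E(4)[OF e0(1)] _ Fb])
      fix u assume u: "u \<in> F" "norm u = 1"
      have "(u \<bullet> e0)\<^sup>2 * (sinh x)\<^sup>2 \<le> 1 - (u \<bullet> e0)\<^sup>2"
        using lanczos_failure_component[OF H \<epsilon> E e0 fail[OF u(1)] u(2)] unfolding x_def h_def .
      then have "sqrt ((u \<bullet> e0)\<^sup>2 * (sinh x)\<^sup>2) \<le> sqrt (1 - (u \<bullet> e0)\<^sup>2)" by (rule real_sqrt_le_mono)
      then have "\<bar>u \<bullet> e0\<bar> * sinh x \<le> sqrt (1 - (u \<bullet> e0)\<^sup>2)" using s(1) by (simp add: real_sqrt_mult)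
      then show "\<bar>u \<bullet> e0\<bar> \<le> 1 / sinh x * sqrt (1 - (u \<bullet> e0)\<^sup>2)" using s(1) by (simp add: field_simps)
    qed (use s(1) in simp)
    then show ?thesis using s(2) unfolding of by linarith
  qed
  have "measure uniform_sphere (UNIV - F) = 1 - measure uniform_sphere F"
    using measure_Diff[of uniform_sphere UNIV F] Fb uniform_sphere_prob[where 'a="real^'n"]
    by (simp add: measure_def)
  moreover have "UNIV - F = {u. min_eig_oracle H \<epsilon> \<delta> u sel \<noteq> None}" unfolding F_def by auto
  moreover have "1 - oracle_failure CARD('n) \<delta> h \<le> 1 - measure uniform_sphere F" if "sqrt (2.75 * real CARD('n)) * D < 1"
    using le[OF that] by simp
  moreover have "1 - oracle_failure CARD('n) \<delta> h \<le> measure uniform_sphere (UNIV - F)" if "\<not> sqrt (2.75 * real CARD('n)) * D < 1"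
    using that measure_nonneg[of uniform_sphere "UNIV - F"] unfolding of by linarith
  ultimately show ?thesis unfolding h_def[symmetric] by (metis (no_types, lifting))
qed

lemma oracle_failure_mono:
  assumes "0 < \<delta>" "\<delta> < 1" "0 \<le> h" "h \<le> h'"
  shows "oracle_failure n \<delta> h \<le> oracle_failure n \<delta> h'"
proof (cases "h = 0")
  case True
  then show ?thesis by (simp add: oracle_failure_def)
next
  case False
  then have h: "0 < h" "0 < h'" using assms by auto
  have "h' powr (- 1/2) \<le> h powr (- 1/2)" using h assms by (intro powr_mono2') auto
  then have "\<delta> powr (h powr (- 1/2)) \<le> \<delta> powr (h' powr (- 1/2))"
    using assms by (intro powr_mono') auto
  then show ?thesis using h unfolding oracle_failure_def by (auto intro!: mult_left_mono)
qed

section \<open>Gradients, Hessians and third derivatives\<close>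

lemma GDERIV_grad:
  fixes f :: "'a::euclidean_space \<Rightarrow> real"
  assumes "f differentiable (at x)"
  shows "GDERIV f x :> grad f x"
proof -
  define D where "D = (\<Sum>b\<in>Basis. frechet_derivative f (at x) b *\<^sub>R b)"
  have der: "(f has_derivative frechet_derivative f (at x)) (at x)"
    using assms by (simp add: frechet_derivative_works)
  have "frechet_derivative f (at x) = (\<lambda>h. h \<bullet> D)"
  proof
    fix h
    interpret linear "frechet_derivative f (at x)" by (rule has_derivative_linear[OF der])
    have "frechet_derivative f (at x) h = frechet_derivative f (at x) (\<Sum>b\<in>Basis. (h \<bullet> b) *\<^sub>R b)"
      by (simp add: euclidean_representation)
    also have "\<dots> = h \<bullet> D" unfolding D_def by (simp add: sum scale inner_sum_right mult.commute)
    finally show "frechet_derivative f (at x) h = h \<bullet> D" .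
  qed
  then have D: "GDERIV f x :> D" using der by (simp add: gderiv_def)
  moreover have "D' = D" if "GDERIV f x :> D'" for D'
  proof -
    have "(\<lambda>h. h \<bullet> D') = (\<lambda>h. h \<bullet> D)"
      using that D unfolding gderiv_def by (rule has_derivative_unique)
    then show ?thesis by (metis vector_eq_rdot inner_commute)
  qed
  ultimately show ?thesis unfolding grad_def by (rule theI)
qed

lemma grad_dot:
  fixes f :: "'a::euclidean_space \<Rightarrow> real"
  assumes "f differentiable (at x)"
  shows "frechet_derivative f (at x) h = grad f x \<bullet> h"
proof -
  have "(f has_derivative (\<lambda>h. h \<bullet> grad f x)) (at x)"
    using GDERIV_grad[OF assms] by (simp add: gderiv_def)
  from frechet_derivative_at[OF this, symmetric] show ?thesis by (simp add: inner_commute)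
qed

lemma C_k_on_Suc_imp: "C_k_on (Suc k) S f \<Longrightarrow> C_k_on k S f"
proof (induction k arbitrary: f)
  case 0
  then show ?case
    by (auto intro!: continuous_at_imp_continuous_on differentiable_imp_continuous_within)
next
  case (Suc k)
  then show ?case by (subst C_k_on.simps(2)) auto
qed

lemma C_k_on_subset: "C_k_on k S f \<Longrightarrow> T \<subseteq> S \<Longrightarrow> C_k_on k T f"
proof (induction k arbitrary: f)
  case 0
  then show ?case by (simp add: continuous_on_subset)
qed auto

lemma has_vector_derivative_line:
  fixes f :: "'a::real_normed_vector \<Rightarrow> 'b::real_normed_vector"
  assumes "(f has_derivative f') (at (x + t *\<^sub>R u))"
  shows "((\<lambda>t. f (x + t *\<^sub>R u)) has_vector_derivative f' u) (at t)"
proof -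
  have "((\<lambda>t. x + t *\<^sub>R u) has_derivative (\<lambda>h. h *\<^sub>R u)) (at t)"
    by (auto intro!: derivative_eq_intros)
  from has_derivative_compose[OF this assms]
  have "((\<lambda>t. f (x + t *\<^sub>R u)) has_derivative (\<lambda>h. f' (h *\<^sub>R u))) (at t)" .
  then show ?thesis
    unfolding has_vector_derivative_def using linear_scale[OF has_derivative_linear[OF assms]] by simp
qed

lemma DERIV_frechet_line:
  fixes f :: "'a::real_normed_vector \<Rightarrow> real"
  assumes "f differentiable (at (x + t *\<^sub>R u))"
  shows "((\<lambda>t. f (x + t *\<^sub>R u)) has_real_derivative frechet_derivative f (at (x + t *\<^sub>R u)) u) (at t)"
  unfolding has_real_derivative_iff_has_vector_derivative
  by (rule has_vector_derivative_line) (use assms in \<open>simp add: frechet_derivative_works\<close>)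

text \<open>The mean value theorem, once in each direction.\<close>

lemma second_difference:
  fixes f :: "real^'n \<Rightarrow> real"
  assumes D: "ball x d \<subseteq> S" and f: "\<And>y. y \<in> S \<Longrightarrow> f differentiable (at y)"
    and g: "\<And>y. y \<in> S \<Longrightarrow> (\<lambda>y. frechet_derivative f (at y) v) differentiable (at y)"
    and s: "0 < s" "s * (norm v + norm w) < d"
  obtains p where "p \<in> ball x d"
    "f (x + s *\<^sub>R v + s *\<^sub>R w) - f (x + s *\<^sub>R v) - f (x + s *\<^sub>R w) + f x =
     s\<^sup>2 * frechet_derivative (\<lambda>y. frechet_derivative f (at y) v) (at p) w"
proof -
  have inb: "x + a *\<^sub>R v + b *\<^sub>R w \<in> ball x d" if "0 \<le> a" "a \<le> s" "0 \<le> b" "b \<le> s" for a b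
  proof -
    have "norm (a *\<^sub>R v + b *\<^sub>R w) \<le> a * norm v + b * norm w"
      using norm_triangle_ineq[of "a *\<^sub>R v" "b *\<^sub>R w"] that by simp
    also have "\<dots> \<le> s * norm v + s * norm w" using that by (intro add_mono mult_right_mono) auto
    finally have "norm (a *\<^sub>R v + b *\<^sub>R w) < d" using s(2) by (simp add: distrib_left)
    moreover have "dist x (x + z) = norm z" for z :: "real^'n" by (simp add: dist_norm)
    ultimately show ?thesis by (simp add: add.assoc)
  qed
  let ?g = "\<lambda>y. frechet_derivative f (at y) v"
  note fd = DERIV_frechet_line[OF f]
  note gd = DERIV_frechet_line[OF g]
  have in1: "x + s *\<^sub>R w + t *\<^sub>R v \<in> S" "x + t *\<^sub>R v \<in> S" if "0 \<le> t" "t \<le> s" for t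
    using inb[of t s] inb[of t 0] that s(1) D by (auto simp: add.commute add.left_commute)
  obtain a where a: "0 < a" "a < s"
    "(f (x + s *\<^sub>R w + s *\<^sub>R v) - f (x + s *\<^sub>R v)) - (f (x + s *\<^sub>R w + 0 *\<^sub>R v) - f (x + 0 *\<^sub>R v)) =
      (s - 0) * (?g (x + s *\<^sub>R w + a *\<^sub>R v) - ?g (x + a *\<^sub>R v))"
    using MVT2[of 0 s "\<lambda>t. f (x + s *\<^sub>R w + t *\<^sub>R v) - f (x + t *\<^sub>R v)"
        "\<lambda>t. ?g (x + s *\<^sub>R w + t *\<^sub>R v) - ?g (x + t *\<^sub>R v)"] s(1) DERIV_diff[OF fd[OF in1(1)] fd[OF in1(2)]] by blast
  have in2: "x + a *\<^sub>R v + t *\<^sub>R w \<in> S" if "0 \<le> t" "t \<le> s" for t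
    using inb[of a t] that a D by auto
  obtain b where b: "0 < b" "b < s"
    "?g (x + a *\<^sub>R v + s *\<^sub>R w) - ?g (x + a *\<^sub>R v + 0 *\<^sub>R w) =
      (s - 0) * frechet_derivative ?g (at (x + a *\<^sub>R v + b *\<^sub>R w)) w"
    using MVT2[of 0 s "\<lambda>t. ?g (x + a *\<^sub>R v + t *\<^sub>R w)"
        "\<lambda>t. frechet_derivative ?g (at (x + a *\<^sub>R v + t *\<^sub>R w)) w"] s(1) gd[OF in2] by blast
  have c: "x + s *\<^sub>R w + a *\<^sub>R v = x + a *\<^sub>R v + s *\<^sub>R w" "x + s *\<^sub>R w + s *\<^sub>R v = x + s *\<^sub>R v + s *\<^sub>R w"
    by (simp_all add: algebra_simps)
  show ?thesis
  proof (rule that)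
    show "x + a *\<^sub>R v + b *\<^sub>R w \<in> ball x d" using inb[of a b] a b by simp
    show "f (x + s *\<^sub>R v + s *\<^sub>R w) - f (x + s *\<^sub>R v) - f (x + s *\<^sub>R w) + f x =
        s\<^sup>2 * frechet_derivative ?g (at (x + a *\<^sub>R v + b *\<^sub>R w)) w"
      using a(3) b(3) unfolding c by (simp add: power2_eq_square)
  qed
qed

text \<open>Both mixed derivatives are limits of the same second difference quotient.\<close>

lemma mixed_derivatives_commute:
  fixes f :: "real^'n \<Rightarrow> real"
  assumes S: "open S" "x \<in> S" and C: "C_k_on 2 S f"
  shows "frechet_derivative (\<lambda>y. frechet_derivative f (at y) v) (at x) w =
    frechet_derivative (\<lambda>y. frechet_derivative f (at y) w) (at x) v"
proof -
  let ?A = "\<lambda>p. frechet_derivative (\<lambda>y. frechet_derivative f (at y) v) (at p) w"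
  let ?B = "\<lambda>p. frechet_derivative (\<lambda>y. frechet_derivative f (at y) w) (at p) v"
  have C': "\<And>y. y \<in> S \<Longrightarrow> f differentiable (at y)"
    "\<And>u y. y \<in> S \<Longrightarrow> (\<lambda>y. frechet_derivative f (at y) u) differentiable (at y)"
    "continuous_on S ?A" "continuous_on S ?B"
    using C by (auto simp: numeral_2_eq_2)
  have "\<bar>?A x - ?B x\<bar> \<le> e" if e: "0 < e" for e
  proof -
    have "isCont ?A x" "isCont ?B x" using C'(3,4) S by (auto simp: continuous_on_eq_continuous_at)
    then obtain d1 d2 where d: "0 < d1" "\<And>p. dist p x < d1 \<Longrightarrow> dist (?A p) (?A x) < e / 2"
      "0 < d2" "\<And>p. dist p x < d2 \<Longrightarrow> dist (?B p) (?B x) < e / 2"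
      using e unfolding continuous_at_eps_delta by (metis half_gt_zero)
    obtain d3 where d3: "0 < d3" "ball x d3 \<subseteq> S" using S openE by blast
    define dd where "dd = min d1 (min d2 d3)"
    have dd: "0 < dd" "ball x dd \<subseteq> S" using d d3 unfolding dd_def by auto
    define s where "s = dd / (2 * (norm v + norm w + 1))"
    have n: "0 < norm v + norm w + 1" by (simp add: add_nonneg_pos)
    have s: "0 < s" unfolding s_def using dd n by simp
    have "s * (norm v + norm w) < s * (2 * (norm v + norm w + 1))"
      using s n by (intro mult_strict_left_mono) auto
    also have "\<dots> = dd" unfolding s_def using n by simp
    finally have sd: "s * (norm v + norm w) < dd" .
    obtain p where p: "p \<in> ball x dd"
      "f (x + s *\<^sub>R v + s *\<^sub>R w) - f (x + s *\<^sub>R v) - f (x + s *\<^sub>R w) + f x = s\<^sup>2 * ?A p"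
      using second_difference[OF dd(2) C'(1) C'(2) s sd] by blast
    have sd': "s * (norm w + norm v) < dd" using sd by (simp add: add.commute)
    obtain q where q: "q \<in> ball x dd"
      "f (x + s *\<^sub>R w + s *\<^sub>R v) - f (x + s *\<^sub>R w) - f (x + s *\<^sub>R v) + f x = s\<^sup>2 * ?B q"
      using second_difference[OF dd(2) C'(1) C'(2) s sd'] by blast
    have "x + s *\<^sub>R w + s *\<^sub>R v = x + s *\<^sub>R v + s *\<^sub>R w" by simp
    then have "s\<^sup>2 * ?A p = s\<^sup>2 * ?B q" using p(2) q(2) by (simp only:)
    then have "?A p = ?B q" using s by (metis mult_left_cancel power2_eq_square mult_eq_0_iff less_irrefl)
    moreover have "dist (?A p) (?A x) < e / 2" "dist (?B q) (?B x) < e / 2"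
      using d p(1) q(1) by (auto simp: dd_def dist_commute)
    ultimately show ?thesis unfolding dist_real_def by linarith
  qed
  then have "\<bar>?A x - ?B x\<bar> \<le> 0" by (rule field_le_epsilon[of _ 0, simplified])
  then show ?thesis by simp
qed

locale C2_function =
  fixes f :: "real^'n \<Rightarrow> real" and S :: "(real^'n) set"
  assumes opn: "open S" and C2: "C_k_on 2 S f"
begin

lemma differentiable: "x \<in> S \<Longrightarrow> f differentiable (at x)"
  using C2 by (simp add: numeral_2_eq_2)

lemma differentiable_partial: "x \<in> S \<Longrightarrow> (\<lambda>y. frechet_derivative f (at y) v) differentiable (at x)"
  using C2 by (simp add: numeral_2_eq_2)

lemma grad_has_derivative:
  assumes x: "x \<in> S"
  shows "(grad f has_derivative (\<lambda>h. hess f x *v h)) (at x)"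
proof -
  have "((\<lambda>y. \<Sum>b\<in>Basis. frechet_derivative f (at y) b *\<^sub>R b) has_derivative
      (\<lambda>h. \<Sum>b\<in>Basis. frechet_derivative (\<lambda>y. frechet_derivative f (at y) b) (at x) h *\<^sub>R b)) (at x)"
    using differentiable_partial[OF x]
    by (intro has_derivative_sum has_derivative_scaleR_left) (simp add: frechet_derivative_works)
  moreover have "(\<Sum>b\<in>Basis. frechet_derivative f (at y) b *\<^sub>R b) = grad f y" if "y \<in> S" for y
    using grad_dot[OF differentiable[OF that]] euclidean_representation[of "grad f y"] by simp
  ultimately have "(grad f has_derivative
      (\<lambda>h. \<Sum>b\<in>Basis. frechet_derivative (\<lambda>y. frechet_derivative f (at y) b) (at x) h *\<^sub>R b)) (at x)"
    by (rule has_derivative_transform_within_open[OF _ opn x])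
  then have "grad f differentiable (at x)" by (rule differentiableI)
  then show ?thesis unfolding hess_def by (simp add: jacobian_works)
qed

lemma hess_dot:
  assumes x: "x \<in> S"
  shows "v \<bullet> (hess f x *v h) = frechet_derivative (\<lambda>y. frechet_derivative f (at y) v) (at x) h"
proof -
  have "((\<lambda>y. grad f y \<bullet> v) has_derivative (\<lambda>h. (hess f x *v h) \<bullet> v)) (at x)"
    by (intro has_derivative_inner_left grad_has_derivative x)
  then have "((\<lambda>y. frechet_derivative f (at y) v) has_derivative (\<lambda>h. (hess f x *v h) \<bullet> v)) (at x)"
    using opn x by (rule has_derivative_transform_within_open) (simp add: grad_dot differentiable)
  from frechet_derivative_at[OF this, symmetric] show ?thesis by (simp add: inner_commute)
qed

lemma hess_symmetric: "x \<in> S \<Longrightarrow> symmetric_matrix (hess f x)"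
proof (rule symmetric_matrixI)
  fix v w assume x: "x \<in> S"
  show "(hess f x *v v) \<bullet> w = v \<bullet> (hess f x *v w)"
    using mixed_derivatives_commute[OF opn x C2, of v w] by (simp add: hess_dot[OF x] inner_commute[of _ w])
qed

lemma DERIV_line:
  assumes "x + t *\<^sub>R u \<in> S"
  shows "((\<lambda>t. f (x + t *\<^sub>R u)) has_real_derivative grad f (x + t *\<^sub>R u) \<bullet> u) (at t)"
  using DERIV_frechet_line[OF differentiable[OF assms]] grad_dot[OF differentiable[OF assms]] by simp

lemma DERIV_grad_line:
  assumes "x + t *\<^sub>R u \<in> S"
  shows "((\<lambda>t. grad f (x + t *\<^sub>R u) \<bullet> v) has_real_derivative v \<bullet> (hess f (x + t *\<^sub>R u) *v u)) (at t)"
proof -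
  have "((\<lambda>y. grad f y \<bullet> v) has_derivative (\<lambda>h. (hess f (x + t *\<^sub>R u) *v h) \<bullet> v)) (at (x + t *\<^sub>R u))"
    by (intro has_derivative_inner_left grad_has_derivative assms)
  from has_vector_derivative_line[OF this] show ?thesis
    by (simp add: has_real_derivative_iff_has_vector_derivative inner_commute)
qed

end

subsection \<open>Linear combinations\<close>

lemma grad_add_scale:
  assumes "f differentiable (at x)" "g differentiable (at x)"
  shows "grad (\<lambda>x. f x + c * g x) x = grad f x + c *\<^sub>R grad g (x::real^'n)"
proof -
  have "GDERIV (\<lambda>x. f x + c * g x) x :> grad f x + c *\<^sub>R grad g x"
    using GDERIV_grad[OF assms(1)] GDERIV_grad[OF assms(2)] unfolding gderiv_def
    by (auto intro!: derivative_eq_intros simp: inner_add_right)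
  moreover from this have "(\<lambda>x. f x + c * g x) differentiable (at x)"
    unfolding gderiv_def by (rule differentiableI)
  ultimately have "(\<lambda>h. h \<bullet> grad (\<lambda>x. f x + c * g x) x) = (\<lambda>h. h \<bullet> (grad f x + c *\<^sub>R grad g x))"
    using GDERIV_grad unfolding gderiv_def by (intro has_derivative_unique)
  then show ?thesis by (metis (no_types, lifting) vector_eq_ldot)
qed

lemma hess_eqI:
  assumes "(grad f has_derivative (\<lambda>h. Q *v h)) (at x)"
  shows "hess f x = (Q :: real^'n^'n)"
proof -
  have "frechet_derivative (grad f) (at x) = (*v) Q"
    using frechet_derivative_at[OF assms] by simp
  then show ?thesis by (simp add: hess_def jacobian_def)
qed

lemma hess_add_scale:
  fixes f g :: "real^'n \<Rightarrow> real"
  assumes "C2_function f S" "C2_function g S" "x \<in> S"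
  shows "hess (\<lambda>x. f x + c * g x) x = hess f x + c *\<^sub>R hess g x"
proof (rule hess_eqI)
  interpret f: C2_function f S by fact
  interpret g: C2_function g S by fact
  have "((\<lambda>x. grad f x + c *\<^sub>R grad g x) has_derivative (\<lambda>h. hess f x *v h + c *\<^sub>R (hess g x *v h))) (at x)"
    by (intro has_derivative_add has_derivative_scaleR_right f.grad_has_derivative g.grad_has_derivative assms)
  then have "(grad (\<lambda>x. f x + c * g x) has_derivative (\<lambda>h. hess f x *v h + c *\<^sub>R (hess g x *v h))) (at x)"
    using f.opn assms(3)
    by (rule has_derivative_transform_within_open)
      (simp add: grad_add_scale f.differentiable g.differentiable)
  then show "(grad (\<lambda>x. f x + c * g x) has_derivative (\<lambda>h. (hess f x + c *\<^sub>R hess g x) *v h)) (at x)"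
    by (simp add: matrix_vector_mult_add_rdistrib scaleR_matrix_vector_assoc)
qed

subsection \<open>Taylor estimates on the unit interval\<close>

lemma DERIV_nonneg_unit:
  fixes h :: "real \<Rightarrow> real"
  assumes "\<And>t. 0 \<le> t \<Longrightarrow> t \<le> b \<Longrightarrow> (h has_real_derivative h' t) (at t)"
    and "\<And>t. 0 \<le> t \<Longrightarrow> t \<le> b \<Longrightarrow> 0 \<le> h' t" and "0 \<le> b"
  shows "h 0 \<le> h b"
  using DERIV_nonneg_imp_nondecreasing[of 0 b h] assms by blast

lemma taylor1_upper:
  fixes g g' :: "real \<Rightarrow> real"
  assumes "\<And>t. 0 \<le> t \<Longrightarrow> t \<le> 1 \<Longrightarrow> (g has_real_derivative g' t) (at t)"
    and "\<And>t. 0 \<le> t \<Longrightarrow> t \<le> 1 \<Longrightarrow> g' t \<le> g' 0 + c * t"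
  shows "g 1 \<le> g 0 + g' 0 + c / 2"
proof -
  have "(\<lambda>t. g' 0 * t + c / 2 * t\<^sup>2 - g t) 0 \<le> (\<lambda>t. g' 0 * t + c / 2 * t\<^sup>2 - g t) 1"
  proof (rule DERIV_nonneg_unit)
    fix t :: real assume t: "0 \<le> t" "t \<le> 1"
    show "((\<lambda>t. g' 0 * t + c / 2 * t\<^sup>2 - g t) has_real_derivative g' 0 + c * t - g' t) (at t)"
      by (auto intro!: derivative_eq_intros assms(1) t)
    show "0 \<le> g' 0 + c * t - g' t" using assms(2)[OF t] by simp
  qed simp
  then show ?thesis by simp
qed

lemma taylor2_upper:
  fixes g g' g'' :: "real \<Rightarrow> real"
  assumes "\<And>t. 0 \<le> t \<Longrightarrow> t \<le> 1 \<Longrightarrow> (g has_real_derivative g' t) (at t)"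
    and "\<And>t. 0 \<le> t \<Longrightarrow> t \<le> 1 \<Longrightarrow> (g' has_real_derivative g'' t) (at t)"
    and "\<And>t. 0 \<le> t \<Longrightarrow> t \<le> 1 \<Longrightarrow> g'' t \<le> g'' 0 + c * t"
  shows "g 1 \<le> g 0 + g' 0 + g'' 0 / 2 + c / 6"
proof -
  have d1: "g' t \<le> g' 0 + g'' 0 * t + c / 2 * t\<^sup>2" if t: "0 \<le> t" "t \<le> 1" for t
  proof -
    have "(\<lambda>t. g'' 0 * t + c / 2 * t\<^sup>2 - g' t) 0 \<le> (\<lambda>t. g'' 0 * t + c / 2 * t\<^sup>2 - g' t) t"
    proof (rule DERIV_nonneg_unit)
      fix s :: real assume "0 \<le> s" "s \<le> t"
      then have s: "0 \<le> s" "s \<le> 1" using t by auto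
      show "((\<lambda>t. g'' 0 * t + c / 2 * t\<^sup>2 - g' t) has_real_derivative g'' 0 + c * s - g'' s) (at s)"
        by (auto intro!: derivative_eq_intros assms(2) s)
      show "0 \<le> g'' 0 + c * s - g'' s" using assms(3)[OF s] by simp
    qed (use t in simp)
    then show ?thesis by simp
  qed
  have "(\<lambda>t. g' 0 * t + g'' 0 / 2 * t\<^sup>2 + c / 6 * t ^ 3 - g t) 0 \<le> (\<lambda>t. g' 0 * t + g'' 0 / 2 * t\<^sup>2 + c / 6 * t ^ 3 - g t) 1"
  proof (rule DERIV_nonneg_unit)
    fix t :: real assume t: "0 \<le> t" "t \<le> 1"
    show "((\<lambda>t. g' 0 * t + g'' 0 / 2 * t\<^sup>2 + c / 6 * t ^ 3 - g t) has_real_derivative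
        g' 0 + g'' 0 * t + c / 2 * t\<^sup>2 - g' t) (at t)"
      by (auto intro!: derivative_eq_intros assms(1) t)
    show "0 \<le> g' 0 + g'' 0 * t + c / 2 * t\<^sup>2 - g' t" using d1[OF t] by simp
  qed simp
  then show ?thesis by simp
qed

section \<open>Symmetric trilinear forms\<close>

text \<open>Among the pairs \<open>(v, u)\<close> of unit vectors
  that maximise \<open>T v v u\<close>, one with the smallest angle lies on the diagonal, unless \<open>u = - v\<close>: the bisector \<open>w\<close> of \<open>u\<close>
  and \<open>v\<close> gives another maximiser \<open>(w, v)\<close> at half the angle. Hence the values on the diagonal determine the norm.\<close>

lemma symmetric_trilinear_diagonal:
  fixes T :: "'a::euclidean_space \<Rightarrow> 'a \<Rightarrow> 'a \<Rightarrow> real"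
  assumes lin: "\<And>v w. linear (\<lambda>u. T u v w)"
    and sym: "\<And>u v w. T u v w = T v u w" "\<And>u v w. T u v w = T u w v"
    and diag: "\<And>u. \<bar>T u u u\<bar> \<le> m * norm u ^ 3"
  shows "\<bar>T v v u\<bar> \<le> m * (norm v)\<^sup>2 * norm u"
proof (cases "v = 0 \<or> u = 0")
  case True
  have T1: "T 0 v w = 0" for v w using linear_0[OF lin] .
  have T0: "T 0 v w = 0" "T v v 0 = 0" for v w
    using T1 sym(1)[of v 0 v] sym(2)[of v v 0] by auto
  show ?thesis using T0 True by auto
next
  case False
  have add: "T (a + b) c d = T a c d + T b c d" for a b c d using linear_add[OF lin] .
  have scale: "T (r *\<^sub>R a) c d = r * T a c d" for r a c d using linear_scale[OF lin] by (metis real_scaleR_def)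
  have add2: "T a (b + c) d = T a b d + T a c d" for a b c d using add sym(1) by metis
  have scale2: "T a (r *\<^sub>R b) d = r * T a b d" for a r b d using scale sym(1) by metis
  have add3: "T a b (c + d) = T a b c + T a b d" for a b c d using add2 sym(2) by metis
  have scale3: "T a b (r *\<^sub>R d) = r * T a b d" for a b r d using scale2 sym(2) by metis
  define F where "F z = T (fst z) (fst z) (snd z)" for z :: "'a \<times> 'a"
  have contF: "continuous_on UNIV F"
  proof -
    have "F z = (\<Sum>a\<in>Basis. \<Sum>b\<in>Basis. \<Sum>c\<in>Basis. (fst z \<bullet> a) * (fst z \<bullet> b) * (snd z \<bullet> c) * T a b c)" for z
    proof -
      have e1: "T p q s = (\<Sum>a\<in>Basis. (p \<bullet> a) * T a q s)" for p q s
      proof -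
        have "T p q s = T (\<Sum>a\<in>Basis. (p \<bullet> a) *\<^sub>R a) q s" by (simp add: euclidean_representation)
        also have "\<dots> = (\<Sum>a\<in>Basis. (p \<bullet> a) * T a q s)" by (simp add: linear_sum[OF lin] scale)
        finally show ?thesis .
      qed
      have e2: "T p q s = (\<Sum>b\<in>Basis. (q \<bullet> b) * T p b s)" for p q s
        using e1[of q p s] sym(1)[of p q s] by (simp only: sym(1)[of p])
      have e3: "T p q s = (\<Sum>c\<in>Basis. (s \<bullet> c) * T p q c)" for p q s
        using e2[of p s q] sym(2)[of p q s] by (simp only: sym(2)[of p q])
      have "F z = (\<Sum>a\<in>Basis. (fst z \<bullet> a) * T a (fst z) (snd z))" unfolding F_def by (rule e1)
      also have "\<dots> = (\<Sum>a\<in>Basis. (fst z \<bullet> a) * (\<Sum>b\<in>Basis. (fst z \<bullet> b) * T a b (snd z)))"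
        by (intro sum.cong refl arg_cong2[where f = "(*)"] e2)
      also have "\<dots> = (\<Sum>a\<in>Basis. (fst z \<bullet> a) * (\<Sum>b\<in>Basis. (fst z \<bullet> b) * (\<Sum>c\<in>Basis. (snd z \<bullet> c) * T a b c)))"
        by (intro sum.cong refl arg_cong2[where f = "(*)"] e3)
      finally show ?thesis by (simp only: sum_distrib_left mult.assoc)
    qed
    then have "F = (\<lambda>z. \<Sum>a\<in>Basis. \<Sum>b\<in>Basis. \<Sum>c\<in>Basis. (fst z \<bullet> a) * (fst z \<bullet> b) * (snd z \<bullet> c) * T a b c)" by blast
    then show ?thesis by (simp only:) (intro continuous_intros)
  qed
  define C where "C = (sphere 0 1 :: 'a set) \<times> (sphere 0 1 :: 'a set)"
  have "compact C" unfolding C_def by (intro compact_Times compact_sphere)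
  have "C \<noteq> {}" unfolding C_def using False by (auto intro!: exI[of _ "sgn v"] simp: norm_sgn)
  have "continuous_on C F" using contF continuous_on_subset by blast
  from continuous_attains_sup[OF \<open>compact C\<close> \<open>C \<noteq> {}\<close> this]
  obtain z0 where z0: "z0 \<in> C" "\<And>z. z \<in> C \<Longrightarrow> F z \<le> F z0" by blast
  define M where "M = F z0"
  define X where "X = {z \<in> C. F z = M}"
  have "closed X"
  proof -
    have "X = C \<inter> (F -` {M})" unfolding X_def by auto
    moreover have "closed (F -` {M})" using contF by (intro closed_vimage) auto
    moreover have "closed C" using \<open>compact C\<close> by (rule compact_imp_closed)
    ultimately show ?thesis by auto
  qed
  then have "compact X" using \<open>compact C\<close> closed_Int_compact[of X C] unfolding X_def by (simp add: Int_def conj_ac)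
  have "z0 \<in> X" using z0(1) unfolding X_def M_def by blast
  then have "X \<noteq> {}" by blast
  have "continuous_on X (\<lambda>z. fst z \<bullet> snd z)" by (intro continuous_intros)
  from continuous_attains_sup[OF \<open>compact X\<close> \<open>X \<noteq> {}\<close> this]
  obtain z where z: "z \<in> X" "\<And>y. y \<in> X \<Longrightarrow> fst y \<bullet> snd y \<le> fst z \<bullet> snd z" by blast
  obtain p q where pq: "z = (p, q)" by (cases z)
  have n: "norm p = 1" "norm q = 1" and TM: "T p p q = M" using z(1) unfolding X_def C_def pq F_def by auto
  have max: "T a a b \<le> M * (norm a)\<^sup>2 * norm b" for a b
  proof (cases "a = 0 \<or> b = 0")
    case True
    then show ?thesis using scale[of 0 a a b] scale3[of a a 0 b] by auto
  next
    case nz: False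
    have "(sgn a, sgn b) \<in> C" unfolding C_def using nz by (simp add: norm_sgn)
    from z0(2)[OF this] have "T (sgn a) (sgn a) (sgn b) \<le> M" by (simp add: M_def F_def)
    then have "(norm a)\<^sup>2 * norm b * T (sgn a) (sgn a) (sgn b) \<le> (norm a)\<^sup>2 * norm b * M"
      by (intro mult_left_mono) auto
    moreover have "(norm a)\<^sup>2 * norm b * T (sgn a) (sgn a) (sgn b) = T a a b"
      using nz by (simp add: sgn_div_norm scale scale2 scale3 power2_eq_square field_simps)
    ultimately show ?thesis by (simp add: mult_ac)
  qed
  have mz: "0 \<le> m"
    using diag[of p] n by (metis abs_ge_zero mult.right_neutral order_trans power_one)
  have pp: "p \<bullet> p = 1" "q \<bullet> q = 1" using n by (auto simp: dot_square_norm)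
  define c where "c = p \<bullet> q"
  have rearrange1: "0 \<le> 2 * t * (M * x - y) + t\<^sup>2 * (M * z)"
    if "M + t * y \<le> M * (1 + t * x + t\<^sup>2 * z / 2)" for t x y z :: real
    using that by (simp add: algebra_simps)
  have rearrange2: "0 \<le> 2 * t * (M * x - y) + t\<^sup>2 * (M * z - w)"
    if "M + 2 * t * y + t\<^sup>2 * w \<le> M * (1 + 2 * t * x + t\<^sup>2 * z)" for t x y z w :: real
    using that by (simp add: algebra_simps)
  \<comment> \<open>stationarity in each of the two arguments\<close>
  have st1: "T p p b = M * (q \<bullet> b)" for b
  proof -
    have "0 = M * (q \<bullet> b) - T p p b"
    proof (rule linear_coefficient_zero[symmetric])
      fix t :: real
      have Mn: "0 \<le> M" using max[of p "- q"] TM n scale3[of p p "-1" q] by simp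
      have "T p p (q + t *\<^sub>R b) \<le> M * norm (q + t *\<^sub>R b)" using max[of p "q + t *\<^sub>R b"] n by simp
      also have "norm (q + t *\<^sub>R b) \<le> (1 + (norm (q + t *\<^sub>R b))\<^sup>2) / 2"
        using sum_squares_bound[of 1 "norm (q + t *\<^sub>R b)"] by simp
      then have "M * norm (q + t *\<^sub>R b) \<le> M * ((1 + (norm (q + t *\<^sub>R b))\<^sup>2) / 2)" using Mn by (rule mult_left_mono)
      also have "(norm (q + t *\<^sub>R b))\<^sup>2 = 1 + 2 * t * (q \<bullet> b) + t\<^sup>2 * (b \<bullet> b)"
        unfolding power2_norm_eq_inner using pp
        by (simp add: inner_add_left inner_add_right inner_commute[of b q] power2_eq_square algebra_simps)
      also have "(1 + (1 + 2 * t * (q \<bullet> b) + t\<^sup>2 * (b \<bullet> b))) / 2 = 1 + t * (q \<bullet> b) + t\<^sup>2 * (b \<bullet> b) / 2"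
        by (simp add: field_simps)
      finally have "M + t * T p p b \<le> M * (1 + t * (q \<bullet> b) + t\<^sup>2 * (b \<bullet> b) / 2)"
        by (simp only: add3 scale3 TM)
      then show "0 \<le> 2 * t * (M * (q \<bullet> b) - T p p b) + t\<^sup>2 * (M * (b \<bullet> b))"
        by (rule rearrange1)
    qed
    then show ?thesis by simp
  qed
  have st2: "T p b q = M * (p \<bullet> b)" for b
  proof -
    have "0 = M * (p \<bullet> b) - T p b q"
    proof (rule linear_coefficient_zero[symmetric])
      fix t :: real
      have "T (p + t *\<^sub>R b) (p + t *\<^sub>R b) q \<le> M * (norm (p + t *\<^sub>R b))\<^sup>2"
        using max[of "p + t *\<^sub>R b" q] n by simp
      also have "(norm (p + t *\<^sub>R b))\<^sup>2 = 1 + 2 * t * (p \<bullet> b) + t\<^sup>2 * (b \<bullet> b)"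
        unfolding power2_norm_eq_inner using pp
        by (simp add: inner_add_left inner_add_right inner_commute[of b p] power2_eq_square algebra_simps)
      finally have "T (p + t *\<^sub>R b) (p + t *\<^sub>R b) q \<le> M * (1 + 2 * t * (p \<bullet> b) + t\<^sup>2 * (b \<bullet> b))" .
      then have "M + 2 * t * T p b q + t\<^sup>2 * T b b q \<le> M * (1 + 2 * t * (p \<bullet> b) + t\<^sup>2 * (b \<bullet> b))"
      proof -
        have "T (p + t *\<^sub>R b) (p + t *\<^sub>R b) q = M + 2 * t * T p b q + t\<^sup>2 * T b b q"
          unfolding add add2 scale scale2 TM sym(1)[of b p q] by (simp add: power2_eq_square distrib_left mult.assoc)
        then show ?thesis using \<open>T (p + t *\<^sub>R b) (p + t *\<^sub>R b) q \<le> M * (1 + 2 * t * (p \<bullet> b) + t\<^sup>2 * (b \<bullet> b))\<close> by simp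
      qed
      then show "0 \<le> 2 * t * (M * (p \<bullet> b) - T p b q) + t\<^sup>2 * (M * (b \<bullet> b) - T b b q)"
        by (rule rearrange2)
    qed
    then show ?thesis by simp
  qed
  have "M \<le> m"
  proof (cases "p + q = 0")
    case True
    then have "q = - p" by (simp add: eq_neg_iff_add_eq_0 add.commute)
    then have "T p p p = - M" using TM scale3[of p p "-1" p] by simp
    then show ?thesis using diag[of p] n by simp
  next
    case False
    have c: "- 1 \<le> c" "c \<le> 1" using Cauchy_Schwarz_ineq2[of p q] n unfolding c_def by auto
    have n2: "(norm (p + q))\<^sup>2 = 2 + 2 * c"
      unfolding power2_norm_eq_inner using pp by (simp add: inner_add_left inner_add_right inner_commute[of q p] c_def)
    have "0 < (norm (p + q))\<^sup>2" using False by simp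
    then have cgt: "- 1 < c" unfolding n2 by simp
    define w where "w = sgn (p + q)"
    have TW: "T (p + q) (p + q) p = M * (norm (p + q))\<^sup>2"
    proof -
      have "T (p + q) (p + q) p = T p p p + 2 * T p p q + T p q q"
        using sym(1)[of q p p] sym(2)[of p q p] sym(1)[of q q p] sym(2)[of q q p] sym(1)[of q p q]
        by (simp add: add add2)
      also have "\<dots> = M * (2 + 2 * c)"
        using st1[of p] st2[of q] TM by (simp only: c_def inner_commute[of q p]) (simp add: algebra_simps)
      finally show ?thesis by (simp add: n2)
    qed
    have "F (w, p) = M"
    proof -
      have "T (sgn s) (sgn s) p = T s s p / (norm s)\<^sup>2" for s
        by (simp add: sgn_div_norm scale scale2 power2_eq_square divide_inverse)
      then have "F (w, p) = T (p + q) (p + q) p / (norm (p + q))\<^sup>2" by (simp add: F_def w_def)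
      then show ?thesis
        unfolding TW using \<open>0 < (norm (p + q))\<^sup>2\<close> by simp
    qed
    moreover have "(w, p) \<in> C" unfolding C_def w_def using False n by (simp add: norm_sgn)
    ultimately have "(w, p) \<in> X" unfolding X_def by simp
    from z(2)[OF this] have le: "w \<bullet> p \<le> c" by (simp add: pq c_def)
    have "w \<bullet> p = (1 + c) / norm (p + q)"
    proof -
      have "sgn s \<bullet> p = (s \<bullet> p) / norm s" for s by (simp add: sgn_div_norm divide_inverse mult.commute)
      then show ?thesis unfolding w_def using pp by (simp add: inner_add_left c_def inner_commute[of q p])
    qed
    with le have "1 + c \<le> c * norm (p + q)" using False by (simp add: field_simps)
    moreover have "0 < 1 + c" using cgt by simp
    ultimately have sq: "(1 + c)\<^sup>2 \<le> (c * norm (p + q))\<^sup>2" by (intro power_mono) auto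
    have "(1 + c)\<^sup>2 \<le> c\<^sup>2 * (2 * (1 + c))" using sq by (simp add: power_mult_distrib n2)
    then have "(1 + c) * (1 + c) \<le> (1 + c) * (2 * c\<^sup>2)" by (simp add: power2_eq_square algebra_simps)
    then have "1 + c \<le> 2 * c\<^sup>2" using \<open>0 < 1 + c\<close> by (simp add: mult_le_cancel_left)
    moreover have "0 < c"
    proof (rule ccontr)
      assume "\<not> 0 < c"
      then have "c * norm (p + q) \<le> 0" by (simp add: mult_nonpos_nonneg)
      then show False using \<open>1 + c \<le> c * norm (p + q)\<close> \<open>0 < 1 + c\<close> by linarith
    qed
    moreover from this c have "c * c \<le> c * 1" by (intro mult_left_mono) auto
    ultimately have "c = 1" using c by (simp add: power2_eq_square)
    then have "(norm (p - q))\<^sup>2 = 0"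
      unfolding power2_norm_eq_inner using pp by (simp add: inner_diff_left inner_diff_right inner_commute[of q p] flip: c_def)
    then have "p = q" by simp
    then show ?thesis using TM diag[of p] n by simp
  qed
  then have up: "T a a b \<le> m * (norm a)\<^sup>2 * norm b" for a b
    using max[of a b] by (meson mult_right_mono norm_ge_zero order_trans zero_le_power2)
  have "T v v (- u) = - T v v u" using scale3[of v v "-1" u] by simp
  then show ?thesis using up[of v u] up[of v "- u"] by simp
qed

section \<open>Self-concordant barriers\<close>

text \<open>The differential inequality behind self-concordance makes \<open>s\<^bsup>-1/2\<^esup>\<close> Lipschitz with constant \<open>1\<close>. The shift by
  \<open>\<epsilon>\<close> covers the points where \<open>s\<close> vanishes.\<close>

lemma self_concordant_lipschitz:
  fixes s s' :: "real \<Rightarrow> real"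
  assumes der: "\<And>t. 0 \<le> t \<Longrightarrow> t \<le> b \<Longrightarrow> (s has_real_derivative s' t) (at t)"
    and nn: "\<And>t. 0 \<le> t \<Longrightarrow> t \<le> b \<Longrightarrow> 0 \<le> s t"
    and sc: "\<And>t. 0 \<le> t \<Longrightarrow> t \<le> b \<Longrightarrow> \<bar>s' t\<bar> \<le> 2 * s t powr (3/2)"
    and b: "0 \<le> b" and e: "0 < \<epsilon>"
  shows "\<bar>1 / sqrt (s b + \<epsilon>) - 1 / sqrt (s 0 + \<epsilon>)\<bar> \<le> b"
proof -
  define h where "h t = 1 / sqrt (s t + \<epsilon>)" for t
  define h' where "h' t = - (s' t / (2 * sqrt (s t + \<epsilon>))) / (s t + \<epsilon>)" for t
  have dh: "(h has_real_derivative h' t) (at t)" if t: "0 \<le> t" "t \<le> b" for t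
  proof -
    have p: "0 < s t + \<epsilon>" using nn[OF t] e by simp
    show ?thesis unfolding h_def[abs_def] h'_def using p
      by (auto intro!: derivative_eq_intros der[OF t] simp: field_simps)
  qed
  have bh: "\<bar>h' t\<bar> \<le> 1" if t: "0 \<le> t" "t \<le> b" for t
  proof -
    have p: "0 < s t + \<epsilon>" using nn[OF t] e by simp
    have "s t powr (3/2) \<le> (s t + \<epsilon>) powr (3/2)" using nn[OF t] e by (intro powr_mono2) auto
    also have "\<dots> = (s t + \<epsilon>) * sqrt (s t + \<epsilon>)"
    proof -
      have "(s t + \<epsilon>) powr (1 + 1/2) = (s t + \<epsilon>) powr 1 * (s t + \<epsilon>) powr (1/2)" by (rule powr_add)
      then show ?thesis using p by (simp add: powr_half_sqrt)
    qed
    finally have "\<bar>s' t\<bar> \<le> 2 * ((s t + \<epsilon>) * sqrt (s t + \<epsilon>))" using sc[OF t] by linarith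
    moreover have "h' t = - s' t / (2 * ((s t + \<epsilon>) * sqrt (s t + \<epsilon>)))" by (simp add: h'_def)
    moreover have "0 < (s t + \<epsilon>) * sqrt (s t + \<epsilon>)" using p by simp
    ultimately show ?thesis by (simp add: abs_divide divide_le_eq)
  qed
  have "(\<lambda>t. h t + t) 0 \<le> (\<lambda>t. h t + t) b"
  proof (rule DERIV_nonneg_unit[OF _ _ b])
    fix t assume t: "0 \<le> t" "t \<le> b"
    show "((\<lambda>t. h t + t) has_real_derivative h' t + 1) (at t)"
      by (auto intro!: derivative_eq_intros dh[OF t])
    show "0 \<le> h' t + 1" using bh[OF t] by linarith
  qed
  moreover have "(\<lambda>t. t - h t) 0 \<le> (\<lambda>t. t - h t) b"
  proof (rule DERIV_nonneg_unit[OF _ _ b])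
    fix t assume t: "0 \<le> t" "t \<le> b"
    show "((\<lambda>t. t - h t) has_real_derivative 1 - h' t) (at t)"
      by (auto intro!: derivative_eq_intros dh[OF t])
    show "0 \<le> 1 - h' t" using bh[OF t] by linarith
  qed
  ultimately show ?thesis unfolding h_def by (simp add: abs_le_iff)
qed

text \<open>The limit of the Lipschitz bound as the shift tends to \<open>0\<close>. The parameter \<open>\<rho>\<close>, with the shift
  \<open>\<rho>\<^sup>2 - s 0\<close>, makes the bounds explicit and also covers \<open>s 0 = 0\<close>.\<close>

lemma self_concordant_growth:
  fixes s s' :: "real \<Rightarrow> real"
  assumes der: "\<And>t. 0 \<le> t \<Longrightarrow> t \<le> b \<Longrightarrow> (s has_real_derivative s' t) (at t)"
    and nn: "\<And>t. 0 \<le> t \<Longrightarrow> t \<le> b \<Longrightarrow> 0 \<le> s t"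
    and sc: "\<And>t. 0 \<le> t \<Longrightarrow> t \<le> b \<Longrightarrow> \<bar>s' t\<bar> \<le> 2 * s t powr (3/2)"
    and b: "0 \<le> b" and r: "r = sqrt (s 0)"
  shows "r * b < 1 \<Longrightarrow> s b \<le> (r / (1 - r * b))\<^sup>2" "(r / (1 + r * b))\<^sup>2 \<le> s b"
proof -
  have s0: "0 \<le> s 0" "0 \<le> s b" using nn b by auto
  have r0: "0 \<le> r" "r\<^sup>2 = s 0" using r s0 by auto
  have lip: "\<bar>1 / sqrt (s b + (\<rho>\<^sup>2 - s 0)) - 1 / \<rho>\<bar> \<le> b" if \<rho>: "r < \<rho>" for \<rho>
  proof -
    have "s 0 < \<rho>\<^sup>2" using \<rho> r0 by (metis power_strict_mono zero_less_numeral)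
    then show ?thesis
      using self_concordant_lipschitz[OF der nn sc b, of "\<rho>\<^sup>2 - s 0"] \<rho> r0 by simp
  qed
  show "s b \<le> (r / (1 - r * b))\<^sup>2" if rb: "r * b < 1"
  proof (rule tendsto_lowerbound)
    show "((\<lambda>\<rho>. (\<rho> / (1 - \<rho> * b))\<^sup>2) \<longlongrightarrow> (r / (1 - r * b))\<^sup>2) (at_right r)"
      using rb by (intro tendsto_intros) auto
    have "((\<lambda>\<rho>. \<rho> * b) \<longlongrightarrow> r * b) (at_right r)" by (intro tendsto_intros)
    then have "eventually (\<lambda>\<rho>. \<rho> * b < 1) (at_right r)" using rb by (rule order_tendstoD(2))
    moreover have "eventually (\<lambda>\<rho>. r < \<rho>) (at_right r)" by (rule eventually_at_right_less)
    ultimately show "eventually (\<lambda>\<rho>. s b \<le> (\<rho> / (1 - \<rho> * b))\<^sup>2) (at_right r)"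
    proof eventually_elim
      case (elim \<rho>)
      have p: "0 < \<rho>" using elim r0 by linarith
      have e: "0 < \<rho>\<^sup>2 - s 0" using elim(2) r0 by (metis diff_gt_0_iff_gt power_strict_mono zero_less_numeral)
      define S where "S = sqrt (s b + (\<rho>\<^sup>2 - s 0))"
      have S: "0 < S" "S\<^sup>2 = s b + (\<rho>\<^sup>2 - s 0)" unfolding S_def using s0 e by auto
      have "1 / \<rho> - b \<le> 1 / S" using lip[OF elim(2)] unfolding S_def by linarith
      then have "(1 - \<rho> * b) / \<rho> \<le> 1 / S" using p by (simp add: diff_divide_distrib)
      then have "S \<le> \<rho> / (1 - \<rho> * b)" using p S elim(1) by (simp add: field_simps)
      then have "S\<^sup>2 \<le> (\<rho> / (1 - \<rho> * b))\<^sup>2" using S by (intro power_mono) auto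
      then show ?case using S(2) e by linarith
    qed
  qed simp
  show "(r / (1 + r * b))\<^sup>2 \<le> s b"
  proof (rule tendsto_upperbound)
    have nz: "1 + r * b \<noteq> 0" using r0 b by (metis add_nonneg_eq_0_iff mult_nonneg_nonneg zero_le_one zero_neq_one)
    then have "((\<lambda>\<rho>. (\<rho> / (1 + \<rho> * b))\<^sup>2 - (\<rho>\<^sup>2 - s 0)) \<longlongrightarrow> (r / (1 + r * b))\<^sup>2 - (r\<^sup>2 - s 0)) (at_right r)"
      by (intro tendsto_intros)
    then show "((\<lambda>\<rho>. (\<rho> / (1 + \<rho> * b))\<^sup>2 - (\<rho>\<^sup>2 - s 0)) \<longlongrightarrow> (r / (1 + r * b))\<^sup>2) (at_right r)" using r0 by simp
    have "eventually (\<lambda>\<rho>. r < \<rho>) (at_right r)" by (rule eventually_at_right_less)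
    then show "eventually (\<lambda>\<rho>. (\<rho> / (1 + \<rho> * b))\<^sup>2 - (\<rho>\<^sup>2 - s 0) \<le> s b) (at_right r)"
    proof eventually_elim
      case (elim \<rho>)
      have p: "0 < \<rho>" using elim r0 by linarith
      have e: "0 < \<rho>\<^sup>2 - s 0" using elim r0 by (metis diff_gt_0_iff_gt power_strict_mono zero_less_numeral)
      define S where "S = sqrt (s b + (\<rho>\<^sup>2 - s 0))"
      have S: "0 < S" "S\<^sup>2 = s b + (\<rho>\<^sup>2 - s 0)" unfolding S_def using s0 e by auto
      have pb: "0 < 1 + \<rho> * b" using p b by (simp add: add_pos_nonneg)
      have "1 / S \<le> 1 / \<rho> + b" using lip[OF elim] unfolding S_def by linarith
      then have "1 / S \<le> (1 + \<rho> * b) / \<rho>" using p by (simp add: add_divide_distrib)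
      then have "\<rho> / (1 + \<rho> * b) \<le> S" using p S pb by (simp add: field_simps)
      then have "(\<rho> / (1 + \<rho> * b))\<^sup>2 \<le> S\<^sup>2" using p pb by (intro power_mono) auto
      then show ?case using S(2) by linarith
    qed
  qed simp
qed

lemma log_remainder_bound:
  fixes r :: real
  assumes "0 \<le> r" "r < 1"
  shows "- r - ln (1 - r) \<le> r\<^sup>2 / 2 + r ^ 3 / (3 * (1 - r))"
proof -
  define h where "h t = t\<^sup>2 / 2 + t ^ 3 / (3 * (1 - t)) + t + ln (1 - t)" for t :: real
  have "h 0 \<le> h r"
  proof (rule DERIV_nonneg_unit[OF _ _ assms(1)])
    fix t :: real assume "0 \<le> t" "t \<le> r"
    then have t: "0 \<le> t" "t < 1" using assms by auto
    show "(h has_real_derivative t ^ 3 / (3 * (1 - t)\<^sup>2)) (at t)"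
    proof -
      have "(h has_real_derivative (t + (3 * t\<^sup>2 * (3 * (1 - t)) - t ^ 3 * (3 * (0 - 1))) / ((3 * (1 - t)) * (3 * (1 - t))) + 1 + (1 / (1 - t)) * (0 - 1))) (at t)"
        unfolding h_def[abs_def] using t
        by (auto intro!: derivative_eq_intros simp: numeral_3_eq_3 power2_eq_square)
      moreover have "t + (3 * t\<^sup>2 * (3 * (1 - t)) - t ^ 3 * (3 * (0 - 1))) / ((3 * (1 - t)) * (3 * (1 - t))) + 1 + (1 / (1 - t)) * (0 - 1) = t ^ 3 / (3 * (1 - t)\<^sup>2)"
      proof -
        define c where "c = 1 - t"
        have c: "c \<noteq> 0" "t = 1 - c" using t by (auto simp: c_def)
        show ?thesis unfolding c_def[symmetric] using c(1) unfolding c(2)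
          by (simp add: field_simps power2_eq_square power3_eq_cube)
      qed
      ultimately show ?thesis by simp
    qed
    show "0 \<le> t ^ 3 / (3 * (1 - t)\<^sup>2)" using t by simp
  qed
  then show ?thesis by (simp add: h_def)
qed

locale lhsc =
  fixes \<nu> :: real and K :: "(real^'n) set" and B :: "real^'n \<Rightarrow> real"
  assumes K: "closed K" "convex K" "cone K" "pointed K"
    and barrier: "LHSC_barrier \<nu> K B"
begin

abbreviation "I \<equiv> interior K"

lemma nu_ge_1: "1 \<le> \<nu>" using barrier by (simp add: LHSC_barrier_def)

lemma convex_interior_cone: "convex I" using K by (simp add: convex_interior)

lemma smooth: "C_k_on 3 I B" using barrier by (simp add: LHSC_barrier_def)

sublocale B: C2_function B I
  using C_k_on_Suc_imp[of 2 I B] smooth by unfold_locales (auto simp: numeral_2_eq_2 numeral_3_eq_3)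

lemma partial_C2: "C2_function (\<lambda>x. frechet_derivative B (at x) v) I"
  using smooth by unfold_locales (auto simp: numeral_3_eq_3 numeral_2_eq_2)

definition third :: "real^'n \<Rightarrow> real^'n \<Rightarrow> real^'n \<Rightarrow> real^'n \<Rightarrow> real" where
  "third x u v w = frechet_derivative (\<lambda>y. v \<bullet> (hess B y *v w)) (at x) u"

lemma hess_entry_differentiable:
  assumes x: "x \<in> I"
  shows "(\<lambda>y. v \<bullet> (hess B y *v w)) differentiable (at x)"
proof -
  interpret P: C2_function "\<lambda>x. frechet_derivative B (at x) v" I by (rule partial_C2)
  have "((\<lambda>y. frechet_derivative (\<lambda>x. frechet_derivative B (at x) v) (at y) w) has_derivative
      frechet_derivative (\<lambda>y. frechet_derivative (\<lambda>x. frechet_derivative B (at x) v) (at y) w) (at x)) (at x)"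
    using P.differentiable_partial[OF x] by (simp add: frechet_derivative_works)
  then have "((\<lambda>y. v \<bullet> (hess B y *v w)) has_derivative
      frechet_derivative (\<lambda>y. frechet_derivative (\<lambda>x. frechet_derivative B (at x) v) (at y) w) (at x)) (at x)"
    by (rule has_derivative_transform_within_open[OF _ open_interior x]) (simp add: B.hess_dot)
  then show ?thesis by (rule differentiableI)
qed

lemma third_linear: "x \<in> I \<Longrightarrow> linear (\<lambda>u. third x u v w)"
  unfolding third_def by (rule linear_frechet_derivative[OF hess_entry_differentiable])

lemma third_swap_right: assumes x: "x \<in> I" shows "third x u v w = third x u w v"
proof -
  have "v \<bullet> (hess B y *v w) = w \<bullet> (hess B y *v v)" if "y \<in> I" for y
    using symmetric_matrix_dot[OF B.hess_symmetric[OF that], of w v] by (metis inner_commute)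
  then show ?thesis
    unfolding third_def
    using frechet_derivative_transform_within_open[OF hess_entry_differentiable[OF x] open_interior x]
    by metis
qed

lemma third_swap_left:
  assumes x: "x \<in> I"
  shows "third x u v w = third x v u w"
proof -
  interpret P: C2_function "\<lambda>x. frechet_derivative B (at x) w" I by (rule partial_C2)
  have e: "third x u v w = frechet_derivative (\<lambda>y. frechet_derivative (\<lambda>x. frechet_derivative B (at x) w) (at y) v) (at x) u"
    for u v
  proof -
    have "frechet_derivative (\<lambda>y. w \<bullet> (hess B y *v v)) (at x) =
      frechet_derivative (\<lambda>y. frechet_derivative (\<lambda>x. frechet_derivative B (at x) w) (at y) v) (at x)"
      by (rule frechet_derivative_transform_within_open[OF hess_entry_differentiable[OF x] open_interior x])
        (simp add: B.hess_dot)
    then show ?thesis using third_swap_right[OF x, of u v w] by (simp add: third_def)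
  qed
  show ?thesis unfolding e by (rule mixed_derivatives_commute[OF open_interior x P.C2])
qed

lemma DERIV_hess_line:
  assumes "x + t *\<^sub>R u \<in> I"
  shows "((\<lambda>t. v \<bullet> (hess B (x + t *\<^sub>R u) *v w)) has_real_derivative third (x + t *\<^sub>R u) u v w) (at t)"
  unfolding third_def by (rule DERIV_frechet_line[OF hess_entry_differentiable[OF assms]])

lemma line_open: "open {t. x + t *\<^sub>R u \<in> I}"
proof -
  have "open ((\<lambda>t. x + t *\<^sub>R u) -` I)"
    by (intro open_vimage open_interior continuous_intros)
  then show ?thesis by (simp add: vimage_def)
qed

lemma self_concordant_diagonal:
  assumes x: "x \<in> I"
  shows "\<bar>third x u u u\<bar> \<le> 2 * (u \<bullet> (hess B x *v u)) powr (3/2)"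
proof -
  define \<phi> where "\<phi> t = B (x + t *\<^sub>R u)" for t
  define N where "N = {t. x + t *\<^sub>R u \<in> I}"
  have N: "open N" "0 \<in> N" unfolding N_def using line_open x by auto
  have d1: "deriv \<phi> t = grad B (x + t *\<^sub>R u) \<bullet> u" if "t \<in> N" for t
    using B.DERIV_line[of x t u] that unfolding N_def \<phi>_def[abs_def] by (auto intro: DERIV_imp_deriv)
  have d2: "deriv (deriv \<phi>) t = u \<bullet> (hess B (x + t *\<^sub>R u) *v u)" if t: "t \<in> N" for t
  proof (rule DERIV_imp_deriv)
    have "((\<lambda>t. grad B (x + t *\<^sub>R u) \<bullet> u) has_real_derivative u \<bullet> (hess B (x + t *\<^sub>R u) *v u)) (at t)"
      using B.DERIV_grad_line[of x t u u] t unfolding N_def by simp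
    then show "(deriv \<phi> has_real_derivative u \<bullet> (hess B (x + t *\<^sub>R u) *v u)) (at t)"
      by (rule has_field_derivative_transform_within_open[OF _ N(1) t]) (simp add: d1)
  qed
  have "(deriv (deriv \<phi>) has_real_derivative third (x + 0 *\<^sub>R u) u u u) (at 0)"
    by (rule has_field_derivative_transform_within_open[OF DERIV_hess_line N]) (use x d2 in auto)
  then have d3: "deriv (deriv (deriv \<phi>)) 0 = third x u u u" using DERIV_imp_deriv by fastforce
  have "\<bar>(deriv ^^ 3) \<phi> 0\<bar> \<le> 2 * ((deriv ^^ 2) \<phi> 0) powr (3/2)"
    using barrier x unfolding LHSC_barrier_def \<phi>_def[abs_def] Let_def by blast
  then show ?thesis using d2[OF N(2)] d3 by (simp add: numeral_3_eq_3 numeral_2_eq_2)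
qed

lemma above_tangent:
  assumes x: "x \<in> I" and y: "y \<in> I"
  shows "grad B x \<bullet> (y - x) \<le> B y - B x"
proof -
  define \<phi> where "\<phi> t = B (x + t *\<^sub>R (y - x))" for t
  define N where "N = {t. x + t *\<^sub>R (y - x) \<in> I}"
  have comb: "x + (c * a + (1 - c) * b) *\<^sub>R (y - x) = c *\<^sub>R (x + a *\<^sub>R (y - x)) + (1 - c) *\<^sub>R (x + b *\<^sub>R (y - x))"
    for a b c :: real by (simp add: algebra_simps)
  have cB: "convex_on I B" using barrier by (simp add: LHSC_barrier_def)
  have cI: "c *\<^sub>R p + (1 - c) *\<^sub>R q \<in> I" if "p \<in> I" "q \<in> I" "0 \<le> c" "c \<le> 1" for p q c
    using convexD[OF convex_interior_cone that(1,2), of c "1 - c"] that by simp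
  have cN: "convex N"
    unfolding convex_alt N_def
  proof (intro ballI allI impI, goal_cases)
    case (1 a b c)
    then show ?case using cI[of "x + b *\<^sub>R (y - x)" "x + a *\<^sub>R (y - x)" c] comb[of c b a]
      by (simp add: add.commute)
  qed
  have "\<phi> (c *\<^sub>R a + (1 - c) *\<^sub>R b) \<le> c * \<phi> a + (1 - c) * \<phi> b"
    if "a \<in> N" "b \<in> N" "0 \<le> c" "c \<le> 1" for a b c
    using cB that unfolding convex_on_alt \<phi>_def N_def by (simp add: comb)
  then have "convex_on N \<phi>" unfolding convex_on_alt using cN by blast
  moreover have "0 \<in> interior N" "1 \<in> N"
    using x y line_open[of x "y - x"] by (auto simp: N_def interior_open)
  moreover have "connected N" using cN by (rule convex_connected)
  moreover have "(\<phi> has_real_derivative grad B x \<bullet> (y - x)) (at 0 within N)"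
    using B.DERIV_line[of x 0 "y - x"] x unfolding \<phi>_def[abs_def] by (auto intro: has_field_derivative_at_within)
  ultimately have "\<phi> 1 - \<phi> 0 \<ge> grad B x \<bullet> (y - x) * (1 - 0)"
    by (intro convex_on_imp_above_tangent)
  then show ?thesis by (simp add: \<phi>_def)
qed

lemma hess_nonneg:
  assumes x: "x \<in> I"
  shows "0 \<le> u \<bullet> (hess B x *v u)"
proof (rule ccontr)
  assume "\<not> ?thesis"
  then have neg: "u \<bullet> (hess B x *v u) < 0" by simp
  have der: "((\<lambda>t. grad B (x + t *\<^sub>R u) \<bullet> u) has_real_derivative u \<bullet> (hess B x *v u)) (at 0)"
    using B.DERIV_grad_line[of x 0 u u] x by simp
  obtain d where d: "0 < d" "\<And>h. 0 < h \<Longrightarrow> h < d \<Longrightarrow> grad B (x + h *\<^sub>R u) \<bullet> u < grad B x \<bullet> u"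
    using DERIV_neg_dec_right[OF der neg] by auto
  obtain e where e: "0 < e" "\<And>t. \<bar>t\<bar> < e \<Longrightarrow> x + t *\<^sub>R u \<in> I"
  proof -
    have "0 \<in> {t. x + t *\<^sub>R u \<in> I}" using x by simp
    then obtain e where "0 < e" "ball 0 e \<subseteq> {t. x + t *\<^sub>R u \<in> I}" using openE[OF line_open] by blast
    then show ?thesis using that[of e] by (auto simp: dist_real_def subset_iff)
  qed
  define h where "h = min d e / 2"
  have h: "0 < h" "h < d" "h < e" unfolding h_def using d e by auto
  have y: "x + h *\<^sub>R u \<in> I" using e(2)[of h] h by simp
  have "grad B x \<bullet> (h *\<^sub>R u) \<le> B (x + h *\<^sub>R u) - B x" using above_tangent[OF x y] by simp
  moreover have "grad B (x + h *\<^sub>R u) \<bullet> (- (h *\<^sub>R u)) \<le> B x - B (x + h *\<^sub>R u)"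
    using above_tangent[OF y x] by (simp del: inner_minus_right)
  ultimately have "h * (grad B x \<bullet> u) \<le> h * (grad B (x + h *\<^sub>R u) \<bullet> u)" by simp
  then show False using d(2)[OF h(1,2)] h(1) by (simp add: mult_le_cancel_left)
qed

text \<open>At the first exit point, which lies on the frontier of the cone, the barrier would have to tend to infinity. In
  \<open>bd\<close> the bound may be derived under the hypothesis that the segment up to that point is inside.\<close>

lemma barrier_bounded_stays:
  assumes x: "x \<in> I" and bd: "\<And>t. 0 \<le> t \<Longrightarrow> t \<le> b \<Longrightarrow> (\<And>s. 0 \<le> s \<Longrightarrow> s \<le> t \<Longrightarrow> x + s *\<^sub>R u \<in> I) \<Longrightarrow> B (x + t *\<^sub>R u) \<le> C"
    and t: "0 \<le> t" "t \<le> b"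
  shows "x + t *\<^sub>R u \<in> I"
proof (rule ccontr)
  assume out: "x + t *\<^sub>R u \<notin> I"
  define Z where "Z = {0..b} \<inter> - {t. x + t *\<^sub>R u \<in> I}"
  have "compact Z" unfolding Z_def using line_open by (intro compact_Int_closed) auto
  moreover have "Z \<noteq> {}" using out t unfolding Z_def by auto
  ultimately obtain T where T: "T \<in> Z" "\<And>s. s \<in> Z \<Longrightarrow> T \<le> s" using compact_attains_inf by metis
  define y where "y = x + T *\<^sub>R u"
  have T0: "0 < T" using T(1) x unfolding Z_def by (cases "T = 0") auto
  have before: "x + s *\<^sub>R u \<in> I" if "0 \<le> s" "s < T" for s
    using that T unfolding Z_def by force
  have lim: "((\<lambda>s. x + s *\<^sub>R u) \<longlongrightarrow> y) (at_left T)" unfolding y_def by (intro tendsto_intros)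
  have ev: "eventually (\<lambda>s. 0 < s \<and> s < T) (at_left T)"
    using eventually_at_left_real[OF T0] by eventually_elim auto
  have evI: "eventually (\<lambda>s. x + s *\<^sub>R u \<in> I) (at_left T)" using ev by eventually_elim (use before in auto)
  have "y \<notin> I" using T(1) unfolding Z_def y_def by auto
  moreover have "y \<in> closure K"
  proof -
    have "eventually (\<lambda>s. x + s *\<^sub>R u \<in> K) (at_left T)" using evI by eventually_elim (use interior_subset in blast)
    then show ?thesis
      using Lim_in_closed_set[OF K(1) _ _ lim] K(1) by (simp add: closure_closed)
  qed
  ultimately have "y \<in> frontier K" by (simp add: frontier_def)
  then have "filterlim B at_top (at y within I)" using barrier by (simp add: LHSC_barrier_def)
  moreover have "filterlim (\<lambda>s. x + s *\<^sub>R u) (at y within I) (at_left T)"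
    unfolding filterlim_at using lim evI \<open>y \<notin> I\<close> by (auto elim: eventually_mono)
  ultimately have "filterlim (\<lambda>s. B (x + s *\<^sub>R u)) at_top (at_left T)" by (rule filterlim_compose)
  then have "eventually (\<lambda>s. C < B (x + s *\<^sub>R u)) (at_left T)" by (simp add: filterlim_at_top_dense)
  moreover have "eventually (\<lambda>s. B (x + s *\<^sub>R u) \<le> C) (at_left T)"
    using ev
  proof eventually_elim
    case (elim s)
    show ?case
    proof (rule bd)
      show "s \<le> b" using elim T(1) unfolding Z_def by auto
    qed (use elim before in auto)
  qed
  ultimately have "eventually (\<lambda>s. False) (at_left T)" by eventually_elim simp
  then show False by simp
qed

lemma line_growth:
  assumes line: "\<And>s. 0 \<le> s \<Longrightarrow> s \<le> t \<Longrightarrow> x + s *\<^sub>R u \<in> I" and t: "0 \<le> t"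
    and r: "r = sqrt (u \<bullet> (hess B x *v u))"
  shows "r * t < 1 \<Longrightarrow> u \<bullet> (hess B (x + t *\<^sub>R u) *v u) \<le> (r / (1 - r * t))\<^sup>2"
    "(r / (1 + r * t))\<^sup>2 \<le> u \<bullet> (hess B (x + t *\<^sub>R u) *v u)"
proof -
  define m where "m s = u \<bullet> (hess B (x + s *\<^sub>R u) *v u)" for s
  have r': "r = sqrt (m 0)" using r by (simp add: m_def)
  have der: "(m has_real_derivative third (x + s *\<^sub>R u) u u u) (at s)" if "0 \<le> s" "s \<le> t" for s
    unfolding m_def[abs_def] by (rule DERIV_hess_line[OF line[OF that]])
  have nn: "0 \<le> m s" if "0 \<le> s" "s \<le> t" for s unfolding m_def by (rule hess_nonneg[OF line[OF that]])
  have sc: "\<bar>third (x + s *\<^sub>R u) u u u\<bar> \<le> 2 * m s powr (3/2)" if "0 \<le> s" "s \<le> t" for s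
    unfolding m_def by (rule self_concordant_diagonal[OF line[OF that]])
  note g = self_concordant_growth[OF der nn sc t r']
  show "r * t < 1 \<Longrightarrow> u \<bullet> (hess B (x + t *\<^sub>R u) *v u) \<le> (r / (1 - r * t))\<^sup>2"
    "(r / (1 + r * t))\<^sup>2 \<le> u \<bullet> (hess B (x + t *\<^sub>R u) *v u)"
    using g unfolding m_def by blast+
qed

text \<open>The upper bound of \<open>line_growth\<close>, integrated twice.\<close>

lemma line_upper:
  assumes line: "\<And>s. 0 \<le> s \<Longrightarrow> s \<le> t \<Longrightarrow> x + s *\<^sub>R u \<in> I" and t: "0 \<le> t"
    and r: "r = sqrt (u \<bullet> (hess B x *v u))" "r * t < 1"
  shows "B (x + t *\<^sub>R u) \<le> B x + t * (grad B x \<bullet> u) - r * t - ln (1 - r * t)"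
proof -
  have r0: "0 \<le> r" using r(1) hess_nonneg line[of 0] t by simp
  have rs: "r * s < 1" if "0 \<le> s" "s \<le> t" for s
    using r(2) mult_left_mono[OF that(2) r0] by linarith
  have gr: "grad B (x + s *\<^sub>R u) \<bullet> u \<le> grad B x \<bullet> u + r / (1 - r * s) - r" if s: "0 \<le> s" "s \<le> t" for s
  proof -
    have "(\<lambda>s. r / (1 - r * s) - grad B (x + s *\<^sub>R u) \<bullet> u) 0 \<le> (\<lambda>s. r / (1 - r * s) - grad B (x + s *\<^sub>R u) \<bullet> u) s"
    proof (rule DERIV_nonneg_unit[OF _ _ s(1)])
      fix q assume q: "0 \<le> q" "q \<le> s"
      then have q': "0 \<le> q" "q \<le> t" using s by auto
      have nz: "1 - r * q \<noteq> 0" using rs[OF q'] by simp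
      have "((\<lambda>s. r / (1 - r * s)) has_real_derivative (r / (1 - r * q))\<^sup>2) (at q)"
        using nz by (auto intro!: derivative_eq_intros simp: power2_eq_square)
      moreover have "((\<lambda>s. grad B (x + s *\<^sub>R u) \<bullet> u) has_real_derivative u \<bullet> (hess B (x + q *\<^sub>R u) *v u)) (at q)"
        by (rule B.DERIV_grad_line[OF line[OF q']])
      ultimately show "((\<lambda>s. r / (1 - r * s) - grad B (x + s *\<^sub>R u) \<bullet> u) has_real_derivative
          (r / (1 - r * q))\<^sup>2 - u \<bullet> (hess B (x + q *\<^sub>R u) *v u)) (at q)" by (rule DERIV_diff)
      show "0 \<le> (r / (1 - r * q))\<^sup>2 - u \<bullet> (hess B (x + q *\<^sub>R u) *v u)"
        using line_growth(1)[OF line q'(1) r(1) rs[OF q']] q' by auto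
    qed
    then show ?thesis by simp
  qed
  have "(\<lambda>s. s * (grad B x \<bullet> u) - r * s - ln (1 - r * s) - B (x + s *\<^sub>R u)) 0 \<le>
    (\<lambda>s. s * (grad B x \<bullet> u) - r * s - ln (1 - r * s) - B (x + s *\<^sub>R u)) t"
  proof (rule DERIV_nonneg_unit[OF _ _ t])
    fix s assume s: "0 \<le> s" "s \<le> t"
    show "((\<lambda>s. s * (grad B x \<bullet> u) - r * s - ln (1 - r * s) - B (x + s *\<^sub>R u)) has_real_derivative
        (grad B x \<bullet> u) - r + r / (1 - r * s) - grad B (x + s *\<^sub>R u) \<bullet> u) (at s)"
      using rs[OF s] by (auto intro!: derivative_eq_intros B.DERIV_line line s)
    show "0 \<le> (grad B x \<bullet> u) - r + r / (1 - r * s) - grad B (x + s *\<^sub>R u) \<bullet> u" using gr[OF s] by simp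
  qed
  then show ?thesis by simp
qed

text \<open>By \<open>line_upper\<close> the barrier is bounded on the segment as long as that segment is inside the cone.\<close>

lemma stays_of_small_norm:
  assumes x: "x \<in> I" and r: "r = sqrt (u \<bullet> (hess B x *v u))" "r * b < 1" and t: "0 \<le> t" "t \<le> b"
  shows "x + t *\<^sub>R u \<in> I"
proof (rule barrier_bounded_stays[OF x _ t])
  fix t assume t: "0 \<le> t" "t \<le> b" and line: "\<And>s. 0 \<le> s \<Longrightarrow> s \<le> t \<Longrightarrow> x + s *\<^sub>R u \<in> I"
  have r0: "0 \<le> r" using r(1) hess_nonneg[OF x] by simp
  have rt: "r * t \<le> r * b" using mult_left_mono[OF t(2) r0] .
  have "B (x + t *\<^sub>R u) \<le> B x + t * (grad B x \<bullet> u) - r * t - ln (1 - r * t)"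
    by (rule line_upper[OF line t(1) r(1)]) (use rt r(2) in auto)
  also have "\<dots> \<le> B x + b * \<bar>grad B x \<bullet> u\<bar> - 0 - ln (1 - r * b)"
  proof (intro diff_mono add_mono order.refl)
    have "t * (grad B x \<bullet> u) \<le> t * \<bar>grad B x \<bullet> u\<bar>" using t by (intro mult_left_mono) auto
    also have "\<dots> \<le> b * \<bar>grad B x \<bullet> u\<bar>" using t by (intro mult_right_mono) auto
    finally show "t * (grad B x \<bullet> u) \<le> b * \<bar>grad B x \<bullet> u\<bar>" .
    show "ln (1 - r * b) \<le> ln (1 - r * t)" using rt r(2) by simp
  qed (use r0 t in simp)
  finally show "B (x + t *\<^sub>R u) \<le> B x + b * \<bar>grad B x \<bullet> u\<bar> - 0 - ln (1 - r * b)" .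
qed

text \<open>A direction in which the Hessian degenerates has local norm \<open>0\<close>. The whole line in that direction then stays in the
  cone, so that the direction and its negative belong to the cone.\<close>

lemma hess_pos_def:
  assumes x: "x \<in> I"
  shows "pos_def (hess B x)"
proof -
  have "u = 0" if z: "u \<bullet> (hess B x *v u) = 0" for u
  proof -
    (* The directions v of the rays that stay in K are limits of the points (x + t v) / t of K. *)
    have inK: "v \<in> K" if v: "v \<bullet> (hess B x *v v) = 0" for v
    proof -
      have ray: "x + t *\<^sub>R v \<in> K" if "0 \<le> t" for t
        using stays_of_small_norm[OF x refl, of v t t] v that interior_subset by auto
      have "((\<lambda>t::real. inverse t *\<^sub>R x + v) \<longlongrightarrow> 0 *\<^sub>R x + v) at_top"
        by (intro tendsto_intros tendsto_inverse_0_at_top filterlim_ident)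
      moreover have "eventually (\<lambda>t::real. inverse t *\<^sub>R x + v \<in> K) at_top"
        using eventually_gt_at_top[of 0]
      proof eventually_elim
        case (elim t)
        have "inverse t *\<^sub>R (x + t *\<^sub>R v) \<in> K"
          using K(3) ray[of t] elim unfolding cone_def by simp
        then show ?case using elim by (simp add: scaleR_add_right)
      qed
      ultimately show ?thesis using Lim_in_closed_set[OF K(1)] by fastforce
    qed
    have "u \<in> K" "- u \<in> K" using inK[of u] inK[of "- u"] z by (auto simp: matrix_vector_mult_minus)
    then have "u \<in> K \<inter> uminus ` K" by (auto intro: rev_image_eqI)
    then show ?thesis using K(4) unfolding pointed_def by auto
  qed
  then show ?thesis unfolding pos_def_def
    using B.hess_symmetric[OF x] hess_nonneg[OF x] by (metis less_eq_real_def)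
qed

abbreviation lnorm :: "real^'n \<Rightarrow> real^'n \<Rightarrow> real" where "lnorm x \<equiv> form_norm (hess B x)"
abbreviation dnorm :: "real^'n \<Rightarrow> real^'n \<Rightarrow> real" where "dnorm x \<equiv> form_norm (matrix_inv (hess B x))"

lemma local_norms: "local_norm B x v = lnorm x v" "local_dual_norm B x v = dnorm x v"
  by (simp_all add: local_norm_def local_dual_norm_def form_norm_def)

text \<open>In coordinates in which the Hessian is the identity, the third derivative is a symmetric trilinear form, and
  self-concordance bounds it by \<open>2\<close> on the diagonal.\<close>

lemma third_bound:
  assumes x: "x \<in> I"
  shows "\<bar>third x u v v\<bar> \<le> 2 * (lnorm x v)\<^sup>2 * lnorm x u"
proof -
  note pd = hess_pos_def[OF x]
  obtain G :: "real^'n^'n" where G: "G ** transpose G = matrix_inv (hess B x)"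
    using pos_def_factor_exists[OF pd] .
  note F = form_norm_factor[OF pd G]
  define T where "T a b c = third x (G *v a) (G *v b) (G *v c)" for a b c
  define a where "a w = transpose G *v (hess B x *v w)" for w
  have Ga: "G *v a w = w" "norm (a w) = lnorm x w" for w
    using F(1)[of "a w"] F(3)[of w] by (simp_all add: a_def)
  have "\<bar>T (a v) (a v) (a u)\<bar> \<le> 2 * (norm (a v))\<^sup>2 * norm (a u)"
  proof (rule symmetric_trilinear_diagonal[where T = T])
    show "linear (\<lambda>u. T u v w)" for v w
      unfolding T_def using linear_compose[OF matrix_vector_mul_linear third_linear[OF x]] by (simp add: o_def)
    show "T u v w = T v u w" "T u v w = T u w v" for u v w
      unfolding T_def by (rule third_swap_left[OF x], rule third_swap_right[OF x])
    show "\<bar>T u u u\<bar> \<le> 2 * norm u ^ 3" for u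
    proof -
      have "\<bar>T u u u\<bar> \<le> 2 * ((G *v u) \<bullet> (hess B x *v (G *v u))) powr (3/2)"
        unfolding T_def by (rule self_concordant_diagonal[OF x])
      also have "(G *v u) \<bullet> (hess B x *v (G *v u)) = (norm u)\<^sup>2"
        using F(1)[of u] form_norm_square[OF pd, of "G *v u"] by simp
      also have "((norm u)\<^sup>2) powr (3/2) = norm u ^ 3"
      proof (cases "u = 0")
        case False
        then have "((norm u)\<^sup>2) powr (3/2) = (norm u powr 2) powr (3/2)" by (simp add: powr_numeral)
        also have "\<dots> = norm u powr (2 * (3/2))" by (rule powr_powr)
        finally show ?thesis using False by (simp add: powr_numeral)
      qed simp
      finally show ?thesis .
    qed
  qed
  moreover have "T (a v) (a v) (a u) = third x u v v"
    unfolding T_def Ga using third_swap_left[OF x] third_swap_right[OF x] by metis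
  ultimately show ?thesis by (simp add: Ga)
qed

lemma dikin:
  assumes x: "x \<in> I" and p: "lnorm x p < 1" and t: "0 \<le> t" "t \<le> 1"
  shows "x + t *\<^sub>R p \<in> I"
  using stays_of_small_norm[OF x refl, of p 1 t] p t by (simp add: form_norm_def)

lemma barrier_upper:
  assumes x: "x \<in> I" and p: "lnorm x p < 1"
  shows "B (x + p) \<le> B x + grad B x \<bullet> p + (lnorm x p)\<^sup>2 / 2 + lnorm x p ^ 3 / (3 * (1 - lnorm x p))"
proof -
  have "B (x + 1 *\<^sub>R p) \<le> B x + 1 * (grad B x \<bullet> p) - lnorm x p * 1 - ln (1 - lnorm x p * 1)"
    by (rule line_upper) (use dikin[OF x p] p in \<open>auto simp: form_norm_def\<close>)
  also have "\<dots> \<le> B x + grad B x \<bullet> p + (lnorm x p)\<^sup>2 / 2 + lnorm x p ^ 3 / (3 * (1 - lnorm x p))"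
    using log_remainder_bound[of "lnorm x p"] p form_norm_nonneg[OF hess_pos_def[OF x]] by simp
  finally show ?thesis by simp
qed

text \<open>Let \<open>m t\<close> be the Hessian form of \<open>v\<close> at \<open>x + t p\<close> and \<open>r\<close> the local norm of \<open>p\<close> at \<open>x\<close>. The logarithmic
  derivative of \<open>m\<close> is at most \<open>2 r / (1 - r t)\<close> in absolute value, so that \<open>m t / (1 - r t)\<^sup>2\<close> increases and
  \<open>m t (1 - r t)\<^sup>2\<close> decreases.\<close>

lemma hess_comparison:
  assumes x: "x \<in> I" and p: "lnorm x p < 1"
  shows "(1 - lnorm x p) * lnorm x v \<le> lnorm (x + p) v" "(1 - lnorm x p) * lnorm (x + p) v \<le> lnorm x v"
proof -
  define r where "r = lnorm x p"
  have r: "0 \<le> r" "r < 1" unfolding r_def using p form_norm_nonneg[OF hess_pos_def[OF x]] by auto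
  have seg: "x + t *\<^sub>R p \<in> I" if "0 \<le> t" "t \<le> 1" for t by (rule dikin[OF x p that])
  define m where "m t = v \<bullet> (hess B (x + t *\<^sub>R p) *v v)" for t
  define m' where "m' t = third (x + t *\<^sub>R p) p v v" for t
  have dm: "(m has_real_derivative m' t) (at t)" if "0 \<le> t" "t \<le> 1" for t
    unfolding m_def[abs_def] m'_def by (rule DERIV_hess_line[OF seg[OF that]])
  have rt: "0 < 1 - r * t" if "0 \<le> t" "t \<le> 1" for t
    using r mult_left_le[of t r] that by linarith
  have bm: "\<bar>m' t\<bar> \<le> 2 * m t * (r / (1 - r * t))" if t: "0 \<le> t" "t \<le> 1" for t
  proof -
    note pd = hess_pos_def[OF seg[OF t]]
    have "p \<bullet> (hess B (x + t *\<^sub>R p) *v p) \<le> (r / (1 - r * t))\<^sup>2"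
      by (rule line_growth(1)) (use seg t rt[OF t] in \<open>auto simp: r_def form_norm_def\<close>)
    then have "lnorm (x + t *\<^sub>R p) p \<le> r / (1 - r * t)"
      unfolding form_norm_def using r rt[OF t] by (intro real_le_lsqrt) auto
    then have "2 * m t * lnorm (x + t *\<^sub>R p) p \<le> 2 * m t * (r / (1 - r * t))"
      using hess_nonneg[OF seg[OF t], of v] unfolding m_def by (intro mult_left_mono) auto
    moreover have "\<bar>m' t\<bar> \<le> 2 * m t * lnorm (x + t *\<^sub>R p) p"
      using third_bound[OF seg[OF t], of p v] unfolding m'_def m_def form_norm_square[OF pd] .
    ultimately show ?thesis by linarith
  qed
  have "(\<lambda>t. m t / (1 - r * t)\<^sup>2) 0 \<le> (\<lambda>t. m t / (1 - r * t)\<^sup>2) 1"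
  proof (rule DERIV_nonneg_unit)
    fix t :: real assume t: "0 \<le> t" "t \<le> 1"
    have nz: "1 - r * t \<noteq> 0" using rt[OF t] by simp
    have "((\<lambda>t. m t / (1 - r * t)\<^sup>2) has_real_derivative
        (m' t * (1 - r * t)\<^sup>2 - m t * (2 * (1 - r * t) * (0 - r))) / ((1 - r * t)\<^sup>2 * (1 - r * t)\<^sup>2)) (at t)"
      using nz by (auto intro!: derivative_eq_intros dm[OF t])
    moreover have "(m' t * (1 - r * t)\<^sup>2 - m t * (2 * (1 - r * t) * (0 - r))) / ((1 - r * t)\<^sup>2 * (1 - r * t)\<^sup>2)
        = (m' t + 2 * m t * (r / (1 - r * t))) / (1 - r * t)\<^sup>2"
    proof -
      define c where "c = 1 - r * t"
      have "c \<noteq> 0" using nz by (simp add: c_def)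
      then show ?thesis unfolding c_def[symmetric] by (simp add: field_simps power2_eq_square)
    qed
    ultimately show "((\<lambda>t. m t / (1 - r * t)\<^sup>2) has_real_derivative
        (m' t + 2 * m t * (r / (1 - r * t))) / (1 - r * t)\<^sup>2) (at t)" by simp
    show "0 \<le> (m' t + 2 * m t * (r / (1 - r * t))) / (1 - r * t)\<^sup>2" using bm[OF t] by simp
  qed simp
  then have "(1 - r)\<^sup>2 * m 0 \<le> m 1" using r by (simp add: field_simps)
  then have "sqrt ((1 - r)\<^sup>2 * m 0) \<le> sqrt (m 1)" by (rule real_sqrt_le_mono)
  then show "(1 - lnorm x p) * lnorm x v \<le> lnorm (x + p) v"
    using r by (simp add: real_sqrt_mult m_def form_norm_def r_def)
  have "(\<lambda>t. - (m t * (1 - r * t)\<^sup>2)) 0 \<le> (\<lambda>t. - (m t * (1 - r * t)\<^sup>2)) 1"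
  proof (rule DERIV_nonneg_unit)
    fix t :: real assume t: "0 \<le> t" "t \<le> 1"
    have nz: "1 - r * t \<noteq> 0" using rt[OF t] by simp
    have "((\<lambda>t. - (m t * (1 - r * t)\<^sup>2)) has_real_derivative
        - (m' t * (1 - r * t)\<^sup>2 + m t * (2 * (1 - r * t) * (0 - r)))) (at t)"
      by (auto intro!: derivative_eq_intros dm[OF t])
    moreover have "- (m' t * (1 - r * t)\<^sup>2 + m t * (2 * (1 - r * t) * (0 - r)))
        = (2 * m t * (r / (1 - r * t)) - m' t) * (1 - r * t)\<^sup>2"
    proof -
      define c where "c = 1 - r * t"
      have "c \<noteq> 0" using nz by (simp add: c_def)
      then show ?thesis unfolding c_def[symmetric] by (simp add: field_simps power2_eq_square)
    qed
    ultimately show "((\<lambda>t. - (m t * (1 - r * t)\<^sup>2)) has_real_derivative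
        (2 * m t * (r / (1 - r * t)) - m' t) * (1 - r * t)\<^sup>2) (at t)" by simp
    show "0 \<le> (2 * m t * (r / (1 - r * t)) - m' t) * (1 - r * t)\<^sup>2" using bm[OF t] by simp
  qed simp
  then have "sqrt ((1 - r)\<^sup>2 * m 1) \<le> sqrt (m 0)" by (intro real_sqrt_le_mono) (simp add: mult.commute)
  then show "(1 - lnorm x p) * lnorm (x + p) v \<le> lnorm x v"
    using r by (simp add: real_sqrt_mult m_def form_norm_def r_def)
qed

lemma dual_norm_comparison:
  assumes x: "x \<in> I" and p: "lnorm x p \<le> \<beta>" "\<beta> < 1"
  shows "dnorm (x + p) v \<le> dnorm x v / (1 - \<beta>)"
proof (rule dual_norm_antimono)
  have p1: "lnorm x p < 1" using p by simp
  show "pos_def (hess B x)" by (rule hess_pos_def[OF x])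
  show "pos_def (hess B (x + p))" using hess_pos_def dikin[OF x p1, of 1] by simp
  show "0 < 1 - \<beta>" using p by simp
  show "(1 - \<beta>) * lnorm x u \<le> lnorm (x + p) u" for u
    using hess_comparison(1)[OF x p1, of u] mult_right_mono[of "1 - \<beta>" "1 - lnorm x p" "lnorm x u"] p(1)
      form_norm_nonneg[OF hess_pos_def[OF x], of u] by linarith
qed

lemma local_norm_upper_comparison:
  assumes x: "x \<in> I" and p: "lnorm x p \<le> \<beta>" "\<beta> < 1"
  shows "(1 - \<beta>) * lnorm (x + p) v \<le> lnorm x v"
proof -
  have p1: "lnorm x p < 1" using p by simp
  have "x + p \<in> I" using dikin[OF x p1, of 1] by simp
  then have "0 \<le> lnorm (x + p) v" using form_norm_nonneg[OF hess_pos_def] by blast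
  then show ?thesis
    using hess_comparison(2)[OF x p1, of v] mult_right_mono[of "1 - \<beta>" "1 - lnorm x p" "lnorm (x + p) v"] p(1)
    by linarith
qed

subsection \<open>Logarithmic homogeneity\<close>

lemma interior_scale: assumes x: "x \<in> I" and t: "0 < t" shows "t *\<^sub>R x \<in> I"
proof -
  have "open ((\<lambda>y. (1 / t) *\<^sub>R y) -` I)" by (intro open_vimage open_interior continuous_intros)
  moreover have "(\<lambda>y. (1 / t) *\<^sub>R y) -` I \<subseteq> K"
  proof
    fix y assume "y \<in> (\<lambda>y. (1 / t) *\<^sub>R y) -` I"
    then have "(1 / t) *\<^sub>R y \<in> K" using interior_subset by auto
    then have "t *\<^sub>R ((1 / t) *\<^sub>R y) \<in> K" using K(3) t unfolding cone_def by (meson less_imp_le)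
    then show "y \<in> K" using t by simp
  qed
  ultimately have "(\<lambda>y. (1 / t) *\<^sub>R y) -` I \<subseteq> I" by (rule interior_maximal[rotated])
  then show ?thesis using x t by auto
qed

lemma cone_add: "x \<in> K \<Longrightarrow> y \<in> K \<Longrightarrow> x + y \<in> K"
  using K(2,3) convex_cone by (metis convex_cone_def)

lemma interior_add_cone: assumes x: "x \<in> I" and y: "y \<in> K" shows "x + y \<in> I"
proof -
  have "open ((\<lambda>z. z - y) -` I)" by (intro open_vimage open_interior continuous_intros)
  moreover have "(\<lambda>z. z - y) -` I \<subseteq> K"
  proof
    fix z assume "z \<in> (\<lambda>z. z - y) -` I"
    then have "z - y \<in> K" using interior_subset by auto
    from cone_add[OF this y] show "z \<in> K" by simp
  qed
  ultimately have "(\<lambda>z. z - y) -` I \<subseteq> I" by (rule interior_maximal[rotated])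
  then show ?thesis using x by auto
qed

lemma log_homogeneous: "x \<in> I \<Longrightarrow> 0 < t \<Longrightarrow> B (t *\<^sub>R x) = B x - \<nu> * ln t"
  using barrier by (simp add: LHSC_barrier_def)

lemma grad_dot_self: assumes x: "x \<in> I" shows "grad B x \<bullet> x = - \<nu>"
proof -
  have "((\<lambda>t. B (x + t *\<^sub>R x)) has_real_derivative grad B x \<bullet> x) (at 0)"
    using B.DERIV_line[of x 0 x] x by simp
  moreover have "((\<lambda>t. B (x + t *\<^sub>R x)) has_real_derivative - \<nu>) (at 0)"
  proof (rule has_field_derivative_transform_within_open[where S = "{-1<..}"])
    show "((\<lambda>t. B x - \<nu> * ln (1 + t)) has_real_derivative - \<nu>) (at 0)"
      by (auto intro!: derivative_eq_intros)
    show "B x - \<nu> * ln (1 + t) = B (x + t *\<^sub>R x)" if "t \<in> {-1<..}" for t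
      using log_homogeneous[OF x, of "1 + t"] that by (simp add: scaleR_add_left)
  qed auto
  ultimately show ?thesis by (rule DERIV_unique)
qed

lemma grad_scale: assumes x: "x \<in> I" and t: "0 < t" shows "t * (grad B (t *\<^sub>R x) \<bullet> v) = grad B x \<bullet> v"
proof -
  have "((\<lambda>s. B (t *\<^sub>R x + s *\<^sub>R (t *\<^sub>R v))) has_real_derivative grad B (t *\<^sub>R x) \<bullet> (t *\<^sub>R v)) (at 0)"
    using B.DERIV_line[of "t *\<^sub>R x" 0 "t *\<^sub>R v"] interior_scale[OF x t] by simp
  moreover have "((\<lambda>s. B (t *\<^sub>R x + s *\<^sub>R (t *\<^sub>R v))) has_real_derivative grad B x \<bullet> v) (at 0)"
  proof (rule has_field_derivative_transform_within_open[OF _ line_open[of x v]])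
    show "((\<lambda>s. B (x + s *\<^sub>R v) - \<nu> * ln t) has_real_derivative grad B x \<bullet> v) (at 0)"
      using B.DERIV_line[of x 0 v] x by (auto intro!: derivative_eq_intros)
    show "B (x + s *\<^sub>R v) - \<nu> * ln t = B (t *\<^sub>R x + s *\<^sub>R (t *\<^sub>R v))" if "s \<in> {s. x + s *\<^sub>R v \<in> I}" for s
      using log_homogeneous[of "x + s *\<^sub>R v" t] that t by (simp add: scaleR_add_right mult.commute)
  qed (use x in auto)
  ultimately have "grad B (t *\<^sub>R x) \<bullet> (t *\<^sub>R v) = grad B x \<bullet> v" by (rule DERIV_unique)
  then show ?thesis by simp
qed

lemma hess_self: assumes x: "x \<in> I" shows "hess B x *v x = - grad B x"
proof -
  have "v \<bullet> (hess B x *v x) = v \<bullet> (- grad B x)" for v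
  proof -
    have "((\<lambda>t. grad B (x + t *\<^sub>R x) \<bullet> v) has_real_derivative v \<bullet> (hess B x *v x)) (at 0)"
      using B.DERIV_grad_line[of x 0 x v] x by simp
    moreover have "((\<lambda>t. grad B (x + t *\<^sub>R x) \<bullet> v) has_real_derivative - (grad B x \<bullet> v)) (at 0)"
    proof (rule has_field_derivative_transform_within_open[where S = "{-1<..}"])
      show "((\<lambda>t. (grad B x \<bullet> v) / (1 + t)) has_real_derivative - (grad B x \<bullet> v)) (at 0)"
        by (auto intro!: derivative_eq_intros)
      show "(grad B x \<bullet> v) / (1 + t) = grad B (x + t *\<^sub>R x) \<bullet> v" if "t \<in> {-1<..}" for t
        using grad_scale[OF x, of "1 + t" v] that by (simp add: scaleR_add_left field_simps)
    qed auto
    ultimately show ?thesis using DERIV_unique by (fastforce simp: inner_commute)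
  qed
  then show ?thesis by (metis vector_eq_ldot)
qed

lemma grad_dual_norm: assumes x: "x \<in> I" shows "dnorm x (grad B x) = sqrt \<nu>"
proof -
  have "matrix_inv (hess B x) *v (hess B x *v x) = x"
    using pos_def_inverse(2)[OF hess_pos_def[OF x]] by (simp add: matrix_vector_mul_assoc)
  then have "matrix_inv (hess B x) *v grad B x = - x"
    by (metis hess_self[OF x] matrix_vector_mult_minus minus_minus)
  then show ?thesis using grad_dot_self[OF x] by (simp add: form_norm_def)
qed

text \<open>Along the ray through \<open>w\<close> the barrier decreases, while its tangent at \<open>z\<close> would increase linearly.\<close>

lemma grad_nonpos_interior:
  assumes z: "z \<in> I" and w: "w \<in> I"
  shows "grad B z \<bullet> w \<le> 0"
proof (rule ccontr)
  assume neg: "\<not> ?thesis"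
  define c where "c = grad B z \<bullet> w"
  have c: "0 < c" using neg by (simp add: c_def)
  (* so far along the ray that the tangent exceeds every possible value of the barrier *)
  define s where "s = max 1 ((\<bar>B w - B z - \<nu>\<bar> + 1) / c)"
  have s: "1 \<le> s" "\<bar>B w - B z - \<nu>\<bar> + 1 \<le> s * c"
    unfolding s_def using c by (auto simp: max_def field_simps)
  have "grad B z \<bullet> (s *\<^sub>R w - z) \<le> B (s *\<^sub>R w) - B z"
    by (rule above_tangent[OF z interior_scale[OF w]]) (use s in simp)
  then have "s * c + \<nu> \<le> B w - \<nu> * ln s - B z"
    using log_homogeneous[OF w, of s] s by (simp add: inner_diff_right grad_dot_self[OF z] c_def)
  moreover have "0 \<le> \<nu> * ln s" using s nu_ge_1 by simp
  ultimately show False using s(2) nu_ge_1 by linarith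
qed

lemma grad_nonpos_cone:
  assumes z: "z \<in> I" and w: "w \<in> K"
  shows "grad B z \<bullet> w \<le> 0"
proof (rule field_le_epsilon)
  fix e :: real assume e: "0 < e"
  define d where "d = e / \<nu>"
  have d: "0 < d" "d * \<nu> = e" unfolding d_def using e nu_ge_1 by auto
  have "d *\<^sub>R z + w \<in> I" by (rule interior_add_cone[OF interior_scale[OF z d(1)] w])
  from grad_nonpos_interior[OF z this] show "grad B z \<bullet> w \<le> 0 + e"
    using d(2) by (simp add: inner_add_right grad_dot_self[OF z])
qed

text \<open>The derivative of the barrier along the ray \<open>x + t y\<close> is never positive, as the ray stays in the cone. By
  \<open>line_growth\<close> it increases from \<open>t = 0\<close> on by at least \<open>r - r / (1 + r t)\<close>, where \<open>r\<close> is the local norm of \<open>y\<close>; for large \<open>t\<close> the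
  claim follows.\<close>

lemma norm_le_grad_cone:
  assumes x: "x \<in> I" and y: "y \<in> K"
  shows "lnorm x y \<le> - (grad B x \<bullet> y)"
proof -
  define r where "r = sqrt (y \<bullet> (hess B x *v y))"
  have r0: "0 \<le> r" unfolding r_def using hess_nonneg[OF x] by simp
  have line: "x + t *\<^sub>R y \<in> I" if "0 \<le> t" for t
    using interior_add_cone[OF x, of "t *\<^sub>R y"] K(3) y that unfolding cone_def by auto
  have low: "grad B x \<bullet> y + r - r / (1 + r * t) \<le> 0" if t: "0 \<le> t" for t
  proof -
    have "(\<lambda>s. grad B (x + s *\<^sub>R y) \<bullet> y + r / (1 + r * s)) 0 \<le> (\<lambda>s. grad B (x + s *\<^sub>R y) \<bullet> y + r / (1 + r * s)) t"
    proof (rule DERIV_nonneg_unit[OF _ _ t])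
      fix s assume s: "0 \<le> s" "s \<le> t"
      have pos: "0 < 1 + r * s" using r0 s by (simp add: add_pos_nonneg)
      have "((\<lambda>s. r / (1 + r * s)) has_real_derivative - ((r / (1 + r * s))\<^sup>2)) (at s)"
        using pos by (auto intro!: derivative_eq_intros simp: power2_eq_square)
      with B.DERIV_grad_line[OF line[OF s(1)], of y]
      show "((\<lambda>s. grad B (x + s *\<^sub>R y) \<bullet> y + r / (1 + r * s)) has_real_derivative
          y \<bullet> (hess B (x + s *\<^sub>R y) *v y) + - ((r / (1 + r * s))\<^sup>2)) (at s)" by (rule DERIV_add)
      show "0 \<le> y \<bullet> (hess B (x + s *\<^sub>R y) *v y) + - ((r / (1 + r * s))\<^sup>2)"
        using line_growth(2)[OF line s(1) r_def] by simp
    qed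
    then have "grad B x \<bullet> y + r \<le> grad B (x + t *\<^sub>R y) \<bullet> y + r / (1 + r * t)" by simp
    then show ?thesis using grad_nonpos_cone[OF line[OF t] y] by linarith
  qed
  have "grad B x \<bullet> y + r \<le> 0"
  proof (rule ccontr)
    assume "\<not> ?thesis"
    then have d: "0 < grad B x \<bullet> y + r" by simp
    (* so large that r / (1 + r t) is less than the alleged positive value *)
    define t where "t = 1 / (grad B x \<bullet> y + r)"
    have t: "0 < t" unfolding t_def using d by simp
    have "r / (1 + r * t) < 1 / t" using t r0 by (simp add: field_simps add_pos_nonneg)
    then show False using low[of t] t by (simp add: t_def)
  qed
  then show ?thesis by (simp add: form_norm_def r_def)
qed

end

section \<open>Projection onto the kernel of the constraint matrix\<close>

lemma capped_bounds:
  assumes a: "0 < a" and c: "0 < c" and t: "0 \<le> t"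
  shows "0 < capped a c t" "capped a c t \<le> a" "capped a c t * t \<le> c"
    "capped a c t < a \<Longrightarrow> capped a c t * t = c"
    "\<lbrakk>e \<le> a * w; e \<le> c; t \<le> w\<rbrakk> \<Longrightarrow> e \<le> capped a c t * w"
proof -
  show "0 < capped a c t" "capped a c t \<le> a" using assms by (auto simp: capped_def)
  show "capped a c t * t \<le> c" using assms by (auto simp: capped_def min_def field_simps)
  show "capped a c t < a \<Longrightarrow> capped a c t * t = c" using assms by (auto simp: capped_def min_def split: if_splits)
  assume *: "e \<le> a * w" "e \<le> c" "t \<le> w"
  show "e \<le> capped a c t * w"
  proof (cases "t = 0 \<or> a \<le> c / t")
    case True
    then show ?thesis using * by (auto simp: capped_def min_def)
  next
    case False
    then have "capped a c t * w = c * (w / t)" by (simp add: capped_def min_def)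
    moreover have "1 \<le> w / t" using False * t by (simp add: field_simps)
    then have "c * 1 \<le> c * (w / t)" using c by (intro mult_left_mono) auto
    ultimately show ?thesis using * by simp
  qed
qed

text \<open>With \<open>G\<close> as coordinates, in which the norm of \<open>H\<close> is Euclidean, \<open>Qmat A G\<close> is the orthogonal projection onto the
  kernel of \<open>A ** G\<close>.\<close>

locale constraint_projection =
  fixes A :: "real^'n^'m" and H G :: "real^'n^'n"
  assumes surjA: "surj ((*v) A)" and pdH: "pos_def H" and GG: "G ** transpose G = matrix_inv H"
begin

abbreviation "q \<equiv> (*v) (Qmat A G)"
abbreviation "p \<equiv> (*v) (Pmat A G)"
abbreviation "W \<equiv> matrix_inv (A ** G ** transpose G ** transpose A)"

lemma normal_matrix: "pos_def (A ** G ** transpose G ** transpose A)"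
proof -
  let ?N = "A ** G ** transpose G ** transpose A"
  have N: "?N *v y = A *v (G *v (transpose G *v (transpose A *v y)))" for y
    by (simp add: matrix_vector_mul_assoc matrix_mul_assoc)
  have dot: "x \<bullet> (?N *v y) = (transpose G *v (transpose A *v x)) \<bullet> (transpose G *v (transpose A *v y))" for x y
    unfolding N by (simp add: transpose_dot)
  have "symmetric_matrix ?N"
    by (rule symmetric_matrixI) (metis dot inner_commute)
  moreover have "0 < v \<bullet> (?N *v v)" if "v \<noteq> 0" for v
  proof -
    have "transpose G *v (transpose A *v v) \<noteq> 0"
    proof
      assume z: "transpose G *v (transpose A *v v) = 0"
      obtain x where x: "A *v x = v" using surjA by (metis surjD)
      have "x = G *v (transpose G *v (H *v x))" by (simp add: form_norm_factor(3)[OF pdH GG])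
      then have "v \<bullet> v = v \<bullet> (A *v (G *v (transpose G *v (H *v x))))" using x by simp
      also have "\<dots> = (transpose G *v (transpose A *v v)) \<bullet> (transpose G *v (H *v x))"
        by (simp add: transpose_dot)
      finally show False using z that by simp
    qed
    then show ?thesis unfolding dot by simp
  qed
  ultimately show ?thesis by (simp add: pos_def_def)
qed

lemma q_apply: "q c = c - transpose G *v (transpose A *v (W *v (A *v (G *v c))))"
  by (simp add: Qmat_def matrix_vector_mult_diff_rdistrib matrix_vector_mul_assoc matrix_mul_assoc)

lemma p_apply: "p c = G *v q c"
  by (simp add: Pmat_def matrix_vector_mul_assoc)

lemma A_p [simp]: "A *v p c = 0"
proof -
  let ?z = "W *v (A *v (G *v c))"
  have "A *v p c = A *v (G *v c) - (A ** G ** transpose G ** transpose A) *v ?z"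
    unfolding p_apply q_apply
    by (simp add: matrix_vector_mult_diff_distrib matrix_vector_mul_assoc matrix_mul_assoc)
  also have "(A ** G ** transpose G ** transpose A) *v ?z = A *v (G *v c)"
    using pos_def_inverse(1)[OF normal_matrix] by (metis matrix_vector_mul_assoc matrix_vector_mul_lid)
  finally show ?thesis by simp
qed

lemma q_fixed: "A *v (G *v c) = 0 \<Longrightarrow> q c = c"
  by (simp add: q_apply)

lemma q_idem [simp]: "q (q c) = q c"
  using A_p[of c] by (intro q_fixed) (simp add: p_apply)

lemma q_symmetric: "q x \<bullet> y = x \<bullet> q y"
proof -
  have W: "symmetric_matrix W" using pos_def_inverse(3)[OF normal_matrix] by (simp add: pos_def_def)
  have "(transpose G *v (transpose A *v (W *v (A *v (G *v x))))) \<bullet> y = (A *v (G *v x)) \<bullet> (W *v (A *v (G *v y)))" for x y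
    by (simp add: transpose_dot symmetric_matrix_dot[OF W])
  then show ?thesis
    unfolding q_apply by (simp add: inner_diff_left inner_diff_right) (metis inner_commute symmetric_matrix_dot[OF W])
qed

lemma norm_q: "norm (q c) \<le> norm c"
proof -
  have "(norm (q c))\<^sup>2 = c \<bullet> q c" by (simp add: power2_norm_eq_inner q_symmetric)
  also have "\<dots> \<le> norm c * norm (q c)" by (rule norm_cauchy_schwarz)
  finally show ?thesis by (cases "q c = 0") (auto simp: power2_eq_square)
qed

lemma norm_p: "form_norm H (p c) = norm (q c)"
  by (simp add: p_apply form_norm_factor(1)[OF pdH GG])

lemma transpose_p: "transpose (Pmat A G) *v w = q (transpose G *v w)"
proof -
  have "(transpose (Pmat A G) *v w) \<bullet> y = q (transpose G *v w) \<bullet> y" for y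
    by (simp add: transpose_dot p_apply q_symmetric)
  then show ?thesis by (metis vector_eq_rdot)
qed

text \<open>\<open>Rmat A G\<close> yields the least squares multiplier: adding its contribution to \<open>w\<close> amounts to the projection of
  \<open>transpose G *v w\<close>.\<close>

lemma dual_norm_multiplier:
  "form_norm (matrix_inv H) (w + transpose A *v (Rmat A G *v w)) = norm (transpose (Pmat A G) *v w)"
proof -
  have "Rmat A G *v w = - (W *v (A *v (G *v (transpose G *v w))))"
    unfolding Rmat_def
    by (simp add: matrix_vector_mul_assoc matrix_mul_assoc) (simp add: matrix_vector_mult_def vec_eq_iff sum_negf)
  then have "transpose G *v (w + transpose A *v (Rmat A G *v w)) = q (transpose G *v w)"
    by (simp add: q_apply matrix_vector_right_distrib matrix_vector_mult_minus matrix_vector_mult_diff_distrib)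
  then show ?thesis by (simp add: form_norm_factor(2)[OF pdH GG] transpose_p)
qed

lemma reduced_form: "c \<bullet> ((transpose (Pmat A G) ** F ** Pmat A G) *v c) = p c \<bullet> (F *v p c)"
proof -
  have "(transpose (Pmat A G) ** F ** Pmat A G) *v c = transpose (Pmat A G) *v (F *v p c)"
    by (simp add: matrix_vector_mul_assoc matrix_mul_assoc)
  then show ?thesis by (metis inner_commute transpose_dot)
qed

lemma reduced_symmetric:
  assumes "symmetric_matrix F"
  shows "symmetric_matrix (transpose (Pmat A G) ** F ** Pmat A G)"
proof (rule symmetric_matrixI)
  fix x y
  have e: "(transpose (Pmat A G) ** F ** Pmat A G) *v c = transpose (Pmat A G) *v (F *v p c)" for c
    by (simp add: matrix_vector_mul_assoc matrix_mul_assoc)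
  show "((transpose (Pmat A G) ** F ** Pmat A G) *v x) \<bullet> y = x \<bullet> ((transpose (Pmat A G) ** F ** Pmat A G) *v y)"
    unfolding e transpose_dot by (metis inner_commute transpose_dot symmetric_matrix_dot[OF assms])
qed

lemma reduced_metric: "transpose (Pmat A G) *v (H *v p c) = q c"
  by (simp add: transpose_p p_apply form_norm_factor(4)[OF pdH GG])

lemma norm_transpose_p: "norm (transpose (Pmat A G) *v w) \<le> form_norm (matrix_inv H) w"
  unfolding transpose_p form_norm_factor(2)[OF pdH GG] by (rule norm_q)

end

text \<open>The supremum is finite because it is a Euclidean operator norm in suitable coordinates.\<close>

lemma dual_opnorm_bound:
  fixes H F :: "real^'n^'n"
  assumes H: "pos_def H"
  defines "N \<equiv> SUP v\<in>{v. form_norm H v \<le> 1}. form_norm (matrix_inv H) (F *v v)"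
  shows "form_norm (matrix_inv H) (F *v w) \<le> N * form_norm H w" "0 \<le> N"
proof -
  obtain G :: "real^'n^'n" where G: "G ** transpose G = matrix_inv H" using pos_def_factor_exists[OF H] .
  note FG = form_norm_factor[OF H G]
  have bdd: "bdd_above ((\<lambda>v. form_norm (matrix_inv H) (F *v v)) ` {v. form_norm H v \<le> 1})"
  proof (rule bdd_aboveI2)
    fix v assume v: "v \<in> {v. form_norm H v \<le> 1}"
    define c where "c = transpose G *v (H *v v)"
    have vc: "v = G *v c" by (simp add: c_def FG)
    have c1: "norm c \<le> 1" using v by (simp add: vc FG)
    have "form_norm (matrix_inv H) (F *v v) = norm ((transpose G ** F ** G) *v c)"
      by (simp add: FG vc matrix_vector_mul_assoc matrix_mul_assoc)
    also have "\<dots> \<le> onorm ((*v) (transpose G ** F ** G)) * norm c" by (rule onorm) simp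
    also have "\<dots> \<le> onorm ((*v) (transpose G ** F ** G)) * 1"
      using c1 by (intro mult_left_mono onorm_pos_le) auto
    finally show "form_norm (matrix_inv H) (F *v v) \<le> onorm ((*v) (transpose G ** F ** G)) * 1" .
  qed
  have up: "form_norm (matrix_inv H) (F *v v) \<le> N" if "form_norm H v \<le> 1" for v
    unfolding N_def using that by (intro cSUP_upper bdd) auto
  show "0 \<le> N" using up[of 0] by simp
  show "form_norm (matrix_inv H) (F *v w) \<le> N * form_norm H w"
  proof (cases "w = 0")
    case False
    define r where "r = form_norm H w"
    have r: "0 < r" using form_norm_nonneg[OF H, of w] form_norm_eq_0[OF H, of w] False unfolding r_def by linarith
    have "form_norm (matrix_inv H) (F *v ((1 / r) *\<^sub>R w)) \<le> N"
      using r by (intro up) (simp add: form_norm_scaleR flip: r_def)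
    then have "form_norm (matrix_inv H) (F *v w) / r \<le> N"
      using r by (simp add: matrix_vector_mult_scaleR form_norm_scaleR)
    then show ?thesis using r by (simp add: field_simps r_def)
  qed simp
qed

section \<open>Analysis of the Newton-CG barrier method\<close>

locale ncgb_convergence =
  lhsc \<nu> K B + ncgb f A B \<nu> \<epsilon> x0 \<zeta> \<beta> \<theta> \<eta> \<delta> M cgsel ritzsel
  for \<nu> :: real and K :: "(real^'n) set" and B f :: "real^'n \<Rightarrow> real" and A :: "real^'n^'m"
    and \<epsilon> :: real and x0 :: "real^'n" and \<zeta> \<beta> \<theta> \<eta> \<delta> :: real
    and M :: "nat \<Rightarrow> real^'n \<Rightarrow> real^'n^'n"
    and cgsel :: "nat \<Rightarrow> ((real^'n) \<times> dtype) set \<Rightarrow> (real^'n) \<times> dtype"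
    and ritzsel :: "nat \<Rightarrow> (real^'n) set \<Rightarrow> real^'n" +
  fixes b :: "real^'m" and D :: "(real^'n) set" and \<mu>bar \<phi>low L :: real
  assumes surjA: "surj ((*v) A)"
    and D: "open D" "strictly_feasible A b K \<subseteq> D" "C_k_on 2 D f"
    and D_near: "\<And>x. x \<in> level_union f A b K B \<mu>bar x0 \<Longrightarrow> {y. local_norm B x (y - x) \<le> \<beta>} \<subseteq> D"
    and eps: "0 < \<epsilon>" "\<epsilon> < 1" and x0: "x0 \<in> strictly_feasible A b K"
    and zeta: "0 < \<zeta>" "\<zeta> < 1" and beta: "sqrt \<epsilon> \<le> \<beta>" "\<beta> < 1"
    and theta: "0 < \<theta>" "\<theta> < 1" and eta: "0 < \<eta>" "\<eta> < 1" and delta: "0 < \<delta>" "\<delta> < 1"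
    and mubar: "ncgb_mu \<epsilon> \<beta> \<nu> \<le> \<mu>bar"
    and lower: "\<And>\<mu> x. 0 < \<mu> \<Longrightarrow> \<mu> \<le> \<mu>bar \<Longrightarrow> x \<in> strictly_feasible A b K \<Longrightarrow> \<phi>low \<le> barrier_fun f B \<mu> x"
    and L: "0 < L"
    and hess_lipschitz: "\<And>x y. x \<in> level_union f A b K B \<mu>bar x0 \<Longrightarrow> local_norm B x (y - x) \<le> \<beta> \<Longrightarrow>
           local_dual_opnorm B x (hess f y - hess f x) \<le> L * local_norm B x (x - y)"
    and hess_bounded: "bdd_above ((\<lambda>x. local_dual_opnorm B x (hess f x)) ` level_union f A b K B \<mu>bar x0)"
    and factor: "\<And>k x. x \<in> interior K \<Longrightarrow> M k x ** transpose (M k x) = matrix_inv (hess B x)"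
    and cgsel: "\<And>k X. X \<noteq> {} \<Longrightarrow> cgsel k X \<in> X"
    and ritzsel: "\<And>k X. X \<noteq> {} \<Longrightarrow> ritzsel k X \<in> X"
begin

abbreviation "S \<equiv> level_union f A b K B \<mu>bar x0"
abbreviation "\<Omega> \<equiv> strictly_feasible A b K"

definition e :: real where "e = sqrt \<epsilon>"
text \<open>The coefficient of the cubic error in \<open>phi_upper\<close>: \<open>L / 6\<close> comes from \<open>f\<close> and \<open>1 / (12 (1 - \<beta>))\<close> from \<open>\<mu> B\<close>, as
  \<open>\<mu> \<le> 1/4\<close>.\<close>

definition C :: real where "C = (L * (1 - \<beta>) + 1/2) / (6 * (1 - \<beta>))"

lemma e: "0 < e" "e < 1" "e\<^sup>2 = \<epsilon>" "e \<le> \<beta>" "sqrt \<epsilon> = e"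
  using eps beta by (auto simp: e_def)

lemma C_pos: "0 < C" unfolding C_def using L beta by (simp add: add_pos_pos)

text \<open>The equation is the purpose of \<open>\<mu>\<close>: it says that \<open>(1 - \<beta>) \<mu> + \<mu> \<surd>\<nu> / (1 - \<beta>) = \<epsilon> / 2\<close>.\<close>

lemma mu: "0 < \<mu>" "\<mu> \<le> \<epsilon> / 4" "\<mu> * (2 * ((1 - \<beta>)\<^sup>2 + sqrt \<nu>)) = (1 - \<beta>) * \<epsilon>"
proof -
  have s: "1 \<le> sqrt \<nu>" using nu_ge_1 by simp
  have d: "0 < 2 * ((1 - \<beta>)\<^sup>2 + sqrt \<nu>)" using s by (simp add: add_nonneg_pos)
  then show "0 < \<mu>" unfolding \<mu>_def ncgb_mu_def using beta eps by simp
  show eq: "\<mu> * (2 * ((1 - \<beta>)\<^sup>2 + sqrt \<nu>)) = (1 - \<beta>) * \<epsilon>"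
    unfolding \<mu>_def ncgb_mu_def using d by simp
  have AMGM: "4 * c \<le> 2 * (c\<^sup>2 + q)" if "1 \<le> q" for c q :: real
  proof -
    have "0 \<le> c\<^sup>2 - 2 * c * 1 + 1\<^sup>2" using zero_le_power2[of "c - 1"] by (simp only: power2_diff)
    then have "2 * c \<le> c\<^sup>2 + 1" by simp
    then have "2 * c \<le> c\<^sup>2 + q" using that by (rule order_trans[OF _ add_left_mono])
    then have "2 * (2 * c) \<le> 2 * (c\<^sup>2 + q)" by (intro mult_left_mono) auto
    then show ?thesis by simp
  qed
  have "\<mu> * (4 * (1 - \<beta>)) \<le> (1 - \<beta>) * \<epsilon>"
    unfolding eq[symmetric] using \<open>0 < \<mu>\<close> by (intro mult_left_mono AMGM[OF s]) simp
  then have "(1 - \<beta>) * (\<mu> * 4) \<le> (1 - \<beta>) * \<epsilon>" by (simp add: algebra_simps)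
  then show "\<mu> \<le> \<epsilon> / 4" using beta by (simp add: mult_le_cancel_left)
qed

lemma mu_le_mubar: "\<mu> \<le> \<mu>bar" using mubar by (simp add: \<mu>_def)

lemma in_S: "x \<in> \<Omega> \<Longrightarrow> \<phi> x \<le> \<phi> x0 \<Longrightarrow> x \<in> S"
  unfolding level_union_def \<phi>_def using mu mu_le_mubar by auto

lemma phi_lower: "x \<in> \<Omega> \<Longrightarrow> \<phi>low \<le> \<phi> x"
  unfolding \<phi>_def using lower mu mu_le_mubar by blast

lemma S_interior: "x \<in> S \<Longrightarrow> x \<in> I" unfolding level_union_def strictly_feasible_def by auto

lemma Omega_interior: "x \<in> \<Omega> \<Longrightarrow> x \<in> I" unfolding strictly_feasible_def by auto

sublocale f: C2_function f D using D by unfold_locales auto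

lemma phi_eq: "\<phi> = (\<lambda>x. f x + \<mu> * B x)" by (simp add: \<phi>_def barrier_fun_def)

lemma grad_phi: "x \<in> \<Omega> \<Longrightarrow> grad \<phi> x = grad f x + \<mu> *\<^sub>R grad B x"
  unfolding phi_eq using D(2) Omega_interior
  by (intro grad_add_scale f.differentiable B.differentiable) auto

lemma hess_phi: assumes "x \<in> \<Omega>" shows "hess \<phi> x = hess f x + \<mu> *\<^sub>R hess B x"
  unfolding phi_eq
proof (rule hess_add_scale)
  show "C2_function f (D \<inter> I)"
    using f.C2 D(1) by unfold_locales (auto intro: C_k_on_subset)
  show "C2_function B (D \<inter> I)"
    using B.C2 D(1) by unfold_locales (auto intro: C_k_on_subset)
  show "x \<in> D \<inter> I" using assms D(2) Omega_interior by auto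
qed

lemma projection: "x \<in> I \<Longrightarrow> constraint_projection A (hess B x) (M k x)"
  by unfold_locales (auto simp: surjA hess_pos_def factor)

lemma hess_difference_bound:
  assumes x: "x \<in> S" and y: "lnorm x (y - x) \<le> \<beta>"
  shows "u \<bullet> ((hess f y - hess f x) *v w) \<le> L * lnorm x (y - x) * lnorm x u * lnorm x w"
proof -
  note pd = hess_pos_def[OF S_interior[OF x]]
  let ?F = "hess f y - hess f x"
  have op: "local_dual_opnorm B x ?F \<le> L * lnorm x (y - x)"
    using hess_lipschitz[OF x, of y] y form_norm_minus[of "hess B x" "y - x"] by (simp add: local_norms)
  have nn: "0 \<le> lnorm x u" "0 \<le> lnorm x w" using form_norm_nonneg[OF pd] by auto
  have "u \<bullet> (?F *v w) \<le> dnorm x (?F *v w) * lnorm x u"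
    using form_norm_cauchy_schwarz[OF pd, of "?F *v w" u] by (simp add: inner_commute)
  also have "\<dots> \<le> (local_dual_opnorm B x ?F * lnorm x w) * lnorm x u"
    using dual_opnorm_bound(1)[OF pd, of ?F w] nn
    by (intro mult_right_mono) (auto simp: local_dual_opnorm_def local_norms)
  also have "\<dots> \<le> (L * lnorm x (y - x) * lnorm x w) * lnorm x u"
    using op nn by (intro mult_right_mono) auto
  finally show ?thesis by (simp add: mult_ac)
qed

lemma segment_in_D:
  assumes x: "x \<in> S" and p: "lnorm x p \<le> \<beta>" and t: "0 \<le> t" "t \<le> 1"
  shows "lnorm x ((x + t *\<^sub>R p) - x) = t * lnorm x p" "lnorm x ((x + t *\<^sub>R p) - x) \<le> \<beta>" "x + t *\<^sub>R p \<in> D"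
proof -
  note nn = form_norm_nonneg[OF hess_pos_def[OF S_interior[OF x]], of p]
  show e: "lnorm x ((x + t *\<^sub>R p) - x) = t * lnorm x p" using t by (simp add: form_norm_scaleR)
  show le: "lnorm x ((x + t *\<^sub>R p) - x) \<le> \<beta>" unfolding e using mult_right_mono[OF t(2) nn] p by simp
  then show "x + t *\<^sub>R p \<in> D" using D_near[OF x] by (auto simp: local_norms)
qed

lemma f_upper:
  assumes x: "x \<in> S" and p: "lnorm x p \<le> \<beta>"
  shows "f (x + p) \<le> f x + grad f x \<bullet> p + (p \<bullet> (hess f x *v p)) / 2 + L * lnorm x p ^ 3 / 6"
proof -
  let ?g'' = "\<lambda>t. p \<bullet> (hess f (x + t *\<^sub>R p) *v p)"
  have "f (x + 1 *\<^sub>R p) \<le> f (x + 0 *\<^sub>R p) + grad f (x + 0 *\<^sub>R p) \<bullet> p + ?g'' 0 / 2 + L * lnorm x p ^ 3 / 6"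
  proof (rule taylor2_upper)
    fix t :: real assume t: "0 \<le> t" "t \<le> 1"
    note seg = segment_in_D[OF x p t]
    show "((\<lambda>t. f (x + t *\<^sub>R p)) has_real_derivative grad f (x + t *\<^sub>R p) \<bullet> p) (at t)"
      by (rule f.DERIV_line[OF seg(3)])
    show "((\<lambda>t. grad f (x + t *\<^sub>R p) \<bullet> p) has_real_derivative ?g'' t) (at t)"
      by (rule f.DERIV_grad_line[OF seg(3)])
    have "?g'' t - ?g'' 0 = p \<bullet> ((hess f (x + t *\<^sub>R p) - hess f x) *v p)"
      by (simp add: matrix_vector_mult_diff_rdistrib inner_diff_right)
    also have "\<dots> \<le> L * (t * lnorm x p) * lnorm x p * lnorm x p"
      using hess_difference_bound[OF x seg(2), of p p] unfolding seg(1) .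
    finally show "?g'' t \<le> ?g'' 0 + L * lnorm x p ^ 3 * t" by (simp add: power3_eq_cube algebra_simps)
  qed
  then show ?thesis by simp
qed

lemma f_grad_remainder:
  assumes x: "x \<in> S" and p: "lnorm x p \<le> \<beta>"
  shows "dnorm x (grad f (x + p) - grad f x - hess f x *v p) \<le> L / 2 * (lnorm x p)\<^sup>2"
proof (rule dual_norm_le[OF hess_pos_def[OF S_interior[OF x]]])
  fix u
  have "grad f (x + 1 *\<^sub>R p) \<bullet> u \<le> grad f (x + 0 *\<^sub>R p) \<bullet> u + u \<bullet> (hess f (x + 0 *\<^sub>R p) *v p) + (L * (lnorm x p)\<^sup>2 * lnorm x u) / 2"
  proof (rule taylor1_upper)
    fix t :: real assume t: "0 \<le> t" "t \<le> 1"
    note seg = segment_in_D[OF x p t]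
    show "((\<lambda>t. grad f (x + t *\<^sub>R p) \<bullet> u) has_real_derivative u \<bullet> (hess f (x + t *\<^sub>R p) *v p)) (at t)"
      by (rule f.DERIV_grad_line[OF seg(3)])
    have "u \<bullet> (hess f (x + t *\<^sub>R p) *v p) - u \<bullet> (hess f x *v p) = u \<bullet> ((hess f (x + t *\<^sub>R p) - hess f x) *v p)"
      by (simp add: matrix_vector_mult_diff_rdistrib inner_diff_right)
    also have "\<dots> \<le> L * (t * lnorm x p) * lnorm x u * lnorm x p"
      using hess_difference_bound[OF x seg(2), of u p] unfolding seg(1) .
    finally show "u \<bullet> (hess f (x + t *\<^sub>R p) *v p) \<le> u \<bullet> (hess f (x + 0 *\<^sub>R p) *v p) + L * (lnorm x p)\<^sup>2 * lnorm x u * t"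
      by (simp add: power2_eq_square algebra_simps)
  qed
  then show "(grad f (x + p) - grad f x - hess f x *v p) \<bullet> u \<le> L / 2 * (lnorm x p)\<^sup>2 * lnorm x u"
    by (simp add: inner_diff_right inner_commute[of _ u])
qed (use L in simp)

definition reduced_grad where "reduced_grad k x = transpose (P k x) *v grad \<phi> x"
definition reduced_hess_phi where "reduced_hess_phi k x = transpose (P k x) ** hess \<phi> x ** P k x"

lemma step_feasible:
  assumes x: "x \<in> \<Omega>" and d: "norm (Q k x *v d) \<le> \<beta>" and t: "0 \<le> t" "t \<le> 1"
  shows "x + t *\<^sub>R (P k x *v d) \<in> \<Omega>" "lnorm x (P k x *v d) \<le> \<beta>"
proof -
  interpret constraint_projection A "hess B x" "M k x" by (rule projection[OF Omega_interior[OF x]])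
  show l: "lnorm x (P k x *v d) \<le> \<beta>" using d norm_p[of d] by (simp add: P_def Q_def)
  then have "x + t *\<^sub>R (P k x *v d) \<in> I"
    using dikin[OF Omega_interior[OF x] _ t] beta by simp
  moreover have "A *v (x + t *\<^sub>R (P k x *v d)) = b"
    using x A_p[of d] by (simp add: strictly_feasible_def P_def matrix_vector_right_distrib matrix_vector_mult_scaleR)
  ultimately show "x + t *\<^sub>R (P k x *v d) \<in> \<Omega>" by (simp add: strictly_feasible_def)
qed

text \<open>The cubic Taylor estimates of \<open>f\<close> and \<open>B\<close>, transported to the coordinates \<open>d\<close>, in which the local norm of a step is
  at most the Euclidean norm of \<open>d\<close>.\<close>

lemma phi_upper:
  assumes x: "x \<in> \<Omega>" "\<phi> x \<le> \<phi> x0" and d: "norm (Q k x *v d) \<le> \<beta>" and t: "0 \<le> t" "t \<le> 1"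
  shows "\<phi> (x + t *\<^sub>R (P k x *v d)) \<le>
    \<phi> x + t * (reduced_grad k x \<bullet> d) + t\<^sup>2 / 2 * (d \<bullet> (reduced_hess_phi k x *v d)) + C * (t * norm d) ^ 3"
proof -
  interpret constraint_projection A "hess B x" "M k x" by (rule projection[OF Omega_interior[OF x(1)]])
  define w where "w = P k x *v d"
  define z where "z = t *\<^sub>R w"
  have xS: "x \<in> S" by (rule in_S[OF x])
  have wl: "lnorm x w \<le> norm d" "lnorm x w \<le> \<beta>"
    using norm_p[of d] norm_q[of d] d by (auto simp: w_def P_def Q_def)
  have nw: "0 \<le> lnorm x w" using form_norm_nonneg[OF pdH] .
  have zl: "lnorm x z = t * lnorm x w" using t by (simp add: z_def form_norm_scaleR)
  have zb: "lnorm x z \<le> \<beta>" using mult_right_mono[OF t(2) nw] wl(2) unfolding zl by simp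
  have nz: "0 \<le> lnorm x z" using form_norm_nonneg[OF pdH] .
  have z1: "lnorm x z < 1" using zb beta by simp
  have "B (x + z) \<le> B x + grad B x \<bullet> z + (lnorm x z)\<^sup>2 / 2 + lnorm x z ^ 3 / (3 * (1 - lnorm x z))"
    by (rule barrier_upper[OF Omega_interior[OF x(1)] z1])
  also have "lnorm x z ^ 3 / (3 * (1 - lnorm x z)) \<le> lnorm x z ^ 3 / (3 * (1 - \<beta>))"
    using zb beta nz by (intro divide_left_mono mult_pos_pos) auto
  finally have Bu: "B (x + z) \<le> B x + grad B x \<bullet> z + (lnorm x z)\<^sup>2 / 2 + lnorm x z ^ 3 / (3 * (1 - \<beta>))" by simp
  have "\<mu> * B (x + z) \<le> \<mu> * (B x + grad B x \<bullet> z + (lnorm x z)\<^sup>2 / 2) + \<mu> * (lnorm x z ^ 3 / (3 * (1 - \<beta>)))"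
    using mult_left_mono[OF Bu, of \<mu>] mu(1) by (simp add: distrib_left)
  also have "\<mu> * (lnorm x z ^ 3 / (3 * (1 - \<beta>))) \<le> (1/4) * (lnorm x z ^ 3 / (3 * (1 - \<beta>)))"
    using mu(2) eps nz beta by (intro mult_right_mono) auto
  finally have muB: "\<mu> * B (x + z) \<le> \<mu> * (B x + grad B x \<bullet> z + (lnorm x z)\<^sup>2 / 2) + (1/4) * (lnorm x z ^ 3 / (3 * (1 - \<beta>)))" by simp
  have Ceq: "L * lnorm x z ^ 3 / 6 + (1/4) * (lnorm x z ^ 3 / (3 * (1 - \<beta>))) = C * lnorm x z ^ 3"
    unfolding C_def using beta by (simp add: field_simps)
  have "C * lnorm x z ^ 3 \<le> C * (t * norm d) ^ 3"
    using C_pos nz wl(1) t unfolding zl by (intro mult_left_mono power_mono) auto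
  then have main: "\<phi> (x + z) \<le> \<phi> x + grad \<phi> x \<bullet> z + (z \<bullet> (hess f x *v z) + \<mu> * (lnorm x z)\<^sup>2) / 2 + C * (t * norm d) ^ 3"
    using f_upper[OF xS zb] muB Ceq unfolding phi_eq[unfolded fun_eq_iff, rule_format] grad_phi[OF x(1)]
    by (simp add: inner_add_left distrib_left add_divide_distrib)
  have gz: "grad \<phi> x \<bullet> z = t * (reduced_grad k x \<bullet> d)"
    unfolding z_def w_def reduced_grad_def by (simp add: transpose_dot)
  have "z \<bullet> (hess f x *v z) + \<mu> * (lnorm x z)\<^sup>2 = z \<bullet> (hess \<phi> x *v z)"
    unfolding hess_phi[OF x(1)] form_norm_square[OF pdH]
    by (simp add: matrix_vector_mult_add_rdistrib inner_add_right flip: scaleR_matrix_vector_assoc)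
  also have "\<dots> = t\<^sup>2 * (w \<bullet> (hess \<phi> x *v w))"
    unfolding z_def by (simp add: matrix_vector_mult_scaleR power2_eq_square mult.assoc)
  also have "w \<bullet> (hess \<phi> x *v w) = d \<bullet> (reduced_hess_phi k x *v d)"
    unfolding w_def reduced_hess_phi_def P_def by (simp add: reduced_form)
  finally have "z \<bullet> (hess f x *v z) + \<mu> * (lnorm x z)\<^sup>2 = t\<^sup>2 * (d \<bullet> (reduced_hess_phi k x *v d))" .
  from main[unfolded gz this] show ?thesis by (simp add: z_def w_def)
qed

text \<open>Backtracking undershoots the threshold by at most one factor \<open>\<theta>\<close>.\<close>

lemma line_search_exponent:
  assumes T: "0 < T" and ok: "\<And>j. \<theta> ^ j < T \<Longrightarrow> R j"
  shows "\<exists>j. R j" "(LEAST j. R j) = 0 \<or> \<theta> * T \<le> \<theta> ^ (LEAST j. R j)"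
proof -
  obtain j where "\<theta> ^ j < T" using real_arch_pow_inv[OF T theta(2)] by blast
  then show ex: "\<exists>j. R j" using ok by blast
  show "(LEAST j. R j) = 0 \<or> \<theta> * T \<le> \<theta> ^ (LEAST j. R j)"
  proof (cases "LEAST j. R j")
    case (Suc i)
    then have "\<not> R i" using not_less_Least[of i R] by simp
    then have "T \<le> \<theta> ^ i" using ok[of i] by linarith
    then show ?thesis using Suc theta by simp
  qed simp
qed

lemma theta_power: "0 < \<theta> ^ j" "\<theta> ^ j \<le> 1"
  using theta by (auto simp: power_le_one)

definition c_nc :: real where
  "c_nc = \<eta> / 2 * min 1 ((3 * (1 - \<beta>) * (1 - \<eta>) * \<theta> / (L * (1 - \<beta>) + 1/2))\<^sup>2)"

definition c_d :: real where
  "c_d = (1 - \<beta>) ^ 3 / ((L + \<zeta> + 4) * ((1 - \<beta>)\<^sup>2 + sqrt \<nu>) + 1 - \<beta>)"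

definition c_sol :: real where
  "c_sol = \<eta> * min (c_d\<^sup>2) ((6 * (1 - \<beta>) * (1 - \<eta>) * \<theta> / (L * (1 - \<beta>) + 1/2))\<^sup>2)"

lemma C_inverse: "6 * (1 - \<beta>) / (L * (1 - \<beta>) + 1/2) = 1 / C" unfolding C_def by simp

text \<open>Steps with \<open>\<theta>\<^sup>j < T\<close> keep the cubic error below a fraction \<open>1 - \<eta>\<close> of the quadratic gain.\<close>

lemma negative_curvature_step:
  assumes x: "x \<in> \<Omega>" "\<phi> x \<le> \<phi> x0" and d: "norm (Q k x *v d) \<le> \<beta>" "d \<noteq> 0"
    and g: "reduced_grad k x \<bullet> d \<le> 0" and h: "d \<bullet> (reduced_hess_phi k x *v d) \<le> - (norm d ^ 3)"
  shows "\<exists>j. sufficient_decrease k x NC d j"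
    "\<phi> (x + \<theta> ^ (LEAST j. sufficient_decrease k x NC d j) *\<^sub>R (P k x *v d)) \<le> \<phi> x - c_nc * norm d ^ 3"
proof -
  define T where "T = (1 - \<eta>) / (2 * C)"
  have T: "0 < T" unfolding T_def using eta C_pos by simp
  have dp: "0 < norm d ^ 3" using d by simp
  have ok: "sufficient_decrease k x NC d j" if j: "\<theta> ^ j < T" for j
  proof -
    define t where "t = \<theta> ^ j"
    have t: "0 < t" "t \<le> 1" "C * t < (1 - \<eta>) / 2"
      using theta_power[of j] j C_pos unfolding t_def T_def by (auto simp: field_simps)
    have "\<phi> (x + t *\<^sub>R (P k x *v d)) \<le> \<phi> x + t * (reduced_grad k x \<bullet> d) + t\<^sup>2 / 2 * (d \<bullet> (reduced_hess_phi k x *v d)) + C * (t * norm d) ^ 3"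
      using phi_upper[OF x d(1)] t by simp
    also have "\<dots> \<le> \<phi> x + 0 + t\<^sup>2 / 2 * (- (norm d ^ 3)) + C * (t * norm d) ^ 3"
      using t g h by (intro add_mono mult_left_mono order.refl mult_nonneg_nonpos) auto
    also have "\<dots> = \<phi> x - (1/2 - C * t) * (t\<^sup>2 * norm d ^ 3)"
      by (simp add: power_mult_distrib power2_eq_square power3_eq_cube algebra_simps)
    also have "\<dots> < \<phi> x - \<eta> / 2 * (t\<^sup>2 * norm d ^ 3)"
      using t dp by (intro diff_strict_left_mono mult_strict_right_mono) auto
    finally show ?thesis unfolding sufficient_decrease_def t_def
      by (simp add: power_even_eq mult.assoc)
  qed
  have ls: "\<exists>j. sufficient_decrease k x NC d j" "(LEAST j. sufficient_decrease k x NC d j) = 0 \<or>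
      \<theta> * T \<le> \<theta> ^ (LEAST j. sufficient_decrease k x NC d j)"
    using line_search_exponent[of T "sufficient_decrease k x NC d"] T ok by blast+
  show ex: "\<exists>j. sufficient_decrease k x NC d j" by (rule ls(1))
  define j where "j = (LEAST j. sufficient_decrease k x NC d j)"
  have sd: "sufficient_decrease k x NC d j" unfolding j_def using LeastI_ex[OF ex] .
  have Tt: "\<theta> * T = 3 * (1 - \<beta>) * (1 - \<eta>) * \<theta> / (L * (1 - \<beta>) + 1/2)"
  proof -
    have "3 * (1 - \<beta>) * (1 - \<eta>) * \<theta> / (L * (1 - \<beta>) + 1/2) = (6 * (1 - \<beta>) / (L * (1 - \<beta>) + 1/2)) * ((1 - \<eta>) * \<theta> / 2)"
    proof -
      have "3 * c * h * u / N = (6 * c / N) * (h * u / 2)" for c h u N :: real by simp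
      then show ?thesis .
    qed
    then show ?thesis unfolding C_inverse T_def by (simp add: mult_ac)
  qed
  have "min 1 ((\<theta> * T)\<^sup>2) \<le> (\<theta> ^ j)\<^sup>2"
  proof (cases "j = 0")
    case False
    moreover have "j = 0 \<or> \<theta> * T \<le> \<theta> ^ j" using ls(2) unfolding j_def .
    ultimately have "\<theta> * T \<le> \<theta> ^ j" by simp
    then have "(\<theta> * T)\<^sup>2 \<le> (\<theta> ^ j)\<^sup>2" using theta T by (intro power_mono) auto
    then show ?thesis by simp
  qed simp
  then have "\<eta> / 2 * min 1 ((\<theta> * T)\<^sup>2) * norm d ^ 3 \<le> \<eta> / 2 * (\<theta> ^ j)\<^sup>2 * norm d ^ 3"
    using eta by (intro mult_right_mono mult_left_mono) auto
  then have "c_nc * norm d ^ 3 \<le> \<eta> / 2 * (\<theta> ^ j)\<^sup>2 * norm d ^ 3" unfolding c_nc_def Tt .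
  moreover have "\<phi> (x + \<theta> ^ j *\<^sub>R (P k x *v d)) < \<phi> x - \<eta> / 2 * (\<theta> ^ j)\<^sup>2 * norm d ^ 3"
    using sd unfolding sufficient_decrease_def by (simp add: power_even_eq)
  ultimately show "\<phi> (x + \<theta> ^ (LEAST j. sufficient_decrease k x NC d j) *\<^sub>R (P k x *v d)) \<le> \<phi> x - c_nc * norm d ^ 3"
    unfolding j_def by linarith
qed

text \<open>The curvature \<open>h\<close> along the direction may be negative, down to \<open>- e |dh|\<^sup>2\<close>. The identity for \<open>g \<bullet> dh\<close>, which comes
  from the regularisation of the linear system by \<open>2 e I\<close>, outweighs it.\<close>

lemma newton_step:
  assumes x: "x \<in> \<Omega>" "\<phi> x \<le> \<phi> x0" and ans: "cg_answer (reduced_hess_phi k x) (reduced_grad k x) e \<zeta> dh SOL"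
  defines "d \<equiv> capped 1 \<beta> (norm (Q k x *v dh)) *\<^sub>R dh"
  defines "j \<equiv> LEAST j. sufficient_decrease k x SOL d j"
  shows "\<exists>j. sufficient_decrease k x SOL d j" "norm (Q k x *v d) \<le> \<beta>" "d \<noteq> 0"
    "\<phi> (x + \<theta> ^ j *\<^sub>R (P k x *v d)) \<le> \<phi> x - \<eta> * e * (\<theta> ^ j * norm d)\<^sup>2"
    "j \<noteq> 0 \<Longrightarrow> (6 * (1 - \<beta>) * (1 - \<eta>) * \<theta> / (L * (1 - \<beta>) + 1/2)) * e \<le> \<theta> ^ j * norm d"
proof -
  define h where "h = dh \<bullet> (reduced_hess_phi k x *v dh)"
  define n where "n = (norm dh)\<^sup>2"
  have a: "dh \<noteq> 0" "- e * n \<le> h" "reduced_grad k x \<bullet> dh = - h - 2 * e * n"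
    using ans unfolding cg_answer_def h_def n_def by auto
  define \<gamma> where "\<gamma> = capped 1 \<beta> (norm (Q k x *v dh))"
  have b0: "0 < \<beta>" using e by simp
  note cap = capped_bounds[OF zero_less_one b0 norm_ge_zero[of "Q k x *v dh"], folded \<gamma>_def]
  have d: "d = \<gamma> *\<^sub>R dh" unfolding d_def \<gamma>_def ..
  show dn: "d \<noteq> 0" using cap(1) a by (simp add: d)
  show Qd: "norm (Q k x *v d) \<le> \<beta>" using cap by (simp add: d matrix_vector_mult_scaleR)
  define T where "T = (1 - \<eta>) * e / (C * norm d)"
  have T: "0 < T" unfolding T_def using eta C_pos e dn by simp
  have ok: "sufficient_decrease k x SOL d j" if j: "\<theta> ^ j < T" for j
  proof -
    define t where "t = \<theta> ^ j"
    define \<sigma> where "\<sigma> = t * \<gamma>"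
    have t: "0 < t" "t \<le> 1" "C * (t * norm d) < (1 - \<eta>) * e"
      using theta_power[of j] j C_pos dn unfolding t_def T_def by (auto simp: field_simps)
    have s: "0 < \<sigma>" "\<sigma> \<le> 1" unfolding \<sigma>_def using t cap mult_le_one[of t \<gamma>] by auto
    have n0: "0 < n" unfolding n_def using a by simp
    have tn: "(t * norm d)\<^sup>2 = \<sigma>\<^sup>2 * n" unfolding \<sigma>_def n_def d using cap by (simp add: power_mult_distrib)
    have "\<phi> (x + t *\<^sub>R (P k x *v d)) \<le> \<phi> x + t * (reduced_grad k x \<bullet> d) + t\<^sup>2 / 2 * (d \<bullet> (reduced_hess_phi k x *v d)) + C * (t * norm d) ^ 3"
      using phi_upper[OF x Qd] t by simp
    also have "t * (reduced_grad k x \<bullet> d) = - \<sigma> * h - 2 * \<sigma> * e * n"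
      unfolding d \<sigma>_def by (simp add: a(3) algebra_simps)
    also have "t\<^sup>2 / 2 * (d \<bullet> (reduced_hess_phi k x *v d)) = \<sigma>\<^sup>2 * h / 2"
      unfolding d \<sigma>_def h_def by (simp add: matrix_vector_mult_scaleR power2_eq_square)
    also have "C * (t * norm d) ^ 3 \<le> (1 - \<eta>) * e * (\<sigma>\<^sup>2 * n)"
    proof -
      have "C * (t * norm d) ^ 3 = (C * (t * norm d)) * (t * norm d)\<^sup>2" by (simp add: power2_eq_square power3_eq_cube)
      also have "\<dots> \<le> ((1 - \<eta>) * e) * (t * norm d)\<^sup>2" using t by (intro mult_right_mono) auto
      finally show ?thesis unfolding tn .
    qed
    finally have "\<phi> (x + t *\<^sub>R (P k x *v d)) \<le> \<phi> x - \<sigma> * (1 - \<sigma> / 2) * h - 2 * \<sigma> * e * n + (1 - \<eta>) * e * (\<sigma>\<^sup>2 * n)"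
      by (simp add: power2_eq_square algebra_simps)
    also have "\<dots> \<le> \<phi> x + \<sigma> * (1 - \<sigma> / 2) * (e * n) - 2 * \<sigma> * e * n + (1 - \<eta>) * e * (\<sigma>\<^sup>2 * n)"
      using mult_left_mono[of "- h" "e * n" "\<sigma> * (1 - \<sigma> / 2)"] a(2) s by simp
    also have "\<dots> = \<phi> x - \<eta> * e * (\<sigma>\<^sup>2 * n) - (\<sigma> - \<sigma>\<^sup>2 / 2) * (e * n)"
      by (simp add: power2_eq_square algebra_simps)
    also have "\<dots> < \<phi> x - \<eta> * e * (\<sigma>\<^sup>2 * n)"
    proof -
      have "\<sigma>\<^sup>2 \<le> \<sigma>" using s by (simp add: power2_eq_square mult_left_le)
      then have "0 < \<sigma> - \<sigma>\<^sup>2 / 2" using s by linarith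
      then show ?thesis using e n0 by simp
    qed
    finally show ?thesis unfolding sufficient_decrease_def tn[symmetric] e(5)
      by (simp add: t_def power_even_eq power_mult_distrib mult.assoc)
  qed
  have ls: "\<exists>j. sufficient_decrease k x SOL d j" "(LEAST j. sufficient_decrease k x SOL d j) = 0 \<or>
      \<theta> * T \<le> \<theta> ^ (LEAST j. sufficient_decrease k x SOL d j)"
    using line_search_exponent[of T "sufficient_decrease k x SOL d"] T ok by blast+
  show ex: "\<exists>j. sufficient_decrease k x SOL d j" by (rule ls(1))
  have sd: "sufficient_decrease k x SOL d j" unfolding j_def using LeastI_ex[OF ex] .
  then show "\<phi> (x + \<theta> ^ j *\<^sub>R (P k x *v d)) \<le> \<phi> x - \<eta> * e * (\<theta> ^ j * norm d)\<^sup>2"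
    unfolding sufficient_decrease_def e(5) by (simp add: power_even_eq power_mult_distrib mult.assoc)
  assume nz: "j \<noteq> 0"
  have "j = 0 \<or> \<theta> * T \<le> \<theta> ^ j" using ls(2) unfolding j_def .
  then have "\<theta> * T \<le> \<theta> ^ j" using nz by simp
  then have "\<theta> * T * norm d \<le> \<theta> ^ j * norm d" by (intro mult_right_mono) auto
  moreover have "\<theta> * T * norm d = (6 * (1 - \<beta>) * (1 - \<eta>) * \<theta> / (L * (1 - \<beta>) + 1/2)) * e"
  proof -
    have "(6 * (1 - \<beta>) * (1 - \<eta>) * \<theta> / (L * (1 - \<beta>) + 1/2)) * e = (6 * (1 - \<beta>) / (L * (1 - \<beta>) + 1/2)) * ((1 - \<eta>) * \<theta> * e)" by simp
    then show ?thesis unfolding C_inverse T_def using dn C_pos by simp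
  qed
  ultimately show "(6 * (1 - \<beta>) * (1 - \<eta>) * \<theta> / (L * (1 - \<beta>) + 1/2)) * e \<le> \<theta> ^ j * norm d" by simp
qed

lemma reduced_grad_norm:
  assumes x: "x \<in> \<Omega>"
  shows "dnorm x (grad \<phi> x + transpose A *v (Rmat A (M k x) *v grad \<phi> x)) = norm (reduced_grad k x)"
proof -
  interpret constraint_projection A "hess B x" "M k x" by (rule projection[OF Omega_interior[OF x]])
  show ?thesis unfolding reduced_grad_def P_def by (rule dual_norm_multiplier)
qed

lemma hess_f_symmetric: "x \<in> \<Omega> \<Longrightarrow> symmetric_matrix (hess f x)"
  using f.hess_symmetric D(2) by blast

lemma hess_phi_symmetric:
  assumes x: "x \<in> \<Omega>"
  shows "symmetric_matrix (hess \<phi> x)"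
proof (rule symmetric_matrixI)
  fix u w
  have "(hess f x *v u) \<bullet> w = u \<bullet> (hess f x *v w)" "(hess B x *v u) \<bullet> w = u \<bullet> (hess B x *v w)"
    using symmetric_matrix_dot hess_f_symmetric[OF x] B.hess_symmetric[OF Omega_interior[OF x]] by blast+
  then show "(hess \<phi> x *v u) \<bullet> w = u \<bullet> (hess \<phi> x *v w)"
    unfolding hess_phi[OF x]
    by (simp add: matrix_vector_mult_add_rdistrib inner_add_left inner_add_right flip: scaleR_matrix_vector_assoc)
qed

lemma reduced_hess_phi_symmetric: "x \<in> \<Omega> \<Longrightarrow> symmetric_matrix (reduced_hess_phi k x)"
  unfolding reduced_hess_phi_def P_def
  by (rule constraint_projection.reduced_symmetric[OF projection[OF Omega_interior] hess_phi_symmetric])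

lemma reduced_hess_symmetric: "x \<in> \<Omega> \<Longrightarrow> symmetric_matrix (reduced_hess k x)"
  unfolding reduced_hess_def P_def
  by (rule constraint_projection.reduced_symmetric[OF projection[OF Omega_interior] hess_f_symmetric])

lemma reduced_hess_phi_apply:
  assumes x: "x \<in> \<Omega>"
  shows "reduced_hess_phi k x *v d = transpose (P k x) *v (hess f x *v (P k x *v d)) + \<mu> *\<^sub>R (Q k x *v d)"
proof -
  interpret constraint_projection A "hess B x" "M k x" by (rule projection[OF Omega_interior[OF x]])
  have "reduced_hess_phi k x *v d = transpose (P k x) *v (hess \<phi> x *v (P k x *v d))"
    unfolding reduced_hess_phi_def by (simp add: matrix_vector_mul_assoc matrix_mul_assoc)
  also have "\<dots> = transpose (P k x) *v (hess f x *v (P k x *v d)) + \<mu> *\<^sub>R (transpose (P k x) *v (hess B x *v (P k x *v d)))"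
    unfolding hess_phi[OF x]
    by (simp add: matrix_vector_mult_add_rdistrib matrix_vector_right_distrib matrix_vector_mult_scaleR
        flip: scaleR_matrix_vector_assoc)
  finally show ?thesis by (simp add: P_def Q_def reduced_metric)
qed

lemma norm_Q_le: "x \<in> \<Omega> \<Longrightarrow> norm (Q k x *v d) \<le> norm d"
  unfolding Q_def by (rule constraint_projection.norm_q[OF projection[OF Omega_interior]])

lemma reduced_form_split:
  assumes x: "x \<in> \<Omega>"
  shows "d \<bullet> (reduced_hess_phi k x *v d) = d \<bullet> (reduced_hess k x *v d) + \<mu> * (norm (Q k x *v d))\<^sup>2"
proof -
  interpret constraint_projection A "hess B x" "M k x" by (rule projection[OF Omega_interior[OF x]])
  have "d \<bullet> (reduced_hess k x *v d) = d \<bullet> (transpose (P k x) *v (hess f x *v (P k x *v d)))"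
    unfolding reduced_hess_def by (simp add: matrix_vector_mul_assoc matrix_mul_assoc)
  moreover have "d \<bullet> (Q k x *v d) = (norm (Q k x *v d))\<^sup>2"
    unfolding Q_def power2_norm_eq_inner by (simp add: q_symmetric)
  ultimately show ?thesis unfolding reduced_hess_phi_apply[OF x] by (simp add: inner_add_right)
qed

text \<open>The factor \<open>|w \<bullet> H w| / |w|\<^sup>3\<close> gives the direction a length equal to the modulus of the curvature along the unit
  vector, so that the quadratic and the cubic term are balanced; the cap by \<open>\<beta>\<close> only shortens it.\<close>

lemma curvature_direction:
  assumes x: "x \<in> \<Omega>" and w: "w \<noteq> 0" "w \<bullet> (reduced_hess_phi k x *v w) \<le> - s * (norm w)\<^sup>2"
    and s: "0 < s" "s \<le> \<beta>"
  defines "d \<equiv> (- sgn1 (reduced_grad k x \<bullet> w) *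
    capped (\<bar>w \<bullet> (reduced_hess_phi k x *v w)\<bar> / norm w ^ 3) \<beta> (norm (Q k x *v w))) *\<^sub>R w"
  shows "norm (Q k x *v d) \<le> \<beta>" "d \<noteq> 0" "reduced_grad k x \<bullet> d \<le> 0"
    "d \<bullet> (reduced_hess_phi k x *v d) \<le> - (norm d ^ 3)" "s \<le> norm d"
proof -
  define h where "h = w \<bullet> (reduced_hess_phi k x *v w)"
  define \<gamma> where "\<gamma> = capped (\<bar>h\<bar> / norm w ^ 3) \<beta> (norm (Q k x *v w))"
  define \<sigma> where "\<sigma> = sgn1 (reduced_grad k x \<bullet> w)"
  have d: "d = (- \<sigma> * \<gamma>) *\<^sub>R w" unfolding d_def \<gamma>_def \<sigma>_def h_def ..
  have nw: "0 < norm w" using w by simp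
  have b0: "0 < \<beta>" using e by simp
  have hneg: "h \<le> - s * (norm w)\<^sup>2" using w(2) by (simp add: h_def)
  have sw: "0 < s * (norm w)\<^sup>2" using s nw by simp
  have ah: "\<bar>h\<bar> = - h" "0 < \<bar>h\<bar>" using hneg sw by auto
  have hp: "0 < \<bar>h\<bar> / norm w ^ 3" using ah(2) nw by simp
  note cap = capped_bounds[OF hp b0 norm_ge_zero[of "Q k x *v w"], folded \<gamma>_def]
  have sg: "\<bar>\<sigma>\<bar> = 1" "\<sigma> * \<sigma> = 1" by (auto simp: \<sigma>_def sgn1_def)
  have nd: "norm d = \<gamma> * norm w" using cap(1) sg by (simp add: d abs_mult)
  show "d \<noteq> 0" using nd cap(1) nw by auto
  have "norm (Q k x *v d) = \<gamma> * norm (Q k x *v w)" using cap(1) sg by (simp add: d matrix_vector_mult_scaleR abs_mult matrix_vector_mult_minus)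
  then show "norm (Q k x *v d) \<le> \<beta>" using cap(3) by simp
  have "\<sigma> * (reduced_grad k x \<bullet> w) = \<bar>reduced_grad k x \<bullet> w\<bar>" by (auto simp: \<sigma>_def sgn1_def)
  then have "reduced_grad k x \<bullet> d = - (\<gamma> * \<bar>reduced_grad k x \<bullet> w\<bar>)" by (simp add: d mult_ac)
  then show "reduced_grad k x \<bullet> d \<le> 0" using cap(1) by simp
  have "d \<bullet> (reduced_hess_phi k x *v d) = (\<sigma> * \<sigma>) * (\<gamma>\<^sup>2 * h)"
    by (simp add: d h_def matrix_vector_mult_scaleR matrix_vector_mult_minus power2_eq_square)
  then have dh: "d \<bullet> (reduced_hess_phi k x *v d) = - (\<gamma>\<^sup>2 * \<bar>h\<bar>)" using sg ah by simp
  have "\<gamma> * norm w ^ 3 \<le> \<bar>h\<bar>" using cap(2) nw by (simp add: field_simps)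
  then have "\<gamma>\<^sup>2 * (\<gamma> * norm w ^ 3) \<le> \<gamma>\<^sup>2 * \<bar>h\<bar>" by (intro mult_left_mono) auto
  then show "d \<bullet> (reduced_hess_phi k x *v d) \<le> - (norm d ^ 3)"
    unfolding dh nd by (simp add: power_mult_distrib power2_eq_square power3_eq_cube mult_ac)
  have "s \<le> \<bar>h\<bar> / norm w ^ 3 * norm w"
  proof -
    have "s \<le> \<bar>h\<bar> / (norm w)\<^sup>2" using hneg ah nw by (simp add: field_simps)
    also have "\<dots> = \<bar>h\<bar> / norm w ^ 3 * norm w" using nw by (simp add: power2_eq_square power3_eq_cube)
    finally show ?thesis .
  qed
  then show "s \<le> norm d" unfolding nd using cap(5) s(2) norm_Q_le[OF x] by blast
qed

lemma c_d_bounds: "0 < c_d" "c_d \<le> 1"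
  "c_d * ((L * c_d + \<zeta> + 4) * ((1 - \<beta>)\<^sup>2 + sqrt \<nu>) + (1 - \<beta>)) \<le> (1 - \<beta>) ^ 3"
proof -
  define N where "N = (1 - \<beta>)\<^sup>2 + sqrt \<nu>"
  have N: "1 \<le> N" unfolding N_def using nu_ge_1 by (simp add: add_increasing)
  define E where "E = (L + \<zeta> + 4) * N + 1 - \<beta>"
  have LN: "0 \<le> L * N" "0 \<le> \<zeta> * N" using L zeta N by auto
  have E4: "4 \<le> E"
    using N LN beta unfolding E_def by (simp add: distrib_right)
  have b3: "0 < (1 - \<beta>) ^ 3" "(1 - \<beta>) ^ 3 \<le> 1" using beta e by (auto intro: power_le_one)
  have cd: "c_d = (1 - \<beta>) ^ 3 / E" unfolding c_d_def E_def N_def ..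
  show c0: "0 < c_d" unfolding cd using b3 E4 by simp
  show c1: "c_d \<le> 1" unfolding cd using b3 E4 by (simp add: divide_le_eq)
  have "L * c_d \<le> L * 1" using c1 L by (intro mult_left_mono) auto
  then have "(L * c_d + \<zeta> + 4) * N \<le> (L + \<zeta> + 4) * N" using N by (intro mult_right_mono) auto
  then have "c_d * ((L * c_d + \<zeta> + 4) * N + (1 - \<beta>)) \<le> c_d * E"
    using c0 unfolding E_def by (intro mult_left_mono) auto
  also have "\<dots> = (1 - \<beta>) ^ 3" unfolding cd using E4 by simp
  finally show "c_d * ((L * c_d + \<zeta> + 4) * ((1 - \<beta>)\<^sup>2 + sqrt \<nu>) + (1 - \<beta>)) \<le> (1 - \<beta>) ^ 3"
    unfolding N_def .
qed

text \<open>A full Newton step to a point that is not yet nearly stationary for the second multiplier estimate cannot be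
  short, since the residual there is quadratic in the step length plus the inexactness of the linear solve.\<close>

lemma full_step_length:
  assumes x: "x \<in> \<Omega>" "\<phi> x \<le> \<phi> x0" and ans: "cg_answer (reduced_hess_phi k x) (reduced_grad k x) e \<zeta> d SOL"
    and Qd: "norm (Q k x *v d) \<le> \<beta>"
    and big: "(1 - \<beta>) * \<mu> < dnorm (x + P k x *v d) (grad f (x + P k x *v d) +
      transpose A *v (Rmat A (M k x) *v (hess f x *v (P k x *v d) + grad \<phi> x)) + \<mu> *\<^sub>R grad B x)"
  shows "c_d * e \<le> norm d"
proof (rule ccontr)
  assume "\<not> ?thesis"
  then have short: "norm d < c_d * e" by simp
  interpret constraint_projection A "hess B x" "M k x" by (rule projection[OF Omega_interior[OF x(1)]])
  define w where "w = P k x *v d"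
  define g where "g = hess f x *v w + grad \<phi> x"
  have xS: "x \<in> S" by (rule in_S[OF x])
  have wl: "lnorm x w \<le> norm d" "lnorm x w \<le> \<beta>" "0 \<le> lnorm x w"
    using norm_p[of d] norm_q[of d] Qd form_norm_nonneg[OF pdH] by (auto simp: w_def P_def Q_def)
  let ?r = "grad f (x + w) - grad f x - hess f x *v w"
  have split: "grad f (x + w) + transpose A *v (Rmat A (M k x) *v g) + \<mu> *\<^sub>R grad B x =
      ?r + (g + transpose A *v (Rmat A (M k x) *v g))"
    unfolding g_def grad_phi[OF x(1)] by (simp add: algebra_simps)
  have "dnorm (x + w) (grad f (x + w) + transpose A *v (Rmat A (M k x) *v g) + \<mu> *\<^sub>R grad B x) \<le>
      dnorm x (?r + (g + transpose A *v (Rmat A (M k x) *v g))) / (1 - \<beta>)"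
    unfolding split by (rule dual_norm_comparison[OF Omega_interior[OF x(1)] wl(2) beta(2)])
  then have "(1 - \<beta>) * \<mu> < dnorm x (?r + (g + transpose A *v (Rmat A (M k x) *v g))) / (1 - \<beta>)"
    using big unfolding g_def w_def by simp
  then have "(1 - \<beta>)\<^sup>2 * \<mu> < dnorm x (?r + (g + transpose A *v (Rmat A (M k x) *v g)))"
    using beta by (simp add: field_simps power2_eq_square)
  also have "\<dots> \<le> dnorm x ?r + dnorm x (g + transpose A *v (Rmat A (M k x) *v g))"
    by (rule form_norm_triangle[OF pos_def_inverse(3)[OF pdH]])
  also have "dnorm x ?r \<le> L / 2 * (norm d)\<^sup>2"
  proof -
    have "dnorm x ?r \<le> L / 2 * (lnorm x w)\<^sup>2" by (rule f_grad_remainder[OF xS wl(2)])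
    also have "\<dots> \<le> L / 2 * (norm d)\<^sup>2" using wl L by (intro mult_left_mono power_mono) auto
    finally show ?thesis .
  qed
  also have "dnorm x (g + transpose A *v (Rmat A (M k x) *v g)) \<le> (\<zeta> * e / 2 + 2 * e + \<mu>) * norm d"
  proof -
    have "dnorm x (g + transpose A *v (Rmat A (M k x) *v g)) = norm (transpose (P k x) *v g)"
      unfolding P_def by (rule dual_norm_multiplier)
    also have "transpose (P k x) *v g =
        (reduced_hess_phi k x *v d + (2 * e) *\<^sub>R d + reduced_grad k x) - (2 * e) *\<^sub>R d - \<mu> *\<^sub>R (Q k x *v d)"
      unfolding g_def reduced_hess_phi_apply[OF x(1)] reduced_grad_def w_def
      by (simp add: matrix_vector_right_distrib)
    also have "norm \<dots> \<le> norm (reduced_hess_phi k x *v d + (2 * e) *\<^sub>R d + reduced_grad k x) + norm ((2 * e) *\<^sub>R d) + norm (\<mu> *\<^sub>R (Q k x *v d))"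
      by (intro order_trans[OF norm_triangle_ineq4] add_mono norm_triangle_ineq4 order.refl)
    also have "\<dots> \<le> \<zeta> * e / 2 * norm d + 2 * e * norm d + \<mu> * norm d"
    proof (intro add_mono)
      show "norm (reduced_hess_phi k x *v d + (2 * e) *\<^sub>R d + reduced_grad k x) \<le> \<zeta> * e / 2 * norm d"
        using ans by (simp add: cg_answer_def)
      show "norm ((2 * e) *\<^sub>R d) \<le> 2 * e * norm d" using e by simp
      show "norm (\<mu> *\<^sub>R (Q k x *v d)) \<le> \<mu> * norm d"
        using mu(1) norm_Q_le[OF x(1), of k d] by simp
    qed
    finally show ?thesis by (simp add: distrib_right)
  qed
  finally have lt: "(1 - \<beta>)\<^sup>2 * \<mu> < L / 2 * (norm d)\<^sup>2 + (\<zeta> * e / 2 + 2 * e + \<mu>) * norm d" by simp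
  also have "\<dots> \<le> L / 2 * (c_d * e)\<^sup>2 + (\<zeta> * e / 2 + 2 * e + \<mu>) * (c_d * e)"
    using short L e zeta mu(1) by (intro add_mono mult_left_mono power_mono) auto
  also have "\<dots> \<le> (1 - \<beta>)\<^sup>2 * \<mu>"
  proof -
    define N where "N = (1 - \<beta>)\<^sup>2 + sqrt \<nu>"
    have N: "0 < N" unfolding N_def using nu_ge_1 by (simp add: add_nonneg_pos)
    have muN: "2 * (\<mu> * N) = (1 - \<beta>) * e\<^sup>2" proof -
      have "2 * (\<mu> * N) = \<mu> * (2 * N)" by simp
      then show ?thesis using mu(3)[folded N_def] unfolding e(3) by simp
    qed
    have "2 * N * (L / 2 * (c_d * e)\<^sup>2 + (\<zeta> * e / 2 + 2 * e + \<mu>) * (c_d * e)) =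
        e\<^sup>2 * c_d * ((L * c_d + \<zeta> + 4) * N) + 2 * (\<mu> * N) * (c_d * e)"
      by (simp add: power2_eq_square algebra_simps)
    also have "\<dots> = e\<^sup>2 * (c_d * ((L * c_d + \<zeta> + 4) * N + (1 - \<beta>) * e))"
      unfolding muN by (simp add: algebra_simps)
    also have "\<dots> \<le> e\<^sup>2 * (c_d * ((L * c_d + \<zeta> + 4) * N + (1 - \<beta>)))"
      using e eps beta c_d_bounds(1) by (intro mult_left_mono add_left_mono) (auto simp: mult_left_le)
    also have "\<dots> \<le> e\<^sup>2 * (1 - \<beta>) ^ 3"
      using c_d_bounds(3) eps unfolding N_def by (intro mult_left_mono) auto
    also have "\<dots> = 2 * N * ((1 - \<beta>)\<^sup>2 * \<mu>)"
    proof -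
      have "2 * N * ((1 - \<beta>)\<^sup>2 * \<mu>) = (1 - \<beta>)\<^sup>2 * (2 * (\<mu> * N))" by simp
      also have "\<dots> = (1 - \<beta>)\<^sup>2 * ((1 - \<beta>) * e\<^sup>2)" unfolding muN ..
      also have "\<dots> = e\<^sup>2 * (1 - \<beta>) ^ 3" by (simp add: power2_eq_square power3_eq_cube)
      finally show ?thesis ..
    qed
    finally show ?thesis using N by (simp add: mult_le_cancel_left)
  qed
  finally show False by simp
qed

subsection \<open>Iterations\<close>

text \<open>The invariant of the iteration. The distance to the previous iterate matters because the second multiplier estimate
  uses the barrier gradient there.\<close>

definition good :: "('n, 'm) ncgb_state \<Rightarrow> bool" where
  "good s \<longleftrightarrow> cur s \<in> \<Omega> \<and> \<phi> (cur s) \<le> \<phi> x0 \<and> prev s \<in> I \<and> lnorm (prev s) (cur s - prev s) \<le> \<beta>"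

lemma good_init: "good init"
  using x0 Omega_interior e by (simp add: good_def init_def)

lemma advance_good:
  assumes s: "good s" and d: "norm (Q k (cur s) *v d) \<le> \<beta>"
    and ex: "\<exists>j. sufficient_decrease k (cur s) t d j"
  defines "\<alpha> \<equiv> \<theta> ^ (LEAST j. sufficient_decrease k (cur s) t d j)"
  defines "s' \<equiv> \<lparr>cur = cur s + \<alpha> *\<^sub>R (P k (cur s) *v d), prev = cur s, prev_M = M k (cur s), prev_dir = d,
          prev_type = t, prev_step = \<alpha>, prev_lam2 = lam2 s\<rparr>"
  shows "advance k s t d = Running s'" "good s'" "\<phi> (cur s') \<le> \<phi> (cur s)"
proof -
  show "advance k s t d = Running s'" using ex by (simp add: advance_def Let_def s'_def \<alpha>_def)
  have a: "0 < \<alpha>" "\<alpha> \<le> 1" unfolding \<alpha>_def using theta_power by auto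
  have x: "cur s \<in> \<Omega>" using s by (simp add: good_def)
  have "sufficient_decrease k (cur s) t d (LEAST j. sufficient_decrease k (cur s) t d j)"
    using LeastI_ex[OF ex] .
  moreover have "0 \<le> (case t of SOL \<Rightarrow> \<eta> * sqrt \<epsilon> * \<theta> ^ (2 * j) * (norm d)\<^sup>2 | NC \<Rightarrow> \<eta> * \<theta> ^ (2 * j) * norm d ^ 3 / 2)" for j
    using eta eps theta by (cases t) auto
  ultimately show dec: "\<phi> (cur s') \<le> \<phi> (cur s)"
    unfolding sufficient_decrease_def s'_def \<alpha>_def by (simp, smt (verit))
  note sf = step_feasible[OF x d, of \<alpha>]
  have "lnorm (cur s) (\<alpha> *\<^sub>R (P k (cur s) *v d)) \<le> \<beta>"
    using sf(2) a mult_right_mono[of \<alpha> 1 "lnorm (cur s) (P k (cur s) *v d)"]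
      form_norm_nonneg[OF hess_pos_def[OF Omega_interior[OF x]], of "P k (cur s) *v d"]
    by (simp add: form_norm_scaleR)
  then show "good s'"
    using sf(1) a dec s Omega_interior[OF x] unfolding good_def by (simp add: s'_def)
qed

text \<open>A fixed decrease is certain only if the next iteration calls CG again: a short full Newton step may gain
  little, but then the next iteration calls the oracle.\<close>

lemma cg_iteration:
  assumes s: "good s" and cg: "calls_cg k s"
  shows "\<exists>s'. iteration rnd k s = Running s' \<and> good s' \<and> \<phi> (cur s') \<le> \<phi> (cur s) \<and>
    (calls_cg (Suc k) s' \<longrightarrow> \<phi> (cur s') \<le> \<phi> (cur s) - min c_sol c_nc * e ^ 3)"
proof -
  define x where "x = cur s"
  have x: "x \<in> \<Omega>" "\<phi> x \<le> \<phi> x0" using s by (auto simp: good_def x_def)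
  have "grad f x + transpose A *v lam1 k s + \<mu> *\<^sub>R grad B x =
      grad \<phi> x + transpose A *v (Rmat A (M k x) *v grad \<phi> x)"
    unfolding lam1_def x_def[symmetric] grad_phi[OF x(1)] by (simp add: algebra_simps)
  then have "(1 - \<beta>) * \<mu> < norm (reduced_grad k x)"
    using cg unfolding calls_cg_def x_def[symmetric] Let_def local_norms reduced_grad_norm[OF x(1), of k, symmetric]
    by simp
  moreover have "0 < (1 - \<beta>) * \<mu>" using beta mu by simp
  ultimately have g: "reduced_grad k x \<noteq> 0" by auto
  define X where "X = capped_cg (reduced_hess_phi k x) (reduced_grad k x) e \<zeta> 0"
  note cc = capped_cg_correct[OF reduced_hess_phi_symmetric[OF x(1), of k] g e(1) zeta, folded X_def]
  obtain dh t where sel: "cgsel k X = (dh, t)" by (cases "cgsel k X") auto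
  have ans: "cg_answer (reduced_hess_phi k x) (reduced_grad k x) e \<zeta> dh t"
    using cc(2) cgsel[OF cc(1)] sel by metis
  define d where "d = cg_direction k x t dh"
  have it: "iteration rnd k s = advance k s t d"
    using cg cc(1) sel unfolding iteration_def Let_def d_def X_def x_def reduced_hess_phi_def reduced_grad_def e(5)
    by simp
  show ?thesis
  proof (cases t)
    case NC
    have neg: "dh \<noteq> 0" "dh \<bullet> (reduced_hess_phi k x *v dh) \<le> - e * (norm dh)\<^sup>2"
      using ans unfolding cg_answer_def NC by auto
    have d': "d = (- sgn1 (reduced_grad k x \<bullet> dh) *
      capped (\<bar>dh \<bullet> (reduced_hess_phi k x *v dh)\<bar> / norm dh ^ 3) \<beta> (norm (Q k x *v dh))) *\<^sub>R dh"
      unfolding d_def NC cg_direction_def reduced_grad_def reduced_hess_phi_def Let_def by simp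
    note cd = curvature_direction[OF x(1) neg e(1) e(4), folded d']
    note st = negative_curvature_step[OF x cd(1-4)]
    note adv = advance_good[OF s, of k d NC, folded x_def, OF cd(1) st(1)]
    have "c_nc * e ^ 3 \<le> c_nc * norm d ^ 3"
      unfolding c_nc_def using cd(5) e eta by (intro mult_left_mono power_mono) auto
    moreover have "min c_sol c_nc * e ^ 3 \<le> c_nc * e ^ 3" using e by (intro mult_right_mono) auto
    ultimately have "\<phi> (x + \<theta> ^ (LEAST j. sufficient_decrease k x NC d j) *\<^sub>R (P k x *v d)) \<le> \<phi> x - min c_sol c_nc * e ^ 3"
      using st(2) by linarith
    then show ?thesis using adv unfolding it NC x_def[symmetric]
      by (intro exI conjI) (auto intro: adv(1))
  next
    case SOL
    have d': "d = capped 1 \<beta> (norm (Q k x *v dh)) *\<^sub>R dh"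
      unfolding d_def SOL cg_direction_def by (simp add: Let_def)
    define j where "j = (LEAST j. sufficient_decrease k x SOL d j)"
    note st = newton_step[OF x ans[unfolded SOL], folded d', folded j_def]
    define s' where "s' = \<lparr>cur = x + \<theta> ^ j *\<^sub>R (P k x *v d), prev = x, prev_M = M k x, prev_dir = d,
          prev_type = SOL, prev_step = \<theta> ^ j, prev_lam2 = lam2 s\<rparr>"
    note adv = advance_good[OF s, of k d SOL, folded x_def, OF st(2) st(1), folded j_def, folded s'_def]
    have "\<phi> (cur s') \<le> \<phi> x - min c_sol c_nc * e ^ 3" if next_cg: "calls_cg (Suc k) s'"
    proof -
      define c where "c = 6 * (1 - \<beta>) * (1 - \<eta>) * \<theta> / (L * (1 - \<beta>) + 1/2)"
      have c0: "0 \<le> c" unfolding c_def using beta eta theta L by simp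
      have len: "min (c_d\<^sup>2) (c\<^sup>2) * e\<^sup>2 \<le> (\<theta> ^ j * norm d)\<^sup>2"
      proof (cases "j = 0")
        case False
        then have "c * e \<le> \<theta> ^ j * norm d" using st(5) unfolding c_def by blast
        then have "(c * e)\<^sup>2 \<le> (\<theta> ^ j * norm d)\<^sup>2" using c0 e by (intro power_mono) auto
        moreover have "min (c_d\<^sup>2) (c\<^sup>2) * e\<^sup>2 \<le> c\<^sup>2 * e\<^sup>2" by (intro mult_right_mono) auto
        ultimately show ?thesis by (simp add: power_mult_distrib)
      next
        case True
        have "c_d * e \<le> norm d"
        proof (cases "capped 1 \<beta> (norm (Q k x *v dh)) < 1")
          case True
          have b0: "0 < \<beta>" using e by simp
          note cap = capped_bounds[OF zero_less_one b0 norm_ge_zero[of "Q k x *v dh"]]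
          have "norm (Q k x *v d) = \<beta>"
            using cap(4)[OF True] cap(1) by (simp add: d' matrix_vector_mult_scaleR)
          then have "e \<le> norm d" using norm_Q_le[OF x(1), of k d] e by simp
          moreover have "c_d * e \<le> 1 * e" using c_d_bounds e by (intro mult_right_mono) auto
          ultimately show ?thesis by simp
        next
          case False
          then have "capped 1 \<beta> (norm (Q k x *v dh)) = 1"
            using capped_bounds(2)[of 1 \<beta> "norm (Q k x *v dh)"] e by fastforce
          then have dd: "d = dh" by (simp add: d')
          have l2: "lam2 s' = Rmat A (M k x) *v (hess f x *v (P k x *v d) + grad \<phi> x)"
            by (simp add: lam2_def s'_def \<open>j = 0\<close> P_def)
          have cur': "cur s' = x + P k x *v d" "prev s' = x" by (auto simp: s'_def \<open>j = 0\<close>)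
          show ?thesis
          proof (rule full_step_length[OF x ans[unfolded SOL, folded dd] st(2)])
            show "(1 - \<beta>) * \<mu> < dnorm (x + P k x *v d) (grad f (x + P k x *v d) +
                transpose A *v (Rmat A (M k x) *v (hess f x *v (P k x *v d) + grad \<phi> x)) + \<mu> *\<^sub>R grad B x)"
              using next_cg unfolding calls_cg_def Let_def local_norms l2 cur' by simp
          qed
        qed
        then have "(c_d * e)\<^sup>2 \<le> (norm d)\<^sup>2" using c_d_bounds e by (intro power_mono) auto
        moreover have "min (c_d\<^sup>2) (c\<^sup>2) * e\<^sup>2 \<le> c_d\<^sup>2 * e\<^sup>2" by (intro mult_right_mono) auto
        ultimately show ?thesis by (simp add: True power_mult_distrib)
      qed
      have "min c_sol c_nc * e ^ 3 \<le> c_sol * e ^ 3" using e by (intro mult_right_mono) auto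
      also have "\<dots> = \<eta> * e * (min (c_d\<^sup>2) (c\<^sup>2) * e\<^sup>2)"
        unfolding c_sol_def c_def by (simp add: power2_eq_square power3_eq_cube)
      also have "\<dots> \<le> \<eta> * e * (\<theta> ^ j * norm d)\<^sup>2" using len eta e by (intro mult_left_mono) auto
      finally show ?thesis using st(4) by (simp add: s'_def)
    qed
    then show ?thesis using adv unfolding it SOL x_def[symmetric] by blast
  qed
qed

text \<open>The oracle finds curvature at most \<open>-e/2\<close> of \<open>f\<close>. The barrier can take away at most \<open>\<mu> \<le> e/4\<close> of it, whence
  the factor \<open>1/64 = (1/4)\<^sup>3\<close>.\<close>

lemma oracle_iteration:
  assumes s: "good s" and cg: "\<not> calls_cg k s"
  shows "iteration rnd k s = (case min_eig_oracle (reduced_hess k (cur s)) e \<delta> (rnd k) (ritzsel k) of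
      None \<Rightarrow> Terminated (cur s) | Some v \<Rightarrow> advance k s NC (eig_direction k (cur s) v))"
    and "min_eig_oracle (reduced_hess k (cur s)) e \<delta> (rnd k) (ritzsel k) = Some v \<Longrightarrow>
      \<exists>s'. iteration rnd k s = Running s' \<and> good s' \<and> \<phi> (cur s') \<le> \<phi> (cur s) - c_nc / 64 * e ^ 3"
proof -
  define x where "x = cur s"
  have x: "x \<in> \<Omega>" "\<phi> x \<le> \<phi> x0" using s by (auto simp: good_def x_def)
  show it: "iteration rnd k s = (case min_eig_oracle (reduced_hess k (cur s)) e \<delta> (rnd k) (ritzsel k) of
      None \<Rightarrow> Terminated (cur s) | Some v \<Rightarrow> advance k s NC (eig_direction k (cur s) v))"
    using cg by (simp add: iteration_def Let_def e(5))
  assume v: "min_eig_oracle (reduced_hess k (cur s)) e \<delta> (rnd k) (ritzsel k) = Some v"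
  have vv: "norm v = 1" "v \<bullet> (reduced_hess k x *v v) \<le> - e / 2"
    using min_eig_oracle_Some[OF v] ritzsel unfolding x_def by blast+
  have "\<mu> * (norm (Q k x *v v))\<^sup>2 \<le> \<mu> * 1"
    using norm_Q_le[OF x(1), of k v] vv(1) mu(1) by (intro mult_left_mono) (auto intro: power_le_one)
  also have "\<mu> \<le> e / 4"
  proof -
    have "e\<^sup>2 \<le> e" using e(1,2) by (simp add: power2_eq_square mult_left_le)
    then have "\<epsilon> \<le> e" unfolding e(3) .
    then show ?thesis using mu(2) by linarith
  qed
  finally have "v \<bullet> (reduced_hess_phi k x *v v) \<le> - (e / 4) * (norm v)\<^sup>2"
    unfolding reduced_form_split[OF x(1)] using vv by simp
  moreover have "v \<noteq> 0" using vv(1) by auto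
  moreover have "0 < e / 4" "e / 4 \<le> \<beta>" using e by auto
  moreover define d where "d = eig_direction k x v"
  moreover have d': "d = (- sgn1 (reduced_grad k x \<bullet> v) *
      capped (\<bar>v \<bullet> (reduced_hess_phi k x *v v)\<bar> / norm v ^ 3) \<beta> (norm (Q k x *v v))) *\<^sub>R v"
    unfolding d_def eig_direction_def reduced_grad_def reduced_hess_phi_def Let_def
    by (simp add: vv(1) inner_commute[of v "_ *v grad \<phi> x"])
  ultimately have cd: "norm (Q k x *v d) \<le> \<beta>" "d \<noteq> 0" "reduced_grad k x \<bullet> d \<le> 0"
    "d \<bullet> (reduced_hess_phi k x *v d) \<le> - (norm d ^ 3)" "e / 4 \<le> norm d"
    using curvature_direction[OF x(1), of v k "e / 4"] by simp_all
  note st = negative_curvature_step[OF x cd(1-4)]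
  note adv = advance_good[OF s, of k d NC, folded x_def, OF cd(1) st(1)]
  have "c_nc * (e / 4) ^ 3 \<le> c_nc * norm d ^ 3"
    unfolding c_nc_def using cd(5) e eta by (intro mult_left_mono power_mono) auto
  then have dec: "\<phi> (x + \<theta> ^ (LEAST j. sufficient_decrease k x NC d j) *\<^sub>R (P k x *v d)) \<le> \<phi> x - c_nc / 64 * e ^ 3"
    using st(2) by (simp add: power_divide)
  have "iteration rnd k s = advance k s NC d" using it v by (simp add: d_def x_def)
  from this[unfolded adv(1)]
  show "\<exists>s'. iteration rnd k s = Running s' \<and> good s' \<and> \<phi> (cur s') \<le> \<phi> (cur s) - c_nc / 64 * e ^ 3"
    unfolding x_def[symmetric] using adv(2) dec by (intro exI conjI) (assumption, assumption, simp)
qed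

subsection \<open>Stationarity of the output\<close>

text \<open>On the cone, \<open>- \<nabla>B(z)\<close> is at least the local norm at \<open>z\<close>, which absorbs a perturbation that is small in the dual
  norm at the nearby point \<open>y\<close>.\<close>

lemma dual_cone_near_barrier_gradient:
  assumes p: "z \<in> I" "y \<in> I" and near: "\<And>w. (1 - \<beta>) * lnorm y w \<le> lnorm z w"
    and v: "dnorm y (v + \<mu> *\<^sub>R grad B z) \<le> (1 - \<beta>) * \<mu>"
  shows "v \<in> dual_cone K"
  unfolding dual_cone_def
proof (intro CollectI ballI)
  fix w assume w: "w \<in> K"
  have "- ((v + \<mu> *\<^sub>R grad B z) \<bullet> w) = (v + \<mu> *\<^sub>R grad B z) \<bullet> (- w)" by simp
  also have "\<dots> \<le> dnorm y (v + \<mu> *\<^sub>R grad B z) * lnorm y (- w)"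
    by (rule form_norm_cauchy_schwarz[OF hess_pos_def[OF p(2)]])
  also have "\<dots> \<le> ((1 - \<beta>) * \<mu>) * lnorm y (- w)"
    using v form_norm_nonneg[OF hess_pos_def[OF p(2)]] by (intro mult_right_mono) auto
  also have "\<dots> = \<mu> * ((1 - \<beta>) * lnorm y w)" by (simp add: form_norm_minus)
  also have "\<dots> \<le> \<mu> * lnorm z w" using near mu(1) by (intro mult_left_mono) auto
  also have "\<dots> \<le> \<mu> * (- (grad B z \<bullet> w))" using norm_le_grad_cone[OF p(1) w] mu(1) by (intro mult_left_mono) auto
  finally show "0 \<le> v \<bullet> w" by (simp add: inner_add_left)
qed

lemma dual_norm_near_barrier_gradient:
  assumes y: "y \<in> I" and z: "dnorm y (grad B z) \<le> sqrt \<nu> / (1 - \<beta>)"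
    and v: "dnorm y (v + \<mu> *\<^sub>R grad B z) \<le> (1 - \<beta>) * \<mu>"
  shows "dnorm y v \<le> \<epsilon>"
proof -
  have "v = (v + \<mu> *\<^sub>R grad B z) + (- \<mu>) *\<^sub>R grad B z" by simp
  then have "dnorm y v \<le> dnorm y (v + \<mu> *\<^sub>R grad B z) + dnorm y ((- \<mu>) *\<^sub>R grad B z)"
    by (metis form_norm_triangle[OF pos_def_inverse(3)[OF hess_pos_def[OF y]]])
  also have "dnorm y ((- \<mu>) *\<^sub>R grad B z) = \<mu> * dnorm y (grad B z)"
    using mu(1) by (simp only: form_norm_scaleR)
  also have "dnorm y (v + \<mu> *\<^sub>R grad B z) + \<mu> * dnorm y (grad B z) \<le> (1 - \<beta>) * \<mu> + \<mu> * (sqrt \<nu> / (1 - \<beta>))"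
    using v z mu(1) by (intro add_mono mult_left_mono) auto
  also have "\<dots> = \<mu> * (2 * ((1 - \<beta>)\<^sup>2 + sqrt \<nu>)) / (2 * (1 - \<beta>))"
    using beta by (simp add: field_simps power2_eq_square)
  also have "\<dots> = \<epsilon> / 2" unfolding mu(3) using beta by (simp add: field_simps)
  finally show ?thesis using eps by simp
qed

text \<open>The point whose barrier gradient appears in the stationarity condition is the current iterate for the first
  multiplier estimate and the previous one for the second.\<close>

lemma first_order_at_termination:
  assumes s: "good s" and stop: "\<not> calls_cg k s"
  shows "first_order_stationary f A b K B \<epsilon> (cur s)"
proof -
  define x z where "x = cur s" "z = prev s"
  have x: "x \<in> \<Omega>" "x \<in> I" "A *v x = b" using s unfolding good_def x_z_def strictly_feasible_def by auto
  have z: "z \<in> I" "lnorm z (x - z) \<le> \<beta>" using s by (auto simp: good_def x_z_def)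
  obtain l y where ly: "y \<in> I" "dnorm x (grad B y) \<le> sqrt \<nu> / (1 - \<beta>)"
      "\<And>w. (1 - \<beta>) * lnorm x w \<le> lnorm y w"
      "dnorm x ((grad f x + transpose A *v l) + \<mu> *\<^sub>R grad B y) \<le> (1 - \<beta>) * \<mu>"
  proof (cases "dnorm x (grad f x + transpose A *v lam1 k s + \<mu> *\<^sub>R grad B x) \<le> (1 - \<beta>) * \<mu>")
    case True
    have "dnorm x (grad B x) \<le> sqrt \<nu> / (1 - \<beta>)"
      unfolding grad_dual_norm[OF x(2)] using beta e nu_ge_1 by (simp add: le_divide_eq mult_left_le)
    moreover have "(1 - \<beta>) * lnorm x w \<le> lnorm x w" for w
      using form_norm_nonneg[OF hess_pos_def[OF x(2)], of w] beta e by (simp add: mult_le_cancel_right2)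
    ultimately show ?thesis using that x(2) True by blast
  next
    case False
    then have small: "dnorm x (grad f x + transpose A *v lam2 s + \<mu> *\<^sub>R grad B z) \<le> (1 - \<beta>) * \<mu>"
      using stop unfolding calls_cg_def Let_def local_norms x_z_def by (auto simp: min_def split: if_splits)
    have xz: "z + (x - z) = x" by simp
    have "dnorm x (grad B z) \<le> sqrt \<nu> / (1 - \<beta>)"
      using dual_norm_comparison[OF z beta(2), of "grad B z"] unfolding xz grad_dual_norm[OF z(1)] .
    moreover have "(1 - \<beta>) * lnorm x w \<le> lnorm z w" for w
      using local_norm_upper_comparison[OF z beta(2), of w] unfolding xz .
    ultimately show ?thesis using that z(1) small by blast
  qed
  show ?thesis unfolding first_order_stationary_def x_z_def(1)[symmetric] local_norms
    using x(2,3) dual_cone_near_barrier_gradient[OF ly(1) x(2) ly(3,4)]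
      dual_norm_near_barrier_gradient[OF x(2) ly(2,4)] by blast
qed

text \<open>Any two factors of the inverse Hessian differ by an isometry, so that the curvature condition for the factor
  used by the method carries over to the symmetric square root.\<close>

lemma second_order_at_termination:
  assumes x: "x \<in> \<Omega>" and fo: "first_order_stationary f A b K B \<epsilon> x"
    and curv: "\<And>c. - e * (c \<bullet> c) \<le> c \<bullet> (reduced_hess k x *v c)"
  shows "second_order_stationary f A b K B \<epsilon> (sqrt \<epsilon>) x"
proof -
  interpret constraint_projection A "hess B x" "M k x" by (rule projection[OF Omega_interior[OF x]])
  define R where "R = psd_sqrt (matrix_inv (hess B x))"
  note pdi = pos_def_inverse(3)[OF pdH]
  have R: "symmetric_matrix R" "R ** R = matrix_inv (hess B x)"
    using psd_sqrt[of "matrix_inv (hess B x)"] pdi pos_def_nonneg[OF pdi] by (auto simp: R_def pos_def_def)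
  have RR: "R ** transpose R = matrix_inv (hess B x)" using R by simp
  have "- sqrt \<epsilon> * (norm d)\<^sup>2 \<le> d \<bullet> ((R ** hess f x ** R) *v d)" if Ad: "A *v (R *v d) = 0" for d
  proof -
    (* the vector with M c = R d, where R is the symmetric root *)
    define c where "c = transpose (M k x) *v (hess B x *v (R *v d))"
    have Gc: "M k x *v c = R *v d" unfolding c_def by (rule form_norm_factor(3)[OF pdH GG])
    have "norm c = norm d"
      using form_norm_factor(1)[OF pdH GG, of c] form_norm_factor(1)[OF pdH RR, of d] Gc by simp
    then have cc: "c \<bullet> c = (norm d)\<^sup>2" by (simp add: power2_norm_eq_inner[symmetric])
    have pc: "p c = R *v d" unfolding p_apply using q_fixed[of c] Ad Gc by simp
    have "c \<bullet> (reduced_hess k x *v c) = (R *v d) \<bullet> (hess f x *v (R *v d))"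
      unfolding reduced_hess_def P_def reduced_form pc ..
    also have "\<dots> = d \<bullet> (R *v (hess f x *v (R *v d)))" by (rule symmetric_matrix_dot[OF R(1)])
    also have "\<dots> = d \<bullet> ((R ** hess f x ** R) *v d)" by (simp add: matrix_vector_mul_assoc matrix_mul_assoc)
    finally show ?thesis using curv[of c] cc e(5) by simp
  qed
  then show ?thesis using fo unfolding second_order_stationary_def R_def Let_def by simp
qed

lemma reduced_hess_norm:
  assumes x: "x \<in> S"
  shows "0 \<le> onorm ((*v) (reduced_hess k x))"
    "onorm ((*v) (reduced_hess k x)) \<le> (SUP x\<in>S. local_dual_opnorm B x (hess f x))"
proof -
  interpret constraint_projection A "hess B x" "M k x" by (rule projection[OF S_interior[OF x]])
  show "0 \<le> onorm ((*v) (reduced_hess k x))" by (rule onorm_pos_le) simp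
  let ?N = "local_dual_opnorm B x (hess f x)"
  have "norm (reduced_hess k x *v c) \<le> ?N * norm c" for c
  proof -
    have "reduced_hess k x *v c = transpose (Pmat A (M k x)) *v (hess f x *v p c)"
      unfolding reduced_hess_def P_def by (simp add: matrix_vector_mul_assoc matrix_mul_assoc)
    then have "norm (reduced_hess k x *v c) \<le> dnorm x (hess f x *v p c)" using norm_transpose_p by simp
    also have "\<dots> \<le> ?N * lnorm x (p c)"
      unfolding local_dual_opnorm_def local_norms by (rule dual_opnorm_bound(1)[OF pdH])
    also have "\<dots> \<le> ?N * norm c"
      using norm_p[of c] norm_q[of c] dual_opnorm_bound(2)[OF pdH, of "hess f x"]
      unfolding local_dual_opnorm_def local_norms by (intro mult_left_mono) auto
    finally show ?thesis .
  qed
  then have "onorm ((*v) (reduced_hess k x)) \<le> ?N" by (rule onorm_le)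
  also have "\<dots> \<le> (SUP x\<in>S. local_dual_opnorm B x (hess f x))" by (rule cSUP_upper[OF x hess_bounded])
  finally show "onorm ((*v) (reduced_hess k x)) \<le> (SUP x\<in>S. local_dual_opnorm B x (hess f x))" .
qed

lemma run_cong: "(\<And>i. i < k \<Longrightarrow> rnd i = rnd' i) \<Longrightarrow> run rnd k = run rnd' k"
proof (induction k)
  case (Suc k)
  then have eq: "run rnd k = run rnd' k" "rnd k = rnd' k" by auto
  have step: "iteration rnd k = iteration rnd' k" unfolding iteration_def[abs_def] eq(2) ..
  show ?case unfolding run.simps eq(1) step ..
qed simp

lemma run_good: "run rnd k = Running s \<Longrightarrow> good s"
proof (induction k arbitrary: s)
  case 0
  then show ?case using good_init by simp
next
  case (Suc k)
  then obtain s' where s': "run rnd k = Running s'" "iteration rnd k s' = Running s"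
    by (auto split: ncgb_outcome.splits)
  note g = Suc.IH[OF s'(1)]
  show ?case
  proof (cases "calls_cg k s'")
    case True
    then show ?thesis using cg_iteration[OF g True, of rnd] s'(2) by auto
  next
    case False
    show ?thesis
    proof (cases "min_eig_oracle (reduced_hess k (cur s')) e \<delta> (rnd k) (ritzsel k)")
      case None
      then show ?thesis using oracle_iteration(1)[OF g False, of rnd] s'(2) by simp
    next
      case (Some v)
      then show ?thesis using oracle_iteration(2)[OF g False, of rnd, OF Some] s'(2) by auto
    qed
  qed
qed

lemma good_in_S: "good s \<Longrightarrow> cur s \<in> S"
  by (auto simp: good_def intro: in_S)

text \<open>The data of iteration \<open>k\<close> do not depend on the starting vector drawn in it, and the run terminates there if and
  only if the oracle finds nothing. If the iterate is not stationary to second order, that is a failure of the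
  oracle.\<close>

lemma certified_second_order_probability:
  assumes run: "run rnd k = Running s" and k: "k \<in> oracle_calls rnd"
  shows "1 - oracle_failure CARD('n) \<delta> (onorm ((*v) (reduced_hess k (cur s)))) \<le> measure uniform_sphere
      {u. \<forall>x. run (rnd(k := u)) (Suc k) = Terminated x \<longrightarrow> second_order_stationary f A b K B \<epsilon> (sqrt \<epsilon>) x}"
    (is "_ \<le> measure _ ?E")
proof -
  note g = run_good[OF run]
  have stop: "\<not> calls_cg k s" using run k by (auto simp: oracle_calls_def)
  have x: "cur s \<in> \<Omega>" using g by (simp add: good_def)
  have next_state: "run (rnd(k := u)) (Suc k) =
      (case min_eig_oracle (reduced_hess k (cur s)) e \<delta> u (ritzsel k) of
        None \<Rightarrow> Terminated (cur s) | Some v \<Rightarrow> advance k s NC (eig_direction k (cur s) v))" for u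
  proof -
    have "run (rnd(k := u)) k = Running s" using run_cong[of k "rnd(k := u)" rnd] run by simp
    then show ?thesis using oracle_iteration(1)[OF g stop, of "rnd(k := u)"] by simp
  qed
  have adv: "advance k s NC d \<noteq> Terminated y" for d y by (simp add: advance_def Let_def)
  show ?thesis
  proof (cases "second_order_stationary f A b K B \<epsilon> (sqrt \<epsilon>) (cur s)")
    case True
    then have E: "?E = UNIV" unfolding next_state using adv by (auto split: option.splits)
    have "measure (uniform_sphere :: (real^'n) measure) UNIV = 1"
      unfolding measure_def uniform_sphere_prob by simp
    moreover have "0 \<le> oracle_failure CARD('n) \<delta> h" for h by (simp add: oracle_failure_def)
    ultimately show ?thesis unfolding E by simp
  next
    case False
    then have "?E = {u. min_eig_oracle (reduced_hess k (cur s)) e \<delta> u (ritzsel k) \<noteq> None}"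
      unfolding next_state using adv by (auto split: option.splits)
    moreover obtain c where "c \<bullet> (reduced_hess k (cur s) *v c) < - e * (c \<bullet> c)"
      using False second_order_at_termination[OF x first_order_at_termination[OF g stop], of k] not_le by blast
    ultimately show ?thesis
      using oracle_success_probability[OF reduced_hess_symmetric[OF x] e(1) delta] by simp
  qed
qed

lemma oracle_failure_uniform:
  assumes "run rnd k = Running s"
  shows "oracle_failure CARD('n) \<delta> (onorm ((*v) (reduced_hess k (cur s)))) \<le>
    oracle_failure CARD('n) \<delta> (SUP x\<in>S. local_dual_opnorm B x (hess f x))"
  using reduced_hess_norm[OF good_in_S[OF run_good[OF assms]]] delta by (intro oracle_failure_mono) auto

subsection \<open>Counting the calls\<close>

lemma run_step:
  assumes run: "run rnd k = Running s"
  obtains (cg) s' where "calls_cg k s" "run rnd (Suc k) = Running s'" "\<phi> (cur s') \<le> \<phi> (cur s)"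
      "calls_cg (Suc k) s' \<Longrightarrow> \<phi> (cur s') \<le> \<phi> (cur s) - min c_sol c_nc * e ^ 3"
  | (curvature) s' where "\<not> calls_cg k s" "run rnd (Suc k) = Running s'"
      "\<phi> (cur s') \<le> \<phi> (cur s) - c_nc / 64 * e ^ 3"
  | (stop) "\<not> calls_cg k s" "run rnd (Suc k) = Terminated (cur s)"
proof -
  note g = run_good[OF run]
  have step: "run rnd (Suc k) = iteration rnd k s" using run by simp
  show thesis
  proof (cases "calls_cg k s")
    case True
    then show ?thesis using cg_iteration[OF g True, of rnd] cg step by metis
  next
    case False
    show ?thesis
    proof (cases "min_eig_oracle (reduced_hess k (cur s)) e \<delta> (rnd k) (ritzsel k)")
      case None
      then show ?thesis using oracle_iteration(1)[OF g False, of rnd] stop[OF False] step by simp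
    next
      case (Some v)
      then show ?thesis using oracle_iteration(2)[OF g False, of rnd, OF Some] curvature[OF False] step by metis
    qed
  qed
qed

lemma running_before: "run rnd n = Running s \<Longrightarrow> k \<le> n \<Longrightarrow> \<exists>s'. run rnd k = Running s'"
proof (induction n arbitrary: s)
  case (Suc n)
  obtain s' where "run rnd n = Running s'" using Suc.prems(1) by (auto split: ncgb_outcome.splits)
  then show ?case using Suc.IH Suc.prems by (cases "k = Suc n") auto
qed simp

lemma card_Int_lessThan_Suc:
  "card (X \<inter> {..<Suc n}) = card (X \<inter> {..<n}) + (if n \<in> X then 1 else 0)" for X :: "nat set"
proof (cases "n \<in> X")
  case True
  then have "X \<inter> {..<Suc n} = insert n (X \<inter> {..<n})" by auto
  then show ?thesis using True by simp
next
  case False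
  then have "X \<inter> {..<Suc n} = X \<inter> {..<n}" by (auto simp: less_Suc_eq)
  then show ?thesis using False by simp
qed

text \<open>The calls of CG that are followed by another one, and hence have a guaranteed decrease.\<close>

definition paired_cg_calls where
  "paired_cg_calls rnd = {i. i \<in> cg_calls rnd \<and> Suc i \<in> cg_calls rnd}"

lemma constants_pos: "0 < c_nc" "0 < c_sol"
proof -
  have "0 < L * (1 - \<beta>) + 1/2" using L beta by (simp add: add_pos_pos)
  then have "0 < 3 * (1 - \<beta>) * (1 - \<eta>) * \<theta> / (L * (1 - \<beta>) + 1/2)" "0 < 6 * (1 - \<beta>) * (1 - \<eta>) * \<theta> / (L * (1 - \<beta>) + 1/2)"
    using beta eta theta by auto
  then show "0 < c_nc" "0 < c_sol" unfolding c_nc_def c_sol_def using eta c_d_bounds(1)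
    by (auto simp: zero_less_mult_iff)
qed

lemma decrease_bounds_calls:
  assumes "run rnd n = Running s"
  shows "c_nc / 64 * e ^ 3 * card (oracle_calls rnd \<inter> {..<n}) \<le> \<phi> x0 - \<phi> (cur s)"
    "min c_sol c_nc * e ^ 3 * card (paired_cg_calls rnd \<inter> {..<n}) \<le> \<phi> x0 - \<phi> (cur s)"
  using assms
proof (induction n arbitrary: s)
  case 0
  {
    case 1 then show ?case by (auto simp: init_def)
  next
    case 2 then show ?case by (auto simp: init_def)
  }
next
  case (Suc n)
  have pos: "0 < c_nc / 64 * e ^ 3" using constants_pos e by simp
  have inv: "c_nc / 64 * e ^ 3 * card (oracle_calls rnd \<inter> {..<Suc n}) \<le> \<phi> x0 - \<phi> (cur s) \<and>
      min c_sol c_nc * e ^ 3 * card (paired_cg_calls rnd \<inter> {..<Suc n}) \<le> \<phi> x0 - \<phi> (cur s)"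
    if run: "run rnd (Suc n) = Running s" for s
  proof -
    obtain t where t: "run rnd n = Running t" using run by (auto split: ncgb_outcome.splits)
    note IH = Suc.IH(1)[OF t] Suc.IH(2)[OF t]
    from t show ?thesis
    proof (cases rule: run_step)
      case (cg s')
      have "n \<notin> oracle_calls rnd" using t cg(1) by (auto simp: oracle_calls_def)
      moreover have "n \<in> paired_cg_calls rnd \<longleftrightarrow> calls_cg (Suc n) s"
        using t cg(1) run unfolding paired_cg_calls_def cg_calls_def by auto
      moreover have "s' = s" using cg(2) run by simp
      ultimately show ?thesis using IH cg(3,4) unfolding card_Int_lessThan_Suc by (auto simp: algebra_simps)
    next
      case (curvature s')
      have "n \<in> oracle_calls rnd" using t curvature(1) by (auto simp: oracle_calls_def)
      moreover have "n \<notin> paired_cg_calls rnd"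
        using t curvature(1) unfolding paired_cg_calls_def cg_calls_def by auto
      moreover have "s' = s" using curvature(2) run by simp
      ultimately show ?thesis using IH curvature(3) pos unfolding card_Int_lessThan_Suc by (auto simp: algebra_simps)
    next
      case stop
      then show ?thesis using run by simp
    qed
  qed
  { case 1 then show ?case using inv by blast
  next
    case 2 then show ?case using inv by blast }
qed

text \<open>Every other call of CG is followed by a call of the oracle. That one may be made in iteration \<open>n\<close> itself,
  whence the summand \<open>1\<close>.\<close>

lemma cg_calls_cover:
  assumes "run rnd n = Running s"
  shows "card (cg_calls rnd \<inter> {..<n}) \<le> card (paired_cg_calls rnd \<inter> {..<n}) + card (oracle_calls rnd \<inter> {..<n}) + 1"
proof -
  let ?O = "{i. i < n \<and> Suc i \<in> oracle_calls rnd}"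
  have "cg_calls rnd \<inter> {..<n} \<subseteq> (paired_cg_calls rnd \<inter> {..<n}) \<union> ?O"
  proof
    fix i assume i: "i \<in> cg_calls rnd \<inter> {..<n}"
    then obtain s' where "run rnd (Suc i) = Running s'" using running_before[OF assms, of "Suc i"] by auto
    then have "Suc i \<in> cg_calls rnd \<or> Suc i \<in> oracle_calls rnd"
      by (auto simp: cg_calls_def oracle_calls_def)
    then show "i \<in> (paired_cg_calls rnd \<inter> {..<n}) \<union> ?O" using i by (auto simp: paired_cg_calls_def)
  qed
  then have "card (cg_calls rnd \<inter> {..<n}) \<le> card ((paired_cg_calls rnd \<inter> {..<n}) \<union> ?O)"
    by (intro card_mono) auto
  also have "\<dots> \<le> card (paired_cg_calls rnd \<inter> {..<n}) + card ?O" by (rule card_Un_le)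
  also have "card ?O = card (Suc ` ?O)" by (simp add: card_image)
  also have "card (Suc ` ?O) \<le> card (oracle_calls rnd \<inter> {..<Suc n})" by (intro card_mono) auto
  also have "\<dots> \<le> card (oracle_calls rnd \<inter> {..<n}) + 1" by (simp add: card_Int_lessThan_Suc)
  finally show ?thesis by simp
qed

lemma calls_disjoint: "cg_calls rnd \<inter> oracle_calls rnd = {}"
  by (auto simp: cg_calls_def oracle_calls_def)

lemma calls_before:
  assumes "run rnd n = Running s"
  shows "n = card (cg_calls rnd \<inter> {..<n}) + card (oracle_calls rnd \<inter> {..<n})"
proof -
  have "{..<n} = (cg_calls rnd \<inter> {..<n}) \<union> (oracle_calls rnd \<inter> {..<n})"
  proof
    show "{..<n} \<subseteq> (cg_calls rnd \<inter> {..<n}) \<union> (oracle_calls rnd \<inter> {..<n})"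
    proof
      fix i assume i: "i \<in> {..<n}"
      then obtain s' where "run rnd i = Running s'" using running_before[OF assms, of i] by auto
      then show "i \<in> (cg_calls rnd \<inter> {..<n}) \<union> (oracle_calls rnd \<inter> {..<n})"
        using i by (auto simp: cg_calls_def oracle_calls_def)
    qed
  qed auto
  then have "card {..<n} = card ((cg_calls rnd \<inter> {..<n}) \<union> (oracle_calls rnd \<inter> {..<n}))" by simp
  also have "\<dots> = card (cg_calls rnd \<inter> {..<n}) + card (oracle_calls rnd \<inter> {..<n})"
    using calls_disjoint[of rnd] by (intro card_Un_disjoint) auto
  finally show ?thesis by simp
qed

lemma call_count_ceiling:
  assumes c: "0 < c" and n: "c * e ^ 3 * real n \<le> \<phi> x0 - \<phi>low" and \<phi>0: "\<phi>0 = f x0 + \<mu>bar * max (B x0) 0"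
  shows "int n \<le> \<lceil>(\<phi>0 - \<phi>low) / c * \<epsilon> powr (- 3/2)\<rceil>"
proof -
  have "\<mu> * B x0 \<le> \<mu> * max (B x0) 0" using mu(1) by (intro mult_left_mono) auto
  also have "\<dots> \<le> \<mu>bar * max (B x0) 0" using mu_le_mubar by (intro mult_right_mono) auto
  finally have le: "c * e ^ 3 * real n \<le> \<phi>0 - \<phi>low" using n by (simp add: phi_eq \<phi>0)
  have pw: "\<epsilon> powr (- 3/2) = 1 / e ^ 3"
  proof -
    have "e ^ 3 = (\<epsilon> powr (1/2)) powr 3" using eps e(1) by (simp add: powr_half_sqrt powr_numeral e_def)
    also have "\<dots> = \<epsilon> powr (3/2)" by (simp add: powr_powr)
    finally show ?thesis by (simp add: powr_minus_divide)
  qed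
  have "real n = c * e ^ 3 * real n / (c * e ^ 3)" using c e(1) by simp
  also have "\<dots> \<le> (\<phi>0 - \<phi>low) / (c * e ^ 3)" using le c e(1) by (intro divide_right_mono) auto
  also have "\<dots> = (\<phi>0 - \<phi>low) / c * \<epsilon> powr (- 3/2)" unfolding pw by simp
  finally have "real n \<le> (\<phi>0 - \<phi>low) / c * \<epsilon> powr (- 3/2)" .
  then show ?thesis by linarith
qed

text \<open>A run that reaches iteration \<open>n\<close> has made \<open>n\<close> calls of either kind, but these are bounded independently of \<open>n\<close>. The
  oracle call that ends the run brings no decrease, which accounts for the summands \<open>1\<close>.\<close>

theorem termination_and_call_counts:
  assumes N: "\<And>n. c_nc / 64 * e ^ 3 * real n \<le> \<phi> x0 - \<phi>low \<Longrightarrow> n \<le> n\<^sub>O"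
    "\<And>n. min c_sol c_nc * e ^ 3 * real n \<le> \<phi> x0 - \<phi>low \<Longrightarrow> n \<le> n\<^sub>W"
  obtains k s where "run rnd k = Running s" "run rnd (Suc k) = Terminated (cur s)" "\<not> calls_cg k s"
    "finite (oracle_calls rnd)" "card (oracle_calls rnd) \<le> n\<^sub>O + 1"
    "finite (cg_calls rnd)" "card (cg_calls rnd) \<le> n\<^sub>W + n\<^sub>O + 1"
    "Suc k = card (cg_calls rnd) + card (oracle_calls rnd)"
proof -
  have few: "card (oracle_calls rnd \<inter> {..<n}) \<le> n\<^sub>O" "card (paired_cg_calls rnd \<inter> {..<n}) \<le> n\<^sub>W"
    if run: "run rnd n = Running s" for n s
  proof -
    have "\<phi>low \<le> \<phi> (cur s)" using run_good[OF run] by (auto simp: good_def intro: phi_lower)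
    then show "card (oracle_calls rnd \<inter> {..<n}) \<le> n\<^sub>O" "card (paired_cg_calls rnd \<inter> {..<n}) \<le> n\<^sub>W"
      using decrease_bounds_calls[OF run] by (intro N; linarith)+
  qed
  have bounded: "n \<le> n\<^sub>W + 2 * n\<^sub>O + 1" if run: "run rnd n = Running s" for n s
    using few[OF run] cg_calls_cover[OF run] calls_before[OF run] by linarith
  define m where "m = (LEAST m. \<forall>s. run rnd m \<noteq> Running s)"
  have "\<forall>s. run rnd (n\<^sub>W + 2 * n\<^sub>O + 2) \<noteq> Running s" using bounded[of "n\<^sub>W + 2 * n\<^sub>O + 2"] by fastforce
  then have m: "\<forall>s. run rnd m \<noteq> Running s" unfolding m_def by (rule LeastI)
  then have "m \<noteq> 0" by (cases m) auto
  then obtain k where k: "m = Suc k" by (cases m) auto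
  obtain s where s: "run rnd k = Running s" using not_less_Least[of k "\<lambda>m. \<forall>s. run rnd m \<noteq> Running s"] k m_def by auto
  have stop: "\<not> calls_cg k s" "run rnd (Suc k) = Terminated (cur s)"
    using s by (cases rule: run_step; use m k in simp)+
  have after: "run rnd (Suc k + j) = Terminated (cur s)" for j
    by (induction j) (use stop(2) in auto)
  have within: "i \<le> k" if "run rnd i = Running s'" for i s'
  proof (rule ccontr)
    assume "\<not> ?thesis"
    then obtain j where "i = Suc k + j" using less_imp_Suc_add[of k i] by auto
    then show False using after[of j] that by simp
  qed
  have kO: "k \<in> oracle_calls rnd" "k \<notin> cg_calls rnd" using s stop(1) by (auto simp: oracle_calls_def cg_calls_def)
  have O: "oracle_calls rnd = oracle_calls rnd \<inter> {..<Suc k}"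
    using within by (fastforce simp: oracle_calls_def)
  have "cg_calls rnd \<subseteq> {..k}" using within by (fastforce simp: cg_calls_def)
  then have C: "cg_calls rnd = cg_calls rnd \<inter> {..<k}" using kO(2) by (auto simp: le_less)
  have fin: "finite (oracle_calls rnd)" "finite (cg_calls rnd)"
    using O C by (metis finite_Int finite_lessThan)+
  have cO: "card (oracle_calls rnd) = card (oracle_calls rnd \<inter> {..<k}) + 1"
    using arg_cong[OF O, of card] kO(1) by (simp add: card_Int_lessThan_Suc)
  have cC: "card (cg_calls rnd) = card (cg_calls rnd \<inter> {..<k})" using arg_cong[OF C, of card] .
  show thesis
  proof (rule that[OF s stop(2) stop(1) fin(1) _ fin(2)])
    show "card (oracle_calls rnd) \<le> n\<^sub>O + 1" using cO few(1)[OF s] by simp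
    show "card (cg_calls rnd) \<le> n\<^sub>W + n\<^sub>O + 1" using cC few[OF s] cg_calls_cover[OF s] by linarith
    show "Suc k = card (cg_calls rnd) + card (oracle_calls rnd)" using cO cC calls_before[OF s] by simp
  qed
qed

end

theorem theorem8:
  fixes f B :: "real^'n \<Rightarrow> real"
    and A :: "real^'n^'m" and b :: "real^'m" and K :: "(real^'n) set"
    and \<nu> \<epsilon> \<zeta> \<beta> \<theta> \<eta> \<delta> \<mu>bar \<phi>low L\<^sub>H U\<^sub>H c_d c_sol c_nc \<phi>0 :: real
    and K\<^sub>1 K\<^sub>2 :: int
    and x0 :: "real^'n"
    and \<Omega> S :: "(real^'n) set"
    and M :: "nat \<Rightarrow> real^'n \<Rightarrow> real^'n^'n"
    and cgsel :: "nat \<Rightarrow> ((real^'n) \<times> dtype) set \<Rightarrow> (real^'n) \<times> dtype"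
    and ritzsel :: "nat \<Rightarrow> (real^'n) set \<Rightarrow> real^'n"
  defines "\<Omega> \<equiv> strictly_feasible A b K"
    and "S \<equiv> level_union f A b K B \<mu>bar x0"
    and "U\<^sub>H \<equiv> (SUP x\<in>S. local_dual_opnorm B x (hess f x))"
    and "c_d \<equiv> (1 - \<beta>) ^ 3 / ((L\<^sub>H + \<zeta> + 4) * ((1 - \<beta>)\<^sup>2 + sqrt \<nu>) + 1 - \<beta>)"
    and "c_sol \<equiv> \<eta> * min (c_d\<^sup>2) ((6 * (1 - \<beta>) * (1 - \<eta>) * \<theta> / (L\<^sub>H * (1 - \<beta>) + 1/2))\<^sup>2)"
    and "c_nc \<equiv> \<eta> / 2 * min 1 ((3 * (1 - \<beta>) * (1 - \<eta>) * \<theta> / (L\<^sub>H * (1 - \<beta>) + 1/2))\<^sup>2)"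
    and "\<phi>0 \<equiv> f x0 + \<mu>bar * max (B x0) 0"
    and "K\<^sub>1 \<equiv> \<lceil>(\<phi>0 - \<phi>low) / min c_sol c_nc * \<epsilon> powr (- 3/2)\<rceil>
           + \<lceil>64 * (\<phi>0 - \<phi>low) / c_nc * \<epsilon> powr (- 3/2)\<rceil> + 1"
    and "K\<^sub>2 \<equiv> \<lceil>64 * (\<phi>0 - \<phi>low) / c_nc * \<epsilon> powr (- 3/2)\<rceil> + 1"
  assumes
    \<comment> \<open>the conic problem\<close>
        "rank A = CARD('m)"
    and "closed K" "convex K" "cone K" "pointed K" "interior K \<noteq> {}"
    and "\<exists>x. A *v x = b \<and> x \<in> K \<and> (\<forall>y. A *v y = b \<and> y \<in> K \<longrightarrow> f x \<le> f y)"
    and "\<Omega> \<noteq> {}"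
    and "\<not> convex_on \<Omega> f"
    and "\<exists>D. open D \<and> \<Omega> \<subseteq> D \<and> (\<forall>x\<in>S. {y. local_norm B x (y - x) \<le> \<beta>} \<subseteq> D) \<and> C_k_on 2 D f"
    and "LHSC_barrier \<nu> K B"
    \<comment> \<open>the inputs of the method\<close>
    and "0 < \<epsilon>" "\<epsilon> < 1" "x0 \<in> \<Omega>" "0 < \<zeta>" "\<zeta> < 1" "sqrt \<epsilon> \<le> \<beta>" "\<beta> < 1"
    and "0 < \<theta>" "\<theta> < 1" "0 < \<eta>" "\<eta> < 1" "0 < \<delta>" "\<delta> < 1"
    \<comment> \<open>Assumption A\<close>
    and "ncgb_mu \<epsilon> \<beta> \<nu> \<le> \<mu>bar"
    and "\<And>\<mu> x. 0 < \<mu> \<Longrightarrow> \<mu> \<le> \<mu>bar \<Longrightarrow> x \<in> \<Omega> \<Longrightarrow> \<phi>low \<le> barrier_fun f B \<mu> x"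
    and "bounded S"
    and "0 < L\<^sub>H"
    and "\<And>x y. x \<in> S \<Longrightarrow> local_norm B x (y - x) \<le> \<beta> \<Longrightarrow>
           local_dual_opnorm B x (hess f y - hess f x) \<le> L\<^sub>H * local_norm B x (x - y)"
    and "bdd_above ((\<lambda>x. local_dual_norm B x (grad f x)) ` S)"
    and "bdd_above ((\<lambda>x. local_dual_opnorm B x (hess f x)) ` S)"
    \<comment> \<open>the choices left open by the method\<close>
    and "\<And>k x. x \<in> interior K \<Longrightarrow> M k x ** transpose (M k x) = matrix_inv (hess B x)"
    and "\<And>k X. X \<noteq> {} \<Longrightarrow> cgsel k X \<in> X"
    and "\<And>k X. X \<noteq> {} \<Longrightarrow> ritzsel k X \<in> X"
  defines "run \<equiv> ncgb.run f A B \<nu> \<epsilon> x0 \<zeta> \<beta> \<theta> \<eta> \<delta> M cgsel ritzsel"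
    and "cg_calls \<equiv> ncgb.cg_calls f A B \<nu> \<epsilon> x0 \<zeta> \<beta> \<theta> \<eta> \<delta> M cgsel ritzsel"
    and "oracle_calls \<equiv> ncgb.oracle_calls f A B \<nu> \<epsilon> x0 \<zeta> \<beta> \<theta> \<eta> \<delta> M cgsel ritzsel"
    and "H \<equiv> ncgb.reduced_hess f A M"
  shows
    "(\<forall>rnd. (\<forall>k. norm (rnd k) = 1) \<longrightarrow>
        \<comment> \<open>(i)\<close>
        (finite (oracle_calls rnd) \<and> int (card (oracle_calls rnd)) \<le> K\<^sub>2) \<and>
        \<comment> \<open>(ii)\<close>
        (finite (cg_calls rnd) \<and> int (card (cg_calls rnd)) \<le> K\<^sub>1) \<and>
        \<comment> \<open>(iii)\<close>
        (\<exists>k s. int (Suc k) \<le> K\<^sub>1 + K\<^sub>2 \<and>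
           run rnd k = Running s \<and> run rnd (Suc k) = Terminated (cur s) \<and>
           first_order_stationary f A b K B \<epsilon> (cur s)) \<and>
        \<comment> \<open>(iii), second-order part: the data of iteration \<open>k\<close> depend only on the starting vectors drawn
          before it; given these, the probability is over the one drawn in iteration \<open>k\<close>\<close>
        (\<forall>k s. run rnd k = Running s \<and> k \<in> oracle_calls rnd \<longrightarrow>
           measure uniform_sphere
             {u. \<forall>x. run (rnd(k := u)) (Suc k) = Terminated x \<longrightarrow>
                   second_order_stationary f A b K B \<epsilon> (sqrt \<epsilon>) x}
             \<ge> 1 - oracle_failure CARD('n) \<delta> (onorm ((*v) (H k (cur s)))) \<and>
           1 - oracle_failure CARD('n) \<delta> (onorm ((*v) (H k (cur s))))
             \<ge> 1 - oracle_failure CARD('n) \<delta> U\<^sub>H))"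
proof -
  have surjA: "surj ((*v) A)"
    using full_rank_surjective[of A] \<open>rank A = CARD('m)\<close> by simp
  obtain D where D: "open D" "\<Omega> \<subseteq> D" "\<And>x. x \<in> S \<Longrightarrow> {y. local_norm B x (y - x) \<le> \<beta>} \<subseteq> D" "C_k_on 2 D f"
    using \<open>\<exists>D. open D \<and> \<Omega> \<subseteq> D \<and> (\<forall>x\<in>S. {y. local_norm B x (y - x) \<le> \<beta>} \<subseteq> D) \<and> C_k_on 2 D f\<close> by blast
  interpret N: ncgb_convergence \<nu> K B f A \<epsilon> x0 \<zeta> \<beta> \<theta> \<eta> \<delta> M cgsel ritzsel b D \<mu>bar \<phi>low L\<^sub>H
    by unfold_locales (fact assms[unfolded \<Omega>_def S_def] surjA D[unfolded \<Omega>_def S_def])+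
  have constants: "N.c_d = c_d" "N.c_sol = c_sol" "N.c_nc = c_nc"
    unfolding N.c_sol_def N.c_nc_def N.c_d_def c_sol_def c_nc_def c_d_def by (rule refl)+
  define n\<^sub>W n\<^sub>O where "n\<^sub>W = \<lceil>(\<phi>0 - \<phi>low) / min c_sol c_nc * \<epsilon> powr (- 3/2)\<rceil>"
    and "n\<^sub>O = \<lceil>64 * (\<phi>0 - \<phi>low) / c_nc * \<epsilon> powr (- 3/2)\<rceil>"
  have K: "K\<^sub>1 = n\<^sub>W + n\<^sub>O + 1" "K\<^sub>2 = n\<^sub>O + 1" unfolding K\<^sub>1_def K\<^sub>2_def n\<^sub>W_def n\<^sub>O_def by (rule refl)+
  have \<phi>0: "\<phi>0 = f x0 + \<mu>bar * max (B x0) 0" by (simp add: \<phi>0_def)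
  have pos: "0 < c_nc / 64" "0 < min c_sol c_nc" using N.constants_pos unfolding constants by auto
  have scale: "(\<phi>0 - \<phi>low) / (c_nc / 64) = 64 * (\<phi>0 - \<phi>low) / c_nc" by simp
  have countO: "int n \<le> n\<^sub>O" if "c_nc / 64 * N.e ^ 3 * real n \<le> N.\<phi> x0 - \<phi>low" for n
    using N.call_count_ceiling[OF pos(1) that \<phi>0] unfolding n\<^sub>O_def scale .
  have countW: "int n \<le> n\<^sub>W" if "min c_sol c_nc * N.e ^ 3 * real n \<le> N.\<phi> x0 - \<phi>low" for n
    using N.call_count_ceiling[OF pos(2) that \<phi>0] unfolding n\<^sub>W_def .
  have "\<phi>low \<le> N.\<phi> x0" by (rule N.phi_lower[OF N.x0])
  then have nonneg: "0 \<le> n\<^sub>O" "0 \<le> n\<^sub>W" using countO[of 0] countW[of 0] by auto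
  show ?thesis
  proof (intro allI impI)
    fix rnd :: "nat \<Rightarrow> real^'n"
    from N.termination_and_call_counts[of "nat n\<^sub>O" "nat n\<^sub>W" rnd, unfolded constants]
    obtain k s where ks: "run rnd k = Running s" "run rnd (Suc k) = Terminated (cur s)" "\<not> N.calls_cg k s"
      and O: "finite (oracle_calls rnd)" "card (oracle_calls rnd) \<le> nat n\<^sub>O + 1"
      and C: "finite (cg_calls rnd)" "card (cg_calls rnd) \<le> nat n\<^sub>W + nat n\<^sub>O + 1"
      and k: "Suc k = card (cg_calls rnd) + card (oracle_calls rnd)"
      unfolding run_def cg_calls_def oracle_calls_def using countO countW by (metis nat_int nat_mono)
    have card: "int (card (oracle_calls rnd)) \<le> K\<^sub>2" "int (card (cg_calls rnd)) \<le> K\<^sub>1"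
      using O(2) C(2) nonneg unfolding K by linarith+
    have bound: "int (Suc k) \<le> K\<^sub>1 + K\<^sub>2" using k card by linarith
    have first: "first_order_stationary f A b K B \<epsilon> (cur s)"
      using N.first_order_at_termination[OF N.run_good ks(3)] ks(1) unfolding run_def by blast
    have second: "1 - oracle_failure CARD('n) \<delta> (onorm ((*v) (H k (cur s)))) \<le> measure uniform_sphere
          {u. \<forall>x. run (rnd(k := u)) (Suc k) = Terminated x \<longrightarrow> second_order_stationary f A b K B \<epsilon> (sqrt \<epsilon>) x} \<and>
        1 - oracle_failure CARD('n) \<delta> U\<^sub>H \<le> 1 - oracle_failure CARD('n) \<delta> (onorm ((*v) (H k (cur s))))"
      if "run rnd k = Running s" "k \<in> oracle_calls rnd" for k s
      using N.certified_second_order_probability[OF that[unfolded run_def oracle_calls_def]]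
        N.oracle_failure_uniform[OF that(1)[unfolded run_def]]
      unfolding run_def H_def U\<^sub>H_def S_def by simp
    show "(finite (oracle_calls rnd) \<and> int (card (oracle_calls rnd)) \<le> K\<^sub>2) \<and>
        (finite (cg_calls rnd) \<and> int (card (cg_calls rnd)) \<le> K\<^sub>1) \<and>
        (\<exists>k s. int (Suc k) \<le> K\<^sub>1 + K\<^sub>2 \<and> run rnd k = Running s \<and> run rnd (Suc k) = Terminated (cur s) \<and>
           first_order_stationary f A b K B \<epsilon> (cur s)) \<and>
        (\<forall>k s. run rnd k = Running s \<and> k \<in> oracle_calls rnd \<longrightarrow>
           measure uniform_sphere
             {u. \<forall>x. run (rnd(k := u)) (Suc k) = Terminated x \<longrightarrow>
                   second_order_stationary f A b K B \<epsilon> (sqrt \<epsilon>) x}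
             \<ge> 1 - oracle_failure CARD('n) \<delta> (onorm ((*v) (H k (cur s)))) \<and>
           1 - oracle_failure CARD('n) \<delta> (onorm ((*v) (H k (cur s))))
             \<ge> 1 - oracle_failure CARD('n) \<delta> U\<^sub>H)"
      using O(1) C(1) card bound ks(1,2) first second by blast
  qed
qed

end
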